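(* Let $\Omega\subseteq\mathbb{R}^n$ be a bounded John domain, let $\alpha\in[0,1]$ and $1<p\le q<\infty$. Let $w_1,w_2$ be nonnegative measurable functions on $\mathbb{R}^n$ such that both $w=w_1$ and $w=w_2^{1-p'}$ satisfy the following reverse doubling condition: for any $\epsilon\in(0,1)$ there exists $\delta\in(0,1)$ such that $$\int_{\epsilon Q}w(x)\,dx\le\delta\int_Q w(x)\,dx$$ for every $n$-dimensional cube $Q\subset\mathbb{R}^n$. Assume moreover the following. (i) If $p<q$: there exists a constant $K<\infty$, independent of $Q$, such that for every $n$-dimensional cube $Q\subset\mathbb{R}^n$ $$|Q|^{\frac{1-\alpha}{n}-1}\left(\int_Q w_1(x)\,dx\right)^{1/q}\left(\int_Q w_2(x)^{1-p'}\,dx\right)^{1/p'}\le K.$$ (ii) If $p=q$: there exist $r>1$ and a constant $K(r)<\infty$, independent of $Q$, such that for every $n$-dimensional cube $Q\subset\mathbb{R}^n$ $$|Q|^{\frac{1-\alpha}{n}+\frac1q-\frac1p}\left(\frac{1}{|Q|}\int_Q w_1(x)^r\,dx\right)^{\frac{1}{qr}}\left(\frac{1}{|Q|}\int_Q w_2(x)^{(1-p')r}\,dx\right)^{\frac{1}{p'r}}\le K(r).$$ Then there is a constant $C$, independent of $f$, such that $$\inf_{a\in\mathbb{R}}\|(f(x)-a)\,w_1(x)^{1/q}\|_{L^q(\Omega)}\le C\,\|\nabla f(x)\,d(x)^\alpha\,w_2(x)^{1/p}\|_{L^p(\Omega)}$$ for all locally Lipschitz functions $f$ on $\Omega$.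
   Context: For a domain $\Omega\subset\mathbb{R}^n$ and $x\in\Omega$, $d(x)$ denotes the distance from $x$ to the boundary $\partial\Omega$. A bounded domain $\Omega\subset\mathbb{R}^n$ is a John domain if, for a fixed $x_0\in\Omega$, there exist constants $\delta_0>0$ and $K_0<\infty$, depending only on $\Omega$ and $x_0$, such that for every $y\in\Omega$ there is a rectifiable curve $\gamma(\cdot,y):[0,1]\to\Omega$ with $\gamma(0,y)=y$, $\gamma(1,y)=x_0$, $d(\gamma(s,y))\ge\delta_0 s$ and $|\dot\gamma(s,y)|\le K_0$, where $\dot\gamma(s,y)=\frac{\partial\gamma}{\partial s}(s,y)$. Here $p'$ is the dual exponent of $p$, $\frac1p+\frac1{p'}=1$; $|Q|$ is the Lebesgue measure of $Q$; and $\epsilon Q$ is the cube concentric with $Q$ with side length $\epsilon$ times that of $Q$. The gradient of a locally Lipschitz function exists almost everywhere. The right-hand side of the conclusion may be $+\infty$, in which case the inequality is trivial. *)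

theory Defs
  imports "HOL-Analysis.Analysis"
begin

text \<open>
  The distribution's \<open>powr\<close> satisfies \<open>0 powr a = 0\<close> for every \<open>a\<close>, whereas a weight
  \<open>w powr (1 - p')\<close> with \<open>1 - p' < 0\<close> has to be infinite where \<open>w\<close> vanishes.
\<close>

definition ennpow :: "ennreal \<Rightarrow> real \<Rightarrow> ennreal" where
  "ennpow x a =
     (if a = 0 then 1
      else if x = 0 then (if a > 0 then 0 else \<infinity>)
      else if x = \<infinity> then (if a > 0 then \<infinity> else 0)
      else ennreal (enn2real x powr a))"

definition bdist :: "'a::metric_space set \<Rightarrow> 'a \<Rightarrow> real" where
  "bdist \<Omega> x = infdist x (frontier \<Omega>)"

text \<open>
  The bound on the derivative controls the curve only if the curve is the integral of its
  derivative: under a Cantor-type parametrisation a rectifiable curve has derivative \<open>0\<close>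
  almost everywhere. The rectifiable curves below are therefore absolutely continuous, which for a
  curve with essentially bounded derivative means Lipschitz; the Lipschitz constant \<open>L\<close> may depend
  on the curve, while \<open>K0\<close> may not. As is usual for Lipschitz curves, the derivative is taken almost
  everywhere.
\<close>

definition john_curve ::
    "'a::euclidean_space set \<Rightarrow> 'a \<Rightarrow> real \<Rightarrow> real \<Rightarrow> 'a \<Rightarrow> (real \<Rightarrow> 'a) \<Rightarrow> bool" where
  "john_curve \<Omega> x0 \<delta>0 K0 y \<gamma> \<longleftrightarrow>
     (\<exists>L. L-lipschitz_on {0..1} \<gamma>) \<and> \<gamma> ` {0..1} \<subseteq> \<Omega> \<and> \<gamma> 0 = y \<and> \<gamma> 1 = x0 \<and>
     (\<forall>s\<in>{0..1}. bdist \<Omega> (\<gamma> s) \<ge> \<delta>0 * s) \<and>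
     (AE s in lebesgue. s \<in> {0..1} \<longrightarrow>
        \<gamma> differentiable (at s) \<and> norm (vector_derivative \<gamma> (at s)) \<le> K0)"

definition bounded_john_domain :: "'a::euclidean_space set \<Rightarrow> bool" where
  "bounded_john_domain \<Omega> \<longleftrightarrow>
     open \<Omega> \<and> connected \<Omega> \<and> bounded \<Omega> \<and>
     (\<exists>x0\<in>\<Omega>. \<exists>\<delta>0>0. \<exists>K0. \<forall>y\<in>\<Omega>. \<exists>\<gamma>. john_curve \<Omega> x0 \<delta>0 K0 y \<gamma>)"

text \<open>The axis-parallel cube with centre \<open>c\<close> and side length \<open>l\<close>.\<close>

definition cube :: "real ^ 'n \<Rightarrow> real \<Rightarrow> (real ^ 'n) set" where
  "cube c l = cbox (c - vec (l / 2)) (c + vec (l / 2))"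

definition reverse_doubling :: "(real ^ 'n \<Rightarrow> ennreal) \<Rightarrow> bool" where
  "reverse_doubling w \<longleftrightarrow>
     (\<forall>\<epsilon>\<in>{0<..<1}. \<exists>\<delta>\<in>{0<..<1}. \<forall>c. \<forall>l>0.
        (\<integral>\<^sup>+x\<in>cube c (\<epsilon> * l). w x \<partial>lebesgue) \<le> ennreal \<delta> * (\<integral>\<^sup>+x\<in>cube c l. w x \<partial>lebesgue))"

definition locally_lipschitz_on :: "'a::metric_space set \<Rightarrow> ('a \<Rightarrow> 'b::metric_space) \<Rightarrow> bool" where
  "locally_lipschitz_on S f \<longleftrightarrow> (\<forall>x\<in>S. \<exists>e>0. \<exists>L. L-lipschitz_on (cball x e \<inter> S) f)"

text \<open>Unspecified at points where \<open>f\<close> is not differentiable.\<close>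

definition gradient :: "('a::real_inner \<Rightarrow> real) \<Rightarrow> 'a \<Rightarrow> 'a" where
  "gradient f x = (THE D. GDERIV f x :> D)"

definition Lp_norm ::
    "real \<Rightarrow> 'a::euclidean_space set \<Rightarrow> ('a \<Rightarrow> 'b::real_normed_vector) \<Rightarrow> ennreal" where
  "Lp_norm p S g = ennpow (\<integral>\<^sup>+x\<in>S. ennreal (norm (g x) powr p) \<partial>lebesgue) (1 / p)"

end

theory Submission
  imports Defs
begin

text \<open>
The inequality follows from two facts: a John domain allows \<open>f - a\<close> to be bounded pointwise by
averages of the gradient over small balls that keep away from the boundary in proportion to their
size, and the weight conditions bound the resulting averaging operator between the two weighted
spaces.

\<^emph>\<open>The representation.\<close> A John curve \<open>\<gamma>\<close> from \<open>y\<close> to \<open>x0\<close> is thickened to a family of curves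
\<open>s \<mapsto> \<gamma> s + s z\<close> with \<open>z\<close> small. All of them start at \<open>y\<close>, and at time \<open>s\<close> they fill a ball of radius
comparable to \<open>s\<close> whose distance to the boundary is at least comparable to \<open>s\<close>. Integrating the
derivative of \<open>f\<close> along these curves and averaging over \<open>z\<close> gives, with \<open>a\<close> the mean of \<open>f\<close> over a ball
about \<open>x0\<close>, that \<open>\<bar>f y - a\<bar>\<close> is at most a constant times the sum over \<open>j\<close> of \<open>2^(j (n - 1))\<close> times the
integral of \<open>\<bar>\<nabla>f\<bar>\<close> over the points \<open>x\<close> with \<open>dist x y\<close> at most about \<open>2^(-j)\<close> and \<open>d x\<close> at least about
\<open>2^(-j)\<close> (\<open>john_representation\<close>). That a locally Lipschitz function has a gradient almost everywhere,
and that its increments are controlled by that gradient, is Rademacher's theorem (\<open>rademacher\<close>) and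
the fundamental theorem of calculus for Lipschitz functions (\<open>lipschitz_real_ae_differentiable\<close>).
Every ball lies in a comparable cell of one of \<open>2^n\<close> shifted dyadic grids, so balls can be replaced
by dyadic cells (\<open>john_grid_representation\<close>).

\<^emph>\<open>The power of the distance.\<close> At level \<open>j\<close>, with side \<open>l_j\<close>, the integrand in the grid representation
is \<open>k_j = l_j \<bar>\<nabla>f\<bar>\<close> where \<open>l_j \<le> D d\<close> and \<open>0\<close> elsewhere. The sides form a geometric sequence, so the sum
of \<open>k_i\<close> over \<open>i \<ge> j\<close> is at most \<open>2 min l_j (D d) \<bar>\<nabla>f\<bar>\<close>, hence at most \<open>l_j^(1 - \<alpha>)\<close> times
\<open>2 D^\<alpha> \<bar>\<nabla>f\<bar> d^\<alpha>\<close>. This tail bound is all that is used of \<open>k\<close>, and it is uniform in \<open>\<alpha>\<close>, the case \<open>\<alpha> = 1\<close>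
included, where a bound of each single \<open>k_i\<close> would not suffice for \<open>p = q\<close>.

\<^emph>\<open>The weighted estimate.\<close> By duality it is enough to bound the sum of the forms
\<open>\<integral> h w1 l_i^(-n) (\<integral> k_i over the cell)\<close> when \<open>\<integral> g^p w2 \<le> 1\<close> and \<open>\<integral> h^q' w1 \<le> 1\<close> (\<open>duality_bound\<close>,
\<open>grid_estimate\<close>). Put \<open>\<sigma> = w2^(1 - p')\<close> and \<open>g = G \<sigma>\<close>.

For \<open>p < q\<close>, the condition on the tripled cell \<open>3Q\<close> bounds \<open>l^(1 - \<alpha> - n)\<close> by a constant times
\<open>\<sigma>(3Q)^(-1/p') w1(3Q)^(-1/q)\<close>. With \<open>p < s < q\<close>, Young's inequality with exponents \<open>s\<close> and \<open>s'\<close>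
separates the two weights and leaves \<open>\<sigma>(3Q)^(-s/p') (\<integral> G \<sigma> over Q)^s\<close>, summed over all cells, and
the analogous sum for \<open>h\<close> and \<open>w1\<close>, where \<open>s' > q'\<close>. Each sum is an embedding of \<open>L^p(\<sigma>)\<close> into a
weighted \<open>\<ell>^s\<close>. It holds because reverse doubling makes \<open>\<sigma>(3Q)\<close> decay geometrically along nested
cells, so that at each point the sum over the cells containing it is comparable to its largest
possible term, which is a power of the maximal function (\<open>fractional_embedding\<close>).

For \<open>p = q\<close> there is no gap between the exponents. The averages of \<open>h w1\<close> along the nested cells are
at most their running maximum, and the steps of that maximum satisfy a Carleson condition for
Lebesgue measure, whatever the function averaged (\<open>jump_carleson\<close>). Summation by parts and the tail
bound for \<open>k\<close> therefore bound the form by twice the integral of the supremum, over the cells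
containing a point, of \<open>l^(1 - \<alpha>)\<close> times the average of \<open>g\<close> times the average of \<open>h w1\<close>. Hoelder's
inequality and the condition for \<open>p = q\<close> bound this supremum by a product of maximal functions of \<open>u^a\<close> and
\<open>v^b\<close>, where \<open>u = g w2^(1/p)\<close>, \<open>v = h w1^(1/p')\<close>, and \<open>r > 1\<close> gives \<open>a < p\<close> and \<open>b < p'\<close>; Doob's inequality
(\<open>maximal_inequality\<close>) concludes.

If \<open>w1\<close> vanishes almost everywhere the left-hand side is \<open>0\<close>. Otherwise the conditions force
\<open>w1\<close> and \<open>\<sigma>\<close> to be locally integrable and hence \<open>w2\<close> to be positive almost everywhere
(\<open>weight_product_finite\<close>). The normalisation of the right-hand side is removed by scaling \<open>f\<close>.
\<close>

section \<open>Nested partitions and the maximal inequality\<close>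

text \<open>
A sequence of refining countable partitions, given by labels: \<open>\<iota> i x\<close> names the cell of level \<open>i\<close> that
contains \<open>x\<close>, and \<open>par\<close> sends a label to that of the enclosing cell one level coarser. A label may name
cells of several levels. The measure is a parameter because the same dyadic cells are used with
Lebesgue measure and with both weights.
\<close>

locale cell_tree =
  fixes M :: "'a measure" and \<iota> :: "nat \<Rightarrow> 'a \<Rightarrow> 'c::countable" and par :: "'c \<Rightarrow> 'c"
  assumes cell_measurable [measurable]: "\<And>i. \<iota> i \<in> M \<rightarrow>\<^sub>M count_space UNIV"
    and parent: "\<And>i x. x \<in> space M \<Longrightarrow> par (\<iota> (Suc i) x) = \<iota> i x"
    and finite_cell: "\<And>i c. emeasure M {y \<in> space M. \<iota> i y = c} < \<infinity>"
begin

definition cell :: "nat \<Rightarrow> 'c \<Rightarrow> 'a set" where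
  "cell i c = {y \<in> space M. \<iota> i y = c}"

definition cell_int :: "nat \<Rightarrow> ('a \<Rightarrow> ennreal) \<Rightarrow> 'c \<Rightarrow> ennreal" where
  "cell_int i G c = (\<integral>\<^sup>+y\<in>cell i c. G y \<partial>M)"

text \<open>
Division by zero gives cells of measure \<open>0\<close> the average \<open>0\<close>, so identities about averages need no
exception for them.
\<close>

definition avg :: "nat \<Rightarrow> ('a \<Rightarrow> real) \<Rightarrow> 'c \<Rightarrow> real" where
  "avg i G c = enn2real (cell_int i (\<lambda>x. ennreal (G x)) c) / measure M (cell i c)"

primrec runmax :: "(nat \<Rightarrow> 'c \<Rightarrow> real) \<Rightarrow> nat \<Rightarrow> 'c \<Rightarrow> real" where
  "runmax A 0 c = A 0 c"
| "runmax A (Suc i) c = max (runmax A i (par c)) (A (Suc i) c)"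

abbreviation maxavg :: "nat \<Rightarrow> ('a \<Rightarrow> real) \<Rightarrow> 'c \<Rightarrow> real" where
  "maxavg i G \<equiv> runmax (\<lambda>i. avg i G) i"

lemma cell_sets [measurable]: "cell i c \<in> sets M"
  unfolding cell_def by measurable

lemma measurable_cell_fun [measurable (raw)]: "(\<lambda>x. X (\<iota> i x)) \<in> borel_measurable M"
  by (rule measurable_compose[OF cell_measurable]) simp

lemma emeasure_cell: "emeasure M (cell i c) = ennreal (measure M (cell i c))"
  using finite_cell[of i c] by (simp add: cell_def emeasure_eq_ennreal_measure)

text \<open>
A function constant on the cells of level \<open>i\<close> is integrated cell by cell; every exchange of a function
for its averages goes through this identity.
\<close>

lemma integral_over_cells:
  assumes [measurable]: "G \<in> borel_measurable M"
  shows "(\<integral>\<^sup>+x. \<phi> (\<iota> i x) * G x \<partial>M) = (\<integral>\<^sup>+c. \<phi> c * cell_int i G c \<partial>count_space UNIV)"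
proof -
  have "(\<integral>\<^sup>+c. \<phi> c * cell_int i G c \<partial>count_space UNIV)
      = (\<integral>\<^sup>+c. \<integral>\<^sup>+x. \<phi> c * (G x * indicator (cell i c) x) \<partial>M \<partial>count_space UNIV)"
    unfolding cell_int_def by (intro nn_integral_cong nn_integral_cmult[symmetric]) measurable
  also have "\<dots> = (\<integral>\<^sup>+x. \<integral>\<^sup>+c. \<phi> c * (G x * indicator (cell i c) x) \<partial>count_space UNIV \<partial>M)"
    by (rule nn_integral_count_space_nn_integral[symmetric]) auto
  also have "\<dots> = (\<integral>\<^sup>+x. \<phi> (\<iota> i x) * G x \<partial>M)"
  proof (rule nn_integral_cong)
    fix x assume x: "x \<in> space M"
    have "(\<integral>\<^sup>+c. \<phi> c * (G x * indicator (cell i c) x) \<partial>count_space UNIV)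
        = (\<integral>\<^sup>+c. (\<phi> (\<iota> i x) * G x) * indicator {\<iota> i x} c \<partial>count_space UNIV)"
      using x by (intro nn_integral_cong) (auto simp: cell_def indicator_def)
    also have "\<dots> = \<phi> (\<iota> i x) * G x"
      by (subst nn_integral_cmult_indicator) auto
    finally show "(\<integral>\<^sup>+c. \<phi> c * (G x * indicator (cell i c) x) \<partial>count_space UNIV) = \<phi> (\<iota> i x) * G x" .
  qed
  finally show ?thesis by simp
qed

text \<open>
Averaging over the cells of one level is self-adjoint.
\<close>

lemma integral_cell_int_swap:
  assumes [measurable]: "G \<in> borel_measurable M" "H \<in> borel_measurable M"
  shows "(\<integral>\<^sup>+x. \<phi> (\<iota> i x) * cell_int i G (\<iota> i x) * H x \<partial>M)
       = (\<integral>\<^sup>+x. \<phi> (\<iota> i x) * cell_int i H (\<iota> i x) * G x \<partial>M)"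
  using integral_over_cells[of H "\<lambda>c. \<phi> c * cell_int i G c" i]
    integral_over_cells[of G "\<lambda>c. \<phi> c * cell_int i H c" i]
  by (simp add: mult_ac)

lemma cell_int_null:
  assumes "measure M (cell i c) = 0"
  shows "cell_int i G c = 0"
proof -
  have "cell i c \<in> null_sets M"
    using assms emeasure_cell[of i c] by (auto simp: null_sets_def)
  then show ?thesis
    unfolding cell_int_def by (rule nn_integral_null_set)
qed

lemma avg_nonneg [simp]: "0 \<le> avg i G c"
  by (simp add: avg_def)

lemma avg_times_measure:
  assumes "cell_int i (\<lambda>x. ennreal (G x)) c < \<infinity>"
  shows "ennreal (avg i G c) * emeasure M (cell i c) = cell_int i (\<lambda>x. ennreal (G x)) c"
proof (cases "measure M (cell i c) = 0")
  case True
  then show ?thesis using cell_int_null[OF True] by (simp add: emeasure_cell)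
next
  case False
  then have "avg i G c * measure M (cell i c) = enn2real (cell_int i (\<lambda>x. ennreal (G x)) c)"
    by (simp add: avg_def)
  then show ?thesis
    using assms by (simp add: emeasure_cell ennreal_mult'[symmetric] less_top[symmetric])
qed

text \<open>
The defining property of a conditional expectation, for nonnegative functions that are integrable on
each cell.
\<close>

lemma integral_avg:
  assumes [measurable]: "G \<in> borel_measurable M"
    and fin: "\<And>c. cell_int i (\<lambda>x. ennreal (G x)) c < \<infinity>"
  shows "(\<integral>\<^sup>+x. \<phi> (\<iota> i x) * ennreal (avg i G (\<iota> i x)) \<partial>M) = (\<integral>\<^sup>+x. \<phi> (\<iota> i x) * ennreal (G x) \<partial>M)"
proof -
  have "cell_int i (\<lambda>_. 1) c = emeasure M (cell i c)" for c
    by (simp add: cell_int_def)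
  then show ?thesis
    using integral_over_cells[of "\<lambda>_. 1" "\<lambda>c. \<phi> c * ennreal (avg i G c)" i]
      integral_over_cells[of "\<lambda>x. ennreal (G x)" \<phi> i]
    by (simp add: avg_times_measure[OF fin] mult.assoc)
qed

text \<open>
The power \<open>t^p\<close> lies above its tangent at \<open>a\<close>; this is Young's inequality for \<open>t\<close> and \<open>a^(p-1)\<close>.
\<close>

lemma powr_tangent:
  fixes a t p :: real
  assumes "1 < p" "0 \<le> a" "0 \<le> t"
  shows "p * a powr (p - 1) * t \<le> t powr p + (p - 1) * a powr p"
proof -
  define p' where "p' = p / (p - 1)"
  have p': "p' > 1" "1/p + 1/p' = 1" using assms by (auto simp: p'_def field_simps)
  have "t * a powr (p - 1) \<le> t powr p / p + (a powr (p - 1)) powr p' / p'"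
    using assms p' by (intro Youngs_inequality) auto
  also have "(a powr (p - 1)) powr p' = a powr p"
    using assms by (simp add: powr_powr p'_def)
  finally have "t * a powr (p - 1) \<le> t powr p / p + a powr p / p'" .
  then have "p * (t * a powr (p - 1)) \<le> p * (t powr p / p + a powr p / p')"
    using assms by (intro mult_left_mono) auto
  also have "\<dots> = t powr p + (p - 1) * a powr p"
    using assms by (simp add: p'_def field_simps)
  finally show ?thesis by (simp add: mult_ac)
qed

lemma cell_int_le_integral:
  "cell_int i G c \<le> (\<integral>\<^sup>+x. G x \<partial>M)"
  unfolding cell_int_def by (intro nn_integral_mono) (auto simp: indicator_def)

lemma finite_cell_int:
  assumes [measurable]: "G \<in> borel_measurable M" and "1 < p" and G0: "\<And>x. 0 \<le> G x"
    and fin: "cell_int i (\<lambda>x. ennreal (G x powr p)) c < \<infinity>"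
  shows "cell_int i (\<lambda>x. ennreal (G x)) c < \<infinity>"
proof -
  have le: "G x \<le> 1 + G x powr p" for x
  proof (cases "G x \<le> 1")
    case False
    then have "G x powr 1 \<le> G x powr p" using \<open>1 < p\<close> by (intro powr_mono) auto
    with False show ?thesis by simp
  qed (simp add: add_increasing2)
  have "cell_int i (\<lambda>x. ennreal (G x)) c \<le> cell_int i (\<lambda>x. 1 + ennreal (G x powr p)) c"
    unfolding cell_int_def
    by (intro nn_integral_mono mult_right_mono) (use le in \<open>auto simp flip: ennreal_1 ennreal_plus\<close>)
  also have "\<dots> = emeasure M (cell i c) + cell_int i (\<lambda>x. ennreal (G x powr p)) c"
  proof -
    have "cell_int i (\<lambda>x. 1 + ennreal (G x powr p)) c
        = (\<integral>\<^sup>+x. indicator (cell i c) x + ennreal (G x powr p) * indicator (cell i c) x \<partial>M)"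
      unfolding cell_int_def by (simp add: distrib_right)
    also have "\<dots> = emeasure M (cell i c) + cell_int i (\<lambda>x. ennreal (G x powr p)) c"
      unfolding cell_int_def by (subst nn_integral_add) auto
    finally show ?thesis .
  qed
  also have "\<dots> < \<infinity>" using fin finite_cell[of i c] by (simp add: cell_def)
  finally show ?thesis .
qed

text \<open>
Jensen's inequality for powers: the tangent of \<open>t^p\<close> at the average is integrated over the cell.
\<close>

lemma avg_jensen:
  assumes [measurable]: "G \<in> borel_measurable M" and p: "1 < p" and G0: "\<And>x. 0 \<le> G x"
    and fin: "cell_int i (\<lambda>x. ennreal (G x powr p)) c < \<infinity>"
  shows "ennreal (avg i G c powr p) * emeasure M (cell i c) \<le> cell_int i (\<lambda>x. ennreal (G x powr p)) c"
proof -
  define a where "a = avg i G c"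
  define m where "m = measure M (cell i c)"
  have a0: "0 \<le> a" by (simp add: a_def)
  have m0: "0 \<le> m" by (simp add: m_def)
  note fin1 = finite_cell_int[OF assms]
  have "ennreal (p * a powr (p - 1)) * cell_int i (\<lambda>x. ennreal (G x)) c
      = (\<integral>\<^sup>+x\<in>cell i c. ennreal (p * a powr (p - 1) * G x) \<partial>M)"
    unfolding cell_int_def using p a0 
    by (subst nn_integral_cmult[symmetric]) (auto simp: ennreal_mult' mult.assoc)
  also have "\<dots> \<le> (\<integral>\<^sup>+x\<in>cell i c. ennreal (G x powr p + (p - 1) * a powr p) \<partial>M)"
    using powr_tangent[OF p a0 G0] by (intro nn_integral_mono mult_right_mono ennreal_leI) auto
  also have "\<dots> = cell_int i (\<lambda>x. ennreal (G x powr p)) c + ennreal ((p - 1) * a powr p) * emeasure M (cell i c)"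
    unfolding cell_int_def using p
    by (subst nn_integral_cmult_indicator[symmetric], simp, subst nn_integral_add[symmetric])
      (auto simp: distrib_right)
  finally have *: "ennreal (p * a powr (p - 1)) * cell_int i (\<lambda>x. ennreal (G x)) c \<le> \<dots>" .
  obtain z where z: "cell_int i (\<lambda>x. ennreal (G x powr p)) c = ennreal z" "0 \<le> z"
    using fin by (cases "cell_int i (\<lambda>x. ennreal (G x powr p)) c") auto
  have "cell_int i (\<lambda>x. ennreal (G x)) c = ennreal (a * m)"
    using avg_times_measure[OF fin1] a0 m0 by (simp add: a_def m_def emeasure_cell ennreal_mult')
  with * z have "ennreal (p * a powr (p - 1) * (a * m)) \<le> ennreal (z + (p - 1) * a powr p * m)"
    using p a0 m0 by (simp add: emeasure_cell m_def ennreal_mult' mult.assoc)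
  then have le: "p * a powr (p - 1) * (a * m) \<le> z + (p - 1) * a powr p * m"
    using z p m0 by (subst (asm) ennreal_le_iff) auto
  have "a powr (p - 1) * a = a powr p"
    using a0 p by (cases "a = 0") (auto simp: powr_diff)
  then have "p * a powr (p - 1) * (a * m) = p * (a powr p * m)" by (metis mult.assoc)
  moreover have "(p - 1) * a powr p * m = p * (a powr p * m) - a powr p * m"
    by (simp add: algebra_simps)
  ultimately have "a powr p * m \<le> z" using le by linarith
  then show ?thesis using z a0 m0
    by (simp add: emeasure_cell flip: m_def a_def ennreal_mult')
qed

lemma integral_avg_powr:
  assumes [measurable]: "G \<in> borel_measurable M" and p: "1 < p" and G0: "\<And>x. 0 \<le> G x"
    and fin: "(\<integral>\<^sup>+x. ennreal (G x powr p) \<partial>M) < \<infinity>"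
  shows "(\<integral>\<^sup>+x. ennreal (avg i G (\<iota> i x) powr p) \<partial>M) \<le> (\<integral>\<^sup>+x. ennreal (G x powr p) \<partial>M)"
proof -
  have fin': "cell_int i (\<lambda>x. ennreal (G x powr p)) c < \<infinity>" for c
    using cell_int_le_integral fin by (rule le_less_trans)
  have 1: "cell_int i (\<lambda>_. 1) c = emeasure M (cell i c)" for c
    by (simp add: cell_int_def)
  have "(\<integral>\<^sup>+x. ennreal (avg i G (\<iota> i x) powr p) \<partial>M)
      = (\<integral>\<^sup>+c. ennreal (avg i G c powr p) * emeasure M (cell i c) \<partial>count_space UNIV)"
    using integral_over_cells[of "\<lambda>_. 1" "\<lambda>c. ennreal (avg i G c powr p)" i] by (simp add: 1)
  also have "\<dots> \<le> (\<integral>\<^sup>+c. cell_int i (\<lambda>x. ennreal (G x powr p)) c \<partial>count_space UNIV)"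
    using avg_jensen[OF assms(1) p G0 fin'] by (intro nn_integral_mono)
  also have "\<dots> = (\<integral>\<^sup>+x. ennreal (G x powr p) \<partial>M)"
    using integral_over_cells[of "\<lambda>x. ennreal (G x powr p)" "\<lambda>_. 1" i] by simp
  finally show ?thesis .
qed

lemma maxavg_nonneg [simp]: "0 \<le> maxavg i G c"
  by (induction i arbitrary: c) (auto simp: le_max_iff_disj)

text \<open>
A crude bound growing with \<open>n\<close>. Only finiteness matters: it allows a fraction of the left-hand side
to be absorbed in the proof of \<open>maximal_inequality\<close>.
\<close>

lemma maxavg_pow_finite:
  assumes [measurable]: "G \<in> borel_measurable M" and p: "1 < p" and G0: "\<And>x. 0 \<le> G x"
    and fin: "(\<integral>\<^sup>+x. ennreal (G x powr p) \<partial>M) < \<infinity>"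
  shows "(\<integral>\<^sup>+x. ennreal (maxavg n G (\<iota> n x) powr p) \<partial>M) < \<infinity>"
proof (induction n)
  case 0
  then show ?case using integral_avg_powr[OF assms, of 0] fin by (simp add: le_less_trans)
next
  case (Suc n)
  have "(\<integral>\<^sup>+x. ennreal (maxavg (Suc n) G (\<iota> (Suc n) x) powr p) \<partial>M)
      \<le> (\<integral>\<^sup>+x. ennreal (maxavg n G (\<iota> n x) powr p) + ennreal (avg (Suc n) G (\<iota> (Suc n) x) powr p) \<partial>M)"
    by (intro nn_integral_mono) (auto simp: parent max_def simp flip: ennreal_plus intro!: ennreal_leI)
  also have "\<dots> = (\<integral>\<^sup>+x. ennreal (maxavg n G (\<iota> n x) powr p) \<partial>M)
       + (\<integral>\<^sup>+x. ennreal (avg (Suc n) G (\<iota> (Suc n) x) powr p) \<partial>M)"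
    by (intro nn_integral_add) measurable
  also have "\<dots> < \<infinity>" using Suc integral_avg_powr[OF assms, of "Suc n"] fin
    by (auto simp: le_less_trans)
  finally show ?case .
qed

text \<open>
One refinement step in the proof of \<open>maximal_inequality\<close>: if the running maximum \<open>a\<close> is updated by the
new average \<open>x\<close>, then \<open>M^p\<close> grows by at most \<open>p' x\<close> times the growth of \<open>M^(p-1)\<close>. It is stated without
subtraction so that it can be integrated in the extended nonnegative reals.
\<close>

lemma powr_max_step:
  fixes a b p :: real
  assumes "1 < p" "0 \<le> a" "0 \<le> x" and p': "p' = p / (p - 1)"
  shows "max a x powr p + p' * x * a powr (p - 1) \<le> a powr p + p' * x * max a x powr (p - 1)"
proof (cases "x \<le> a")
  case True
  then show ?thesis using assms by (simp add: max_def)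
next
  case False
  have xx: "x * x powr (p - 1) = x powr p" using False assms by (simp add: powr_diff)
  have "p * a powr (p - 1) * x \<le> x powr p + (p - 1) * a powr p"
    by (rule powr_tangent) (use assms in auto)
  then have "p * a powr (p - 1) * x / (p - 1) \<le> (x powr p + (p - 1) * a powr p) / (p - 1)"
    using assms by (intro divide_right_mono) auto
  also have "\<dots> = x powr p / (p - 1) + a powr p"
    using assms by (simp add: add_divide_distrib)
  finally have "p' * x * a powr (p - 1) \<le> x powr p / (p - 1) + a powr p"
    by (simp add: p' mult_ac)
  also have "x powr p / (p - 1) = p' * x powr p - x powr p"
  proof -
    have "p' - 1 = 1 / (p - 1)" using assms by (simp add: p' divide_simps)
    then have "(p' - 1) * x powr p = x powr p / (p - 1)" by simp
    then show ?thesis by (simp add: left_diff_distrib)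
  qed
  finally have "p' * x * a powr (p - 1) \<le> p' * x powr p - x powr p + a powr p" .
  moreover have "p' * x * x powr (p - 1) = p' * x powr p" by (simp only: xx mult.assoc)
  moreover have "max a x = x" using False by simp
  ultimately show ?thesis by linarith
qed

text \<open>
Doob's inequality. Summing the refinement steps gives \<open>\<integral> M^p \<le> p' \<integral> G M^(p-1)\<close>, since the new average
may be replaced by \<open>G\<close> itself when it is integrated against a function constant on cells. Young's
inequality and absorption of \<open>\<integral> M^p / p'\<close> finish the proof. The constant does not depend on \<open>n\<close>.
\<close>

lemma maximal_inequality:
  assumes [measurable]: "G \<in> borel_measurable M" and p: "1 < p" and G0: "\<And>x. 0 \<le> G x"
    and fin: "(\<integral>\<^sup>+x. ennreal (G x powr p) \<partial>M) < \<infinity>"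
  shows "(\<integral>\<^sup>+x. ennreal (maxavg n G (\<iota> n x) powr p) \<partial>M)
      \<le> ennreal ((p / (p - 1)) powr p) * (\<integral>\<^sup>+x. ennreal (G x powr p) \<partial>M)"
proof -
  define p' where "p' = p / (p - 1)"
  have p': "p' > 1" "1/p + 1/p' = 1" using p by (auto simp: p'_def field_simps)
  define I where "I n = (\<integral>\<^sup>+x. ennreal (maxavg n G (\<iota> n x) powr p) \<partial>M)" for n
  define K where "K n = (\<integral>\<^sup>+x. ennreal (p' * maxavg n G (\<iota> n x) powr (p - 1)) * ennreal (G x) \<partial>M)" for n
  have fin': "cell_int i (\<lambda>x. ennreal (G x)) c < \<infinity>" for i c
    using cell_int_le_integral fin by (intro finite_cell_int[OF assms(1) p G0]) (rule le_less_trans)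
  have young: "p' * m powr (p - 1) * G x \<le> (p' * G x) powr p / p + m powr p / p'" if "0 \<le> m" for m x
  proof -
    have "(p' * G x) * m powr (p - 1) \<le> (p' * G x) powr p / p + (m powr (p - 1)) powr p' / p'"
      using p p' G0 by (intro Youngs_inequality) auto
    also have "(m powr (p - 1)) powr p' = m powr p" using p by (simp add: powr_powr p'_def)
    finally show ?thesis by (simp add: mult_ac)
  qed
  \<comment> \<open>Young's inequality splits off \<open>I n / p'\<close>, which is absorbed at the end.\<close>
  have Kle: "K n \<le> ennreal (p' powr p / p) * (\<integral>\<^sup>+x. ennreal (G x powr p) \<partial>M) + ennreal (1 / p') * I n" for n
  proof -
    have "K n \<le> (\<integral>\<^sup>+x. ennreal (p' powr p / p) * ennreal (G x powr p)
         + ennreal (1/p') * ennreal (maxavg n G (\<iota> n x) powr p) \<partial>M)"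
      unfolding K_def
    proof (intro nn_integral_mono)
      fix x
      show "ennreal (p' * maxavg n G (\<iota> n x) powr (p - 1)) * ennreal (G x)
         \<le> ennreal (p' powr p / p) * ennreal (G x powr p) + ennreal (1/p') * ennreal (maxavg n G (\<iota> n x) powr p)"
        using ennreal_leI[OF young[of "maxavg n G (\<iota> n x)" x, simplified]] p p' G0[of x]
        by (simp add: powr_mult ennreal_mult ennreal_plus divide_inverse mult_ac)
    qed
    also have "\<dots> = ennreal (p' powr p / p) * (\<integral>\<^sup>+x. ennreal (G x powr p) \<partial>M) + ennreal (1/p') * I n"
      unfolding I_def by (simp add: nn_integral_add nn_integral_cmult)
    finally show ?thesis .
  qed
  have Ifin: "I n < \<infinity>" for n unfolding I_def by (rule maxavg_pow_finite[OF assms])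
  have Kfin: "K n < \<infinity>" for n
    using Kle[of n] Ifin[of n] fin by (auto simp: le_less_trans ennreal_mult_less_top)
  \<comment> \<open>Integration of \<open>powr_max_step\<close> gives
    \<open>I (Suc n) - I n \<le> K (Suc n) - K n\<close>.\<close>
  have IK: "I n \<le> K n" for n
  proof (induction n)
    case 0
    have "I 0 \<le> (\<integral>\<^sup>+x. ennreal (p' * avg 0 G (\<iota> 0 x) powr (p - 1)) * ennreal (avg 0 G (\<iota> 0 x)) \<partial>M)"
      unfolding I_def
    proof (intro nn_integral_mono)
      fix x
      have "a powr p \<le> p' * a powr (p - 1) * a" if "0 \<le> a" for a :: real
      proof -
        have "a powr (p - 1) * a = a powr p"
          using that p by (cases "a = 0") (auto simp: powr_diff)
        then show ?thesis using p' mult_right_mono[of 1 p' "a powr p"] by (simp add: mult.assoc)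
      qed
      from ennreal_leI[OF this[of "avg 0 G (\<iota> 0 x)"]]
      show "ennreal (maxavg 0 G (\<iota> 0 x) powr p) \<le> ennreal (p' * avg 0 G (\<iota> 0 x) powr (p - 1)) * ennreal (avg 0 G (\<iota> 0 x))"
        using p' by (simp add: ennreal_mult)
    qed
    also have "\<dots> = K 0"
      unfolding K_def using integral_avg[OF assms(1) fin', where \<phi> = "\<lambda>c. ennreal (p' * avg 0 G c powr (p - 1))"]
      by simp
    finally show ?case .
  next
    case (Suc n)
    let ?m = "\<lambda>c. maxavg n G (par c)"
    let ?a = "avg (Suc n) G"
    let ?s = "\<lambda>x. \<iota> (Suc n) x"
    have "I (Suc n) + (\<integral>\<^sup>+x. ennreal (p' * ?m (?s x) powr (p - 1)) * ennreal (?a (?s x)) \<partial>M)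
       = (\<integral>\<^sup>+x. ennreal (max (?m (?s x)) (?a (?s x)) powr p) + ennreal (p' * ?m (?s x) powr (p - 1)) * ennreal (?a (?s x)) \<partial>M)"
      unfolding I_def by (subst nn_integral_add) (auto intro!: measurable_cell_fun)
    also have "\<dots> \<le> (\<integral>\<^sup>+x. ennreal (?m (?s x) powr p) + ennreal (p' * maxavg (Suc n) G (?s x) powr (p - 1)) * ennreal (?a (?s x)) \<partial>M)"
    proof (intro nn_integral_mono)
      fix x
      show "ennreal (max (?m (?s x)) (?a (?s x)) powr p) + ennreal (p' * ?m (?s x) powr (p - 1)) * ennreal (?a (?s x))
        \<le> ennreal (?m (?s x) powr p) + ennreal (p' * maxavg (Suc n) G (?s x) powr (p - 1)) * ennreal (?a (?s x))"
        using ennreal_leI[OF powr_max_step[OF p _ _ p'_def, of "?m (?s x)" "?a (?s x)"]] p'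
        by (simp add: ennreal_mult ennreal_plus mult_ac le_max_iff_disj del: max.absorb1 max.absorb2 max.absorb3 max.absorb4)
    qed
    also have "\<dots> = (\<integral>\<^sup>+x. ennreal (?m (?s x) powr p) \<partial>M)
        + (\<integral>\<^sup>+x. ennreal (p' * maxavg (Suc n) G (?s x) powr (p - 1)) * ennreal (?a (?s x)) \<partial>M)"
      by (subst nn_integral_add) (auto intro!: measurable_cell_fun)
    also have "(\<integral>\<^sup>+x. ennreal (?m (?s x) powr p) \<partial>M) = I n"
      unfolding I_def by (intro nn_integral_cong) (simp add: parent)
    also have "(\<integral>\<^sup>+x. ennreal (p' * maxavg (Suc n) G (?s x) powr (p - 1)) * ennreal (?a (?s x)) \<partial>M) = K (Suc n)"
      unfolding K_def by (rule integral_avg[OF assms(1) fin', where \<phi> = "\<lambda>c. ennreal (p' * maxavg (Suc n) G c powr (p - 1))"])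
    also have "(\<integral>\<^sup>+x. ennreal (p' * ?m (?s x) powr (p - 1)) * ennreal (?a (?s x)) \<partial>M)
       = (\<integral>\<^sup>+x. ennreal (p' * ?m (?s x) powr (p - 1)) * ennreal (G x) \<partial>M)"
      by (rule integral_avg[OF assms(1) fin', where \<phi> = "\<lambda>c. ennreal (p' * ?m c powr (p - 1))"])
    also have "\<dots> = K n"
      unfolding K_def by (intro nn_integral_cong) (simp add: parent)
    finally have "I (Suc n) + K n \<le> I n + K (Suc n)" .
    also have "\<dots> \<le> K n + K (Suc n)" using Suc by (rule add_right_mono)
    finally show ?case using Kfin[of n] by (auto simp: add.commute ennreal_add_left_cancel_le)
  qed
  obtain z where z: "I n = ennreal z" "0 \<le> z" using Ifin[of n] by (cases "I n") auto
  obtain g where g: "(\<integral>\<^sup>+x. ennreal (G x powr p) \<partial>M) = ennreal g" "0 \<le> g"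
    using fin by (cases "\<integral>\<^sup>+x. ennreal (G x powr p) \<partial>M") auto
  have "ennreal z \<le> ennreal (p' powr p / p * g + z / p')"
    using order_trans[OF IK Kle, of n] z g p p' by (simp flip: ennreal_mult' ennreal_plus)
  then have "z \<le> p' powr p / p * g + z / p'"
    using z g p p' by (subst (asm) ennreal_le_iff) auto
  moreover have "z / p' = z - z / p"
  proof -
    have "1 / p' = 1 - 1 / p" using p' by simp
    then have "z * (1 / p') = z * (1 - 1 / p)" by simp
    then show ?thesis by (simp add: right_diff_distrib)
  qed
  ultimately have "z / p \<le> p' powr p * g / p" by simp
  then have "z \<le> p' powr p * g" using p by (simp add: divide_le_cancel)
  then show ?thesis
    using z g p unfolding I_def[symmetric] p'_def[symmetric] by (simp flip: ennreal_mult')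
qed

end

section \<open>Two summation principles along nested cells\<close>

text \<open>
A sequence that decays at least geometrically has at most a bounded number of terms near \<open>1\<close>, while
\<open>min (t^a) (t^(-b))\<close> decays geometrically away from \<open>1\<close> on both sides. Terms equal to \<open>0\<close> contribute \<open>0\<close>.
\<close>

lemma geometric_potential_sum:
  fixes t :: "nat \<Rightarrow> real"
  assumes t0: "\<And>i. 0 \<le> t i" and dec: "\<And>i. t (Suc i) \<le> \<delta> * t i"
    and \<delta>: "0 < \<delta>" "\<delta> < 1" and ab: "0 < a" "0 < b"
  shows "(\<Sum>i\<le>n. min (t i powr a) (t i powr (- b)))
     \<le> 1 / (1 - \<delta> powr a) + \<delta> powr (- b) / (\<delta> powr (- b) - 1)"
proof -
  define D where "D = \<delta> powr (- b)"
  \<comment> \<open>Telescoping potentials: as long as the sequence is at most \<open>1\<close>, the term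
    \<open>t^a\<close> is paid for by the decrease of \<open>P\<close>, and while it exceeds
    \<open>1\<close>, the term \<open>t^(-b)\<close> is paid for by the increase of
    \<open>Q\<close>.\<close>
  define P where "P u = min u 1 powr a / (1 - \<delta> powr a)" for u
  define Q where "Q u = (if u = 0 then D else min D (u powr (- b))) / (D - 1)" for u
  have da: "\<delta> powr a < 1" using powr_less_mono2[of a \<delta> 1] \<delta> ab by simp
  have D1: "1 < D" using \<delta> ab powr_less_mono2[of b \<delta> 1] by (simp add: D_def powr_minus one_less_inverse)
  have Qle: "Q u \<le> D / (D - 1)" for u using D1 by (auto simp: Q_def intro!: divide_right_mono)
  have Q0: "0 \<le> Q u" for u using D1 by (auto simp: Q_def)
  have P0: "0 \<le> P u" for u using da by (auto simp: P_def)
  have P1: "P u \<le> 1 / (1 - \<delta> powr a)" if "0 \<le> u" for u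
    using da ab that by (auto simp: P_def powr_le1 intro!: divide_right_mono)
  have step: "min (u powr a) (u powr (- b)) \<le> P u - P u' + Q u' - Q u"
    if u: "0 \<le> u'" "u' \<le> \<delta> * u" "0 \<le> u" for u u'
  proof -
    have uu: "u' \<le> u" using u \<delta> mult_right_mono[of \<delta> 1 u] by simp
    have Pm: "P u' \<le> P u" unfolding P_def using da u uu ab
      by (intro divide_right_mono powr_mono2) auto
    have Qm: "Q u \<le> Q u'"
    proof (cases "u' = 0")
      case True then show ?thesis using Qle[of u] D1 by (simp add: Q_def)
    next
      case False
      then have "u powr (- b) \<le> u' powr (- b)" using u uu ab
        by (simp add: powr_minus le_imp_inverse_le powr_mono2)
      then show ?thesis using False u uu D1 by (auto simp: Q_def intro!: divide_right_mono)
    qed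
    show ?thesis
    proof (cases "u \<le> 1")
      case True
      have "u' powr a \<le> (\<delta> * u) powr a" using u ab by (intro powr_mono2) auto
      also have "\<dots> = \<delta> powr a * u powr a" using u \<delta> by (simp add: powr_mult)
      finally have "u powr a * (1 - \<delta> powr a) \<le> u powr a - u' powr a" by (simp add: algebra_simps)
      then have "u powr a \<le> (u powr a - u' powr a) / (1 - \<delta> powr a)" using da by (simp add: field_simps)
      also have "\<dots> = P u - P u'" using True uu by (simp add: P_def min_def diff_divide_distrib)
      finally show ?thesis using Qm by linarith
    next
      case False
      then have u1: "1 < u" by simp
      have ub: "u powr (- b) < 1" using powr_less_mono2_neg[of "- b" 1 u] u1 ab by simp
      have "D * u powr (- b) \<le> (if u' = 0 then D else min D (u' powr (- b)))"
      proof (cases "u' = 0")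
        case True then show ?thesis using ub D1 by (simp add: mult_left_le)
      next
        case False
        have "D * u powr (- b) = (\<delta> * u) powr (- b)" using u1 \<delta> by (simp add: D_def powr_mult)
        also have "\<dots> \<le> u' powr (- b)" using False u ab \<delta> u1
          by (simp add: powr_minus le_imp_inverse_le powr_mono2)
        finally show ?thesis using False ub D1 by (simp add: mult_left_le)
      qed
      then have "D * u powr (- b) / (D - 1) \<le> Q u'"
        unfolding Q_def using D1 by (intro divide_right_mono) auto
      moreover have "Q u \<le> u powr (- b) / (D - 1)"
        unfolding Q_def using D1 u1 by (auto intro!: divide_right_mono)
      moreover have "D * u powr (- b) / (D - 1) - u powr (- b) / (D - 1) = u powr (- b)"
      proof -
        have "D * u powr (- b) - u powr (- b) = (D - 1) * u powr (- b)" by (simp add: left_diff_distrib)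
        then show ?thesis using D1 by (simp flip: diff_divide_distrib)
      qed
      ultimately show ?thesis using Pm by linarith
    qed
  qed
  have "(\<Sum>i\<le>n. min (t i powr a) (t i powr (- b))) \<le> P (t 0) - P (t (Suc n)) + Q (t (Suc n)) - Q (t 0)"
  proof (induction n)
    case 0 then show ?case using step[OF t0 dec t0, of 0] by simp
  next
    case (Suc n) then show ?case using step[OF t0 dec t0, of "Suc n"] by simp
  qed
  also have "\<dots> \<le> 1 / (1 - \<delta> powr a) + D / (D - 1)"
    using P1[OF t0[of 0]] P0[of "t (Suc n)"] Q0[of "t 0"] Qle[of "t (Suc n)"] by linarith
  finally show ?thesis by (simp add: D_def)
qed

context cell_tree
begin

lemma runmax_nonneg: "(\<And>i c. 0 \<le> A i c) \<Longrightarrow> 0 \<le> runmax A i c"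
  by (induction i arbitrary: c) (auto simp: le_max_iff_disj)

text \<open>
The running maximum at level \<open>n\<close> sees all earlier levels, because \<open>par\<close> leads from the cell of \<open>x\<close> at
one level to the cell of \<open>x\<close> at the previous one.
\<close>

lemma runmax_ge:
  assumes "x \<in> space M" "i \<le> n"
  shows "A i (\<iota> i x) \<le> runmax A n (\<iota> n x)"
  using assms(2)
proof (induction n)
  case (Suc n)
  then show ?case using assms(1) by (cases "i = Suc n") (auto simp: parent le_max_iff_disj)
qed simp

text \<open>
This is the dyadic Carleson embedding of \<open>L^p\<close> into \<open>\<ell>^s\<close> with \<open>s > p\<close>: by \<open>integral_over_cells\<close> the left-hand
side is the sum over all cells of \<open>\<tau>^(-s/p')\<close> times the \<open>s\<close>-th power of the integral of \<open>G\<close>, with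
\<open>1/p' = 1 - 1/p\<close>. The numbers \<open>\<tau>\<close> dominate the measures of the cells and decay geometrically along
branches; without decay a chain of cells of nearly equal measure would make the sum diverge. The
integral of \<open>G\<close> over a cell is at most \<open>\<tau> m\<close>, with \<open>m\<close> the maximal function, and at most \<open>\<tau>^(1/p')\<close>, by
Jensen's inequality. With \<open>t = \<tau> m^p\<close>, the factor in front of \<open>G\<close> is therefore at most
\<open>m^(p-1) min (t^a) (t^(-b))\<close>, whose sum along a branch is at most a constant times \<open>m^(p-1)\<close>.
\<close>

lemma fractional_embedding:
  assumes [measurable]: "G \<in> borel_measurable M" and p: "1 < p" "p < s" and G0: "\<And>x. 0 \<le> G x"
    and G1: "(\<integral>\<^sup>+x. ennreal (G x powr p) \<partial>M) \<le> 1"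
    and \<tau>0: "\<And>i c. 0 \<le> \<tau> i c" and \<tau>: "\<And>i c. measure M (cell i c) \<le> \<tau> i c"
    and dec: "\<And>i x. x \<in> space M \<Longrightarrow> \<tau> (Suc i) (\<iota> (Suc i) x) \<le> \<delta> * \<tau> i (\<iota> i x)"
    and \<delta>: "0 < \<delta>" "\<delta> < 1"
  shows "(\<Sum>i\<le>n. \<integral>\<^sup>+x. ennreal (\<tau> i (\<iota> i x) powr (- (s * (1 - 1/p)))
              * enn2real (cell_int i (\<lambda>x. ennreal (G x)) (\<iota> i x)) powr (s - 1)) * ennreal (G x) \<partial>M)
     \<le> ennreal ((1 / (1 - \<delta> powr (s/p - 1)) + \<delta> powr (- (1 - 1/p)) / (\<delta> powr (- (1 - 1/p)) - 1))
         * (1 + (p / (p - 1)) powr p))"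
proof -
  define B where "B i c = enn2real (cell_int i (\<lambda>x. ennreal (G x)) c)" for i c
  define T where "T i c = \<tau> i c powr (- (s * (1 - 1/p))) * B i c powr (s - 1)" for i c
  define a where "a = s/p - 1"
  define b where "b = 1 - 1/p"
  have ab: "0 < a" "0 < b" using p by (auto simp: a_def b_def)
  define C where "C = 1 / (1 - \<delta> powr a) + \<delta> powr (- b) / (\<delta> powr (- b) - 1)"
  have C0: "0 \<le> C"
  proof -
    have "\<delta> powr a < 1" using powr_less_mono2[of a \<delta> 1] \<delta> ab by simp
    moreover have "1 < \<delta> powr (- b)"
      using \<delta> ab powr_less_mono2[of b \<delta> 1] by (simp add: powr_minus one_less_inverse)
    ultimately show ?thesis by (auto simp: C_def)
  qed
  have fin: "(\<integral>\<^sup>+x. ennreal (G x powr p) \<partial>M) < \<infinity>" using G1 by (rule le_less_trans) simp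
  have finc: "cell_int i (\<lambda>x. ennreal (G x powr p)) c < \<infinity>" for i c
    using cell_int_le_integral fin by (rule le_less_trans)
  have fin1: "cell_int i (\<lambda>x. ennreal (G x)) c < \<infinity>" for i c
    by (intro finite_cell_int[OF assms(1) p(1) G0]) (rule finc)
  have B0: "0 \<le> B i c" for i c by (simp add: B_def)
  have Bavg: "B i c = avg i G c * measure M (cell i c)" for i c
  proof -
    have "cell_int i (\<lambda>x. ennreal (G x)) c = ennreal (avg i G c * measure M (cell i c))"
      using avg_times_measure[OF fin1, of i c] by (simp add: emeasure_cell ennreal_mult)
    then show ?thesis by (simp add: B_def)
  qed
  \<comment> \<open>Jensen's inequality on a single cell.\<close>
  have B_le: "B i c \<le> \<tau> i c powr b" for i c
  proof (cases "measure M (cell i c) = 0")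
    case False
    define m where "m = measure M (cell i c)"
    have m: "0 < m" using False by (simp add: m_def zero_less_measure_iff)
    have "ennreal (avg i G c powr p) * emeasure M (cell i c) \<le> 1"
      by (intro order_trans[OF avg_jensen[OF assms(1) p(1) G0 finc]] order_trans[OF cell_int_le_integral G1])
    then have "avg i G c powr p * m \<le> 1"
      by (simp add: emeasure_cell m_def flip: ennreal_mult' ennreal_1)
    then have "avg i G c powr p \<le> m powr (- 1)" using m by (simp add: field_simps powr_minus)
    then have "(avg i G c powr p) powr (1/p) \<le> (m powr (- 1)) powr (1/p)"
      using p by (intro powr_mono2) auto
    moreover have "(avg i G c powr p) powr (1/p) = avg i G c" using p by (simp add: powr_powr)
    moreover have "(m powr (- 1)) powr (1/p) = m powr (- (1/p))" by (simp only: powr_powr) simp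
    ultimately have "avg i G c \<le> m powr (- (1/p))" by simp
    then have "B i c \<le> m powr (- (1/p)) * m" using m unfolding Bavg m_def by (intro mult_right_mono) auto
    also have "\<dots> = m powr b" using m powr_add[of m "- (1/p)" 1] by (simp add: b_def)
    also have "\<dots> \<le> \<tau> i c powr b" using \<tau>[of i c] ab m by (intro powr_mono2) (auto simp: m_def)
    finally show ?thesis .
  qed (simp add: Bavg)
  have pw: "(\<Sum>i\<le>n. T i (\<iota> i x)) \<le> C * maxavg n G (\<iota> n x) powr (p - 1)" if x: "x \<in> space M" for x
  proof -
    define m where "m = maxavg n G (\<iota> n x)"
    have m0: "0 \<le> m" by (simp add: m_def)
    have Bm: "B i (\<iota> i x) \<le> m * \<tau> i (\<iota> i x)" if "i \<le> n" for i
      unfolding Bavg using \<tau> runmax_ge[OF x that, of "\<lambda>i. avg i G"] m0 by (intro mult_mono) (auto simp: m_def)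
    show ?thesis
    proof (cases "m = 0")
      case True
      then have "T i (\<iota> i x) = 0" if "i \<le> n" for i
        using Bm[OF that] B0[of i "\<iota> i x"] by (simp add: T_def)
      then show ?thesis using C0 by simp
    next
      case False
      then have m: "0 < m" using m0 by simp
      \<comment> \<open>In terms of \<open>t\<close> both bounds for \<open>B\<close> have the same factor
        \<open>m^(p-1)\<close>.\<close>
      define t where "t i = \<tau> i (\<iota> i x) * m powr p" for i
      have Tle: "T i (\<iota> i x) \<le> m powr (p - 1) * min (t i powr a) (t i powr (- b))" if i: "i \<le> n" for i
      proof (cases "\<tau> i (\<iota> i x) = 0")
        case True
        then have "B i (\<iota> i x) = 0" using Bm[OF i] B0[of i "\<iota> i x"] by simp
        then show ?thesis by (simp add: T_def)
      next
        case False
        define u where "u = \<tau> i (\<iota> i x)"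
        have u: "0 < u" using False \<tau>0[of i "\<iota> i x"] by (simp add: u_def)
        have "B i (\<iota> i x) powr (s - 1) \<le> (m * u) powr (s - 1)"
          using Bm[OF i] B0 p by (intro powr_mono2) (auto simp: u_def)
        then have "T i (\<iota> i x) \<le> u powr (- (s * (1 - 1/p))) * (m * u) powr (s - 1)"
          unfolding T_def u_def by (intro mult_left_mono) auto
        also have "\<dots> = m powr (s - 1) * u powr (s - 1 - s * (1 - 1/p))"
          using u m by (simp add: powr_mult powr_diff powr_minus divide_inverse)
        also have "s - 1 - s * (1 - 1/p) = a" using p by (simp add: a_def field_simps)
        also have "m powr (s - 1) * u powr a = m powr (p - 1) * t i powr a"
        proof -
          have "s - 1 = (p - 1) + p * a" using p by (simp add: a_def field_simps)
          then have "m powr (s - 1) = m powr (p - 1) * m powr (p * a)" by (metis powr_add)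
          then show ?thesis using u m by (simp add: t_def u_def powr_mult powr_powr)
        qed
        finally have 1: "T i (\<iota> i x) \<le> m powr (p - 1) * t i powr a" .
        have "B i (\<iota> i x) powr (s - 1) \<le> (u powr b) powr (s - 1)"
          using B_le B0 p by (intro powr_mono2) (auto simp: u_def)
        then have "T i (\<iota> i x) \<le> u powr (- (s * (1 - 1/p))) * (u powr b) powr (s - 1)"
          unfolding T_def u_def by (intro mult_left_mono) auto
        also have "\<dots> = u powr (- b)"
        proof -
          have e: "- (s * (1 - 1/p)) + b * (s - 1) = - b" using p by (simp add: b_def field_simps)
          show ?thesis unfolding powr_powr powr_add[symmetric] e ..
        qed
        also have "\<dots> = m powr (p - 1) * t i powr (- b)"
        proof -
          have "(p - 1) + p * (- b) = 0" using p by (simp add: b_def field_simps)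
          then have "m powr (p - 1) * m powr (p * (- b)) = 1" using m by (simp flip: powr_add)
          then show ?thesis using u m
            by (simp add: t_def u_def powr_mult powr_powr)
        qed
        finally have 2: "T i (\<iota> i x) \<le> m powr (p - 1) * t i powr (- b)" .
        show ?thesis using 1 2 by (simp add: min_def)
      qed
      have "(\<Sum>i\<le>n. T i (\<iota> i x)) \<le> m powr (p - 1) * (\<Sum>i\<le>n. min (t i powr a) (t i powr (- b)))"
        unfolding sum_distrib_left using Tle by (intro sum_mono) auto
      also have "\<dots> \<le> m powr (p - 1) * C"
        unfolding C_def
      proof (intro mult_left_mono geometric_potential_sum \<delta> ab)
        show "0 \<le> t i" "t (Suc i) \<le> \<delta> * t i" for i
          using \<tau>0 dec[OF x, of i] mult_right_mono[OF dec[OF x, of i], of "m powr p"] by (auto simp: t_def mult.assoc)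
      qed simp
      finally show ?thesis by (simp add: m_def mult.commute)
    qed
  qed
  have mG: "m powr (p - 1) * g \<le> g powr p + m powr p" if "0 \<le> m" "0 \<le> g" for m g :: real
  proof (cases "m \<le> g")
    case True
    have "m powr (p - 1) * g \<le> g powr (p - 1) * g" using True that p by (intro mult_right_mono powr_mono2) auto
    also have "\<dots> = g powr p" using that p by (cases "g = 0") (auto simp: powr_diff)
    finally show ?thesis by (simp add: add_increasing2)
  next
    case False
    have "m powr (p - 1) * g \<le> m powr (p - 1) * m" using False that p by (intro mult_left_mono) auto
    also have "\<dots> = m powr p" using that p by (cases "m = 0") (auto simp: powr_diff)
    finally show ?thesis by (simp add: add_increasing)
  qed
  have "(\<Sum>i\<le>n. \<integral>\<^sup>+x. ennreal (T i (\<iota> i x)) * ennreal (G x) \<partial>M)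
      = (\<integral>\<^sup>+x. (\<Sum>i\<le>n. ennreal (T i (\<iota> i x)) * ennreal (G x)) \<partial>M)"
    by (rule nn_integral_sum[symmetric]) measurable
  also have "\<dots> \<le> (\<integral>\<^sup>+x. ennreal C * (ennreal (G x powr p) + ennreal (maxavg n G (\<iota> n x) powr p)) \<partial>M)"
  proof (intro nn_integral_mono)
    fix x assume x: "x \<in> space M"
    have T0: "0 \<le> T i c" for i c by (simp add: T_def)
    have "(\<Sum>i\<le>n. ennreal (T i (\<iota> i x)) * ennreal (G x)) = ennreal ((\<Sum>i\<le>n. T i (\<iota> i x)) * G x)"
      using T0 G0 by (simp add: sum_distrib_right sum_ennreal flip: ennreal_mult)
    also have "\<dots> \<le> ennreal (C * (G x powr p + maxavg n G (\<iota> n x) powr p))"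
    proof (intro ennreal_leI)
      have "(\<Sum>i\<le>n. T i (\<iota> i x)) * G x \<le> C * maxavg n G (\<iota> n x) powr (p - 1) * G x"
        using pw[OF x] G0 by (intro mult_right_mono)
      also have "\<dots> = C * (maxavg n G (\<iota> n x) powr (p - 1) * G x)" by (simp add: mult.assoc)
      also have "\<dots> \<le> C * (G x powr p + maxavg n G (\<iota> n x) powr p)"
        using C0 G0 by (intro mult_left_mono mG) auto
      finally show "(\<Sum>i\<le>n. T i (\<iota> i x)) * G x \<le> C * (G x powr p + maxavg n G (\<iota> n x) powr p)" .
    qed
    also have "\<dots> = ennreal C * (ennreal (G x powr p) + ennreal (maxavg n G (\<iota> n x) powr p))"
      using C0 by (simp add: ennreal_mult)
    finally show "(\<Sum>i\<le>n. ennreal (T i (\<iota> i x)) * ennreal (G x)) \<le> \<dots>" .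
  qed
  also have "\<dots> = ennreal C * ((\<integral>\<^sup>+x. ennreal (G x powr p) \<partial>M) + (\<integral>\<^sup>+x. ennreal (maxavg n G (\<iota> n x) powr p) \<partial>M))"
    by (simp add: nn_integral_cmult nn_integral_add)
  also have "\<dots> \<le> ennreal C * (1 + ennreal ((p / (p - 1)) powr p) * 1)"
    using G1 order_trans[OF maximal_inequality[OF assms(1) p(1) G0 fin] mult_left_mono[OF G1], of n]
    by (intro mult_left_mono add_mono) auto
  also have "\<dots> = ennreal (C * (1 + (p / (p - 1)) powr p))"
    using C0 by (simp add: ennreal_mult)
  finally show ?thesis by (simp add: T_def B_def C_def a_def b_def)
qed

text \<open>
The fraction of the average over a cell by which it exceeds all earlier averages on the branch. It
plays the part of the indicator of the stopping cells in a stopping-time argument, without the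
choice of a stopping factor.
\<close>

primrec jump :: "('a \<Rightarrow> real) \<Rightarrow> nat \<Rightarrow> 'c \<Rightarrow> real" where
  "jump G 0 c = (if avg 0 G c > 0 then 1 else 0)"
| "jump G (Suc i) c = (if avg (Suc i) G c > maxavg i G (par c)
      then 1 - maxavg i G (par c) / avg (Suc i) G c else 0)"

lemma jump_bounds: "0 \<le> jump G i c" "jump G i c \<le> 1"
proof (atomize(full), cases i)
  case (Suc k)
  show "0 \<le> jump G i c \<and> jump G i c \<le> 1"
  proof (cases "avg (Suc k) G c > maxavg k G (par c)")
    case True
    moreover have "0 < avg (Suc k) G c" using True maxavg_nonneg[of G k "par c"] by linarith
    ultimately show ?thesis using Suc by (simp add: divide_le_eq)
  qed (simp add: Suc)
qed simp

lemma maxavg_increment: "maxavg (Suc i) G c = maxavg i G (par c) + jump G (Suc i) c * avg (Suc i) G c"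
proof (cases "avg (Suc i) G c > maxavg i G (par c)")
  case True
  moreover have "0 < avg (Suc i) G c" using True maxavg_nonneg[of G i "par c"] by linarith
  ultimately show ?thesis by (simp add: field_simps)
qed simp

lemma maxavg_eq_sum_jumps:
  "x \<in> space M \<Longrightarrow> maxavg n G (\<iota> n x) = (\<Sum>j\<le>n. jump G j (\<iota> j x) * avg j G (\<iota> j x))"
proof (induction n)
  case 0
  then show ?case using avg_nonneg[of 0 G "\<iota> 0 x"] by (auto simp: less_le)
next
  case (Suc n)
  then show ?case using maxavg_increment[of G n "\<iota> (Suc n) x"] by (simp add: parent del: runmax.simps jump.simps)
qed

text \<open>
Averages are replaced by the running maximum, which is a sum of increments, and the double sum is
reordered. The factor in front of the \<open>j\<close>-th increment is then a tail of \<open>k\<close>.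
\<close>

lemma sum_avg_le_sum_jumps:
  assumes x: "x \<in> space M" and k0: "\<And>i. 0 \<le> k i"
  shows "(\<Sum>i\<le>n. k i * avg i G (\<iota> i x))
     \<le> (\<Sum>j\<le>n. (\<Sum>i=j..n. k i) * (jump G j (\<iota> j x) * avg j G (\<iota> j x)))"
proof -
  let ?d = "\<lambda>j. jump G j (\<iota> j x) * avg j G (\<iota> j x)"
  have "(\<Sum>i\<le>n. k i * avg i G (\<iota> i x)) \<le> (\<Sum>i\<le>n. k i * maxavg i G (\<iota> i x))"
    using runmax_ge[OF x order_refl, of "\<lambda>i. avg i G"] k0 by (intro sum_mono mult_left_mono)
  also have "\<dots> = (\<Sum>i\<in>{..n}. \<Sum>j\<in>{j. j \<in> {..n} \<and> j \<le> i}. k i * ?d j)"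
    unfolding maxavg_eq_sum_jumps[OF x] sum_distrib_left
    by (intro sum.cong refl) auto
  also have "\<dots> = (\<Sum>j\<in>{..n}. \<Sum>i\<in>{i. i \<in> {..n} \<and> j \<le> i}. k i * ?d j)"
    by (rule sum.swap_restrict) auto
  also have "\<dots> = (\<Sum>j\<le>n. (\<Sum>i=j..n. k i) * ?d j)"
    unfolding sum_distrib_right by (intro sum.cong refl) auto
  finally show ?thesis .
qed

lemma cell_child: "cell (Suc i) c \<subseteq> cell i (par c)"
  using parent by (auto simp: cell_def)

text \<open>
An infinite integral would also give the average \<open>0\<close>, since \<open>enn2real\<close> maps infinity to \<open>0\<close>; hence the
finiteness hypothesis. The lemma settles the quotient \<open>a / m\<close> in \<open>jump_carleson\<close> when \<open>m = 0\<close>.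
\<close>

lemma avg_zero_child:
  assumes "avg i G (par c) = 0" and fin: "cell_int i (\<lambda>x. ennreal (G x)) (par c) < \<infinity>"
  shows "avg (Suc i) G c = 0"
proof -
  have "cell_int i (\<lambda>x. ennreal (G x)) (par c) = 0"
    using avg_times_measure[OF fin] assms(1) by simp
  moreover have "cell_int (Suc i) (\<lambda>x. ennreal (G x)) c \<le> cell_int i (\<lambda>x. ennreal (G x)) (par c)"
    unfolding cell_int_def using cell_child[of i c]
    by (intro nn_integral_mono) (auto simp: indicator_def)
  ultimately show ?thesis by (simp add: avg_def)
qed

text \<open>
The Carleson embedding for the coefficients \<open>jump G\<close>, whatever \<open>G\<close> is. The proof uses a potential: with
\<open>\<rho>\<close> the quotient of the current average and the running maximum, a number in \<open>[0,1]\<close>, the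
jump plus the new \<open>\<rho>\<close> is at most \<open>a / m\<close>, where \<open>a\<close> is the new average and \<open>m\<close> the old maximum, and the
conditional expectation of \<open>a / m\<close> is the old \<open>\<rho>\<close>. Hence the expected future jumps never exceed the
current potential. Weighted by the running maximum of \<open>A\<close>, each increase of that maximum costs at
most twice its size, once for the jump and once for the potential.
\<close>

lemma jump_carleson:
  assumes [measurable]: "G \<in> borel_measurable M"
    and fin: "\<And>i c. cell_int i (\<lambda>x. ennreal (G x)) c < \<infinity>" and A0: "\<And>i c. 0 \<le> A i c"
  shows "(\<Sum>i\<le>n. \<integral>\<^sup>+x. ennreal (A i (\<iota> i x) * jump G i (\<iota> i x)) \<partial>M)
    \<le> 2 * (\<integral>\<^sup>+x. ennreal (runmax A n (\<iota> n x)) \<partial>M)"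
proof -
  define r where "r i c = avg i G c / maxavg i G c" for i c
  define R where "R n = (\<integral>\<^sup>+x. ennreal (runmax A n (\<iota> n x)) \<partial>M)" for n
  \<comment> \<open>The potential; \<open>r\<close> is \<open>0\<close> by division by zero as long as all
    averages vanish.\<close>
  define V where "V n = (\<integral>\<^sup>+x. ennreal (runmax A n (\<iota> n x) * r n (\<iota> n x)) \<partial>M)" for n
  define S where "S n = (\<Sum>i\<le>n. \<integral>\<^sup>+x. ennreal (A i (\<iota> i x) * jump G i (\<iota> i x)) \<partial>M)" for n
  note RA0 = runmax_nonneg[of A, OF A0]
  have avg_le: "avg i G c \<le> maxavg i G c" for i c by (cases i) auto
  have r: "0 \<le> r i c" "r i c \<le> 1" for i c
    using avg_le[of i c] maxavg_nonneg[of G i c] by (auto simp: r_def divide_le_eq_1 less_le)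
  have "S n + V n \<le> 2 * R n"
  proof (induction n)
    case 0
    have "S 0 + V 0 = (\<integral>\<^sup>+x. ennreal (A 0 (\<iota> 0 x) * jump G 0 (\<iota> 0 x)) + ennreal (runmax A 0 (\<iota> 0 x) * r 0 (\<iota> 0 x)) \<partial>M)"
      unfolding S_def V_def by (subst nn_integral_add) (auto intro!: measurable_cell_fun)
    also have "\<dots> \<le> (\<integral>\<^sup>+x. 2 * ennreal (runmax A 0 (\<iota> 0 x)) \<partial>M)"
    proof (intro nn_integral_mono)
      fix x
      have "A 0 (\<iota> 0 x) * jump G 0 (\<iota> 0 x) + A 0 (\<iota> 0 x) * r 0 (\<iota> 0 x) \<le> A 0 (\<iota> 0 x) * 1 + A 0 (\<iota> 0 x) * 1"
        using A0 jump_bounds r by (intro add_mono mult_left_mono)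
      then have "ennreal (A 0 (\<iota> 0 x) * jump G 0 (\<iota> 0 x) + A 0 (\<iota> 0 x) * r 0 (\<iota> 0 x)) \<le> ennreal (2 * A 0 (\<iota> 0 x))"
        by (intro ennreal_leI) simp
      then show "ennreal (A 0 (\<iota> 0 x) * jump G 0 (\<iota> 0 x)) + ennreal (runmax A 0 (\<iota> 0 x) * r 0 (\<iota> 0 x)) \<le> 2 * ennreal (runmax A 0 (\<iota> 0 x))"
        using A0 jump_bounds r by (simp add: ennreal_mult del: jump.simps)
    qed
    also have "\<dots> = 2 * R 0" unfolding R_def by (rule nn_integral_cmult) measurable
    finally show ?case .
  next
    case (Suc n)
    show ?case
    proof (cases "R (Suc n) = \<infinity>")
      case True then show ?thesis by (simp add: ennreal_mult_top)
    next
      case False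
      have "R n \<le> R (Suc n)"
        unfolding R_def by (intro nn_integral_mono ennreal_leI) (auto simp: parent)
      then have Rfin: "R n < \<infinity>" using False by (auto simp: less_top top_unique)
      let ?s = "\<lambda>x. \<iota> (Suc n) x"
      let ?\<phi> = "\<lambda>c. runmax A n c / maxavg n G c"
      \<comment> \<open>The increase of \<open>S + V\<close> is compared with the increase of \<open>2 R\<close>;
        both are written as sums to avoid subtraction.\<close>
      have "(\<integral>\<^sup>+x. ennreal (A (Suc n) (?s x) * jump G (Suc n) (?s x)) \<partial>M) + V (Suc n) + 2 * R n
         = (\<integral>\<^sup>+x. ennreal (A (Suc n) (?s x) * jump G (Suc n) (?s x)) + ennreal (runmax A (Suc n) (?s x) * r (Suc n) (?s x))
              + 2 * ennreal (runmax A n (\<iota> n x)) \<partial>M)"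
        unfolding V_def R_def by (simp add: nn_integral_add nn_integral_cmult del: jump.simps runmax.simps)
      also have "\<dots> \<le> (\<integral>\<^sup>+x. ennreal (?\<phi> (par (?s x))) * ennreal (avg (Suc n) G (?s x)) + 2 * ennreal (runmax A (Suc n) (?s x)) \<partial>M)"
      proof (intro nn_integral_mono)
        fix x assume x: "x \<in> space M"
        define c where "c = ?s x"
        define j where "j = jump G (Suc n) c"
        define m where "m = maxavg n G (par c)"
        define a where "a = avg (Suc n) G c"
        define \<rho> where "\<rho> = r (Suc n) c"
        define RR where "RR = runmax A n (par c)"
        define RR' where "RR' = runmax A (Suc n) c"
        have j: "0 \<le> j" "j \<le> 1" using jump_bounds by (auto simp: j_def simp del: jump.simps)
        have \<rho>: "0 \<le> \<rho>" "\<rho> \<le> 1" using r by (auto simp: \<rho>_def)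
        have RR: "0 \<le> RR" "RR \<le> RR'" "A (Suc n) c \<le> RR'" using RA0 by (auto simp: RR_def RR'_def)
        have m0: "0 \<le> m" and a0: "0 \<le> a" by (auto simp: m_def a_def)
        have key: "j + \<rho> \<le> a / m"
        proof (cases "m = 0")
          case True
          then have "avg n G (par c) = 0" using avg_le[of n "par c"] avg_nonneg[of n G "par c"] by (simp add: m_def)
          then have "a = 0" unfolding a_def by (intro avg_zero_child fin)
          then show ?thesis using True by (simp add: j_def \<rho>_def r_def m_def a_def)
        next
          case False
          then have m: "0 < m" using m0 by simp
          show ?thesis
          proof (cases "a > m")
            case True
            have "j = 1 - m / a" using True by (simp add: j_def a_def m_def)
            moreover have "\<rho> = 1" using True m by (simp add: \<rho>_def r_def a_def m_def max_def)
            moreover have "2 - m / a \<le> a / m"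
            proof -
              have "0 \<le> (a - m)\<^sup>2" by simp
              then have "2 * (a * m) \<le> a * a + m * m" by (simp add: power2_eq_square algebra_simps)
              then have "2 \<le> (a * a + m * m) / (a * m)" using m True by (simp add: field_simps)
              also have "\<dots> = a / m + m / a" using m True by (simp add: field_simps)
              finally show ?thesis by simp
            qed
            ultimately show ?thesis by simp
          next
            case False
            then have "j = 0" by (simp add: j_def a_def m_def)
            moreover have "\<rho> = a / m" using False by (simp add: \<rho>_def r_def a_def m_def max_def)
            ultimately show ?thesis by simp
          qed
        qed
        have "A (Suc n) c * j \<le> RR * j + (RR' - RR) * 1"
        proof -
          have "A (Suc n) c * j \<le> RR' * j" using RR j by (intro mult_right_mono)
          also have "\<dots> = RR * j + (RR' - RR) * j" by (simp add: algebra_simps)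
          also have "\<dots> \<le> RR * j + (RR' - RR) * 1" using RR j by (intro add_left_mono mult_left_mono) auto
          finally show ?thesis .
        qed
        moreover have "RR' * \<rho> \<le> RR * \<rho> + (RR' - RR) * 1"
        proof -
          have "RR' * \<rho> = RR * \<rho> + (RR' - RR) * \<rho>" by (simp add: algebra_simps)
          also have "\<dots> \<le> RR * \<rho> + (RR' - RR) * 1" using RR \<rho> by (intro add_left_mono mult_left_mono) auto
          finally show ?thesis .
        qed
        moreover have "RR * (j + \<rho>) \<le> RR * (a / m)" using key RR by (intro mult_left_mono)
        ultimately have "A (Suc n) c * j + RR' * \<rho> + 2 * RR \<le> RR / m * a + 2 * RR'"
          by (simp add: distrib_left)
        then have "ennreal (A (Suc n) c * j + RR' * \<rho> + 2 * RR) \<le> ennreal (RR / m * a + 2 * RR')"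
          by (rule ennreal_leI)
        moreover have "ennreal (A (Suc n) c * j + RR' * \<rho> + 2 * RR) = ennreal (A (Suc n) c * j) + ennreal (RR' * \<rho>) + 2 * ennreal RR"
          using RR j \<rho> A0 by (simp add: ennreal_mult)
        moreover have "ennreal (RR / m * a + 2 * RR') = ennreal (RR / m) * ennreal a + 2 * ennreal RR'"
        proof -
          have "0 \<le> RR / m" using RR m0 by simp
          then show ?thesis using RR a0
            by (simp add: ennreal_mult del: times_divide_eq_left times_divide_eq_right)
        qed
        ultimately show "ennreal (A (Suc n) (?s x) * jump G (Suc n) (?s x)) + ennreal (runmax A (Suc n) (?s x) * r (Suc n) (?s x))
              + 2 * ennreal (runmax A n (\<iota> n x))
            \<le> ennreal (?\<phi> (par (?s x))) * ennreal (avg (Suc n) G (?s x)) + 2 * ennreal (runmax A (Suc n) (?s x))"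
          using x unfolding c_def j_def m_def a_def \<rho>_def RR_def RR'_def by (simp only: parent)
      qed
      also have "\<dots> = (\<integral>\<^sup>+x. ennreal (?\<phi> (par (?s x))) * ennreal (avg (Suc n) G (?s x)) \<partial>M) + 2 * R (Suc n)"
        unfolding R_def by (simp add: nn_integral_add nn_integral_cmult del: runmax.simps)
      also have "(\<integral>\<^sup>+x. ennreal (?\<phi> (par (?s x))) * ennreal (avg (Suc n) G (?s x)) \<partial>M) = (\<integral>\<^sup>+x. ennreal (?\<phi> (par (?s x))) * ennreal (G x) \<partial>M)"
        by (rule integral_avg[OF assms(1) fin, where \<phi> = "\<lambda>c. ennreal (?\<phi> (par c))"])
      also have "\<dots> = (\<integral>\<^sup>+x. ennreal (?\<phi> (\<iota> n x)) * ennreal (G x) \<partial>M)"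
        by (intro nn_integral_cong) (simp add: parent)
      also have "\<dots> = (\<integral>\<^sup>+x. ennreal (?\<phi> (\<iota> n x)) * ennreal (avg n G (\<iota> n x)) \<partial>M)"
        by (rule integral_avg[OF assms(1) fin, where \<phi> = "\<lambda>c. ennreal (?\<phi> c)", symmetric])
      also have "\<dots> = V n"
        unfolding V_def using RA0 by (intro nn_integral_cong) (simp add: r_def ennreal_mult[symmetric])
      finally have "(\<integral>\<^sup>+x. ennreal (A (Suc n) (?s x) * jump G (Suc n) (?s x)) \<partial>M) + V (Suc n) + 2 * R n \<le> V n + 2 * R (Suc n)" .
      then have "S n + ((\<integral>\<^sup>+x. ennreal (A (Suc n) (?s x) * jump G (Suc n) (?s x)) \<partial>M) + V (Suc n) + 2 * R n) \<le> S n + (V n + 2 * R (Suc n))"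
        by (rule add_left_mono)
      also have "\<dots> \<le> 2 * R n + 2 * R (Suc n)"
        using Suc add_right_mono[of "S n + V n" "2 * R n" "2 * R (Suc n)"] by (simp add: add.assoc)
      finally have "2 * R n + (S (Suc n) + V (Suc n)) \<le> 2 * R n + 2 * R (Suc n)"
        unfolding S_def by (simp add: add_ac del: jump.simps)
      then show ?thesis using Rfin by (auto simp: ennreal_add_left_cancel_le ennreal_mult_eq_top_iff)
    qed
  qed
  moreover have "S n \<le> S n + V n" by simp
  ultimately have "S n \<le> 2 * R n" by (rule order_trans[rotated])
  then show ?thesis unfolding S_def R_def .
qed

end

section \<open>Hoelder's inequality and dyadic cubes\<close>

text \<open>
Young's inequality after normalisation. A bound equal to \<open>0\<close> cannot be normalised, so both bounds are
first enlarged by \<open>e > 0\<close>, which then tends to \<open>0\<close>.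
\<close>

lemma holder_nn_integral:
  fixes f g :: "'a \<Rightarrow> real"
  assumes [measurable]: "f \<in> borel_measurable M" "g \<in> borel_measurable M"
    and f0: "\<And>x. 0 \<le> f x" and g0: "\<And>x. 0 \<le> g x"
    and ab: "1 < a" "1 < b" "1/a + 1/b = 1" and AB: "0 \<le> A" "0 \<le> B"
    and A: "(\<integral>\<^sup>+x. ennreal (f x powr a) \<partial>M) \<le> ennreal A"
    and B: "(\<integral>\<^sup>+x. ennreal (g x powr b) \<partial>M) \<le> ennreal B"
  shows "(\<integral>\<^sup>+x. ennreal (f x * g x) \<partial>M) \<le> ennreal (A powr (1/a) * B powr (1/b))"
proof -
  have bound: "(\<integral>\<^sup>+x. ennreal (f x * g x) \<partial>M) \<le> ennreal (A' powr (1/a) * B' powr (1/b))"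
    if A': "0 < A'" "A \<le> A'" and B': "0 < B'" "B \<le> B'" for A' B'
  proof -
    define c where "c = A' powr (1/a)"
    define d where "d = B' powr (1/b)"
    have cd: "0 < c" "0 < d" using A' B' by (auto simp: c_def d_def)
    have ca: "c powr a = A'" and db: "d powr b = B'" using A' B' ab by (auto simp: c_def d_def powr_powr)
    have "(\<integral>\<^sup>+x. ennreal (f x * g x) \<partial>M)
       \<le> (\<integral>\<^sup>+x. ennreal (c * d) * (ennreal (1 / (a * A')) * ennreal (f x powr a) + ennreal (1 / (b * B')) * ennreal (g x powr b)) \<partial>M)"
    proof (intro nn_integral_mono)
      fix x
      have "(f x / c) * (g x / d) \<le> (f x / c) powr a / a + (g x / d) powr b / b"
        using f0 g0 cd ab by (intro Youngs_inequality) auto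
      also have "\<dots> = 1 / (a * A') * f x powr a + 1 / (b * B') * g x powr b"
        using f0 g0 cd by (simp add: powr_divide ca db mult.commute)
      finally have "(c * d) * ((f x / c) * (g x / d)) \<le> (c * d) * (1 / (a * A') * f x powr a + 1 / (b * B') * g x powr b)"
        using cd by (intro mult_left_mono) auto
      then have "f x * g x \<le> (c * d) * (1 / (a * A') * f x powr a + 1 / (b * B') * g x powr b)"
        using cd by simp
      then have "ennreal (f x * g x) \<le> ennreal ((c * d) * (1 / (a * A') * f x powr a + 1 / (b * B') * g x powr b))"
        by (rule ennreal_leI)
      also have "\<dots> = ennreal (c * d) * (ennreal (1 / (a * A') * f x powr a) + ennreal (1 / (b * B') * g x powr b))"
        using cd A' B' ab by (subst ennreal_mult, simp, simp, subst ennreal_plus) auto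
      also have "\<dots> = ennreal (c * d) * (ennreal (1 / (a * A')) * ennreal (f x powr a) + ennreal (1 / (b * B')) * ennreal (g x powr b))"
        using A' B' ab by (subst (1 2) ennreal_mult) auto
      finally show "ennreal (f x * g x) \<le> \<dots>" .
    qed
    also have "\<dots> = ennreal (c * d) * (ennreal (1 / (a * A')) * (\<integral>\<^sup>+x. ennreal (f x powr a) \<partial>M)
        + ennreal (1 / (b * B')) * (\<integral>\<^sup>+x. ennreal (g x powr b) \<partial>M))"
      by (simp add: nn_integral_cmult nn_integral_add)
    also have "\<dots> \<le> ennreal (c * d) * (ennreal (1 / (a * A')) * ennreal A' + ennreal (1 / (b * B')) * ennreal B')"
      using A B A' B' by (intro mult_left_mono add_mono order_trans[OF A] order_trans[OF B] ennreal_leI) auto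
    also have "\<dots> = ennreal (c * d) * (ennreal (1 / a) + ennreal (1 / b))"
      using A' B' ab by (simp flip: ennreal_mult)
    also have "ennreal (1 / a) + ennreal (1 / b) = 1"
      using ab by (simp flip: ennreal_plus)
    finally show ?thesis by (simp add: c_def d_def)
  qed
  have "((\<lambda>e. ennreal ((A + e) powr (1/a) * (B + e) powr (1/b))) \<longlongrightarrow> ennreal ((A + 0) powr (1/a) * (B + 0) powr (1/b))) (at_right 0)"
    using ab AB
    by (intro tendsto_ennrealI tendsto_mult tendsto_powr' tendsto_add tendsto_const tendsto_ident_at)
      (auto simp: eventually_at_right_less intro!: always_eventually eventually_mono[OF eventually_at_right_less])
  then have "(\<integral>\<^sup>+x. ennreal (f x * g x) \<partial>M) \<le> ennreal ((A + 0) powr (1/a) * (B + 0) powr (1/b))"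
  proof (rule tendsto_lowerbound)
    show "\<forall>\<^sub>F e in at_right 0. (\<integral>\<^sup>+x. ennreal (f x * g x) \<partial>M) \<le> ennreal ((A + e) powr (1/a) * (B + e) powr (1/b))"
      using AB by (intro eventually_mono[OF eventually_at_right_less[of 0]] bound) auto
  qed simp
  then show ?thesis by simp
qed

text \<open>
The label of the half-open dyadic cube of side \<open>L / 2^i\<close> that contains \<open>x\<close>, in the grid with origin
\<open>org\<close>.
\<close>

definition dyadic :: "real ^ 'n \<Rightarrow> real \<Rightarrow> nat \<Rightarrow> real ^ 'n \<Rightarrow> int ^ 'n" where
  "dyadic org L i x = (\<chi> k. \<lfloor>2 ^ i * ((x $ k - org $ k) / L)\<rfloor>)"

definition dyadic_par :: "int ^ 'n \<Rightarrow> int ^ 'n" where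
  "dyadic_par c = (\<chi> k. c $ k div 2)"

definition dyadic_side :: "real \<Rightarrow> nat \<Rightarrow> real" where
  "dyadic_side L i = L / 2 ^ i"

definition dyadic_centre :: "real ^ 'n \<Rightarrow> real \<Rightarrow> nat \<Rightarrow> int ^ 'n \<Rightarrow> real ^ 'n" where
  "dyadic_centre org L i c = (\<chi> k. org $ k + (real_of_int (c $ k) + 1/2) * dyadic_side L i)"

lemma dyadic_side_pos: "0 < L \<Longrightarrow> 0 < dyadic_side L i"
  by (simp add: dyadic_side_def)

lemma dyadic_side_Suc: "dyadic_side L i = 2 * dyadic_side L (Suc i)"
  by (simp add: dyadic_side_def)

lemma mem_cube: "x \<in> cube c l \<longleftrightarrow> (\<forall>k. \<bar>x $ k - c $ k\<bar> \<le> l / 2)"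
proof -
  have "((c - vec (l / 2)) $ k \<le> x $ k \<and> x $ k \<le> (c + vec (l / 2)) $ k) \<longleftrightarrow> \<bar>x $ k - c $ k\<bar> \<le> l / 2" for k
    by (smt (verit) vector_add_component vector_minus_component vec_component)
  then show ?thesis by (simp add: cube_def mem_box_cart)
qed

lemma dyadic_eq_iff:
  assumes "0 < L"
  shows "dyadic org L i x = c \<longleftrightarrow>
    (\<forall>k. org $ k + real_of_int (c $ k) * dyadic_side L i \<le> x $ k \<and> x $ k < org $ k + (real_of_int (c $ k) + 1) * dyadic_side L i)"
proof -
  have "\<lfloor>2 ^ i * ((x $ k - org $ k) / L)\<rfloor> = c $ k \<longleftrightarrow>
      org $ k + real_of_int (c $ k) * dyadic_side L i \<le> x $ k \<and> x $ k < org $ k + (real_of_int (c $ k) + 1) * dyadic_side L i" for k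
    using assms by (simp add: floor_eq_iff dyadic_side_def field_simps)
  then show ?thesis by (simp add: dyadic_def vec_eq_iff)
qed

lemma dyadic_par: "dyadic_par (dyadic org L (Suc i) x) = dyadic org L i x"
proof -
  have "\<lfloor>2 * t\<rfloor> div 2 = \<lfloor>t\<rfloor>" for t :: real
  proof -
    have "\<lfloor>2 * t\<rfloor> div 2 = \<lfloor>(2 * t) / real_of_int 2\<rfloor>" by (subst floor_divide_real_eq_div) auto
    then show ?thesis by simp
  qed
  from this[of "2 ^ i * ((x $ k - org $ k) / L)" for k] show ?thesis
    by (simp add: dyadic_par_def dyadic_def vec_eq_iff mult.assoc)
qed

lemma dyadic_cell_bounds:
  assumes "0 < L" "dyadic org L i x = c"
  shows "org $ k + real_of_int (c $ k) * dyadic_side L i \<le> x $ k"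
    "x $ k < org $ k + real_of_int (c $ k) * dyadic_side L i + dyadic_side L i"
  using assms(2) unfolding dyadic_eq_iff[OF assms(1)] by (auto simp: distrib_right add.assoc)

lemma dyadic_centre_component:
  "dyadic_centre org L i c $ k = org $ k + real_of_int (c $ k) * dyadic_side L i + dyadic_side L i / 2"
  by (simp add: dyadic_centre_def distrib_right)

lemma dyadic_cell_subset_cube:
  assumes "0 < L"
  shows "{y. dyadic org L i y = c} \<subseteq> cube (dyadic_centre org L i c) (dyadic_side L i)"
proof
  fix x assume "x \<in> {y. dyadic org L i y = c}"
  then have x: "dyadic org L i x = c" by simp
  show "x \<in> cube (dyadic_centre org L i c) (dyadic_side L i)"
    unfolding mem_cube dyadic_centre_component
  proof
    fix k
    show "\<bar>x $ k - (org $ k + real_of_int (c $ k) * dyadic_side L i + dyadic_side L i / 2)\<bar> \<le> dyadic_side L i / 2"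
      using dyadic_cell_bounds[OF assms x, of k] unfolding abs_le_iff by linarith
  qed
qed

lemma emeasure_cube:
  assumes "0 \<le> l"
  shows "emeasure lebesgue (cube (c :: real ^ 'n) l) = ennreal (l ^ CARD('n))"
proof -
  have ne: "cbox (c - vec (l / 2)) (c + vec (l / 2)) \<noteq> {}"
    using assms by (auto simp: interval_ne_empty_cart)
  have "measure lborel (cbox (c - vec (l / 2)) (c + vec (l / 2))) = l ^ CARD('n)"
    by (subst content_cbox_cart[OF ne]) simp
  then show ?thesis
    by (simp add: cube_def emeasure_eq_ennreal_measure emeasure_lborel_cbox_eq)
qed

lemma measure_cube: "0 \<le> l \<Longrightarrow> measure lebesgue (cube (c :: real ^ 'n) l) = l ^ CARD('n)"
  using emeasure_cube[of l c] by (simp add: measure_def)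

lemma cube_sets [measurable]: "cube c l \<in> sets lebesgue" "cube c l \<in> sets borel"
  by (auto simp: cube_def)

lemma dyadic_measurable_borel: "dyadic org L i \<in> borel \<rightarrow>\<^sub>M count_space UNIV"
proof -
  have "{y. dyadic org L i y = c} \<in> sets borel" for c
  proof -
    have "{y. dyadic org L i y = c} = (\<Inter>k. {y. \<lfloor>2 ^ i * ((y $ k - org $ k) / L)\<rfloor> = c $ k})"
      by (auto simp: dyadic_def vec_eq_iff)
    also have "\<dots> \<in> sets borel"
    proof (intro sets.finite_INT)
      fix k
      have [measurable]: "(\<lambda>y::real^'a. y $ k) \<in> borel_measurable borel"
        by (intro borel_measurable_continuous_onI continuous_intros)
      show "{y. \<lfloor>2 ^ i * ((y $ k - org $ k) / L)\<rfloor> = c $ k} \<in> sets borel" by measurable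
    qed auto
    finally show ?thesis .
  qed
  then show ?thesis
    by (subst measurable_count_space_eq2_countable) (auto simp: vimage_def)
qed

lemma dyadic_measurable: "sets M = sets lebesgue \<Longrightarrow> dyadic org L i \<in> M \<rightarrow>\<^sub>M count_space UNIV"
  using dyadic_measurable_borel[of org L i]
  by (subst measurable_cong_sets[OF _ refl, of _ lebesgue])
     (auto intro: measurable_completion simp: measurable_lborel1)

text \<open>
The half-open cell lies between an open and a closed cube that differ by a null set.
\<close>

lemma emeasure_dyadic_cell:
  assumes L: "0 < L"
  shows "emeasure lebesgue {y. dyadic (org :: real ^ 'n) L i y = c} = ennreal (dyadic_side L i ^ CARD('n))"
proof -
  let ?l = "dyadic_side L i" and ?z = "dyadic_centre org L i c"
  let ?C = "{y. dyadic org L i y = c}"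
  let ?b = "box (?z - vec (?l / 2)) (?z + vec (?l / 2))"
  have sub: "?b \<subseteq> ?C"
  proof
    fix x assume x: "x \<in> ?b"
    have "org $ k + real_of_int (c $ k) * ?l \<le> x $ k \<and> x $ k < org $ k + (real_of_int (c $ k) + 1) * ?l" for k
    proof -
      have "?z $ k - ?l / 2 < x $ k" "x $ k < ?z $ k + ?l / 2"
        using x by (simp_all add: mem_box_cart)
      then show ?thesis unfolding dyadic_centre_component distrib_right by linarith
    qed
    then show "x \<in> ?C" by (simp add: dyadic_eq_iff[OF L])
  qed
  have C: "?C \<in> sets lebesgue"
    using dyadic_measurable_borel[of org L i] measurable_sets[of "dyadic org L i" borel "count_space UNIV" "{c}"]
    by (simp add: vimage_def)
  have "negligible (cube ?z ?l - ?b)"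
    unfolding cube_def by (rule negligible_frontier_interval)
  then have "negligible ((cube ?z ?l - ?C) \<union> (?C - cube ?z ?l))"
    by (rule negligible_subset) (use sub dyadic_cell_subset_cube[OF L, of org i c] in auto)
  then have "emeasure lebesgue (cube ?z ?l) = emeasure lebesgue ?C"
    using dyadic_cell_subset_cube[OF L, of org i c] C
    by (intro emeasure_eq_AE) (auto simp: eventually_ae_filter negligible_iff_null_sets
        intro!: bexI[of _ "(cube ?z ?l - ?C) \<union> (?C - cube ?z ?l)"])
  then show ?thesis
    using emeasure_cube[of ?l ?z] dyadic_side_pos[OF L, of i] by simp
qed

lemma cell_tree_dyadic:
  assumes sM: "sets M = sets lebesgue" and L: "0 < L"
    and fin: "\<And>c l. 0 < l \<Longrightarrow> emeasure M (cube c l) < \<infinity>"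
  shows "cell_tree M (dyadic org L) dyadic_par"
proof
  show "dyadic org L i \<in> M \<rightarrow>\<^sub>M count_space UNIV" for i by (rule dyadic_measurable[OF sM])
  show "dyadic_par (dyadic org L (Suc i) x) = dyadic org L i x" for i x by (rule dyadic_par)
  fix i c
  have sp: "space M = UNIV" using sets_eq_imp_space_eq[OF sM] by simp
  have "emeasure M {y \<in> space M. dyadic org L i y = c} \<le> emeasure M (cube (dyadic_centre org L i c) (dyadic_side L i))"
    using dyadic_cell_subset_cube[OF L, of org i c] sp by (intro emeasure_mono) (auto simp: sM)
  also have "\<dots> < \<infinity>" by (intro fin dyadic_side_pos L)
  finally show "emeasure M {y \<in> space M. dyadic org L i y = c} < \<infinity>" .
qed

text \<open>
Reverse doubling compares concentric cubes, but a cell and its parent are not concentric. Tripling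
leaves room: see \<open>tripled_parent\<close>.
\<close>

definition tripled :: "real ^ 'n \<Rightarrow> real \<Rightarrow> nat \<Rightarrow> int ^ 'n \<Rightarrow> (real ^ 'n) set" where
  "tripled org L i c = cube (dyadic_centre org L i c) (3 * dyadic_side L i)"

lemma cell_subset_tripled:
  assumes "0 < L" shows "{y. dyadic org L i y = c} \<subseteq> tripled org L i c"
proof -
  have "cube z l \<subseteq> cube z (3 * l)" if "0 \<le> l" for z :: "real ^ 'n" and l
  proof
    fix x assume "x \<in> cube z l"
    then have "\<bar>x $ k - z $ k\<bar> \<le> l / 2" for k by (simp add: mem_cube)
    then have "\<bar>x $ k - z $ k\<bar> \<le> 3 * l / 2" for k
      using \<open>0 \<le> l\<close> order_trans[of "\<bar>x $ k - z $ k\<bar>" "l / 2" "3 * l / 2"] by simp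
    then show "x \<in> cube z (3 * l)" by (simp add: mem_cube)
  qed
  then show ?thesis
    using dyadic_cell_subset_cube[OF assms, of org i c] dyadic_side_pos[OF assms, of i] unfolding tripled_def
    by (meson less_imp_le order_trans)
qed

text \<open>
In units of the side of the smaller cell, the tripled parent has side \<open>6\<close> and its centre is at distance
\<open>1/2\<close> from that of the child in each coordinate, so it contains the cube of side \<open>5\<close> about the centre of
the child.
\<close>

lemma tripled_parent:
  assumes L: "0 < L"
  shows "cube (dyadic_centre org L (Suc i) c) (5 * dyadic_side L (Suc i)) \<subseteq> tripled org L i (dyadic_par c)"
proof
  fix x assume x: "x \<in> cube (dyadic_centre org L (Suc i) c) (5 * dyadic_side L (Suc i))"
  define l where "l = dyadic_side L (Suc i)"
  have l: "0 < l" using dyadic_side_pos[OF L] by (simp add: l_def)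
  show "x \<in> tripled org L i (dyadic_par c)"
    unfolding tripled_def mem_cube dyadic_side_Suc[of L i]
  proof
    fix k
    define a where "a = real_of_int (c $ k)"
    define b where "b = real_of_int (c $ k div 2)"
    have "2 * (c $ k div 2) \<le> c $ k" "c $ k \<le> 2 * (c $ k div 2) + 1" by linarith+
    then have ab: "2 * b \<le> a" "a \<le> 2 * b + 1" unfolding a_def b_def by linarith+
    have "2 * b * l \<le> a * l" "a * l \<le> (2 * b + 1) * l" using ab l by (auto intro!: mult_right_mono)
    moreover have "\<bar>x $ k - (org $ k + (a + 1/2) * l)\<bar> \<le> 5 * l / 2"
      using x by (auto simp: mem_cube dyadic_centre_def l_def a_def)
    ultimately have "\<bar>x $ k - (org $ k + (b + 1/2) * (2 * l))\<bar> \<le> 3 * (2 * l) / 2"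
      unfolding abs_le_iff distrib_right by simp
    then show "\<bar>x $ k - dyadic_centre org L i (dyadic_par c) $ k\<bar> \<le> 3 * (2 * dyadic_side L (Suc i)) / 2"
      by (simp add: dyadic_centre_def dyadic_par_def b_def l_def dyadic_side_Suc[of L i])
  qed
qed

text \<open>
The tripled child is \<open>3/5\<close> of a concentric cube inside the tripled parent.
\<close>

lemma tripled_reverse_doubling:
  assumes L: "0 < L" and sM: "sets M = sets lebesgue"
    and fin: "\<And>c l. 0 < l \<Longrightarrow> emeasure M (cube c l) < \<infinity>"
    and rd: "\<And>c l. 0 < l \<Longrightarrow> emeasure M (cube c (3/5 * l)) \<le> ennreal \<delta> * emeasure M (cube c l)"
    and \<delta>: "0 \<le> \<delta>"
  shows "measure M (tripled org L (Suc i) c) \<le> \<delta> * measure M (tripled org L i (dyadic_par c))"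
proof -
  let ?z = "dyadic_centre org L (Suc i) c" and ?l = "dyadic_side L (Suc i)"
  have l: "0 < ?l" by (rule dyadic_side_pos[OF L])
  have fin': "emeasure M (tripled org L i c) < \<infinity>" for i c
    unfolding tripled_def using dyadic_side_pos[OF L, of i] by (intro fin) simp
  have "emeasure M (tripled org L (Suc i) c) \<le> ennreal \<delta> * emeasure M (cube ?z (5 * ?l))"
    using rd[of "5 * ?l" ?z] l by (simp add: tripled_def)
  also have "\<dots> \<le> ennreal \<delta> * emeasure M (tripled org L i (dyadic_par c))"
    using tripled_parent[OF L] by (intro mult_left_mono emeasure_mono) (auto simp: tripled_def sM)
  finally have "emeasure M (tripled org L (Suc i) c) \<le> \<dots>" .
  then have "ennreal (measure M (tripled org L (Suc i) c)) \<le> ennreal (\<delta> * measure M (tripled org L i (dyadic_par c)))"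
    using fin' \<delta> by (simp add: emeasure_eq_ennreal_measure ennreal_mult less_top[symmetric])
  then show ?thesis using \<delta> by (subst (asm) ennreal_le_iff) auto
qed

section \<open>The dyadic form when p < q\<close>

text \<open>
The pairing of \<open>h\<close> with the \<open>i\<close>-th level of the averaging operator applied to \<open>k i\<close>. The volume of the
cell enters as a power of its side, in the form in which it occurs in the weight conditions.
\<close>

definition dyadic_form :: "real ^ 'n \<Rightarrow> real \<Rightarrow> (real ^ 'n \<Rightarrow> real) \<Rightarrow> (nat \<Rightarrow> real ^ 'n \<Rightarrow> real) \<Rightarrow> nat \<Rightarrow> ennreal" where
  "dyadic_form org L h k i = (\<integral>\<^sup>+x. ennreal (h x) * (ennreal (dyadic_side L i powr (- real CARD('n))) *
      (\<integral>\<^sup>+y\<in>{y. dyadic org L i y = dyadic org L i x}. ennreal (k i y) \<partial>lebesgue)) \<partial>lebesgue)"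

text \<open>
On one cell the form is \<open>l^(\<gamma> - N) A B\<close> with \<open>A\<close> the integral of \<open>G \<sigma>\<close> and \<open>B\<close> the integral of \<open>h w\<close>. The
condition on the tripled cell turns this into a product of one factor depending on \<open>\<sigma>\<close> and one
depending on \<open>w\<close>; Young's inequality with exponents \<open>s\<close> and \<open>s'\<close> separates them. Since \<open>p < s\<close> and
\<open>q' < s'\<close>, the embedding \<open>fractional_embedding\<close> applies to both, with respect to the measures \<open>\<sigma> dx\<close> and
\<open>w dx\<close>.
\<close>

lemma dyadic_form_bound_fractional:
  fixes w \<sigma> :: "real ^ 'n \<Rightarrow> real"
  defines "W \<equiv> density lebesgue (\<lambda>x. ennreal (w x))" and "S \<equiv> density lebesgue (\<lambda>x. ennreal (\<sigma> x))"
  assumes [measurable]: "w \<in> borel_measurable lebesgue" "\<sigma> \<in> borel_measurable lebesgue"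
    and w0: "\<And>x. 0 \<le> w x" and \<sigma>0: "\<And>x. 0 \<le> \<sigma> x"
    and finW: "\<And>c l. 0 < l \<Longrightarrow> emeasure W (cube c l) < \<infinity>"
    and finS: "\<And>c l. 0 < l \<Longrightarrow> emeasure S (cube c l) < \<infinity>"
    and rdW: "\<And>c l. 0 < l \<Longrightarrow> emeasure W (cube c (3/5 * l)) \<le> ennreal \<delta>w * emeasure W (cube c l)"
    and rdS: "\<And>c l. 0 < l \<Longrightarrow> emeasure S (cube c (3/5 * l)) \<le> ennreal \<delta>s * emeasure S (cube c l)"
    and \<delta>: "0 < \<delta>w" "\<delta>w < 1" "0 < \<delta>s" "\<delta>s < 1"
    and p: "1 < p" "p < q" "1/p + 1/p' = 1" "1/q + 1/q' = 1"
    and K: "\<And>c l. 0 < l \<Longrightarrow> l powr (\<gamma> - real CARD('n)) * measure W (cube c l) powr (1/q) * measure S (cube c l) powr (1/p') \<le> K"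
  shows "\<exists>C\<ge>0. \<forall>org L k G h n. 0 < L \<longrightarrow> (\<forall>i. k i \<in> borel_measurable lebesgue) \<longrightarrow>
      G \<in> borel_measurable lebesgue \<longrightarrow> h \<in> borel_measurable lebesgue \<longrightarrow> (\<forall>x. 0 \<le> G x) \<longrightarrow> (\<forall>x. 0 \<le> h x) \<longrightarrow>
      (\<integral>\<^sup>+x. ennreal (G x powr p) \<partial>S) \<le> 1 \<longrightarrow> (\<integral>\<^sup>+x. ennreal (h x powr q') \<partial>W) \<le> 1 \<longrightarrow>
      (\<forall>i. AE x in lebesgue. k i x \<le> dyadic_side L i powr \<gamma> * (G x * \<sigma> x)) \<longrightarrow>
      (\<Sum>i\<le>n. dyadic_form org L (\<lambda>x. h x * w x) k i) \<le> ennreal C"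
proof -
  define N where "N = real CARD('n)"
  \<comment> \<open>Any exponent strictly between \<open>p\<close> and \<open>q\<close> would do.\<close>
  define s where "s = (p + q) / 2"
  have s: "p < s" "s < q" "1 < s" using p by (auto simp: s_def)
  define s' where "s' = s / (s - 1)"
  have ss': "1/s + 1/s' = 1" using s by (simp add: s'_def divide_simps)
  have q': "q' = q / (q - 1)"
  proof -
    have "1 / q' = (q - 1) / q" using p by (simp add: diff_divide_distrib)
    then have "1 / (1 / q') = 1 / ((q - 1) / q)" by simp
    then show ?thesis by simp
  qed
  have q'1: "1 < q'" using p by (simp add: q' divide_simps)
  have s'q': "q' < s'" using s p by (simp add: q' s'_def divide_simps) (simp add: algebra_simps)
  have s'1: "1 < s'" using q'1 s'q' by simp
  have e1: "1 - 1/p = 1/p'" "1 - 1/q' = 1/q" using p by auto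
  \<comment> \<open>The condition is used on cubes of side \<open>3 l\<close>, which costs a factor
    \<open>3^(N - \<gamma>)\<close>.\<close>
  define K3 where "K3 = max K 0 * 3 powr (N - \<gamma>)"
  have K30: "0 \<le> K3" by (simp add: K3_def)
  define CS where "CS = (1 / (1 - \<delta>s powr (s/p - 1)) + \<delta>s powr (- (1 - 1/p)) / (\<delta>s powr (- (1 - 1/p)) - 1)) * (1 + (p / (p - 1)) powr p)"
  define CW where "CW = (1 / (1 - \<delta>w powr (s'/q' - 1)) + \<delta>w powr (- (1 - 1/q')) / (\<delta>w powr (- (1 - 1/q')) - 1)) * (1 + (q' / (q' - 1)) powr q')"
  define C where "C = K3 * (max CS 0 + max CW 0)"
  have C0: "0 \<le> C" using K30 by (simp add: C_def)
  have sS: "sets S = sets lebesgue" "space S = UNIV" and sW: "sets W = sets lebesgue" "space W = UNIV"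
    by (auto simp: S_def W_def)
  have main: "(\<Sum>i\<le>n. dyadic_form org L (\<lambda>x. h x * w x) k i) \<le> ennreal C"
    if L: "0 < L" and [measurable]: "\<And>i. k i \<in> borel_measurable lebesgue"
      "G \<in> borel_measurable lebesgue" "h \<in> borel_measurable lebesgue"
      and G0: "\<And>x. 0 \<le> G x" and h0: "\<And>x. 0 \<le> h x"
      and G1: "(\<integral>\<^sup>+x. ennreal (G x powr p) \<partial>S) \<le> 1" and h1: "(\<integral>\<^sup>+x. ennreal (h x powr q') \<partial>W) \<le> 1"
      and k: "\<And>i. AE x in lebesgue. k i x \<le> dyadic_side L i powr \<gamma> * (G x * \<sigma> x)"
    for org L k G h n
  proof -
    interpret S: cell_tree S "dyadic org L" dyadic_par
      by (rule cell_tree_dyadic[OF sS(1) L finS])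
    interpret W: cell_tree W "dyadic org L" dyadic_par
      by (rule cell_tree_dyadic[OF sW(1) L finW])
    have GS [measurable]: "G \<in> borel_measurable S" and hW [measurable]: "h \<in> borel_measurable W"
      by (simp_all add: S_def W_def)
    let ?\<iota> = "dyadic org L"
    define l where "l = dyadic_side L"
    have l0: "0 < l i" for i using dyadic_side_pos[OF L] by (simp add: l_def)
    define \<tau> where "\<tau> i c = measure S (tripled org L i c)" for i c
    define \<omega> where "\<omega> i c = measure W (tripled org L i c)" for i c
    define SI where "SI i c = S.cell_int i (\<lambda>x. ennreal (G x)) c" for i c
    define WI where "WI i c = W.cell_int i (\<lambda>x. ennreal (h x)) c" for i c
    define A where "A i c = enn2real (SI i c)" for i c
    define B where "B i c = enn2real (WI i c)" for i c
    have SIfin: "SI i c < \<infinity>" for i c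
      unfolding SI_def using G1 by (intro S.finite_cell_int[OF GS p(1) G0] le_less_trans[OF S.cell_int_le_integral]) (auto intro: le_less_trans)
    have WIfin: "WI i c < \<infinity>" for i c
      unfolding WI_def using h1 by (intro W.finite_cell_int[OF hW q'1 h0] le_less_trans[OF W.cell_int_le_integral]) (auto intro: le_less_trans)
    have SA: "SI i c = ennreal (A i c)" and WB: "WI i c = ennreal (B i c)" and A0: "0 \<le> A i c" and B0: "0 \<le> B i c" for i c
      using SIfin[of i c] WIfin[of i c] by (simp_all add: A_def B_def less_top)
    have trip: "tripled org L i c \<in> sets lebesgue" for i c by (simp add: tripled_def)
    have Scell: "S.cell i c = {y. ?\<iota> i y = c}" and Wcell: "W.cell i c = {y. ?\<iota> i y = c}" for i c
      by (simp_all add: S.cell_def W.cell_def sS sW)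
    have tripfin: "emeasure S (tripled org L i c) < \<infinity>" "emeasure W (tripled org L i c) < \<infinity>" for i c
      unfolding tripled_def using l0[of i] finS[of "3 * dyadic_side L i"] finW[of "3 * dyadic_side L i"]
      by (auto simp: l_def)
    have \<tau>: "measure S (S.cell i c) \<le> \<tau> i c" "measure W (W.cell i c) \<le> \<omega> i c" for i c
      unfolding \<tau>_def \<omega>_def Scell Wcell using cell_subset_tripled[OF L] tripfin S.cell_sets[of i c] W.cell_sets[of i c] trip
      by (auto intro!: measure_mono_fmeasurable simp: fmeasurable_def sS sW Scell Wcell less_top[symmetric])
    have dec: "\<tau> (Suc i) (?\<iota> (Suc i) x) \<le> \<delta>s * \<tau> i (?\<iota> i x)" "\<omega> (Suc i) (?\<iota> (Suc i) x) \<le> \<delta>w * \<omega> i (?\<iota> i x)" for i x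
      unfolding \<tau>_def \<omega>_def
      using tripled_reverse_doubling[OF L sS(1) finS rdS less_imp_le[OF \<delta>(3)], of org i "?\<iota> (Suc i) x"]
        tripled_reverse_doubling[OF L sW(1) finW rdW less_imp_le[OF \<delta>(1)], of org i "?\<iota> (Suc i) x"]
      by (simp_all add: dyadic_par)
    define TS where "TS i c = \<tau> i c powr (- (s * (1 - 1/p))) * A i c powr (s - 1)" for i c
    define TW where "TW i c = \<omega> i c powr (- (s' * (1 - 1/q'))) * B i c powr (s' - 1)" for i c
    have T0: "0 \<le> TS i c" "0 \<le> TW i c" for i c by (auto simp: TS_def TW_def)
    have sumS: "(\<Sum>i\<le>n. \<integral>\<^sup>+x. ennreal (TS i (?\<iota> i x)) * ennreal (G x) \<partial>S) \<le> ennreal CS"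
      unfolding TS_def A_def SI_def CS_def
      by (intro S.fractional_embedding GS p s G0 G1 \<tau> dec \<delta>) (simp add: \<tau>_def)
    have sumW: "(\<Sum>i\<le>n. \<integral>\<^sup>+x. ennreal (TW i (?\<iota> i x)) * ennreal (h x) \<partial>W) \<le> ennreal CW"
      unfolding TW_def B_def WI_def CW_def
      by (intro W.fractional_embedding hW q'1 s'q' h0 h1 \<tau> dec \<delta>) (simp add: \<omega>_def)
    \<comment> \<open>In the degenerate case a tripled cell without mass contains a cell without mass, on which
      the left-hand side is \<open>0\<close>.\<close>
    have pw: "l i powr (\<gamma> - N) * A i c * B i c \<le> K3 * (TS i c * A i c + TW i c * B i c)" for i c
    proof (cases "\<tau> i c = 0 \<or> \<omega> i c = 0")
      case True
      then have "measure S (S.cell i c) = 0 \<or> measure W (W.cell i c) = 0"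
        using \<tau>[of i c] by (auto intro: antisym)
      then have "A i c = 0 \<or> B i c = 0"
        using S.cell_int_null[of i c "\<lambda>x. ennreal (G x)"] W.cell_int_null[of i c "\<lambda>x. ennreal (h x)"]
        by (auto simp: A_def B_def SI_def WI_def)
      then have "l i powr (\<gamma> - N) * A i c * B i c = 0" by auto
      moreover have "0 \<le> K3 * (TS i c * A i c + TW i c * B i c)" using K30 T0 A0 B0 by simp
      ultimately show ?thesis by linarith
    next
      case False
      define t where "t = \<tau> i c" define z where "z = \<omega> i c"
      have tz: "0 < t" "0 < z" using False by (auto simp: t_def z_def \<tau>_def \<omega>_def zero_less_measure_iff)
      define X where "X = t powr (- (1/p')) * A i c"
      define Y where "Y = z powr (- (1/q)) * B i c"
      have XY0: "0 \<le> X" "0 \<le> Y" using A0 B0 by (auto simp: X_def Y_def)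
      have "(3 * l i) powr (\<gamma> - N) * z powr (1/q) * t powr (1/p') \<le> max K 0"
        using K[of "3 * l i" "dyadic_centre org L i c"] l0[of i]
        by (simp add: z_def t_def \<omega>_def \<tau>_def tripled_def l_def N_def)
      then have "3 powr (N - \<gamma>) * ((3 * l i) powr (\<gamma> - N) * z powr (1/q) * t powr (1/p')) \<le> K3"
        unfolding K3_def by (subst mult.commute) (intro mult_right_mono, auto)
      moreover have "3 powr (N - \<gamma>) * (3 * l i) powr (\<gamma> - N) = l i powr (\<gamma> - N)"
      proof -
        have "3 powr (N - \<gamma>) * (3::real) powr (\<gamma> - N) = 1" by (simp flip: powr_add)
        then show ?thesis using l0[of i] by (simp add: powr_mult mult.assoc[symmetric])
      qed
      ultimately have "l i powr (\<gamma> - N) * z powr (1/q) * t powr (1/p') \<le> K3" by (simp add: mult.assoc[symmetric])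
      then have "l i powr (\<gamma> - N) * z powr (1/q) * t powr (1/p') * (X * Y) \<le> K3 * (X * Y)"
        using XY0 by (intro mult_right_mono) auto
      moreover have "l i powr (\<gamma> - N) * z powr (1/q) * t powr (1/p') * (X * Y) = l i powr (\<gamma> - N) * A i c * B i c"
      proof -
        have "z powr (1/q) * z powr (- (1/q)) = 1" "t powr (1/p') * t powr (- (1/p')) = 1"
          using tz by (simp_all flip: powr_add)
        then have "(z powr (1/q) * z powr (- (1/q))) * (t powr (1/p') * t powr (- (1/p'))) * (l i powr (\<gamma> - N) * A i c * B i c) = l i powr (\<gamma> - N) * A i c * B i c"
          by simp
        then show ?thesis by (simp add: X_def Y_def mult_ac)
      qed
      ultimately have 1: "l i powr (\<gamma> - N) * A i c * B i c \<le> K3 * (X * Y)" by simp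
      have "X * Y \<le> X powr s / s + Y powr s' / s'"
        using XY0 s s'1 ss' by (intro Youngs_inequality) auto
      also have "\<dots> \<le> X powr s + Y powr s'"
        using s s'1 by (intro add_mono) (auto simp: divide_le_eq mult_le_cancel_left1)
      also have "X powr s = TS i c * A i c"
      proof -
        have "A i c powr s = A i c powr (s - 1) * A i c" using A0[of i c] by (cases "A i c = 0") (auto simp: powr_diff)
        moreover have "X powr s = (t powr (- (1/p'))) powr s * A i c powr s"
          unfolding X_def by (rule powr_mult)
        moreover have "(t powr (- (1/p'))) powr s = t powr (- (s * (1 - 1/p)))"
          unfolding powr_powr e1 by (rule arg_cong[where f = "(powr) _"]) simp
        ultimately show ?thesis by (simp only: TS_def t_def mult.assoc)
      qed
      also have "Y powr s' = TW i c * B i c"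
      proof -
        have "B i c powr s' = B i c powr (s' - 1) * B i c" using B0[of i c] by (cases "B i c = 0") (auto simp: powr_diff)
        moreover have "Y powr s' = (z powr (- (1/q))) powr s' * B i c powr s'"
          unfolding Y_def by (rule powr_mult)
        moreover have "(z powr (- (1/q))) powr s' = z powr (- (s' * (1 - 1/q')))"
          unfolding powr_powr e1 by (rule arg_cong[where f = "(powr) _"]) simp
        ultimately show ?thesis by (simp only: TW_def z_def mult.assoc)
      qed
      finally have "K3 * (X * Y) \<le> K3 * (TS i c * A i c + TW i c * B i c)" using K30 by (rule mult_left_mono)
      with 1 show ?thesis by simp
    qed
    have form_le: "dyadic_form org L (\<lambda>x. h x * w x) k i
      \<le> ennreal K3 * ((\<integral>\<^sup>+x. ennreal (TS i (?\<iota> i x)) * ennreal (G x) \<partial>S) + (\<integral>\<^sup>+x. ennreal (TW i (?\<iota> i x)) * ennreal (h x) \<partial>W))" for i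
    proof -
      have J: "(\<integral>\<^sup>+y\<in>{y. ?\<iota> i y = c}. ennreal (k i y) \<partial>lebesgue) \<le> ennreal (l i powr \<gamma>) * SI i c" for c
      proof -
        have ms: "{y. ?\<iota> i y = c} \<in> sets lebesgue" using S.cell_sets[of i c] by (simp add: Scell sS)
        have "SI i c = (\<integral>\<^sup>+y. ennreal (\<sigma> y) * (ennreal (G y) * indicator {y. ?\<iota> i y = c} y) \<partial>lebesgue)"
          unfolding SI_def S.cell_int_def Scell unfolding S_def using ms by (subst nn_integral_density) auto
        then have "ennreal (l i powr \<gamma>) * SI i c
          = (\<integral>\<^sup>+y. ennreal (l i powr \<gamma>) * (ennreal (\<sigma> y) * (ennreal (G y) * indicator {y. ?\<iota> i y = c} y)) \<partial>lebesgue)"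
          using ms by (simp add: nn_integral_cmult)
        moreover have "(\<integral>\<^sup>+y\<in>{y. ?\<iota> i y = c}. ennreal (k i y) \<partial>lebesgue) \<le> \<dots>"
        proof (rule nn_integral_mono_AE)
          show "AE y in lebesgue. ennreal (k i y) * indicator {y. ?\<iota> i y = c} y
             \<le> ennreal (l i powr \<gamma>) * (ennreal (\<sigma> y) * (ennreal (G y) * indicator {y. ?\<iota> i y = c} y))"
            using k[of i]
          proof eventually_elim
            case (elim y)
            have "ennreal (k i y) \<le> ennreal (l i powr \<gamma>) * (ennreal (\<sigma> y) * ennreal (G y))"
              using ennreal_leI[OF elim] \<sigma>0[of y] G0[of y] by (simp add: l_def ennreal_mult mult_ac)
            then show ?case by (simp add: indicator_def)
          qed
        qed
        ultimately show ?thesis by simp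
      qed
      have "dyadic_form org L (\<lambda>x. h x * w x) k i
         \<le> (\<integral>\<^sup>+x. ennreal (h x * w x) * (ennreal (l i powr (- N)) * (ennreal (l i powr \<gamma>) * SI i (?\<iota> i x))) \<partial>lebesgue)"
        unfolding dyadic_form_def l_def[symmetric] N_def by (intro nn_integral_mono mult_left_mono J[unfolded l_def[symmetric]]) auto
      also have "\<dots> = (\<integral>\<^sup>+x. ennreal (w x) * (ennreal (l i powr (\<gamma> - N)) * SI i (?\<iota> i x) * ennreal (h x)) \<partial>lebesgue)"
      proof (intro nn_integral_cong)
        fix x
        have *: "ennreal (l i powr (- N)) * ennreal (l i powr \<gamma>) = ennreal (l i powr (\<gamma> - N))"
          by (simp flip: ennreal_mult powr_add)
        show "ennreal (h x * w x) * (ennreal (l i powr (- N)) * (ennreal (l i powr \<gamma>) * SI i (?\<iota> i x)))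
           = ennreal (w x) * (ennreal (l i powr (\<gamma> - N)) * SI i (?\<iota> i x) * ennreal (h x))"
          unfolding ennreal_mult[OF h0 w0] *[symmetric] by (simp only: mult_ac)
      qed
      also have "\<dots> = (\<integral>\<^sup>+x. ennreal (l i powr (\<gamma> - N)) * SI i (?\<iota> i x) * ennreal (h x) \<partial>W)"
      proof -
        have "(\<lambda>x. ennreal (l i powr (\<gamma> - N)) * SI i (?\<iota> i x) * ennreal (h x)) \<in> borel_measurable W"
          by measurable
        then have m: "(\<lambda>x. ennreal (l i powr (\<gamma> - N)) * SI i (?\<iota> i x) * ennreal (h x)) \<in> borel_measurable lebesgue"
          unfolding measurable_cong_sets[OF sW(1) refl] .
        show ?thesis unfolding W_def by (rule nn_integral_density[symmetric, OF _ m]) measurable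
      qed
      also have "\<dots> = (\<integral>\<^sup>+c. ennreal (l i powr (\<gamma> - N)) * SI i c * WI i c \<partial>count_space UNIV)"
        unfolding WI_def by (rule W.integral_over_cells) measurable
      also have "\<dots> \<le> (\<integral>\<^sup>+c. ennreal K3 * (ennreal (TS i c) * SI i c + ennreal (TW i c) * WI i c) \<partial>count_space UNIV)"
      proof (intro nn_integral_mono)
        fix c
        have "ennreal (l i powr (\<gamma> - N) * A i c * B i c) \<le> ennreal (K3 * (TS i c * A i c + TW i c * B i c))"
          by (rule ennreal_leI[OF pw])
        then show "ennreal (l i powr (\<gamma> - N)) * SI i c * WI i c \<le> ennreal K3 * (ennreal (TS i c) * SI i c + ennreal (TW i c) * WI i c)"
          unfolding SA WB using A0 B0 T0 K30 by (simp add: ennreal_mult)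
      qed
      also have "\<dots> = ennreal K3 * ((\<integral>\<^sup>+c. ennreal (TS i c) * SI i c \<partial>count_space UNIV) + (\<integral>\<^sup>+c. ennreal (TW i c) * WI i c \<partial>count_space UNIV))"
        by (simp add: nn_integral_cmult nn_integral_add)
      also have "(\<integral>\<^sup>+c. ennreal (TS i c) * SI i c \<partial>count_space UNIV) = (\<integral>\<^sup>+x. ennreal (TS i (?\<iota> i x)) * ennreal (G x) \<partial>S)"
        unfolding SI_def by (rule S.integral_over_cells[symmetric]) measurable
      also have "(\<integral>\<^sup>+c. ennreal (TW i c) * WI i c \<partial>count_space UNIV) = (\<integral>\<^sup>+x. ennreal (TW i (?\<iota> i x)) * ennreal (h x) \<partial>W)"
        unfolding WI_def by (rule W.integral_over_cells[symmetric]) measurable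
      finally show ?thesis .
    qed
    have "(\<Sum>i\<le>n. dyadic_form org L (\<lambda>x. h x * w x) k i)
       \<le> (\<Sum>i\<le>n. ennreal K3 * ((\<integral>\<^sup>+x. ennreal (TS i (?\<iota> i x)) * ennreal (G x) \<partial>S) + (\<integral>\<^sup>+x. ennreal (TW i (?\<iota> i x)) * ennreal (h x) \<partial>W)))"
      by (rule sum_mono) (rule form_le)
    also have "\<dots> = ennreal K3 * ((\<Sum>i\<le>n. \<integral>\<^sup>+x. ennreal (TS i (?\<iota> i x)) * ennreal (G x) \<partial>S) + (\<Sum>i\<le>n. \<integral>\<^sup>+x. ennreal (TW i (?\<iota> i x)) * ennreal (h x) \<partial>W))"
      by (simp only: sum_distrib_left[symmetric] sum.distrib)
    also have "\<dots> \<le> ennreal K3 * (ennreal (max CS 0) + ennreal (max CW 0))"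
      using sumS sumW by (intro mult_left_mono add_mono) (auto elim!: order_trans intro!: ennreal_leI)
    also have "\<dots> = ennreal C" using K30 by (simp add: C_def ennreal_mult)
    finally show ?thesis .
  qed
  show ?thesis using C0 main by blast
qed

section \<open>The dyadic form when p = q\<close>

context cell_tree
begin

lemma avg_holder:
  assumes [measurable]: "f \<in> borel_measurable M" "g \<in> borel_measurable M"
    and f0: "\<And>x. 0 \<le> f x" and g0: "\<And>x. 0 \<le> g x"
    and ab: "1 < a" "1 < b" "1/a + 1/b = 1"
    and F: "cell_int i (\<lambda>x. ennreal (f x powr a)) c < \<infinity>"
    and G: "cell_int i (\<lambda>x. ennreal (g x powr b)) c < \<infinity>"
  shows "cell_int i (\<lambda>x. ennreal (f x * g x)) c < \<infinity>"
    "avg i (\<lambda>x. f x * g x) c \<le> avg i (\<lambda>x. f x powr a) c powr (1/a) * avg i (\<lambda>x. g x powr b) c powr (1/b)"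
proof -
  define A where "A = enn2real (cell_int i (\<lambda>x. ennreal (f x powr a)) c)"
  define B where "B = enn2real (cell_int i (\<lambda>x. ennreal (g x powr b)) c)"
  have A: "cell_int i (\<lambda>x. ennreal (f x powr a)) c = ennreal A" "0 \<le> A"
    and B: "cell_int i (\<lambda>x. ennreal (g x powr b)) c = ennreal B" "0 \<le> B"
    using F G by (auto simp: A_def B_def less_top)
  let ?f = "\<lambda>x. f x * indicat_real (cell i c) x" and ?g = "\<lambda>x. g x * indicat_real (cell i c) x"
  have *: "cell_int i (\<lambda>x. ennreal (f x * g x)) c \<le> ennreal (A powr (1/a) * B powr (1/b))"
  proof -
    have "cell_int i (\<lambda>x. ennreal (f x * g x)) c = (\<integral>\<^sup>+x. ennreal (?f x * ?g x) \<partial>M)"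
      unfolding cell_int_def by (intro nn_integral_cong) (auto simp: indicator_def)
    also have "\<dots> \<le> ennreal (A powr (1/a) * B powr (1/b))"
    proof (rule holder_nn_integral[OF _ _ _ _ ab A(2) B(2)])
      show "(\<integral>\<^sup>+x. ennreal (?f x powr a) \<partial>M) \<le> ennreal A"
        unfolding A(1)[symmetric] cell_int_def by (intro nn_integral_mono) (auto simp: indicator_def)
      show "(\<integral>\<^sup>+x. ennreal (?g x powr b) \<partial>M) \<le> ennreal B"
        unfolding B(1)[symmetric] cell_int_def by (intro nn_integral_mono) (auto simp: indicator_def)
    qed (use f0 g0 in auto)
    finally show ?thesis .
  qed
  then show "cell_int i (\<lambda>x. ennreal (f x * g x)) c < \<infinity>" by (rule le_less_trans) simp
  define m where "m = measure M (cell i c)"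
  have le: "enn2real (cell_int i (\<lambda>x. ennreal (f x * g x)) c) \<le> A powr (1/a) * B powr (1/b)"
    using enn2real_mono[OF *] by simp
  show "avg i (\<lambda>x. f x * g x) c \<le> avg i (\<lambda>x. f x powr a) c powr (1/a) * avg i (\<lambda>x. g x powr b) c powr (1/b)"
  proof (cases "m = 0")
    case False
    then have m: "0 < m" by (simp add: m_def zero_less_measure_iff)
    have mm: "m = m powr (1/a) * m powr (1/b)" using m ab by (simp flip: powr_add)
    have "avg i (\<lambda>x. f x * g x) c \<le> A powr (1/a) * B powr (1/b) / m"
      unfolding avg_def m_def[symmetric] using le m by (intro divide_right_mono) auto
    also have "\<dots> = A powr (1/a) * B powr (1/b) / (m powr (1/a) * m powr (1/b))" using mm by simp
    also have "\<dots> = (A / m) powr (1/a) * (B / m) powr (1/b)"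
      using A B m by (simp add: powr_divide)
    finally show ?thesis by (simp add: avg_def A_def B_def m_def)
  qed (simp add: avg_def m_def)
qed

lemma runmax_product_le:
  assumes "\<And>i c. A i c \<le> K * (U i c powr a * V i c powr b)" and "0 \<le> K" "0 \<le> a" "0 \<le> b"
    and U0: "\<And>i c. 0 \<le> U i c" and V0: "\<And>i c. 0 \<le> V i c"
  shows "runmax A n c \<le> K * (runmax U n c powr a * runmax V n c powr b)"
proof (induction n arbitrary: c)
  case 0 then show ?case using assms by simp
next
  case (Suc n)
  note R0 = runmax_nonneg[of U n "par c", OF U0] runmax_nonneg[of V n "par c", OF V0]
  have 1: "K * (runmax U n (par c) powr a * runmax V n (par c) powr b)
     \<le> K * (runmax U (Suc n) c powr a * runmax V (Suc n) c powr b)"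
    using R0 assms(2-4) by (intro mult_left_mono mult_mono powr_mono2) auto
  have 2: "K * (U (Suc n) c powr a * V (Suc n) c powr b)
     \<le> K * (runmax U (Suc n) c powr a * runmax V (Suc n) c powr b)"
    using U0 V0 assms(2-4) by (intro mult_left_mono mult_mono powr_mono2) auto
  show ?case using order_trans[OF Suc.IH 1] order_trans[OF assms(1) 2] by (simp only: runmax.simps max.bounded_iff)
qed

end

text \<open>
The averages of \<open>H = v w^(1/p)\<close> are summed by parts, so that \<open>k\<close> enters only through its tails, and \<open>g\<close>
is replaced by its averages. What remains is a sum of \<open>A jump\<close>, with \<open>A\<close> the product of \<open>l^\<gamma>\<close> and the
averages of \<open>g\<close> and \<open>H\<close>; by \<open>jump_carleson\<close> it is at most twice the integral of the maximum of \<open>A\<close> along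
branches. Hoelder's inequality on each cell puts the weights into averages of their \<open>r\<close>-th powers,
which the condition controls, and leaves averages of \<open>u^a\<close> and \<open>v^b\<close> with \<open>a < p\<close> and \<open>b < p'\<close>.
\<close>

lemma dyadic_form_bound_bump:
  fixes w \<sigma> :: "real ^ 'n \<Rightarrow> real"
  assumes [measurable]: "w \<in> borel_measurable lebesgue" "\<sigma> \<in> borel_measurable lebesgue"
    and w0: "\<And>x. 0 \<le> w x" and \<sigma>0: "\<And>x. 0 \<le> \<sigma> x"
    and p: "1 < p" "1/p + 1/p' = 1" and r: "1 < r"
    and finW: "\<And>c l. 0 < l \<Longrightarrow> (\<integral>\<^sup>+x\<in>cube c l. ennreal (w x powr r) \<partial>lebesgue) < \<infinity>"
    and finS: "\<And>c l. 0 < l \<Longrightarrow> (\<integral>\<^sup>+x\<in>cube c l. ennreal (\<sigma> x powr r) \<partial>lebesgue) < \<infinity>"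
    and K: "\<And>c l. 0 < l \<Longrightarrow> l powr \<gamma> *
        (enn2real (\<integral>\<^sup>+x\<in>cube c l. ennreal (w x powr r) \<partial>lebesgue) / l ^ CARD('n)) powr (1 / (p * r)) *
        (enn2real (\<integral>\<^sup>+x\<in>cube c l. ennreal (\<sigma> x powr r) \<partial>lebesgue) / l ^ CARD('n)) powr (1 / (p' * r)) \<le> K"
  shows "\<exists>C\<ge>0. \<forall>org L k u v n. 0 < L \<longrightarrow> (\<forall>i. k i \<in> borel_measurable lebesgue) \<longrightarrow> (\<forall>i x. 0 \<le> k i x) \<longrightarrow>
      u \<in> borel_measurable lebesgue \<longrightarrow> v \<in> borel_measurable lebesgue \<longrightarrow> (\<forall>x. 0 \<le> u x) \<longrightarrow> (\<forall>x. 0 \<le> v x) \<longrightarrow>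
      (\<integral>\<^sup>+x. ennreal (u x powr p) \<partial>lebesgue) \<le> 1 \<longrightarrow> (\<integral>\<^sup>+x. ennreal (v x powr p') \<partial>lebesgue) \<le> 1 \<longrightarrow>
      (AE x in lebesgue. \<forall>j\<le>n. (\<Sum>i=j..n. k i x) \<le> dyadic_side L j powr \<gamma> * (u x * \<sigma> x powr (1/p'))) \<longrightarrow>
      (\<Sum>i\<le>n. dyadic_form org L (\<lambda>x. v x * w x powr (1/p)) k i) \<le> ennreal C"
proof -
  have p'1: "1 < p'"
  proof -
    have "1 / p' = (p - 1) / p" using p by (simp add: diff_divide_distrib)
    then have "1 / (1 / p') = 1 / ((p - 1) / p)" by simp
    then show ?thesis using p by simp
  qed
  \<comment> \<open>The exponents dual to \<open>p' r\<close> and \<open>p r\<close>. They are below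
    \<open>p\<close> and \<open>p'\<close> exactly because \<open>r > 1\<close>.\<close>
  define a where "a = p' * r / (p' * r - 1)"
  define b where "b = p * r / (p * r - 1)"
  have pr: "1 < p * r" "1 < p' * r" using p p'1 r by (auto intro: less_1_mult)
  have a: "1 < a" "1 / a + 1 / (p' * r) = 1" using pr by (auto simp: a_def divide_simps)
  have b: "1 < b" "1 / b + 1 / (p * r) = 1" using pr by (auto simp: b_def divide_simps)
  have ap: "a < p"
  proof -
    have "1 / (p' * r) < 1 / p'" using p'1 r by (simp add: divide_simps)
    then have "1 / p < 1 / a" using a p by linarith
    then show ?thesis using a p by (simp add: divide_simps)
  qed
  have bp: "b < p'"
  proof -
    have "1 / (p * r) < 1 / p" using p r by (simp add: divide_simps)
    then have "1 / p' < 1 / b" using b p by linarith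
    then show ?thesis using b p'1 by (simp add: divide_simps)
  qed
  define K' where "K' = max K 0"
  define C1 where "C1 = (p / a / (p / a - 1)) powr (p / a)"
  define C2 where "C2 = (p' / b / (p' / b - 1)) powr (p' / b)"
  define C where "C = 2 * (K' * (C1 + C2))"
  have C0: "0 \<le> C" "0 \<le> K'" "0 \<le> C1" "0 \<le> C2" by (auto simp: C_def K'_def C1_def C2_def)
  have main: "(\<Sum>i\<le>n. dyadic_form org L (\<lambda>x. v x * w x powr (1/p)) k i) \<le> ennreal C"
    if L: "0 < L" and [measurable]: "\<And>i. k i \<in> borel_measurable lebesgue" and k0: "\<And>i x. 0 \<le> k i x" and
      [measurable]: "u \<in> borel_measurable lebesgue" "v \<in> borel_measurable lebesgue"
      and u0: "\<And>x. 0 \<le> u x" and v0: "\<And>x. 0 \<le> v x"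
      and u1: "(\<integral>\<^sup>+x. ennreal (u x powr p) \<partial>lebesgue) \<le> 1" and v1: "(\<integral>\<^sup>+x. ennreal (v x powr p') \<partial>lebesgue) \<le> 1"
      and k: "AE x in lebesgue. \<forall>j\<le>n. (\<Sum>i=j..n. k i x) \<le> dyadic_side L j powr \<gamma> * (u x * \<sigma> x powr (1/p'))"
    for org L k u v n
  proof -
    interpret T: cell_tree lebesgue "dyadic org L" dyadic_par
      by (rule cell_tree_dyadic[OF refl L]) (subst emeasure_cube, auto)
    let ?\<iota> = "dyadic org L"
    define l where "l = dyadic_side L"
    have l0: "0 < l i" for i using dyadic_side_pos[OF L] by (simp add: l_def)
    define S where "S x = \<sigma> x powr (1/p')" for x
    define W where "W x = w x powr (1/p)" for x
    define H where "H x = v x * W x" for x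
    define g where "g x = u x * S x" for x
    have [measurable]: "S \<in> borel_measurable lebesgue" "W \<in> borel_measurable lebesgue"
      unfolding S_def W_def by measurable
    have Hm [measurable]: "H \<in> borel_measurable lebesgue" and gm [measurable]: "g \<in> borel_measurable lebesgue"
      unfolding H_def g_def by measurable
    have S0: "0 \<le> S x" and W0: "0 \<le> W x" for x by (auto simp: S_def W_def)
    have H0: "0 \<le> H x" and g0: "0 \<le> g x" for x using u0 v0 S0 W0 by (auto simp: H_def g_def)
    have Sr: "S x powr (p' * r) = \<sigma> x powr r" and Wr: "W x powr (p * r) = w x powr r" for x
      using p p'1 by (auto simp: S_def W_def powr_powr)
    have Tcell: "T.cell i c = {y. ?\<iota> i y = c}" for i c by (simp add: T.cell_def)
    have mcell: "emeasure lebesgue (T.cell i c) = ennreal (l i ^ CARD('n))" for i c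
      using emeasure_dyadic_cell[OF L, of org i c] by (simp add: Tcell l_def)
    have mcell': "measure lebesgue (T.cell i c) = l i ^ CARD('n)" for i c
      using mcell[of i c] l0[of i] by (simp add: measure_def)
    have cub: "T.cell_int i (\<lambda>x. ennreal (f x)) c \<le> (\<integral>\<^sup>+x\<in>cube (dyadic_centre org L i c) (l i). ennreal (f x) \<partial>lebesgue)" for i c f
      unfolding T.cell_int_def Tcell using dyadic_cell_subset_cube[OF L, of org i c]
      by (intro nn_integral_mono) (auto simp: indicator_def l_def)
    have finSc: "T.cell_int i (\<lambda>x. ennreal (S x powr (p' * r))) c < \<infinity>" for i c
      unfolding Sr using finS[OF l0] cub by (rule le_less_trans[rotated])
    have finWc: "T.cell_int i (\<lambda>x. ennreal (W x powr (p * r))) c < \<infinity>" for i c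
      unfolding Wr using finW[OF l0] cub by (rule le_less_trans[rotated])
    have ua: "(u x powr a) powr (p / a) = u x powr p" and vb: "(v x powr b) powr (p' / b) = v x powr p'" for x
      using a b by (auto simp: powr_powr)
    have finuI: "(\<integral>\<^sup>+x. ennreal ((u x powr a) powr (p / a)) \<partial>lebesgue) < \<infinity>"
      unfolding ua using u1 by (rule le_less_trans) simp
    have finu: "T.cell_int i (\<lambda>x. ennreal (u x powr a)) c < \<infinity>" for i c
    proof -
      have "T.cell_int i (\<lambda>x. ennreal ((u x powr a) powr (p / a))) c < \<infinity>"
        by (rule le_less_trans[OF T.cell_int_le_integral finuI])
      then show ?thesis by (rule T.finite_cell_int[rotated 3]) (use a ap in auto)
    qed
    have finvI: "(\<integral>\<^sup>+x. ennreal ((v x powr b) powr (p' / b)) \<partial>lebesgue) < \<infinity>"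
      unfolding vb using v1 by (rule le_less_trans) simp
    have finv: "T.cell_int i (\<lambda>x. ennreal (v x powr b)) c < \<infinity>" for i c
    proof -
      have "T.cell_int i (\<lambda>x. ennreal ((v x powr b) powr (p' / b))) c < \<infinity>"
        by (rule le_less_trans[OF T.cell_int_le_integral finvI])
      then show ?thesis by (rule T.finite_cell_int[rotated 3]) (use b bp in auto)
    qed
    have fing: "T.cell_int i (\<lambda>x. ennreal (g x)) c < \<infinity>" and
      avgg: "T.avg i g c \<le> T.avg i (\<lambda>x. u x powr a) c powr (1/a) * T.avg i (\<lambda>x. \<sigma> x powr r) c powr (1/(p' * r))" for i c
      using T.avg_holder[of u S a "p' * r" i c] u0 S0 a pr finu finSc
      unfolding g_def Sr by (auto simp: fun_eq_iff)
    have finH: "T.cell_int i (\<lambda>x. ennreal (H x)) c < \<infinity>" and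
      avgH: "T.avg i H c \<le> T.avg i (\<lambda>x. v x powr b) c powr (1/b) * T.avg i (\<lambda>x. w x powr r) c powr (1/(p * r))" for i c
      using T.avg_holder[of v W b "p * r" i c] v0 W0 b pr finv finWc
      unfolding H_def Wr by (auto simp: fun_eq_iff)
    define A where "A i c = l i powr \<gamma> * (T.avg i g c * T.avg i H c)" for i c
    have A0: "0 \<le> A i c" for i c by (simp add: A_def)
    define U where "U i c = T.avg i (\<lambda>x. u x powr a) c" for i c
    define V where "V i c = T.avg i (\<lambda>x. v x powr b) c" for i c
    have UV0: "0 \<le> U i c" "0 \<le> V i c" for i c by (auto simp: U_def V_def)
    have Ale: "A i c \<le> K' * (U i c powr (1/a) * V i c powr (1/b))" for i c
    proof -
      let ?z = "dyadic_centre org L i c"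
      define X where "X = T.avg i (\<lambda>x. \<sigma> x powr r) c"
      define Y where "Y = T.avg i (\<lambda>x. w x powr r) c"
      have XY0: "0 \<le> X" "0 \<le> Y" by (auto simp: X_def Y_def)
      have X: "X \<le> enn2real (\<integral>\<^sup>+x\<in>cube ?z (l i). ennreal (\<sigma> x powr r) \<partial>lebesgue) / l i ^ CARD('n)"
        unfolding X_def T.avg_def mcell' using finS[OF l0[of i], of ?z] l0[of i]
        by (intro divide_right_mono enn2real_mono cub) auto
      have Y: "Y \<le> enn2real (\<integral>\<^sup>+x\<in>cube ?z (l i). ennreal (w x powr r) \<partial>lebesgue) / l i ^ CARD('n)"
        unfolding Y_def T.avg_def mcell' using finW[OF l0[of i], of ?z] l0[of i]
        by (intro divide_right_mono enn2real_mono cub) auto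
      have "l i powr \<gamma> * Y powr (1 / (p * r)) * X powr (1 / (p' * r)) \<le> K'"
      proof (rule order_trans)
        show "l i powr \<gamma> * Y powr (1 / (p * r)) * X powr (1 / (p' * r)) \<le> l i powr \<gamma> *
          (enn2real (\<integral>\<^sup>+x\<in>cube ?z (l i). ennreal (w x powr r) \<partial>lebesgue) / l i ^ CARD('n)) powr (1 / (p * r)) *
          (enn2real (\<integral>\<^sup>+x\<in>cube ?z (l i). ennreal (\<sigma> x powr r) \<partial>lebesgue) / l i ^ CARD('n)) powr (1 / (p' * r))"
          by (rule mult_mono[OF mult_left_mono[OF powr_mono2] powr_mono2]) (use X Y XY0 pr in auto)
        show "\<dots> \<le> K'" using K[OF l0[of i], of ?z] by (simp add: K'_def)
      qed
      then have "(l i powr \<gamma> * Y powr (1 / (p * r)) * X powr (1 / (p' * r))) * (U i c powr (1/a) * V i c powr (1/b)) \<le> K' * (U i c powr (1/a) * V i c powr (1/b))"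
        by (intro mult_right_mono) auto
      moreover have "A i c \<le> l i powr \<gamma> * ((U i c powr (1/a) * X powr (1/(p' * r))) * (V i c powr (1/b) * Y powr (1/(p * r))))"
        unfolding A_def U_def V_def X_def Y_def by (intro mult_left_mono mult_mono avgg avgH) auto
      ultimately show ?thesis by (simp add: mult_ac)
    qed
    define mU where "mU x = T.maxavg n (\<lambda>x. u x powr a) (?\<iota> n x)" for x
    define mV where "mV x = T.maxavg n (\<lambda>x. v x powr b) (?\<iota> n x)" for x
    have [measurable]: "mU \<in> borel_measurable lebesgue" "mV \<in> borel_measurable lebesgue"
      unfolding mU_def mV_def by measurable
    have RA: "T.runmax A n (?\<iota> n x) \<le> K' * (mU x powr (p / a) + mV x powr (p' / b))" for x
    proof -
      have "T.runmax A n (?\<iota> n x) \<le> K' * (mU x powr (1/a) * mV x powr (1/b))"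
      proof -
        have "(\<lambda>i. T.avg i (\<lambda>x. u x powr a)) = U" "(\<lambda>i. T.avg i (\<lambda>x. v x powr b)) = V"
          by (intro ext; simp add: U_def V_def)+
        then have e: "mU x = T.runmax U n (?\<iota> n x)" "mV x = T.runmax V n (?\<iota> n x)"
          by (simp_all add: mU_def mV_def)
        show ?thesis unfolding e by (rule T.runmax_product_le[OF Ale]) (use C0 a b UV0 in auto)
      qed
      also have "mU x powr (1/a) * mV x powr (1/b) \<le> (mU x powr (1/a)) powr p / p + (mV x powr (1/b)) powr p' / p'"
        using p p'1 by (intro Youngs_inequality) auto
      also have "\<dots> = mU x powr (p / a) / p + mV x powr (p' / b) / p'" by (simp add: powr_powr)
      also have "\<dots> \<le> mU x powr (p / a) + mV x powr (p' / b)"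
        using p p'1 by (intro add_mono) (auto simp: divide_le_eq mult_le_cancel_left1)
      finally show ?thesis using C0 by (simp add: mult_left_mono)
    qed
    have max1: "(\<integral>\<^sup>+x. ennreal (mU x powr (p / a)) \<partial>lebesgue) \<le> ennreal C1"
    proof -
      have "(\<integral>\<^sup>+x. ennreal (mU x powr (p / a)) \<partial>lebesgue) \<le> ennreal C1 * (\<integral>\<^sup>+x. ennreal ((u x powr a) powr (p / a)) \<partial>lebesgue)"
        unfolding mU_def C1_def by (rule T.maximal_inequality[OF _ _ _ finuI]) (use a ap in auto)
      also have "\<dots> \<le> ennreal C1 * 1" unfolding ua by (intro mult_left_mono u1) auto
      finally show ?thesis by simp
    qed
    have max2: "(\<integral>\<^sup>+x. ennreal (mV x powr (p' / b)) \<partial>lebesgue) \<le> ennreal C2"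
    proof -
      have "(\<integral>\<^sup>+x. ennreal (mV x powr (p' / b)) \<partial>lebesgue) \<le> ennreal C2 * (\<integral>\<^sup>+x. ennreal ((v x powr b) powr (p' / b)) \<partial>lebesgue)"
        unfolding mV_def C2_def by (rule T.maximal_inequality[OF _ _ _ finvI]) (use b bp in auto)
      also have "\<dots> \<le> ennreal C2 * 1" unfolding vb by (intro mult_left_mono v1) auto
      finally show ?thesis by simp
    qed
    \<comment> \<open>By self-adjointness the average falls on \<open>H\<close> instead of \<open>k i\<close>.\<close>
    have form_eq: "dyadic_form org L H k i = (\<integral>\<^sup>+x. ennreal (k i x) * ennreal (T.avg i H (?\<iota> i x)) \<partial>lebesgue)" for i
    proof -
      have "dyadic_form org L H k i = (\<integral>\<^sup>+x. ennreal (l i powr - real CARD('n)) * T.cell_int i (\<lambda>y. ennreal (k i y)) (?\<iota> i x) * ennreal (H x) \<partial>lebesgue)"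
        unfolding dyadic_form_def T.cell_int_def Tcell l_def by (intro nn_integral_cong) (simp add: mult_ac)
      also have "\<dots> = (\<integral>\<^sup>+x. ennreal (l i powr - real CARD('n)) * T.cell_int i (\<lambda>y. ennreal (H y)) (?\<iota> i x) * ennreal (k i x) \<partial>lebesgue)"
        by (rule T.integral_cell_int_swap) measurable
      also have "\<dots> = (\<integral>\<^sup>+x. ennreal (k i x) * ennreal (T.avg i H (?\<iota> i x)) \<partial>lebesgue)"
      proof (intro nn_integral_cong)
        fix x
        have "T.cell_int i (\<lambda>y. ennreal (H y)) (?\<iota> i x) = ennreal (T.avg i H (?\<iota> i x)) * ennreal (l i ^ CARD('n))"
          using T.avg_times_measure[OF finH, of i "?\<iota> i x"] by (simp add: mcell)
        moreover have "ennreal (l i powr - real CARD('n)) * ennreal (l i ^ CARD('n)) = 1"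
        proof -
          have "l i powr - real CARD('n) * l i ^ CARD('n) = 1"
            using l0[of i] by (simp add: powr_minus powr_realpow)
          then show ?thesis using l0[of i] by (simp flip: ennreal_mult)
        qed
        moreover have "ennreal (l i powr - real CARD('n)) * (ennreal (T.avg i H (?\<iota> i x)) * ennreal (l i ^ CARD('n))) * ennreal (k i x)
            = (ennreal (l i powr - real CARD('n)) * ennreal (l i ^ CARD('n))) * (ennreal (k i x) * ennreal (T.avg i H (?\<iota> i x)))"
          by (simp only: mult_ac)
        ultimately show "ennreal (l i powr - real CARD('n)) * T.cell_int i (\<lambda>y. ennreal (H y)) (?\<iota> i x) * ennreal (k i x)
            = ennreal (k i x) * ennreal (T.avg i H (?\<iota> i x))"
          by simp
      qed
      finally show ?thesis .
    qed
    have "(\<Sum>i\<le>n. dyadic_form org L (\<lambda>x. v x * w x powr (1/p)) k i) = (\<Sum>i\<le>n. dyadic_form org L H k i)"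
      by (simp add: H_def[abs_def] W_def)
    also have "\<dots> = (\<integral>\<^sup>+x. (\<Sum>i\<le>n. ennreal (k i x) * ennreal (T.avg i H (?\<iota> i x))) \<partial>lebesgue)"
      unfolding form_eq by (rule nn_integral_sum[symmetric]) measurable
    also have "\<dots> \<le> (\<integral>\<^sup>+x. (\<Sum>j\<le>n. ennreal (l j powr \<gamma> * (T.jump H j (?\<iota> j x) * T.avg j H (?\<iota> j x))) * ennreal (g x)) \<partial>lebesgue)"
    proof (rule nn_integral_mono_AE)
      show "AE x in lebesgue. (\<Sum>i\<le>n. ennreal (k i x) * ennreal (T.avg i H (?\<iota> i x)))
         \<le> (\<Sum>j\<le>n. ennreal (l j powr \<gamma> * (T.jump H j (?\<iota> j x) * T.avg j H (?\<iota> j x))) * ennreal (g x))"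
        using k
      proof eventually_elim
        case (elim x)
        have "(\<Sum>i\<le>n. k i x * T.avg i H (?\<iota> i x)) \<le> (\<Sum>j\<le>n. (\<Sum>i=j..n. k i x) * (T.jump H j (?\<iota> j x) * T.avg j H (?\<iota> j x)))"
          by (rule T.sum_avg_le_sum_jumps) (use k0 in auto)
        also have "\<dots> \<le> (\<Sum>j\<le>n. (l j powr \<gamma> * g x) * (T.jump H j (?\<iota> j x) * T.avg j H (?\<iota> j x)))"
          using elim by (intro sum_mono mult_right_mono) (auto simp: l_def g_def S_def T.jump_bounds)
        finally have le: "(\<Sum>i\<le>n. k i x * T.avg i H (?\<iota> i x)) \<le> (\<Sum>j\<le>n. l j powr \<gamma> * (T.jump H j (?\<iota> j x) * T.avg j H (?\<iota> j x)) * g x)"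
          by (simp add: mult_ac)
        have "(\<Sum>i\<le>n. ennreal (k i x) * ennreal (T.avg i H (?\<iota> i x))) = ennreal (\<Sum>i\<le>n. k i x * T.avg i H (?\<iota> i x))"
          using k0 by (simp add: sum_ennreal flip: ennreal_mult)
        also have "\<dots> \<le> ennreal (\<Sum>j\<le>n. l j powr \<gamma> * (T.jump H j (?\<iota> j x) * T.avg j H (?\<iota> j x)) * g x)"
          by (rule ennreal_leI[OF le])
        also have "\<dots> = (\<Sum>j\<le>n. ennreal (l j powr \<gamma> * (T.jump H j (?\<iota> j x) * T.avg j H (?\<iota> j x))) * ennreal (g x))"
          using g0[of x] by (simp add: T.jump_bounds sum_ennreal flip: ennreal_mult)
        finally show ?case .
      qed
    qed
    also have "\<dots> = (\<Sum>j\<le>n. \<integral>\<^sup>+x. ennreal (l j powr \<gamma> * (T.jump H j (?\<iota> j x) * T.avg j H (?\<iota> j x))) * ennreal (g x) \<partial>lebesgue)"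
      by (rule nn_integral_sum) measurable
    also have "\<dots> = (\<Sum>j\<le>n. \<integral>\<^sup>+x. ennreal (A j (?\<iota> j x) * T.jump H j (?\<iota> j x)) \<partial>lebesgue)"
    proof (intro sum.cong refl)
      fix j
      have "(\<integral>\<^sup>+x. ennreal (l j powr \<gamma> * (T.jump H j (?\<iota> j x) * T.avg j H (?\<iota> j x))) * ennreal (g x) \<partial>lebesgue)
         = (\<integral>\<^sup>+x. ennreal (l j powr \<gamma> * (T.jump H j (?\<iota> j x) * T.avg j H (?\<iota> j x))) * ennreal (T.avg j g (?\<iota> j x)) \<partial>lebesgue)"
        by (rule T.integral_avg[OF gm fing, where \<phi> = "\<lambda>c. ennreal (l j powr \<gamma> * (T.jump H j c * T.avg j H c))", symmetric])
      also have "\<dots> = (\<integral>\<^sup>+x. ennreal (A j (?\<iota> j x) * T.jump H j (?\<iota> j x)) \<partial>lebesgue)"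
        by (intro nn_integral_cong) (simp add: A_def T.jump_bounds mult_ac flip: ennreal_mult)
      finally show "(\<integral>\<^sup>+x. ennreal (l j powr \<gamma> * (T.jump H j (?\<iota> j x) * T.avg j H (?\<iota> j x))) * ennreal (g x) \<partial>lebesgue) = \<dots>" .
    qed
    also have "\<dots> \<le> 2 * (\<integral>\<^sup>+x. ennreal (T.runmax A n (?\<iota> n x)) \<partial>lebesgue)"
      by (rule T.jump_carleson[OF Hm finH A0])
    also have "\<dots> \<le> 2 * (\<integral>\<^sup>+x. ennreal K' * (ennreal (mU x powr (p / a)) + ennreal (mV x powr (p' / b))) \<partial>lebesgue)"
    proof (intro mult_left_mono nn_integral_mono)
      fix x
      show "ennreal (T.runmax A n (?\<iota> n x)) \<le> ennreal K' * (ennreal (mU x powr (p / a)) + ennreal (mV x powr (p' / b)))"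
        using ennreal_leI[OF RA, of x] C0 by (simp add: ennreal_mult)
    qed simp
    also have "\<dots> = 2 * (ennreal K' * ((\<integral>\<^sup>+x. ennreal (mU x powr (p / a)) \<partial>lebesgue) + (\<integral>\<^sup>+x. ennreal (mV x powr (p' / b)) \<partial>lebesgue)))"
      by (simp add: nn_integral_cmult nn_integral_add)
    also have "\<dots> \<le> 2 * (ennreal K' * (ennreal C1 + ennreal C2))"
      by (intro mult_left_mono add_mono max1 max2) auto
    also have "\<dots> = ennreal C" using C0 by (simp add: C_def ennreal_mult)
    finally show ?thesis .
  qed
  show ?thesis
  proof (intro exI[of _ C] conjI C0(1) allI impI)
    fix org L and k :: "nat \<Rightarrow> real ^ 'n \<Rightarrow> real" and u v :: "real ^ 'n \<Rightarrow> real" and n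
    assume a: "0 < L" "\<forall>i. k i \<in> borel_measurable lebesgue" "\<forall>i x. 0 \<le> k i x"
      "u \<in> borel_measurable lebesgue" "v \<in> borel_measurable lebesgue" "\<forall>x. 0 \<le> u x" "\<forall>x. 0 \<le> v x"
      "(\<integral>\<^sup>+x. ennreal (u x powr p) \<partial>lebesgue) \<le> 1" "(\<integral>\<^sup>+x. ennreal (v x powr p') \<partial>lebesgue) \<le> 1"
      "AE x in lebesgue. \<forall>j\<le>n. (\<Sum>i=j..n. k i x) \<le> dyadic_side L j powr \<gamma> * (u x * \<sigma> x powr (1/p'))"
    show "(\<Sum>i\<le>n. dyadic_form org L (\<lambda>x. v x * w x powr (1/p)) k i) \<le> ennreal C"
      by (rule main[OF a(1) a(2)[rule_format] a(3)[rule_format] a(4,5) a(6)[rule_format] a(7)[rule_format] a(8-10)])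
  qed
qed

section \<open>Lipschitz functions on the real line\<close>

text \<open>
A bounded piece of the null set is covered by countably many intervals of small total length, and
each interval has Stieltjes measure at most \<open>C\<close> times its length.
\<close>

lemma lipschitz_stieltjes_absolutely_continuous:
  fixes F :: "real \<Rightarrow> real"
  assumes mono: "\<And>x y. x \<le> y \<Longrightarrow> F x \<le> F y"
    and cont: "continuous_on UNIV F"
    and lip: "\<And>a b. a \<le> b \<Longrightarrow> F b - F a \<le> C * (b - a)" and C: "0 \<le> C"
    and A: "A \<in> null_sets lborel"
  shows "A \<in> null_sets (interval_measure F)"
proof -
  let ?\<mu> = "interval_measure F"
  have Icc: "emeasure ?\<mu> (cbox a b) \<le> ennreal C * emeasure lborel (cbox a b)" for a b
  proof (cases "a \<le> b")
    case True
    have "emeasure ?\<mu> {a..b} = ennreal (F b - F a)"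
      using emeasure_interval_measure_Icc[OF True mono cont] .
    also have "\<dots> \<le> ennreal (C * (b - a))" by (rule ennreal_leI[OF lip[OF True]])
    finally show ?thesis using True C by (simp add: cbox_interval ennreal_mult)
  qed simp
  have bdd: "emeasure ?\<mu> (A \<inter> cbox (- real n) (real n)) = 0" for n
  proof -
    let ?A = "A \<inter> cbox (- real n) (real n)"
    have *: "emeasure ?\<mu> ?A \<le> 0 + ennreal e" if e: "0 < e" for e
    proof -
      define e' where "e' = e / (C + 1)"
      have e': "0 < e'" "C * e' \<le> e" using e C by (auto simp: e'_def field_simps)
      have "?A \<in> null_sets lborel" using A by (intro null_set_Int2) auto
      then have neg: "negligible ?A"
        by (simp add: negligible_iff_null_sets null_sets_completionI)
      have m0: "measure lebesgue ?A = 0" using neg by (rule negligible_imp_measure0)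
      obtain D where D: "countable D" "\<And>K. K \<in> D \<Longrightarrow> K \<subseteq> cbox (- real n) (real n) \<and> K \<noteq> {} \<and> (\<exists>c d. K = cbox c d)"
         "pairwise (\<lambda>A B. interior A \<inter> interior B = {}) D" "?A \<subseteq> \<Union>D" "\<Union>D \<in> lmeasurable"
         "measure lebesgue (\<Union>D) \<le> measure lebesgue ?A + e'"
        using measurable_outer_intervals_bounded[OF negligible_imp_measurable[OF neg] _ e'(1), of "- real n" "real n"]
        by (metis Int_lower2)
      have mD: "K \<in> sets borel" "interior K \<in> sets borel" if "K \<in> D" for K using D(2)[OF that] by auto
      have UD: "\<Union>D \<in> sets borel" using D(1) mD by (intro sets.countable_Union) auto
      have "emeasure ?\<mu> ?A \<le> emeasure ?\<mu> (\<Union>D)"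
        using D(4) UD by (intro emeasure_mono) auto
      also have "\<dots> = (\<integral>\<^sup>+x. indicator (\<Union>D) x \<partial>?\<mu>)" using UD by simp
      also have "\<dots> \<le> (\<integral>\<^sup>+x. \<integral>\<^sup>+K. indicator K x \<partial>count_space D \<partial>?\<mu>)"
      proof (intro nn_integral_mono)
        fix x :: real
        show "(indicator (\<Union>D) x :: ennreal) \<le> (\<integral>\<^sup>+K. indicator K x \<partial>count_space D)"
        proof (cases "x \<in> \<Union>D")
          case True
          then obtain K where "K \<in> D" "x \<in> K" by auto
          then have "1 \<le> (\<integral>\<^sup>+K. indicator K x \<partial>count_space D)"
            using nn_integral_ge_point[of K D "\<lambda>K. indicator K x"] by simp
          then show ?thesis by (rule order_trans[rotated]) (simp add: indicator_def)
        qed simp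
      qed
      also have "\<dots> = (\<integral>\<^sup>+K. \<integral>\<^sup>+x. indicator K x \<partial>?\<mu> \<partial>count_space D)"
        using D(1) mD by (intro nn_integral_count_space_nn_integral) auto
      also have "\<dots> = (\<integral>\<^sup>+K. emeasure ?\<mu> K \<partial>count_space D)"
        using mD by (intro nn_integral_cong) auto
      \<comment> \<open>The covering intervals are disjoint only up to endpoints, so lengths are measured by
        interiors.\<close>
      also have "\<dots> \<le> (\<integral>\<^sup>+K. ennreal C * emeasure lborel (interior K) \<partial>count_space D)"
      proof (intro nn_integral_mono)
        fix K assume "K \<in> space (count_space D)"
        then have KD: "K \<in> D" by simp
        then obtain c d where K: "K = cbox c d" using D(2)[OF KD] by blast
        have "emeasure lborel (interior K) = emeasure lborel (cbox c d)"
          unfolding K interior_cbox emeasure_lborel_box_eq emeasure_lborel_cbox_eq ..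
        then show "emeasure ?\<mu> K \<le> ennreal C * emeasure lborel (interior K)" using Icc K by simp
      qed
      also have "\<dots> = ennreal C * (\<integral>\<^sup>+K. emeasure lborel (interior K) \<partial>count_space D)"
        by (rule nn_integral_cmult) simp
      also have "\<dots> \<le> ennreal C * ennreal e'"
      proof (intro mult_left_mono)
        have "(\<integral>\<^sup>+K. emeasure lborel (interior K) \<partial>count_space D) = emeasure lborel (\<Union>K\<in>D. interior K)"
          using D(1,3) mD by (intro emeasure_UN_countable[symmetric]) (auto simp: disjoint_family_on_def pairwise_def)
        also have "\<dots> \<le> emeasure lborel (\<Union>D)"
          using UD interior_subset by (intro emeasure_mono) auto
        also have "\<dots> = ennreal (measure lebesgue (\<Union>D))"
          using D(5) UD emeasure_eq_measure2[OF D(5)] by simp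
        also have "\<dots> \<le> ennreal e'"
          using D(6) m0 by (intro ennreal_leI) auto
        finally show "(\<integral>\<^sup>+K. emeasure lborel (interior K) \<partial>count_space D) \<le> ennreal e'" .
      qed simp
      also have "\<dots> \<le> ennreal e" using e' C by (simp add: ennreal_mult[symmetric] ennreal_leI)
      finally show ?thesis by simp
    qed
    have "emeasure ?\<mu> ?A \<le> 0" by (rule ennreal_le_epsilon) (rule *)
    then show ?thesis by simp
  qed
  have Ab: "A \<in> sets borel" using A by (simp add: null_sets_def)
  have U: "A = (\<Union>n. A \<inter> cbox (- real n) (real n))"
  proof -
    have "\<exists>n. x \<in> cbox (- real n) (real n)" for x
    proof -
      obtain n where "\<bar>x\<bar> \<le> real n" using real_arch_simple by blast
      then show ?thesis by (intro exI[of _ n]) auto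
    qed
    then show ?thesis by auto
  qed
  have "(\<Union>n. A \<inter> cbox (- real n) (real n)) \<in> null_sets ?\<mu>"
    using bdd Ab by (intro null_sets_UN) (auto simp: null_sets_def)
  then show ?thesis using U by simp
qed

text \<open>
Lebesgue differentiation for the intervals \<open>[x, x + h]\<close>.
\<close>

lemma right_derivative_of_integral:
  fixes \<psi> F :: "real \<Rightarrow> real"
  assumes I: "\<And>a b. a \<le> b \<Longrightarrow> (\<psi> has_integral (F b - F a)) {a..b}"
  obtains N where "negligible N" "\<And>x. x \<notin> N \<Longrightarrow> ((\<lambda>h. (F (x + h) - F x) / h) \<longlongrightarrow> \<psi> x) (at_right 0)"
proof -
  have int: "\<psi> integrable_on cbox a b" for a b
    using I[of a b] by (cases "a \<le> b") (auto simp: cbox_interval)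
  obtain N where N: "negligible N" "\<And>x e. \<lbrakk>x \<notin> N; 0 < e\<rbrakk> \<Longrightarrow>
      \<exists>d>0. \<forall>h. 0 < h \<and> h < d \<longrightarrow> norm (integral (cbox x (x + h *\<^sub>R One)) \<psi> /\<^sub>R h ^ DIM(real) - \<psi> x) < e"
    using integrable_ccontinuous_explicit[OF int] by metis
  show ?thesis
  proof (rule that[OF N(1)])
    fix x assume x: "x \<notin> N"
    have eq: "integral (cbox x (x + h *\<^sub>R One)) \<psi> /\<^sub>R h ^ DIM(real) = (F (x + h) - F x) / h" if "0 < h" for h
      using integral_unique[OF I[of x "x + h"]] that by (simp add: cbox_interval divide_inverse mult.commute)
    show "((\<lambda>h. (F (x + h) - F x) / h) \<longlongrightarrow> \<psi> x) (at_right 0)"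
      unfolding tendsto_iff eventually_at_right_field
    proof (intro allI impI)
      fix e :: real assume "0 < e"
      from N(2)[OF x this] obtain d where d: "d > 0"
        "\<And>h. 0 < h \<and> h < d \<Longrightarrow> norm (integral (cbox x (x + h *\<^sub>R One)) \<psi> /\<^sub>R h ^ DIM(real) - \<psi> x) < e" by blast
      show "\<exists>b>0. \<forall>y>0. y < b \<longrightarrow> dist ((F (x + y) - F x) / y) (\<psi> x) < e"
        using d eq by (intro exI[of _ d]) (auto simp: dist_norm)
    qed
  qed
qed

text \<open>
The left difference quotients of \<open>F\<close> are right difference quotients of the reflected function.
\<close>

lemma derivative_of_integral:
  fixes \<psi> F :: "real \<Rightarrow> real"
  assumes I: "\<And>a b. a \<le> b \<Longrightarrow> (\<psi> has_integral (F b - F a)) {a..b}"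
  obtains N where "negligible N" "\<And>x. x \<notin> N \<Longrightarrow> (F has_real_derivative \<psi> x) (at x)"
proof -
  obtain N1 where N1: "negligible N1" "\<And>x. x \<notin> N1 \<Longrightarrow> ((\<lambda>h. (F (x + h) - F x) / h) \<longlongrightarrow> \<psi> x) (at_right 0)"
    using right_derivative_of_integral[OF I] by metis
  have I': "((\<lambda>x. \<psi> (- x)) has_integral (- F (- b) - - F (- a))) {a..b}" if "a \<le> b" for a b
    using has_integral_reflect_real[where f = \<psi> and a = "- b" and b = "- a"] I[of "- b" "- a"] that by simp
  obtain N2 where N2: "negligible N2" "\<And>x. x \<notin> N2 \<Longrightarrow> ((\<lambda>h. (- F (- (x + h)) - - F (- x)) / h) \<longlongrightarrow> \<psi> (- x)) (at_right 0)"
    using right_derivative_of_integral[where \<psi> = "\<lambda>x. \<psi> (- x)" and F = "\<lambda>x. - F (- x)", OF I'] by blast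
  have neg: "negligible (N1 \<union> uminus ` N2)"
    using N1(1) N2(1) negligible_differentiable_image_negligible[of N2 uminus] by (auto intro!: negligible_Un derivative_intros)
  show ?thesis
  proof (rule that[OF neg])
    fix x assume x: "x \<notin> N1 \<union> uminus ` N2"
    then have "x \<notin> N1" "- x \<notin> N2" by (auto simp: image_iff)
    from N1(2)[OF this(1)] N2(2)[OF this(2)]
    have r: "((\<lambda>h. (F (x + h) - F x) / h) \<longlongrightarrow> \<psi> x) (at_right 0)"
      and l: "((\<lambda>h. (- F (x - h) + F x) / h) \<longlongrightarrow> \<psi> x) (at_right 0)" by auto
    have "((\<lambda>h. (F (x + h) - F x) / h) \<longlongrightarrow> \<psi> x) (at_left 0)"
      unfolding at_left_minus[of 0] filterlim_filtermap
      using l by (simp add: minus_divide_left[symmetric] o_def diff_divide_distrib add.commute)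
    with r have "((\<lambda>h. (F (x + h) - F x) / h) \<longlongrightarrow> \<psi> x) (at 0)"
      by (simp add: filterlim_split_at)
    then show "(F has_real_derivative \<psi> x) (at x)" by (simp add: DERIV_def)
  qed
qed

text \<open>
Adding \<open>L x\<close> makes \<open>g\<close> monotone. The Stieltjes measure of the sum is absolutely continuous, and its
Radon-Nikodym density is the derivative.
\<close>

theorem lipschitz_real_ae_differentiable:
  fixes g :: "real \<Rightarrow> real"
  assumes lip: "L-lipschitz_on UNIV g"
  obtains \<psi> N where "\<psi> \<in> borel_measurable borel" "negligible N"
    "\<And>x. x \<notin> N \<Longrightarrow> (g has_real_derivative \<psi> x) (at x)"
    "\<And>a b. a \<le> b \<Longrightarrow> (\<psi> has_integral (g b - g a)) {a..b}"
proof -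
  have L: "0 \<le> L" using lip by (rule lipschitz_on_nonneg)
  have gl: "\<bar>g y - g x\<bar> \<le> L * \<bar>y - x\<bar>" for x y
    using lipschitz_onD[OF lip, of y x] by (simp add: dist_real_def)
  define F where "F x = g x + L * x" for x
  have inc: "0 \<le> F y - F x \<and> F y - F x \<le> (2 * L) * (y - x)" if "x \<le> y" for x y
    using gl[of y x] that by (auto simp: F_def algebra_simps abs_le_iff)
  have mono: "F x \<le> F y" if "x \<le> y" for x y using inc[OF that] by simp
  have cont: "continuous_on UNIV F"
    unfolding F_def using lipschitz_on_continuous_on[OF lip] by (intro continuous_intros)
  have ac: "absolutely_continuous lborel (interval_measure F)"
    unfolding absolutely_continuous_def
  proof
    fix A :: "real set" assume A: "A \<in> null_sets lborel"
    show "A \<in> null_sets (interval_measure F)"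
      by (rule lipschitz_stieltjes_absolutely_continuous[where C = "2 * L", OF mono cont _ _ A]) (use inc L in auto)
  qed
  obtain f where f [measurable]: "f \<in> borel_measurable lborel" and fd: "density lborel f = interval_measure F"
    using sigma_finite_measure.Radon_Nikodym[OF sigma_finite_lborel ac] by auto
  have fint: "(\<integral>\<^sup>+x\<in>{a..b}. f x \<partial>lborel) = ennreal (F b - F a)" if "a \<le> b" for a b
  proof -
    have "(\<integral>\<^sup>+x\<in>{a..b}. f x \<partial>lborel) = emeasure (density lborel f) {a..b}"
      by (subst emeasure_density) auto
    also have "\<dots> = ennreal (F b - F a)"
      unfolding fd using emeasure_interval_measure_Icc[OF that mono cont] .
    finally show ?thesis .
  qed
  define \<psi> where "\<psi> x = enn2real (f x)" for x
  have \<psi>m [measurable]: "\<psi> \<in> borel_measurable borel" unfolding \<psi>_def[abs_def] using f by simp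
  have ffin: "AE x in lborel. f x \<noteq> \<infinity>"
  proof -
    have "AE x in lborel. \<forall>n::nat. f x * indicator {- real n..real n} x \<noteq> \<infinity>"
      unfolding AE_all_countable
    proof
      fix n :: nat
      show "AE x in lborel. f x * indicator {- real n..real n} x \<noteq> \<infinity>"
        using fint[of "- real n" "real n"] by (intro nn_integral_PInf_AE) auto
    qed
    then show ?thesis
    proof eventually_elim
      case (elim x)
      obtain n where "\<bar>x\<bar> \<le> real n" using real_arch_simple by blast
      then have "x \<in> {- real n..real n}" by auto
      then show ?case using elim[rule_format, of n] by simp
    qed
  qed
  have \<psi>I: "(\<psi> has_integral (F b - F a)) {a..b}" if ab: "a \<le> b" for a b
  proof -
    have "(\<integral>\<^sup>+x. ennreal (indicator {a..b} x * \<psi> x) \<partial>lborel) = (\<integral>\<^sup>+x\<in>{a..b}. f x \<partial>lborel)"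
    proof (rule nn_integral_cong_AE)
      show "AE x in lborel. ennreal (indicator {a..b} x * \<psi> x) = f x * indicator {a..b} x"
        using ffin by eventually_elim (auto simp: \<psi>_def indicator_def less_top)
    qed
    then have "((\<lambda>x. indicator {a..b} x * \<psi> x) has_integral (F b - F a)) UNIV"
      using inc[OF ab] fint[OF ab] by (intro nn_integral_has_integral) (auto simp: \<psi>_def)
    moreover have "(\<lambda>x. indicator {a..b} x * \<psi> x) = (\<lambda>x. if x \<in> {a..b} then \<psi> x else 0)"
      by (auto simp: indicator_def)
    ultimately show ?thesis by (simp only: has_integral_restrict_UNIV)
  qed
  obtain N where N: "negligible N" "\<And>x. x \<notin> N \<Longrightarrow> (F has_real_derivative \<psi> x) (at x)"
    using derivative_of_integral[OF \<psi>I] by metis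
  have gF: "g = (\<lambda>x. F x - L * x)" by (auto simp: F_def)
  show ?thesis
  proof (rule that[of "\<lambda>x. \<psi> x - L" N])
    show "(\<lambda>x. \<psi> x - L) \<in> borel_measurable borel" by measurable
    show "negligible N" by fact
    show "(g has_real_derivative \<psi> x - L) (at x)" if "x \<notin> N" for x
      unfolding gF using N(2)[OF that] by (auto intro!: derivative_eq_intros)
    show "((\<lambda>x. \<psi> x - L) has_integral g b - g a) {a..b}" if "a \<le> b" for a b
      using has_integral_diff[OF \<psi>I[OF that] has_integral_const_real[of L a b]] that
      by (simp add: gF algebra_simps)
  qed
qed

lemma negligible_AE_lborel:
  assumes "negligible N" shows "AE x in lborel. x \<notin> N"
proof -
  obtain N' where "N' \<in> null_sets lborel" "N \<subseteq> N'"
    using assms by (auto simp: negligible_iff_null_sets null_sets_completion_iff2)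
  then show ?thesis by (intro AE_I'[of N']) auto
qed

text \<open>
Composition with the projection of the line onto \<open>[a, b]\<close> extends \<open>g\<close> to a Lipschitz function on the
whole line without changing its derivative inside the interval.
\<close>

lemma lipschitz_increment_le_integral:
  fixes g :: "real \<Rightarrow> real"
  assumes lip: "L-lipschitz_on {a..b} g" and ab: "a \<le> b"
    and h [measurable]: "h \<in> borel_measurable borel"
    and der: "AE s in lborel. s \<in> {a<..<b} \<longrightarrow> (\<exists>d. (g has_real_derivative d) (at s) \<and> ennreal \<bar>d\<bar> \<le> h s)"
  shows "ennreal \<bar>g b - g a\<bar> \<le> (\<integral>\<^sup>+s\<in>{a..b}. h s \<partial>lborel)"
proof -
  define G where "G s = g (max a (min b s))" for s
  have "L-lipschitz_on UNIV G"
  proof (rule lipschitz_onI)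
    fix x y :: real
    have "dist (G x) (G y) \<le> L * dist (max a (min b x)) (max a (min b y))"
      unfolding G_def using ab by (intro lipschitz_onD[OF lip]) auto
    also have "\<dots> \<le> L * dist x y"
      using lipschitz_on_nonneg[OF lip] by (intro mult_left_mono) (auto simp: dist_real_def max_def min_def)
    finally show "dist (G x) (G y) \<le> L * dist x y" .
  qed (rule lipschitz_on_nonneg[OF lip])
  from lipschitz_real_ae_differentiable[OF this] obtain \<psi> N where \<psi>: "\<psi> \<in> borel_measurable borel" "negligible N"
    "\<And>x. x \<notin> N \<Longrightarrow> (G has_real_derivative \<psi> x) (at x)"
    "\<And>a b. a \<le> b \<Longrightarrow> (\<psi> has_integral (G b - G a)) {a..b}" by metis
  note [measurable] = \<psi>(1)
  have Gab: "G a = g a" "G b = g b" using ab by (auto simp: G_def)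
  have AEN: "AE s in lborel. s \<notin> N"
    using \<psi>(2) by (rule negligible_AE_lborel)
  have ne: "AE s in lborel. s \<noteq> a \<and> s \<noteq> b"
    using AE_lborel_singleton[of a] AE_lborel_singleton[of b] by auto
  have bound: "AE s in lborel. s \<in> {a..b} \<longrightarrow> ennreal \<bar>\<psi> s\<bar> \<le> h s"
    using AEN der ne
  proof eventually_elim
    case (elim s)
    show ?case
    proof
      assume "s \<in> {a..b}"
      then have s: "s \<in> {a<..<b}" using elim by auto
      then obtain d where d: "(g has_real_derivative d) (at s)" "ennreal \<bar>d\<bar> \<le> h s" using elim by auto
      have "eventually (\<lambda>t. G t = g t) (nhds s)"
        using s by (intro eventually_nhds[THEN iffD2] exI[of _ "{a<..<b}"]) (auto simp: G_def)
      then have "(G has_real_derivative d) (at s)" using d(1) by (subst DERIV_cong_ev[OF refl _ refl])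
      then have "\<psi> s = d" using \<psi>(3) elim(1) DERIV_unique by blast
      then show "ennreal \<bar>\<psi> s\<bar> \<le> h s" using d by simp
    qed
  qed
  show ?thesis
  proof (cases "(\<integral>\<^sup>+s\<in>{a..b}. h s \<partial>lborel) = \<infinity>")
    case False
    have le: "(\<integral>\<^sup>+s. ennreal (indicator {a..b} s * \<bar>\<psi> s\<bar>) \<partial>lborel) \<le> (\<integral>\<^sup>+s\<in>{a..b}. h s \<partial>lborel)"
    proof (rule nn_integral_mono_AE)
      show "AE s in lborel. ennreal (indicator {a..b} s * \<bar>\<psi> s\<bar>) \<le> h s * indicator {a..b} s"
        using bound by eventually_elim (auto simp: indicator_def)
    qed
    then have fin: "(\<integral>\<^sup>+s. ennreal (indicator {a..b} s * \<bar>\<psi> s\<bar>) \<partial>lborel) < \<infinity>"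
      using False by (auto simp: less_top top_unique)
    have eq: "(\<lambda>s. indicator {a..b} s * \<bar>\<psi> s\<bar>) = (\<lambda>s. if s \<in> {a..b} then \<bar>\<psi> s\<bar> else 0)"
      by (auto simp: indicator_def)
    have m: "(\<lambda>s. indicator {a..b} s * \<bar>\<psi> s\<bar>) \<in> borel_measurable borel" by measurable
    have "(\<lambda>s. indicator {a..b} s * \<bar>\<psi> s\<bar>) integrable_on UNIV"
      by (rule nn_integral_integrable_on[OF m _ fin]) simp
    then have int: "(\<lambda>s. \<bar>\<psi> s\<bar>) integrable_on {a..b}" by (simp only: eq integrable_restrict_UNIV)
    have "\<bar>G b - G a\<bar> \<le> integral {a..b} (\<lambda>s. \<bar>\<psi> s\<bar>)"
      using integral_norm_bound_integral[of \<psi> "{a..b}" "\<lambda>s. \<bar>\<psi> s\<bar>"] \<psi>(4)[OF ab] int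
      by (auto simp: integral_unique has_integral_integrable)
    also have "ennreal \<dots> = (\<integral>\<^sup>+s. ennreal (indicator {a..b} s * \<bar>\<psi> s\<bar>) \<partial>lborel)"
      using nn_integral_lborel_eq_integral[OF m _ fin] by (simp only: eq integral_restrict_UNIV) simp
    finally have "ennreal \<bar>G b - G a\<bar> \<le> \<dots>" by (simp add: ennreal_leI)
    also note le
    finally show ?thesis by (simp add: Gab)
  qed simp
qed

section \<open>Differentiability almost everywhere of Lipschitz functions\<close>

definition line_quotient :: "('a::real_normed_vector \<Rightarrow> real) \<Rightarrow> 'a \<Rightarrow> real \<Rightarrow> 'a \<Rightarrow> real" where
  "line_quotient F v t x = (F (x + t *\<^sub>R v) - F x) / t"

definition has_line_derivative :: "('a::real_normed_vector \<Rightarrow> real) \<Rightarrow> 'a \<Rightarrow> 'a \<Rightarrow> real \<Rightarrow> bool" where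
  "has_line_derivative F x v d \<longleftrightarrow> ((\<lambda>t. line_quotient F v t x) \<longlongrightarrow> d) (at 0)"

text \<open>
Rational step sizes suffice by continuity, and they make the condition a countable combination of
inequalities; this yields the measurability of the set where a directional derivative exists.
\<close>

lemma convergent_iff_rational_cauchy:
  fixes q :: "real \<Rightarrow> real"
  assumes cont: "\<And>t. t \<noteq> 0 \<Longrightarrow> isCont q t"
  shows "(\<exists>d. (q \<longlongrightarrow> d) (at 0)) \<longleftrightarrow>
    (\<forall>n::nat. \<exists>m::nat. \<forall>s t :: rat. 0 < \<bar>of_rat s :: real\<bar> \<and> \<bar>of_rat s\<bar> < 1 / Suc m \<and> 0 < \<bar>of_rat t :: real\<bar> \<and> \<bar>of_rat t\<bar> < 1 / Suc m
        \<longrightarrow> \<bar>q (of_rat s) - q (of_rat t)\<bar> \<le> 1 / Suc n)" (is "?L \<longleftrightarrow> ?R")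
proof
  assume ?L
  then obtain d where d: "(q \<longlongrightarrow> d) (at 0)" ..
  show ?R
  proof
    fix n :: nat
    have "0 < 1 / (2 * real (Suc n))" by simp
    from tendstoD[OF d this] obtain \<delta> where \<delta>: "0 < \<delta>" "\<And>t. t \<noteq> 0 \<Longrightarrow> \<bar>t\<bar> < \<delta> \<Longrightarrow> \<bar>q t - d\<bar> < 1 / (2 * real (Suc n))"
      unfolding eventually_at by (auto simp: dist_real_def)
    obtain m where m: "1 / real (Suc m) < \<delta>" using reals_Archimedean[OF \<delta>(1)] unfolding inverse_eq_divide by blast
    show "\<exists>m::nat. \<forall>s t :: rat. 0 < \<bar>of_rat s :: real\<bar> \<and> \<bar>of_rat s\<bar> < 1 / Suc m \<and> 0 < \<bar>of_rat t :: real\<bar> \<and> \<bar>of_rat t\<bar> < 1 / Suc m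
        \<longrightarrow> \<bar>q (of_rat s) - q (of_rat t)\<bar> \<le> 1 / Suc n"
    proof (intro exI[of _ m] allI impI)
      fix s t :: rat
      assume "0 < \<bar>of_rat s :: real\<bar> \<and> \<bar>of_rat s\<bar> < 1 / Suc m \<and> 0 < \<bar>of_rat t :: real\<bar> \<and> \<bar>of_rat t\<bar> < 1 / Suc m"
      then have "of_rat s \<noteq> (0::real)" "\<bar>of_rat s :: real\<bar> < \<delta>" "of_rat t \<noteq> (0::real)" "\<bar>of_rat t :: real\<bar> < \<delta>"
        using m by linarith+
      then have "\<bar>q (of_rat s) - d\<bar> < 1 / (2 * real (Suc n))" "\<bar>q (of_rat t) - d\<bar> < 1 / (2 * real (Suc n))"
        using \<delta>(2) by blast+
      then have "\<bar>q (of_rat s) - q (of_rat t)\<bar> \<le> 1 / (2 * real (Suc n)) + 1 / (2 * real (Suc n))"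
        using abs_triangle_ineq4[of "q (of_rat s) - d" "q (of_rat t) - d"] by simp
      also have "\<dots> = 1 / real (Suc n)" by (simp add: field_simps)
      finally show "\<bar>q (of_rat s) - q (of_rat t)\<bar> \<le> 1 / Suc n" .
    qed
  qed
next
  assume R: ?R
  have *: "\<exists>\<delta>>0. \<forall>s t. 0 < \<bar>s\<bar> \<and> \<bar>s\<bar> < \<delta> \<and> 0 < \<bar>t\<bar> \<and> \<bar>t\<bar> < \<delta> \<longrightarrow> \<bar>q s - q t\<bar> \<le> 1 / Suc n" for n
  proof -
    obtain m where m: "\<And>s t :: rat. 0 < \<bar>of_rat s :: real\<bar> \<and> \<bar>of_rat s\<bar> < 1 / Suc m \<and> 0 < \<bar>of_rat t :: real\<bar> \<and> \<bar>of_rat t\<bar> < 1 / Suc m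
        \<Longrightarrow> \<bar>q (of_rat s) - q (of_rat t)\<bar> \<le> 1 / Suc n" using R by metis
    have apx: "\<exists>r::rat. 0 < \<bar>of_rat r :: real\<bar> \<and> \<bar>of_rat r\<bar> < 1 / Suc m \<and> \<bar>q (of_rat r) - q s\<bar> < e"
      if s: "0 < \<bar>s\<bar>" "\<bar>s\<bar> < 1 / Suc m" and e: "0 < e" for s e
    proof -
      have "isCont q s" using s by (intro cont) auto
      then obtain \<eta> where \<eta>: "0 < \<eta>" "\<And>t. dist t s < \<eta> \<Longrightarrow> dist (q t) (q s) < e"
        using e unfolding continuous_at_eps_delta by blast
      define \<eta>' where "\<eta>' = min \<eta> (min \<bar>s\<bar> (1 / Suc m - \<bar>s\<bar>))"
      have "0 < \<eta>'" using \<eta> s by (simp add: \<eta>'_def)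
      then obtain r where r: "s < of_rat r" "of_rat r < s + \<eta>'" using of_rat_dense[of s "s + \<eta>'"] by auto
      have "\<bar>of_rat r - s\<bar> < \<eta>'" using r by auto
      moreover have "\<eta>' \<le> \<eta>" "\<eta>' \<le> \<bar>s\<bar>" "\<eta>' \<le> 1 / Suc m - \<bar>s\<bar>" by (auto simp: \<eta>'_def)
      ultimately have "\<bar>of_rat r - s\<bar> < \<eta>" "0 < \<bar>of_rat r :: real\<bar>" "\<bar>of_rat r :: real\<bar> < 1 / Suc m" by linarith+
      then show ?thesis using \<eta>(2)[of "of_rat r"] unfolding dist_real_def by blast
    qed
    show ?thesis
    proof (intro exI[of _ "1 / Suc m"] conjI allI impI)
      fix s t assume st: "0 < \<bar>s\<bar> \<and> \<bar>s\<bar> < 1 / Suc m \<and> 0 < \<bar>t\<bar> \<and> \<bar>t\<bar> < 1 / Suc m"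
      show "\<bar>q s - q t\<bar> \<le> 1 / Suc n"
      proof (rule field_le_epsilon)
        fix e :: real assume "0 < e"
        then have e: "0 < e / 2" by simp
        obtain r1 where r1: "0 < \<bar>of_rat r1 :: real\<bar>" "\<bar>of_rat r1\<bar> < 1 / Suc m" "\<bar>q (of_rat r1) - q s\<bar> < e / 2"
          using apx[OF _ _ e, of s] st by blast
        obtain r2 where r2: "0 < \<bar>of_rat r2 :: real\<bar>" "\<bar>of_rat r2\<bar> < 1 / Suc m" "\<bar>q (of_rat r2) - q t\<bar> < e / 2"
          using apx[OF _ _ e, of t] st by blast
        have "\<bar>q (of_rat r1) - q (of_rat r2)\<bar> \<le> 1 / Suc n" using m r1 r2 by blast
        then show "\<bar>q s - q t\<bar> \<le> 1 / Suc n + e" using r1(3) r2(3) by linarith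
      qed
    qed simp
  qed
  define u where "u k = q (1 / real (Suc k))" for k
  have u0: "(\<lambda>k. 1 / real (Suc k)) \<longlonglongrightarrow> 0" using LIMSEQ_inverse_real_of_nat by (simp add: inverse_eq_divide)
  have small: "\<exists>M. \<forall>k\<ge>M. \<bar>1 / real (Suc k)\<bar> < \<delta>" if "0 < \<delta>" for \<delta>
    using tendstoD[OF u0 that] by (auto simp: eventually_sequentially dist_real_def)
  have "Cauchy u"
  proof (rule metric_CauchyI)
    fix e :: real assume e: "0 < e"
    obtain n where n: "1 / real (Suc n) < e" using reals_Archimedean[OF e] unfolding inverse_eq_divide by blast
    obtain \<delta> where \<delta>: "0 < \<delta>" "\<And>s t. 0 < \<bar>s\<bar> \<and> \<bar>s\<bar> < \<delta> \<and> 0 < \<bar>t\<bar> \<and> \<bar>t\<bar> < \<delta> \<Longrightarrow> \<bar>q s - q t\<bar> \<le> 1 / Suc n"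
      using *[of n] by metis
    obtain M where M: "\<And>k. k \<ge> M \<Longrightarrow> \<bar>1 / real (Suc k)\<bar> < \<delta>" using small[OF \<delta>(1)] by blast
    have "dist (u j) (u k) < e" if "j \<ge> M" "k \<ge> M" for j k
      using \<delta>(2)[of "1 / real (Suc j)" "1 / real (Suc k)"] M[OF that(1)] M[OF that(2)] n
      unfolding u_def dist_real_def by simp
    then show "\<exists>M. \<forall>m\<ge>M. \<forall>n\<ge>M. dist (u m) (u n) < e" by blast
  qed
  then obtain d where d: "u \<longlonglongrightarrow> d" using convergent_eq_Cauchy by blast
  have "(q \<longlongrightarrow> d) (at 0)"
  proof (rule tendstoI)
    fix e :: real assume e: "0 < e"
    obtain n where n: "1 / real (Suc n) < e" using reals_Archimedean[OF e] unfolding inverse_eq_divide by blast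
    obtain \<delta> where \<delta>: "0 < \<delta>" "\<And>s t. 0 < \<bar>s\<bar> \<and> \<bar>s\<bar> < \<delta> \<and> 0 < \<bar>t\<bar> \<and> \<bar>t\<bar> < \<delta> \<Longrightarrow> \<bar>q s - q t\<bar> \<le> 1 / Suc n"
      using *[of n] by metis
    obtain M where M: "\<And>k. k \<ge> M \<Longrightarrow> \<bar>1 / real (Suc k)\<bar> < \<delta>" using small[OF \<delta>(1)] by blast
    have "\<bar>q t - d\<bar> \<le> 1 / Suc n" if t: "0 < \<bar>t\<bar>" "\<bar>t\<bar> < \<delta>" for t
    proof (rule LIMSEQ_le_const2)
      show "(\<lambda>k. \<bar>q t - u k\<bar>) \<longlonglongrightarrow> \<bar>q t - d\<bar>" using d by (intro tendsto_intros)
      show "\<exists>M. \<forall>k\<ge>M. \<bar>q t - u k\<bar> \<le> 1 / Suc n"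
      proof (intro exI[of _ M] allI impI)
        fix k assume "M \<le> k"
        then show "\<bar>q t - u k\<bar> \<le> 1 / Suc n" unfolding u_def using t M[of k] by (intro \<delta>(2)) auto
      qed
    qed
    then show "\<forall>\<^sub>F t in at 0. dist (q t) d < e"
      unfolding eventually_at using \<delta>(1) n by (intro exI[of _ \<delta>]) (force simp: dist_real_def)
  qed
  then show ?L ..
qed

lemma emeasure_translation_eq:
  fixes A :: "'a::euclidean_space set"
  assumes [measurable]: "A \<in> sets borel"
  shows "(\<integral>\<^sup>+x. indicator A (x + c) \<partial>lborel) = emeasure lborel A"
proof -
  have "(\<integral>\<^sup>+x. indicator A (x + c) \<partial>lborel) = (\<integral>\<^sup>+x. indicator A x \<partial>distr lborel borel ((+) c))"
    by (subst nn_integral_distr) (auto simp: add.commute)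
  then show ?thesis by (simp add: lborel_distr_plus)
qed

text \<open>
Fubini's theorem without a change of coordinates: the measure of \<open>A\<close> is unchanged under
translation by \<open>t v\<close>, so it can be averaged over \<open>t\<close> between \<open>0\<close> and \<open>1\<close> and the order of integration
exchanged.
\<close>

lemma null_set_of_null_on_lines:
  fixes A :: "'a::euclidean_space set"
  assumes A [measurable]: "A \<in> sets borel" and lines: "\<And>x. AE t in lborel. x + t *\<^sub>R v \<notin> A"
  shows "A \<in> null_sets lborel"
proof -
  have m: "(\<lambda>(x, t). indicator A (x + t *\<^sub>R v) * indicator {0..1::real} t :: ennreal) \<in> borel_measurable (lborel \<Otimes>\<^sub>M lborel)"
  proof -
    have "(\<lambda>z::'a \<times> real. fst z + snd z *\<^sub>R v) \<in> borel_measurable borel"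
      by (intro borel_measurable_continuous_onI continuous_intros)
    then have [measurable]: "(\<lambda>z::'a \<times> real. fst z + snd z *\<^sub>R v) \<in> borel_measurable (lborel \<Otimes>\<^sub>M lborel)"
      by (simp add: lborel_prod)
    show ?thesis unfolding case_prod_beta by measurable
  qed
  have "emeasure lborel A = (\<integral>\<^sup>+t. emeasure lborel A * indicator {0..1::real} t \<partial>lborel)"
    by (subst nn_integral_cmult_indicator) auto
  also have "\<dots> = (\<integral>\<^sup>+t. \<integral>\<^sup>+x. indicator A (x + t *\<^sub>R v) * indicator {0..1::real} t \<partial>lborel \<partial>lborel)"
  proof (intro nn_integral_cong)
    fix t :: real
    have "(\<integral>\<^sup>+x. indicator A (x + t *\<^sub>R v) * indicator {0..1::real} t \<partial>lborel)
        = (\<integral>\<^sup>+x. indicator A (x + t *\<^sub>R v) \<partial>lborel) * indicator {0..1::real} t"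
      by (rule nn_integral_multc) measurable
    then show "emeasure lborel A * indicator {0..1::real} t = (\<integral>\<^sup>+x. indicator A (x + t *\<^sub>R v) * indicator {0..1::real} t \<partial>lborel)"
      by (simp only: emeasure_translation_eq[OF A])
  qed
  also have "\<dots> = (\<integral>\<^sup>+x. \<integral>\<^sup>+t. indicator A (x + t *\<^sub>R v) * indicator {0..1::real} t \<partial>lborel \<partial>lborel)"
    by (rule lborel_pair.Fubini[OF m, simplified])
  also have "\<dots> = (\<integral>\<^sup>+x. 0 \<partial>(lborel :: 'a measure))"
  proof (intro nn_integral_cong)
    fix x
    have "(\<integral>\<^sup>+t. indicator A (x + t *\<^sub>R v) * indicator {0..1::real} t \<partial>lborel) = (\<integral>\<^sup>+t. 0 \<partial>(lborel :: real measure))"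
    proof (rule nn_integral_cong_AE)
      show "AE t in lborel. indicator A (x + t *\<^sub>R v) * indicator {0..1::real} t = (0::ennreal)"
        using lines[of x] by eventually_elim (simp add: indicator_def)
    qed
    then show "(\<integral>\<^sup>+t. indicator A (x + t *\<^sub>R v) * indicator {0..1::real} t \<partial>lborel) = (0 :: ennreal)" by simp
  qed
  finally show ?thesis by (auto simp: null_sets_def)
qed

context
  fixes F :: "'a::euclidean_space \<Rightarrow> real" and L :: real
  assumes lip: "L-lipschitz_on UNIV F"
begin

lemma lipschitz_constant_nonneg: "0 \<le> L" using lip by (rule lipschitz_on_nonneg)

lemma lipschitz_increment: "\<bar>F y - F x\<bar> \<le> L * norm (y - x)"
  using lipschitz_onD[OF lip, of y x] by (simp add: dist_real_def dist_norm)

lemma lipschitz_continuous: "continuous_on A F"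
  using lipschitz_on_continuous_on[OF lip] continuous_on_subset by blast

lemma lipschitz_borel [measurable]: "F \<in> borel_measurable borel"
  by (rule borel_measurable_continuous_onI[OF lipschitz_continuous])

lemma line_quotient_borel [measurable]: "line_quotient F v t \<in> borel_measurable borel"
proof -
  have [measurable]: "(\<lambda>x. F (x + t *\<^sub>R v)) \<in> borel_measurable borel"
    by (intro borel_measurable_continuous_onI continuous_on_compose2[OF lipschitz_continuous[of UNIV]] continuous_intros) auto
  show ?thesis unfolding line_quotient_def[abs_def] by measurable
qed

lemma line_quotient_bound: "\<bar>line_quotient F v t x\<bar> \<le> L * norm v"
proof (cases "t = 0")
  case False
  have "\<bar>F (x + t *\<^sub>R v) - F x\<bar> \<le> (L * norm v) * \<bar>t\<bar>" using lipschitz_increment[of "x + t *\<^sub>R v" x] by (simp add: mult_ac)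
  then show ?thesis using False by (simp add: line_quotient_def abs_divide divide_le_eq)
qed (simp add: line_quotient_def lipschitz_constant_nonneg)

lemma line_derivative_exists_borel: "{x. \<exists>d. has_line_derivative F x v d} \<in> sets borel"
proof -
  have c: "isCont (\<lambda>t. line_quotient F v t x) t" if "t \<noteq> 0" for x t
  proof -
    have "isCont F y" for y using lipschitz_continuous[of UNIV] by (simp add: continuous_on_eq_continuous_at)
    then have "isCont (\<lambda>t. F (x + t *\<^sub>R v)) t" by (intro isCont_o2[of t "\<lambda>t. x + t *\<^sub>R v" F] continuous_intros)
    then show ?thesis unfolding line_quotient_def using that by (intro continuous_intros) auto
  qed
  have "{x. \<exists>d. has_line_derivative F x v d} = {x. \<forall>n::nat. \<exists>m::nat. \<forall>s t :: rat.
      0 < \<bar>of_rat s :: real\<bar> \<and> \<bar>of_rat s\<bar> < 1 / Suc m \<and> 0 < \<bar>of_rat t :: real\<bar> \<and> \<bar>of_rat t\<bar> < 1 / Suc m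
        \<longrightarrow> \<bar>line_quotient F v (of_rat s) x - line_quotient F v (of_rat t) x\<bar> \<le> 1 / Suc n}"
    using convergent_iff_rational_cauchy[of "\<lambda>t. line_quotient F v t x" for x, OF c]
    unfolding has_line_derivative_def by (intro Collect_cong) blast
  also have "\<dots> \<in> sets borel" by measurable
  finally show ?thesis .
qed

lemma line_derivative_ae: "AE x in lborel. \<exists>d. has_line_derivative F x v d"
proof -
  let ?A = "- {x. \<exists>d. has_line_derivative F x v d}"
  have "?A \<in> null_sets lborel"
  proof (rule null_set_of_null_on_lines[where v = v])
    show "?A \<in> sets borel" using line_derivative_exists_borel by (rule borel_comp)
    fix x
    have "(L * norm v)-lipschitz_on UNIV (\<lambda>t. F (x + t *\<^sub>R v))"
    proof (rule lipschitz_onI)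
      fix s t :: real
      show "dist (F (x + s *\<^sub>R v)) (F (x + t *\<^sub>R v)) \<le> L * norm v * dist s t"
        using lipschitz_increment[of "x + s *\<^sub>R v" "x + t *\<^sub>R v"] by (simp add: dist_real_def scaleR_left_diff_distrib[symmetric] mult_ac)
    qed (simp add: lipschitz_constant_nonneg)
    from lipschitz_real_ae_differentiable[OF this] obtain \<psi> N where
      N: "negligible N" "\<And>t. t \<notin> N \<Longrightarrow> ((\<lambda>t. F (x + t *\<^sub>R v)) has_real_derivative \<psi> t) (at t)" by metis
    show "AE t in lborel. x + t *\<^sub>R v \<notin> ?A"
      using negligible_AE_lborel[OF N(1)]
    proof eventually_elim
      case (elim t)
      have "((\<lambda>h. (F (x + (t + h) *\<^sub>R v) - F (x + t *\<^sub>R v)) / h) \<longlongrightarrow> \<psi> t) (at 0)"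
        using N(2)[OF elim] by (simp add: DERIV_def)
      then have "has_line_derivative F (x + t *\<^sub>R v) v (\<psi> t)"
        by (simp add: has_line_derivative_def line_quotient_def scaleR_left_distrib add.assoc)
      then show ?case by auto
    qed
  qed
  then show ?thesis by (intro AE_I'[of ?A]) auto
qed

text \<open>
The clipping to the largest possible absolute value does not change an existing derivative and makes
the function bounded, hence locally integrable, also where the derivative does not exist.
\<close>

definition line_deriv :: "'a \<Rightarrow> 'a \<Rightarrow> real" where
  "line_deriv v x = max (- (L * norm v)) (min (L * norm v) (lim (\<lambda>k. line_quotient F v (1 / Suc k) x)))"

lemma line_deriv_borel [measurable]: "line_deriv v \<in> borel_measurable borel"
  unfolding line_deriv_def[abs_def] by measurable

lemma line_deriv_bound: "\<bar>line_deriv v x\<bar> \<le> L * norm v"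
  using lipschitz_constant_nonneg by (auto simp: line_deriv_def max_def min_def abs_le_iff)

lemma line_quotient_seq:
  assumes "has_line_derivative F x v d"
  shows "(\<lambda>k. line_quotient F v (1 / Suc k) x) \<longlonglongrightarrow> d"
proof -
  have "filterlim (\<lambda>k. 1 / real (Suc k)) (at 0) sequentially"
    unfolding filterlim_at using LIMSEQ_inverse_real_of_nat by (simp add: inverse_eq_divide)
  from filterlim_compose[OF assms[unfolded has_line_derivative_def] this] show ?thesis .
qed

lemma line_deriv_eq:
  assumes "has_line_derivative F x v d"
  shows "line_deriv v x = d"
proof -
  note l = line_quotient_seq[OF assms]
  have "\<bar>d\<bar> \<le> L * norm v"
    using tendsto_rabs[OF l] line_quotient_bound by (intro LIMSEQ_le_const2) auto
  then show ?thesis using limI[OF l] by (auto simp: line_deriv_def max_def min_def abs_le_iff)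
qed

lemma line_deriv_ae: "AE x in lborel. has_line_derivative F x v (line_deriv v x)"
  using line_derivative_ae[of v] by eventually_elim (auto simp: line_deriv_eq)

lemma line_deriv_scale:
  assumes "has_line_derivative F x v d"
  shows "has_line_derivative F x (c *\<^sub>R v) (c * d)"
proof (cases "c = 0")
  case True
  then show ?thesis by (simp add: has_line_derivative_def line_quotient_def)
next
  case False
  have "filterlim (\<lambda>t. c * t) (at 0) (at (0::real))"
    using False by (auto simp: filterlim_at eventually_at_filter intro!: tendsto_eq_intros)
  from filterlim_compose[OF assms[unfolded has_line_derivative_def] this]
  have "((\<lambda>t. c * line_quotient F v (c * t) x) \<longlongrightarrow> c * d) (at 0)" by (intro tendsto_intros)
  moreover have "c * line_quotient F v (c * t) x = line_quotient F (c *\<^sub>R v) t x" for t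
    using False by (simp add: line_quotient_def mult.commute)
  ultimately show ?thesis by (simp add: has_line_derivative_def)
qed

text \<open>
Dominated convergence. The sets may vary because a translation of the domain of integration
occurs in \<open>line_deriv_add\<close>.
\<close>

lemma integral_line_quotient_tendsto:
  assumes S: "\<And>k. S k \<in> sets borel" "S' \<in> sets borel" and bS: "\<And>k. S k \<subseteq> cball 0 R" "S' \<subseteq> cball 0 R"
    and conv: "AE x in lborel. (\<lambda>k. indicat_real (S k) x) \<longlonglongrightarrow> indicat_real S' x"
  shows "(\<lambda>k. \<integral>x. indicat_real (S k) x * line_quotient F v (1 / Suc k) x \<partial>lborel)
     \<longlonglongrightarrow> (\<integral>x. indicat_real S' x * line_deriv v x \<partial>lborel)"
proof (rule integral_dominated_convergence[where w = "\<lambda>x. (L * norm v) * indicator (cball 0 R) x"])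
  note [measurable] = S
  show "(\<lambda>x. indicat_real S' x * line_deriv v x) \<in> borel_measurable lborel" by measurable
  show "(\<lambda>x. indicat_real (S k) x * line_quotient F v (1 / Suc k) x) \<in> borel_measurable lborel" for k by measurable
  show "integrable lborel (\<lambda>x::'a. L * norm v * indicat_real (cball 0 R) x)"
    using emeasure_bounded_finite[OF bounded_cball[of "0::'a" R]] by (intro integrable_mult_right integrable_real_indicator) auto
  show "AE x in lborel. (\<lambda>k. indicat_real (S k) x * line_quotient F v (1 / Suc k) x) \<longlonglongrightarrow> indicat_real S' x * line_deriv v x"
    using conv line_deriv_ae[of v]
    by eventually_elim (intro tendsto_mult line_quotient_seq)
  show "AE x in lborel. norm (indicat_real (S k) x * line_quotient F v (1 / Suc k) x) \<le> L * norm v * indicat_real (cball 0 R) x" for k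
    using bS(1)[of k] line_quotient_bound[of v "1 / Suc k"] mult_nonneg_nonneg[OF lipschitz_constant_nonneg norm_ge_zero[of v]] by (intro AE_I2) (auto simp: indicator_def abs_mult)
qed

text \<open>
The difference quotient in direction \<open>u + v\<close> at \<open>x\<close> is the one in direction \<open>u\<close> at \<open>x\<close> plus the one in
direction \<open>v\<close> at the displaced point \<open>x + t u\<close>. Integrated over a box, the displacement becomes a
translation of the box and disappears as \<open>t\<close> tends to \<open>0\<close>. So the additivity defect has integral \<open>0\<close>
over every box, and Lebesgue differentiation shows that it vanishes almost everywhere.
\<close>

lemma line_deriv_add: "AE x in lborel. line_deriv (u + v) x = line_deriv u x + line_deriv v x"
proof -
  define h where "h x = line_deriv (u + v) x - line_deriv u x - line_deriv v x" for x
  have hm [measurable]: "h \<in> borel_measurable borel" unfolding h_def[abs_def] by measurable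
  have intq: "integrable lborel (\<lambda>x. indicat_real (cbox a b) x * q x)"
    if [measurable]: "q \<in> borel_measurable borel" and q: "\<And>x. \<bar>q x\<bar> \<le> c" for q :: "'a \<Rightarrow> real" and c a b
  proof (rule Bochner_Integration.integrable_bound[where f = "\<lambda>x. c * indicat_real (cbox a b) x"])
    show "integrable lborel (\<lambda>x. c * indicat_real (cbox a b) x)"
      using emeasure_bounded_finite[OF bounded_cbox[of a b]] by (intro integrable_mult_right integrable_real_indicator) auto
    show "AE x in lborel. norm (indicat_real (cbox a b) x * q x) \<le> norm (c * indicat_real (cbox a b) x)"
    proof (rule AE_I2)
      fix x
      have "\<bar>q x\<bar> \<le> \<bar>c\<bar>" using q[of x] by linarith
      then show "norm (indicat_real (cbox a b) x * q x) \<le> norm (c * indicat_real (cbox a b) x)"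
        by (cases "x \<in> cbox a b") simp_all
    qed
  qed measurable
  have intD: "integrable lborel (\<lambda>x. indicat_real (cbox a b) x * line_deriv w x)" for a b w
    by (rule intq[OF line_deriv_borel line_deriv_bound])
  have I0: "(\<integral>x. indicat_real (cbox a b) x * h x \<partial>lborel) = 0" for a b
  proof -
    let ?B = "cbox a b"
    obtain R0 where R0: "\<And>x. x \<in> ?B \<Longrightarrow> norm x \<le> R0" using bounded_cbox[of a b] unfolding bounded_iff by blast
    define R where "R = R0 + norm u"
    have BR: "?B \<subseteq> cball 0 R"
    proof
      fix x assume "x \<in> ?B"
      from R0[OF this] show "x \<in> cball 0 R" by (simp add: R_def add_increasing2)
    qed
    define S where "S k = {x. x - (1 / Suc k) *\<^sub>R u \<in> ?B}" for k :: nat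
    have Sm: "S k \<in> sets borel" for k
    proof -
      have "closed ((\<lambda>x. x - (1 / Suc k) *\<^sub>R u) -` ?B)" by (intro closed_vimage continuous_intros closed_cbox)
      then have "closed (S k)" by (simp add: S_def vimage_def)
      then show ?thesis by (rule borel_closed)
    qed
    have SR: "S k \<subseteq> cball 0 R" for k
    proof
      fix x assume "x \<in> S k"
      then have "norm (x - (1 / Suc k) *\<^sub>R u) \<le> R0" using R0 by (auto simp: S_def)
      moreover have "norm ((1 / Suc k) *\<^sub>R u) \<le> norm u" by (simp add: divide_le_eq mult_le_cancel_left1)
      moreover have "norm x \<le> norm (x - (1 / Suc k) *\<^sub>R u) + norm ((1 / Suc k) *\<^sub>R u)"
        using norm_triangle_ineq[of "x - (1 / Suc k) *\<^sub>R u" "(1 / Suc k) *\<^sub>R u"] by simp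
      ultimately show "x \<in> cball 0 R" by (simp add: R_def)
    qed
    have SB: "AE x in lborel. (\<lambda>k. indicat_real (S k) x) \<longlonglongrightarrow> indicat_real ?B x"
    proof -
      have "negligible (cbox a b - box a b)" by (rule negligible_frontier_interval)
      from negligible_AE_lborel[OF this] show ?thesis
      proof eventually_elim
        case (elim x)
        have lim: "(\<lambda>k. x - (1 / real (Suc k)) *\<^sub>R u) \<longlonglongrightarrow> x - 0 *\<^sub>R u"
          using LIMSEQ_inverse_real_of_nat by (intro tendsto_intros) (simp add: inverse_eq_divide)
        consider "x \<in> box a b" | "x \<in> - cbox a b" using elim by auto
        then have "eventually (\<lambda>k. indicat_real (S k) x = indicat_real ?B x) sequentially"
        proof cases
          case 1
          then have "eventually (\<lambda>k. x - (1 / real (Suc k)) *\<^sub>R u \<in> box a b) sequentially"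
            using lim by (intro topological_tendstoD) auto
          then show ?thesis
            by eventually_elim (use 1 box_subset_cbox[of a b] in \<open>auto simp: S_def indicator_def\<close>)
        next
          case 2
          then have "eventually (\<lambda>k. x - (1 / real (Suc k)) *\<^sub>R u \<in> - cbox a b) sequentially"
            using lim by (intro topological_tendstoD) auto
          then show ?thesis
            by eventually_elim (use 2 in \<open>auto simp: S_def indicator_def\<close>)
        qed
        then show ?case by (rule tendsto_eventually)
      qed
    qed
    have const: "AE x in lborel. (\<lambda>k::nat. indicat_real ?B x) \<longlonglongrightarrow> indicat_real ?B x" by simp
    have t1: "(\<lambda>k. \<integral>x. indicat_real ?B x * line_quotient F w (1 / Suc k) x \<partial>lborel)
        \<longlonglongrightarrow> (\<integral>x. indicat_real ?B x * line_deriv w x \<partial>lborel)" for w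
      by (rule integral_line_quotient_tendsto[OF _ _ BR BR const]) auto
    have t2: "(\<lambda>k. \<integral>x. indicat_real (S k) x * line_quotient F v (1 / Suc k) x \<partial>lborel)
        \<longlonglongrightarrow> (\<integral>x. indicat_real ?B x * line_deriv v x \<partial>lborel)"
      by (rule integral_line_quotient_tendsto[OF Sm _ SR BR SB]) auto
    have split: "(\<integral>x. indicat_real ?B x * line_quotient F (u + v) (1 / Suc k) x \<partial>lborel)
       = (\<integral>x. indicat_real ?B x * line_quotient F u (1 / Suc k) x \<partial>lborel)
       + (\<integral>x. indicat_real (S k) x * line_quotient F v (1 / Suc k) x \<partial>lborel)" for k
    proof -
      let ?t = "1 / real (Suc k)"
      have sm [measurable]: "(\<lambda>x. line_quotient F v ?t (x + ?t *\<^sub>R u)) \<in> borel_measurable borel" by measurable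
      have "line_quotient F (u + v) ?t x = line_quotient F u ?t x + line_quotient F v ?t (x + ?t *\<^sub>R u)" for x
        unfolding line_quotient_def scaleR_right_distrib add.assoc add_divide_distrib[symmetric] by simp
      then have "(\<integral>x. indicat_real ?B x * line_quotient F (u + v) ?t x \<partial>lborel)
        = (\<integral>x. indicat_real ?B x * line_quotient F u ?t x + indicat_real ?B x * line_quotient F v ?t (x + ?t *\<^sub>R u) \<partial>lborel)"
        by (simp add: distrib_left)
      also have "\<dots> = (\<integral>x. indicat_real ?B x * line_quotient F u ?t x \<partial>lborel)
         + (\<integral>x. indicat_real ?B x * line_quotient F v ?t (x + ?t *\<^sub>R u) \<partial>lborel)"
        by (intro Bochner_Integration.integral_add intq[OF _ line_quotient_bound]) measurable
      also have "(\<integral>x. indicat_real ?B x * line_quotient F v ?t (x + ?t *\<^sub>R u) \<partial>lborel)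
         = (\<integral>x. indicat_real (S k) (?t *\<^sub>R u + x) * line_quotient F v ?t (?t *\<^sub>R u + x) \<partial>lborel)"
        by (intro Bochner_Integration.integral_cong refl) (simp add: S_def indicator_def add.commute)
      also have "\<dots> = (\<integral>x. indicat_real (S k) x * line_quotient F v ?t x \<partial>distr lborel borel ((+) (?t *\<^sub>R u)))"
        using Sm[of k] by (subst integral_distr) auto
      finally show ?thesis by (simp add: lborel_distr_plus)
    qed
    have "(\<integral>x. indicat_real ?B x * line_deriv (u + v) x \<partial>lborel)
        = (\<integral>x. indicat_real ?B x * line_deriv u x \<partial>lborel) + (\<integral>x. indicat_real ?B x * line_deriv v x \<partial>lborel)"
      using t1[of "u + v"] unfolding split by (rule LIMSEQ_unique) (intro tendsto_add t1 t2)
    moreover have "(\<integral>x. indicat_real ?B x * h x \<partial>lborel)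
        = (\<integral>x. indicat_real ?B x * line_deriv (u + v) x - indicat_real ?B x * line_deriv u x - indicat_real ?B x * line_deriv v x \<partial>lborel)"
      by (simp add: h_def right_diff_distrib)
    moreover have "\<dots> = (\<integral>x. indicat_real ?B x * line_deriv (u + v) x \<partial>lborel) - (\<integral>x. indicat_real ?B x * line_deriv u x \<partial>lborel) - (\<integral>x. indicat_real ?B x * line_deriv v x \<partial>lborel)"
      using intD[of a b] by simp
    ultimately show ?thesis by simp
  qed
  have hI: "(h has_integral 0) (cbox a b)" for a b
  proof -
    have "integrable lborel (\<lambda>x. indicat_real (cbox a b) x * line_deriv (u + v) x - indicat_real (cbox a b) x * line_deriv u x - indicat_real (cbox a b) x * line_deriv v x)"
      using intD[of a b] by simp
    then have "integrable lborel (\<lambda>x. indicat_real (cbox a b) x * h x)" by (simp add: h_def right_diff_distrib)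
    from has_integral_integral_lborel[OF this] have "((\<lambda>x. indicat_real (cbox a b) x * h x) has_integral 0) UNIV"
      by (simp add: I0)
    moreover have "(\<lambda>x. indicat_real (cbox a b) x * h x) = (\<lambda>x. if x \<in> cbox a b then h x else 0)" by (auto simp: indicator_def)
    ultimately show ?thesis by (simp only: has_integral_restrict_UNIV)
  qed
  obtain N where N: "negligible N" "\<And>x e. \<lbrakk>x \<notin> N; 0 < e\<rbrakk> \<Longrightarrow>
      \<exists>d>0. \<forall>t. 0 < t \<and> t < d \<longrightarrow> norm (integral (cbox x (x + t *\<^sub>R One)) h /\<^sub>R t ^ DIM('a) - h x) < e"
    using integrable_ccontinuous_explicit[OF has_integral_integrable[OF hI]] by metis
  have h0: "h x = 0" if "x \<notin> N" for x
  proof (rule ccontr)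
    assume "h x \<noteq> 0"
    then have "0 < \<bar>h x\<bar>" by simp
    from N(2)[OF that this] obtain d where d: "d > 0" "\<And>t. 0 < t \<and> t < d \<Longrightarrow> norm (integral (cbox x (x + t *\<^sub>R One)) h /\<^sub>R t ^ DIM('a) - h x) < \<bar>h x\<bar>" by blast
    have "norm (integral (cbox x (x + (d / 2) *\<^sub>R One)) h /\<^sub>R (d / 2) ^ DIM('a) - h x) < \<bar>h x\<bar>"
      using d(1) by (intro d(2)) simp
    then show False using integral_unique[OF hI[of x "x + (d / 2) *\<^sub>R One"]] by simp
  qed
  from negligible_AE_lborel[OF N(1)] show ?thesis
  proof eventually_elim
    case (elim x)
    from h0[OF elim] show ?case by (simp add: h_def)
  qed
qed

lemma line_deriv_linear: "AE x in lborel. line_deriv v x = (\<Sum>b\<in>Basis. (v \<bullet> b) * line_deriv b x)"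
proof -
  have "AE x in lborel. line_deriv (\<Sum>b\<in>T. (v \<bullet> b) *\<^sub>R b) x = (\<Sum>b\<in>T. (v \<bullet> b) * line_deriv b x)"
    if "finite T" for T
    using that
  proof (induction T)
    case empty
    have "line_deriv 0 x = 0" for x using line_deriv_bound[of 0 x] by simp
    then show ?case by simp
  next
    case (insert b T)
    show ?case
      using insert.IH line_deriv_add[of "(v \<bullet> b) *\<^sub>R b" "\<Sum>b\<in>T. (v \<bullet> b) *\<^sub>R b"] line_deriv_ae[of b]
    proof eventually_elim
      case (elim x)
      then show ?case using insert.hyps line_deriv_eq[OF line_deriv_scale[OF elim(3), of "v \<bullet> b"]] by simp
    qed
  qed
  from this[OF finite_Basis] show ?thesis by (simp add: euclidean_representation)
qed

text \<open>
For almost every \<open>x\<close> the directional derivatives exist and are given by one linear form for all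
directions in a countable dense set. Since difference quotients are Lipschitz functions of the
direction, a finite net of these directions on the unit sphere makes the convergence uniform in the
direction, which is differentiability.
\<close>

theorem rademacher: "AE x in lborel. F differentiable (at x)"
proof -
  obtain V :: "'a set" where V: "countable V" "\<And>X. open X \<Longrightarrow> X \<noteq> {} \<Longrightarrow> \<exists>d\<in>V. d \<in> X"
    using countable_dense_exists by blast
  define \<xi> where "\<xi> x = (\<Sum>b\<in>Basis. line_deriv b x *\<^sub>R b)" for x
  have \<xi>: "\<xi> x \<bullet> v = (\<Sum>b\<in>Basis. (v \<bullet> b) * line_deriv b x)" for x v
    unfolding \<xi>_def inner_sum_left by (intro sum.cong refl) (simp add: inner_commute)
  have "AE x in lborel. \<forall>v\<in>V. has_line_derivative F x v (\<xi> x \<bullet> v)"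
    unfolding AE_ball_countable[OF V(1)]
  proof
    fix v
    show "AE x in lborel. has_line_derivative F x v (\<xi> x \<bullet> v)"
      using line_deriv_ae[of v] line_deriv_linear[of v] by eventually_elim (simp add: \<xi>)
  qed
  then show ?thesis
  proof eventually_elim
    case (elim x)
    have "(F has_derivative (\<lambda>h. \<xi> x \<bullet> h)) (at x)"
      unfolding has_derivative_at_alt
    proof (intro conjI allI impI)
      show "bounded_linear ((\<bullet>) (\<xi> x))" by (rule bounded_linear_inner_right)
      fix e :: real assume e: "0 < e"
      \<comment> \<open>Replacing a direction by one at distance \<open>e'\<close> changes the quotient minus the
        linear form by at most \<open>c e'\<close>, which is \<open>e / 2\<close>.\<close>
      define c where "c = L + norm (\<xi> x) + 1"
      have c: "0 < c" using lipschitz_constant_nonneg by (simp add: c_def add_nonneg_pos)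
      define e' where "e' = e / (2 * c)"
      have e': "0 < e'" using e c by (simp add: e'_def)
      have cov: "sphere 0 1 \<subseteq> (\<Union>v\<in>V. ball v e')"
      proof
        fix z :: 'a
        obtain v where "v \<in> V" "v \<in> ball z e'" using V(2)[of "ball z e'"] e' by auto
        then show "z \<in> (\<Union>v\<in>V. ball v e')" by (auto simp: dist_commute)
      qed
      obtain T where T: "T \<subseteq> V" "finite T" "sphere 0 1 \<subseteq> (\<Union>v\<in>T. ball v e')"
        using compactE_image[OF compact_sphere _ cov] by (metis open_ball)
      have "\<forall>v\<in>T. \<forall>\<^sub>F t in at 0. \<bar>line_quotient F v t x - \<xi> x \<bullet> v\<bar> < e / 2"
      proof
        fix v assume "v \<in> T"
        then have l: "has_line_derivative F x v (\<xi> x \<bullet> v)" using elim T by auto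
        from e have "0 < e / 2" by simp
        from tendstoD[OF l[unfolded has_line_derivative_def] this]
        show "\<forall>\<^sub>F t in at 0. \<bar>line_quotient F v t x - \<xi> x \<bullet> v\<bar> < e / 2" by (simp only: dist_real_def)
      qed
      then have "\<forall>\<^sub>F t in at 0. \<forall>v\<in>T. \<bar>line_quotient F v t x - \<xi> x \<bullet> v\<bar> < e / 2"
        using T(2) by (simp add: eventually_ball_finite_distrib)
      then obtain d where d: "0 < d" "\<And>t v. t \<noteq> 0 \<Longrightarrow> \<bar>t\<bar> < d \<Longrightarrow> v \<in> T \<Longrightarrow> \<bar>line_quotient F v t x - \<xi> x \<bullet> v\<bar> < e / 2"
        unfolding eventually_at by (auto simp: dist_real_def)
      show "\<exists>d>0. \<forall>y. norm (y - x) < d \<longrightarrow> norm (F y - F x - \<xi> x \<bullet> (y - x)) \<le> e * norm (y - x)"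
      proof (intro exI[of _ d] conjI d(1) allI impI)
        fix y assume y: "norm (y - x) < d"
        show "norm (F y - F x - \<xi> x \<bullet> (y - x)) \<le> e * norm (y - x)"
        proof (cases "y = x")
          case False
          define t where "t = norm (y - x)"
          define z where "z = (1 / t) *\<^sub>R (y - x)"
          have t: "0 < t" "t < d" using False y by (auto simp: t_def)
          have z: "norm z = 1" "t *\<^sub>R z = y - x" using t by (auto simp: z_def t_def)
          then obtain v where v: "v \<in> T" "dist v z < e'" using T(3) by force
          have vz: "norm (z - v) \<le> e'" using v(2) by (simp add: dist_norm norm_minus_commute)
          have "\<bar>line_quotient F v t x - \<xi> x \<bullet> v\<bar> < e / 2" using t v by (intro d(2)) auto
          then have "t * \<bar>line_quotient F v t x - \<xi> x \<bullet> v\<bar> \<le> t * (e / 2)" using t by (intro mult_left_mono) auto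
          moreover have "t * (line_quotient F v t x - \<xi> x \<bullet> v) = F (x + t *\<^sub>R v) - F x - t * (\<xi> x \<bullet> v)"
          proof -
            have "t * line_quotient F v t x = F (x + t *\<^sub>R v) - F x" using t by (simp only: line_quotient_def) simp
            then show ?thesis by (simp add: right_diff_distrib)
          qed
          ultimately have 1: "\<bar>F (x + t *\<^sub>R v) - F x - t * (\<xi> x \<bullet> v)\<bar> \<le> t * (e / 2)"
            using t by (metis abs_mult abs_of_pos)
          have "\<bar>F y - F (x + t *\<^sub>R v)\<bar> \<le> L * norm (t *\<^sub>R (z - v))"
          proof -
            have "y - (x + t *\<^sub>R v) = t *\<^sub>R (z - v)" unfolding scaleR_right_diff_distrib z(2) by simp
            then show ?thesis using lipschitz_increment[of y "x + t *\<^sub>R v"] by simp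
          qed
          also have "\<dots> \<le> L * (t * e')" using t vz lipschitz_constant_nonneg by (intro mult_left_mono) auto
          finally have 2: "\<bar>F y - F (x + t *\<^sub>R v)\<bar> \<le> L * (t * e')" .
          have "\<bar>\<xi> x \<bullet> (t *\<^sub>R (z - v))\<bar> \<le> norm (\<xi> x) * norm (t *\<^sub>R (z - v))" by (rule Cauchy_Schwarz_ineq2)
          also have "\<dots> \<le> norm (\<xi> x) * (t * e')" using t vz by (intro mult_left_mono) auto
          finally have 3: "\<bar>\<xi> x \<bullet> (y - x) - t * (\<xi> x \<bullet> v)\<bar> \<le> norm (\<xi> x) * (t * e')"
            by (simp add: z(2)[symmetric] inner_diff_right right_diff_distrib)
          have "L * (t * e') + norm (\<xi> x) * (t * e') \<le> c * (t * e')"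
            using t e' by (simp add: c_def algebra_simps)
          also have "\<dots> = t * (e / 2)" using c by (simp add: e'_def)
          finally have "\<bar>F y - F x - \<xi> x \<bullet> (y - x)\<bar> \<le> t * (e / 2) + t * (e / 2)" using 1 2 3 by linarith
          then show ?thesis by (simp add: t_def mult.commute)
        qed simp
      qed
    qed
    then show ?case unfolding differentiable_def by (intro exI)
  qed
qed

end

section \<open>The gradient of a locally Lipschitz function\<close>

text \<open>
On a small ball \<open>f\<close> agrees with its composition with the projection onto the ball, which is Lipschitz on
the whole space; countably many such balls cover \<open>\<Omega>\<close>.
\<close>

lemma locally_lipschitz_ae_differentiable:
  fixes f :: "'a::euclidean_space \<Rightarrow> real"
  assumes op: "open \<Omega>" and ll: "locally_lipschitz_on \<Omega> f"
  shows "AE x in lborel. x \<in> \<Omega> \<longrightarrow> f differentiable (at x)"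
proof -
  define \<B> where "\<B> = {ball x e | x e. 0 < e \<and> cball x e \<subseteq> \<Omega> \<and> (\<exists>L. L-lipschitz_on (cball x e) f)}"
  have cov: "\<Union>\<B> = \<Omega>"
  proof
    show "\<Union>\<B> \<subseteq> \<Omega>" using ball_subset_cball by (fastforce simp: \<B>_def)
    show "\<Omega> \<subseteq> \<Union>\<B>"
    proof
      fix x assume x: "x \<in> \<Omega>"
      obtain e L where e: "0 < e" "L-lipschitz_on (cball x e \<inter> \<Omega>) f"
        using ll x unfolding locally_lipschitz_on_def by blast
      obtain e' where e': "0 < e'" "cball x e' \<subseteq> \<Omega>" using op x unfolding open_contains_cball by blast
      define d where "d = min e e'"
      have d: "0 < d" "cball x d \<subseteq> cball x e \<inter> \<Omega>" "cball x d \<subseteq> \<Omega>"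
        using e e' subset_cball[of d e x] subset_cball[of d e' x] by (auto simp: d_def)
      then have "L-lipschitz_on (cball x d) f" using lipschitz_on_subset[OF e(2)] by blast
      then have "ball x d \<in> \<B>" using d by (auto simp: \<B>_def)
      then show "x \<in> \<Union>\<B>" using d(1) by (intro UnionI[of "ball x d"]) auto
    qed
  qed
  obtain \<B>' where B': "\<B>' \<subseteq> \<B>" "countable \<B>'" "\<Union>\<B>' = \<Union>\<B>"
    by (rule Lindelof[of \<B>]) (auto simp: \<B>_def)
  have "AE x in lborel. x \<in> B \<longrightarrow> f differentiable (at x)" if BB: "B \<in> \<B>" for B
  proof -
    obtain z e L where B: "B = ball z e" "0 < e" "L-lipschitz_on (cball z e) f" using BB unfolding \<B>_def by blast
    define F where "F x = f (closest_point (cball z e) x)" for x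
    have ne: "cball z e \<noteq> {}" using B(2) by auto
    have "L-lipschitz_on UNIV F"
    proof (rule lipschitz_onI)
      fix x y :: 'a
      have "dist (F x) (F y) \<le> L * dist (closest_point (cball z e) x) (closest_point (cball z e) y)"
        unfolding F_def using closest_point_in_set[OF closed_cball ne] by (intro lipschitz_onD[OF B(3)])
      also have "\<dots> \<le> L * dist x y"
        using closest_point_lipschitz[OF convex_cball closed_cball ne] lipschitz_on_nonneg[OF B(3)] by (intro mult_left_mono)
      finally show "dist (F x) (F y) \<le> L * dist x y" .
    qed (rule lipschitz_on_nonneg[OF B(3)])
    from rademacher[OF this] show ?thesis
    proof eventually_elim
      case (elim x)
      show ?case
      proof
        assume x: "x \<in> B"
        obtain F' where F': "(F has_derivative F') (at x)" using elim by (auto simp: differentiable_def)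
        have "(f has_derivative F') (at x)"
          using F'
        proof (rule has_derivative_transform_within_open)
          show "open B" "x \<in> B" using B x by auto
          show "F y = f y" if "y \<in> B" for y
            unfolding F_def using that B by (subst closest_point_self) auto
        qed
        then show "f differentiable (at x)" by (auto simp: differentiable_def)
      qed
    qed
  qed
  then have "AE x in lborel. \<forall>B\<in>\<B>'. x \<in> B \<longrightarrow> f differentiable (at x)"
    using B' by (subst AE_ball_countable) auto
  then show ?thesis
  proof eventually_elim
    case (elim x)
    then show ?case using B'(3) cov by blast
  qed
qed

lemma has_gderiv_unique_gradient:
  assumes "(f has_derivative (\<lambda>h. D \<bullet> h)) (at x)"
  shows "gradient f x = D"
proof -
  have "GDERIV f x :> D" using assms by (simp add: gderiv_def inner_commute)
  moreover have "E = D" if "GDERIV f x :> E" for E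
  proof -
    have "(f has_derivative (\<lambda>h. h \<bullet> E)) (at x)" using that by (simp add: gderiv_def)
    from has_derivative_unique[OF this assms] have "h \<bullet> E = D \<bullet> h" for h by (rule fun_cong)
    then have "\<forall>h. h \<bullet> E = h \<bullet> D" by (metis inner_commute)
    then show ?thesis by (simp only: vector_eq_ldot)
  qed
  ultimately show ?thesis unfolding gradient_def by (rule the_equality)
qed

lemma locally_lipschitz_continuous:
  assumes op: "open \<Omega>" and ll: "locally_lipschitz_on \<Omega> f"
  shows "continuous_on \<Omega> f"
  unfolding continuous_on_eq_continuous_at[OF op]
proof
  fix x assume x: "x \<in> \<Omega>"
  obtain e L where e: "0 < e" "L-lipschitz_on (cball x e \<inter> \<Omega>) f"
    using ll x unfolding locally_lipschitz_on_def by blast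
  have "continuous_on (ball x e \<inter> \<Omega>) f"
    by (rule lipschitz_on_continuous_on[OF lipschitz_on_subset[OF e(2)]]) auto
  then show "isCont f x" using x e op by (simp add: continuous_on_eq_continuous_at open_Int)
qed

text \<open>
Points closer than a Lebesgue number of the cover lie in a common ball; for points further apart the
boundedness of \<open>f\<close> suffices.
\<close>

lemma locally_lipschitz_imp_lipschitz_on_compact:
  fixes f :: "'a::metric_space \<Rightarrow> real"
  assumes op: "open \<Omega>" and ll: "locally_lipschitz_on \<Omega> f" and K: "compact K" "K \<subseteq> \<Omega>"
  obtains L where "L-lipschitz_on K f"
proof -
  have "\<forall>x\<in>K. \<exists>e L. 0 < e \<and> L-lipschitz_on (cball x e \<inter> \<Omega>) f"
    using ll K(2) unfolding locally_lipschitz_on_def by blast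
  then obtain e L where e: "\<And>x. x \<in> K \<Longrightarrow> 0 < e x" "\<And>x. x \<in> K \<Longrightarrow> (L x)-lipschitz_on (cball x (e x) \<inter> \<Omega>) f"
    by metis
  have "K \<subseteq> (\<Union>x\<in>K. ball x (e x))" using e(1) by force
  then obtain D where D: "D \<subseteq> K" "finite D" "K \<subseteq> (\<Union>x\<in>D. ball x (e x))"
    using compactE_image[OF K(1), of K "\<lambda>x. ball x (e x)"] by (metis open_ball)
  obtain \<rho> where \<rho>: "0 < \<rho>" "\<And>x. x \<in> K \<Longrightarrow> \<exists>z\<in>D. ball x \<rho> \<subseteq> ball z (e z)"
    using Heine_Borel_lemma[OF K(1) D(3)] by (auto simp: image_iff)
  define L0 where "L0 = (\<Sum>z\<in>D. L z)"
  have Lpos: "0 \<le> L z" if "z \<in> D" for z using lipschitz_on_nonneg[OF e(2)] that D(1) by blast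
  have LL0: "L z \<le> L0" if "z \<in> D" for z
    unfolding L0_def using D(2) Lpos that by (intro member_le_sum) auto
  have "continuous_on K f" using locally_lipschitz_continuous[OF op ll] K(2) continuous_on_subset by blast
  then have "bounded (f ` K)" using K(1) compact_continuous_image compact_imp_bounded by blast
  then obtain M where M: "\<And>x. x \<in> K \<Longrightarrow> \<bar>f x\<bar> \<le> M" unfolding bounded_iff by auto
  define L1 where "L1 = max 0 (max L0 (2 * M / \<rho>))"
  have "L1-lipschitz_on K f"
  proof (rule lipschitz_onI)
    fix x y assume x: "x \<in> K" and y: "y \<in> K"
    show "dist (f x) (f y) \<le> L1 * dist x y"
    proof (cases "dist x y < \<rho>")
      case True
      obtain z where z: "z \<in> D" "ball x \<rho> \<subseteq> ball z (e z)" using \<rho>(2)[OF x] by blast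
      have "x \<in> ball x \<rho>" "y \<in> ball x \<rho>" using True \<rho>(1) by auto
      then have "x \<in> cball z (e z) \<inter> \<Omega>" "y \<in> cball z (e z) \<inter> \<Omega>"
        using z(2) x y K(2) ball_subset_cball by blast+
      moreover have "z \<in> K" using z(1) D(1) by blast
      ultimately have "dist (f x) (f y) \<le> L z * dist x y" using lipschitz_onD[OF e(2)[of z]] by blast
      also have "\<dots> \<le> L1 * dist x y" using LL0[OF z(1)] by (intro mult_right_mono) (auto simp: L1_def)
      finally show ?thesis .
    next
      case False
      have "dist (f x) (f y) \<le> 2 * M" using M[OF x] M[OF y] by (auto simp: dist_real_def)
      also have "\<dots> = 2 * M / \<rho> * \<rho>" using \<rho>(1) by simp
      also have "\<dots> \<le> L1 * \<rho>" using \<rho>(1) by (intro mult_right_mono) (auto simp: L1_def)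
      also have "\<dots> \<le> L1 * dist x y" using False by (intro mult_left_mono) (auto simp: L1_def)
      finally show ?thesis .
    qed
  qed (simp add: L1_def)
  then show ?thesis by (rule that)
qed

text \<open>
Nothing is known about the values of \<open>gradient f\<close> on the exceptional null set, so Borel measurability
is obtained for the limit of difference quotients along the basis vectors instead.
\<close>

lemma gradient_borel_representative:
  fixes f :: "'a::euclidean_space \<Rightarrow> real"
  assumes op: "open \<Omega>" and ll: "locally_lipschitz_on \<Omega> f"
  obtains G :: "'a \<Rightarrow> 'a" where "G \<in> borel_measurable borel"
    "AE x in lborel. x \<in> \<Omega> \<longrightarrow> (f has_derivative (\<lambda>h. G x \<bullet> h)) (at x) \<and> gradient f x = G x"
proof -
  note cont = locally_lipschitz_continuous[OF assms]
  define f0 where "f0 x = (if x \<in> \<Omega> then f x else 0)" for x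
  have [measurable]: "f0 \<in> borel_measurable borel"
    unfolding f0_def[abs_def] using borel_measurable_continuous_on_if[OF _ cont continuous_on_const] op by (simp add: borel_open)
  define q where "q b k x = real (Suc k) * (f0 (x + (1 / Suc k) *\<^sub>R b) - f0 x)" for b k x
  have qm [measurable]: "q b k \<in> borel_measurable borel" for b k
  proof -
    have [measurable]: "(\<lambda>x. x + (1 / real (Suc k)) *\<^sub>R b) \<in> borel_measurable borel" by measurable
    show ?thesis unfolding q_def[abs_def] by measurable
  qed
  define G where "G x = (\<Sum>b\<in>Basis. lim (\<lambda>k. q b k x) *\<^sub>R b)" for x
  have G: "G \<in> borel_measurable borel" unfolding G_def[abs_def] by measurable
  show ?thesis
  proof (rule that[OF G])
    show "AE x in lborel. x \<in> \<Omega> \<longrightarrow> (f has_derivative (\<lambda>h. G x \<bullet> h)) (at x) \<and> gradient f x = G x"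
      using locally_lipschitz_ae_differentiable[OF assms]
    proof eventually_elim
      case (elim x)
      show ?case
      proof
        assume x: "x \<in> \<Omega>"
        obtain f' where f': "(f has_derivative f') (at x)" using elim x by (auto simp: differentiable_def)
        interpret f': bounded_linear f' using f' by (rule has_derivative_bounded_linear)
        have lim: "(\<lambda>k. q b k x) \<longlonglongrightarrow> f' b" for b
        proof -
          have "((\<lambda>t. x + t *\<^sub>R b) has_derivative (\<lambda>t. t *\<^sub>R b)) (at 0)"
            by (auto intro!: derivative_eq_intros)
          moreover have "(f has_derivative f') (at (x + 0 *\<^sub>R b))" using f' by simp
          ultimately have "((\<lambda>t. f (x + t *\<^sub>R b)) has_derivative (\<lambda>t. f' (t *\<^sub>R b))) (at 0)"
            by (rule has_derivative_compose)
          then have "((\<lambda>t. f (x + t *\<^sub>R b)) has_real_derivative f' b) (at 0)"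
            by (simp add: has_field_derivative_def f'.scaleR mult.commute[of _ "f' b"])
          then have d: "((\<lambda>h. (f (x + h *\<^sub>R b) - f x) / h) \<longlongrightarrow> f' b) (at 0)" by (simp add: DERIV_def)
          have s: "filterlim (\<lambda>k. 1 / real (Suc k)) (at 0) sequentially"
            unfolding filterlim_at using LIMSEQ_inverse_real_of_nat by (simp add: inverse_eq_divide)
          have l: "(\<lambda>k. (f (x + (1 / real (Suc k)) *\<^sub>R b) - f x) / (1 / real (Suc k))) \<longlonglongrightarrow> f' b"
            using filterlim_compose[OF d s] .
          have "(\<lambda>k. x + (1 / real (Suc k)) *\<^sub>R b) \<longlonglongrightarrow> x + 0 *\<^sub>R b"
            using LIMSEQ_inverse_real_of_nat by (intro tendsto_intros) (simp add: inverse_eq_divide)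
          then have "\<forall>\<^sub>F k in sequentially. x + (1 / real (Suc k)) *\<^sub>R b \<in> \<Omega>"
            using op x by (intro topological_tendstoD) auto
          then have "\<forall>\<^sub>F k in sequentially. (f (x + (1 / real (Suc k)) *\<^sub>R b) - f x) / (1 / real (Suc k)) = q b k x"
            by eventually_elim (use x in \<open>simp add: q_def f0_def mult.commute\<close>)
          from Lim_transform_eventually[OF l this] show ?thesis .
        qed
        have Gx: "G x = (\<Sum>b\<in>Basis. f' b *\<^sub>R b)" using limI[OF lim] by (simp add: G_def)
        have "f' h = G x \<bullet> h" for h
        proof -
          have "f' h = f' (\<Sum>b\<in>Basis. (h \<bullet> b) *\<^sub>R b)" by (simp add: euclidean_representation)
          also have "\<dots> = (\<Sum>b\<in>Basis. (h \<bullet> b) * f' b)" by (simp add: f'.sum f'.scaleR)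
          also have "\<dots> = G x \<bullet> h" unfolding Gx inner_sum_left by (intro sum.cong refl) (simp add: inner_commute)
          finally show ?thesis .
        qed
        then have "f' = (\<lambda>h. G x \<bullet> h)" by (rule ext)
        with f' have *: "(f has_derivative (\<lambda>h. G x \<bullet> h)) (at x)" by simp
        then show "(f has_derivative (\<lambda>h. G x \<bullet> h)) (at x) \<and> gradient f x = G x"
          using has_gderiv_unique_gradient[OF *] by simp
      qed
    qed
  qed
qed

section \<open>Representation of functions in a John domain\<close>

text \<open>
A segment from \<open>p\<close> to a point outside \<open>\<Omega>\<close> meets the boundary.
\<close>

lemma mem_of_dist_less_bdist:
  fixes p x :: "'a::euclidean_space"
  assumes "p \<in> \<Omega>" "dist p x < bdist \<Omega> p"
  shows "x \<in> \<Omega>"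
proof (rule ccontr)
  assume "x \<notin> \<Omega>"
  then have "closed_segment p x \<inter> frontier \<Omega> \<noteq> {}"
    using assms(1) by (intro connected_Int_frontier) auto
  then obtain z where z: "z \<in> closed_segment p x" "z \<in> frontier \<Omega>" by auto
  have "bdist \<Omega> p \<le> dist p z" unfolding bdist_def using z(2) by (rule infdist_le)
  also have "\<dots> \<le> dist p x" using segment_bound1[OF z(1)] by (simp add: dist_norm norm_minus_commute)
  finally show False using assms(2) by simp
qed

lemma bdist_ge: "bdist \<Omega> p - dist p x \<le> bdist \<Omega> x"
  using infdist_triangle[of p "frontier \<Omega>" x] by (simp add: bdist_def dist_commute)

lemma bdist_borel [measurable]: "bdist \<Omega> \<in> borel_measurable borel"
  unfolding bdist_def[abs_def] by (intro borel_measurable_continuous_onI continuous_intros)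

text \<open>
The speed bound holds only almost everywhere; absolute continuity of the component of \<open>\<gamma>\<close> in the
direction of the increment turns it into a bound for the increment.
\<close>

lemma john_curve_lipschitz:
  assumes J: "john_curve \<Omega> x0 \<delta> K y \<gamma>" and K: "0 \<le> K" and st: "0 \<le> s" "s \<le> t" "t \<le> 1"
  shows "norm (\<gamma> t - \<gamma> s) \<le> K * (t - s)"
proof (cases "\<gamma> t = \<gamma> s")
  case False
  define e where "e = (1 / norm (\<gamma> t - \<gamma> s)) *\<^sub>R (\<gamma> t - \<gamma> s)"
  have ne: "norm e = 1" using False by (simp add: e_def)
  obtain L where L: "L-lipschitz_on {0..1} \<gamma>" using J by (auto simp: john_curve_def)
  have AE: "AE s in lborel. s \<in> {0..1} \<longrightarrow> \<gamma> differentiable (at s) \<and> norm (vector_derivative \<gamma> (at s)) \<le> K"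
    using J by (simp add: john_curve_def AE_completion_iff)
  have "ennreal \<bar>\<gamma> t \<bullet> e - \<gamma> s \<bullet> e\<bar> \<le> (\<integral>\<^sup>+u\<in>{s..t}. ennreal K \<partial>lborel)"
  proof (rule lipschitz_increment_le_integral)
    show "L-lipschitz_on {s..t} (\<lambda>u. \<gamma> u \<bullet> e)"
    proof (rule lipschitz_onI)
      fix a b assume ab: "a \<in> {s..t}" "b \<in> {s..t}"
      have "dist (\<gamma> a \<bullet> e) (\<gamma> b \<bullet> e) = \<bar>(\<gamma> a - \<gamma> b) \<bullet> e\<bar>" by (simp add: dist_real_def inner_diff_left)
      also have "\<dots> \<le> norm (\<gamma> a - \<gamma> b) * norm e" by (rule Cauchy_Schwarz_ineq2)
      also have "\<dots> \<le> L * dist a b" using lipschitz_onD[OF L, of a b] ab st by (simp add: ne dist_norm)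
      finally show "dist (\<gamma> a \<bullet> e) (\<gamma> b \<bullet> e) \<le> L * dist a b" .
    qed (rule lipschitz_on_nonneg[OF L])
    show "AE u in lborel. u \<in> {s<..<t} \<longrightarrow> (\<exists>d. ((\<lambda>u. \<gamma> u \<bullet> e) has_real_derivative d) (at u) \<and> ennreal \<bar>d\<bar> \<le> ennreal K)"
      using AE
    proof eventually_elim
      case (elim u)
      show ?case
      proof
        assume "u \<in> {s<..<t}"
        then have "\<gamma> differentiable (at u)" and n: "norm (vector_derivative \<gamma> (at u)) \<le> K" using elim st by auto
        then have "(\<gamma> has_vector_derivative vector_derivative \<gamma> (at u)) (at u)" by (simp add: vector_derivative_works)
        then have "((\<lambda>u. \<gamma> u \<bullet> e) has_vector_derivative (vector_derivative \<gamma> (at u) \<bullet> e)) (at u)"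
          by (rule bounded_linear.has_vector_derivative[OF bounded_linear_inner_left])
        moreover have "\<bar>vector_derivative \<gamma> (at u) \<bullet> e\<bar> \<le> K"
          using Cauchy_Schwarz_ineq2[of "vector_derivative \<gamma> (at u)" e] n ne by simp
        ultimately show "\<exists>d. ((\<lambda>u. \<gamma> u \<bullet> e) has_real_derivative d) (at u) \<and> ennreal \<bar>d\<bar> \<le> ennreal K"
          by (auto simp: has_real_derivative_iff_has_vector_derivative intro!: ennreal_leI)
      qed
    qed
  qed (use st in auto)
  also have "\<dots> = ennreal (K * (t - s))"
    using st K by (subst nn_integral_cmult_indicator) (auto simp: ennreal_mult)
  finally have "\<bar>\<gamma> t \<bullet> e - \<gamma> s \<bullet> e\<bar> \<le> K * (t - s)" using K st by (subst (asm) ennreal_le_iff) auto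
  moreover have "\<gamma> t \<bullet> e - \<gamma> s \<bullet> e = norm (\<gamma> t - \<gamma> s)"
  proof -
    have "\<gamma> t \<bullet> e - \<gamma> s \<bullet> e = (\<gamma> t - \<gamma> s) \<bullet> e" by (simp add: inner_diff_left)
    also have "\<dots> = norm (\<gamma> t - \<gamma> s)"
      using False by (simp add: e_def dot_square_norm power2_eq_square)
    finally show ?thesis .
  qed
  ultimately show ?thesis by simp
qed (use K st in simp)

lemma nn_integral_affine_ball:
  fixes g :: "'a::euclidean_space \<Rightarrow> ennreal"
  assumes [measurable]: "g \<in> borel_measurable borel" and s: "0 < s"
  shows "(\<integral>\<^sup>+z\<in>ball 0 r. g (p + s *\<^sub>R z) \<partial>lborel) = ennreal (1 / s ^ DIM('a)) * (\<integral>\<^sup>+x\<in>ball p (s * r). g x \<partial>lborel)"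
proof -
  have [measurable]: "ball p (s * r) \<in> sets borel" "ball (0::'a) r \<in> sets borel" by simp_all
  have "(\<integral>\<^sup>+x\<in>ball p (s * r). g x \<partial>lborel)
      = (\<integral>\<^sup>+x. g x * indicator (ball p (s * r)) x \<partial>density (distr lborel borel (\<lambda>x. p + s *\<^sub>R x)) (\<lambda>_. ennreal (\<bar>s\<bar> ^ DIM('a))))"
    using s by (subst lborel_affine[of s p]) auto
  also have "\<dots> = (\<integral>\<^sup>+x. ennreal (\<bar>s\<bar> ^ DIM('a)) * (g x * indicator (ball p (s * r)) x) \<partial>distr lborel borel (\<lambda>x. p + s *\<^sub>R x))"
    by (rule nn_integral_density) measurable
  also have "\<dots> = (\<integral>\<^sup>+x. ennreal (\<bar>s\<bar> ^ DIM('a)) * (g (p + s *\<^sub>R x) * indicator (ball p (s * r)) (p + s *\<^sub>R x)) \<partial>lborel)"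
    by (rule nn_integral_distr) measurable
  also have "\<dots> = (\<integral>\<^sup>+x. ennreal (s ^ DIM('a)) * (g (p + s *\<^sub>R x) * indicator (ball p (s * r)) (p + s *\<^sub>R x)) \<partial>lborel)"
    using s by simp
  also have "\<dots> = ennreal (s ^ DIM('a)) * (\<integral>\<^sup>+z\<in>ball 0 r. g (p + s *\<^sub>R z) \<partial>lborel)"
  proof (subst nn_integral_cmult[symmetric])
    have "indicator (ball p (s * r)) (p + s *\<^sub>R x) = (indicator (ball 0 r) x :: ennreal)" for x
      using s by (simp add: indicator_def dist_norm)
    then show "(\<integral>\<^sup>+x. ennreal (s ^ DIM('a)) * (g (p + s *\<^sub>R x) * indicator (ball p (s * r)) (p + s *\<^sub>R x)) \<partial>lborel)
      = (\<integral>\<^sup>+x. ennreal (s ^ DIM('a)) * (g (p + s *\<^sub>R x) * indicator (ball 0 r) x) \<partial>lborel)" by simp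
  qed measurable
  finally have "ennreal (1 / s ^ DIM('a)) * (\<integral>\<^sup>+x\<in>ball p (s * r). g x \<partial>lborel)
     = (ennreal (1 / s ^ DIM('a)) * ennreal (s ^ DIM('a))) * (\<integral>\<^sup>+z\<in>ball 0 r. g (p + s *\<^sub>R z) \<partial>lborel)"
    by (simp add: mult.assoc)
  also have "ennreal (1 / s ^ DIM('a)) * ennreal (s ^ DIM('a)) = 1"
    using s by (simp flip: ennreal_mult)
  finally show ?thesis by simp
qed

text \<open>
The increment of \<open>f\<close> along the curve \<open>s \<mapsto> \<gamma> s + s z\<close>, whose speed is at most \<open>K + \<delta>\<close>. The curve stays in
\<open>\<Omega>\<close> because it departs from \<open>\<gamma>\<close> by less than \<open>\<delta> s\<close>, a lower bound for the distance of \<open>\<gamma> s\<close> to the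
boundary. Almost every \<open>z\<close> is needed because a single curve might run inside the null set where \<open>f\<close> is
not differentiable.
\<close>

lemma john_increment_bound:
  fixes f :: "'a::euclidean_space \<Rightarrow> real" and G :: "'a \<Rightarrow> 'a"
  assumes op: "open \<Omega>" and ll: "locally_lipschitz_on \<Omega> f"
    and G [measurable]: "G \<in> borel_measurable borel"
    and der: "AE x in lborel. x \<in> \<Omega> \<longrightarrow> (f has_derivative (\<lambda>h. G x \<bullet> h)) (at x)"
    and J: "john_curve \<Omega> x0 \<delta> K y \<gamma>" and K: "0 \<le> K" and \<delta>: "0 < \<delta>" and y: "y \<in> \<Omega>"
  shows "AE z in lborel. z \<in> ball 0 (\<delta> / 2) \<longrightarrow>
    ennreal \<bar>f (x0 + z) - f y\<bar> \<le> (\<integral>\<^sup>+s\<in>{0..1}. ennreal ((K + \<delta>) * norm (G (\<gamma> (max 0 (min 1 s)) + s *\<^sub>R z))) \<partial>lborel)"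
proof -
  obtain L where L: "L-lipschitz_on {0..1} \<gamma>" using J by (auto simp: john_curve_def)
  have \<gamma>: "\<gamma> 0 = y" "\<gamma> 1 = x0" "\<And>s. s \<in> {0..1} \<Longrightarrow> \<gamma> s \<in> \<Omega>" "\<And>s. s \<in> {0..1} \<Longrightarrow> \<delta> * s \<le> bdist \<Omega> (\<gamma> s)"
    using J by (auto simp: john_curve_def)
  have AE\<gamma>: "AE s in lborel. s \<in> {0..1} \<longrightarrow> \<gamma> differentiable (at s) \<and> norm (vector_derivative \<gamma> (at s)) \<le> K"
    using J by (simp add: john_curve_def AE_completion_iff)
  define \<gamma>' where "\<gamma>' s = \<gamma> (max 0 (min 1 s))" for s
  have \<gamma>'c: "continuous_on UNIV \<gamma>'"
    unfolding \<gamma>'_def by (intro continuous_on_compose2[OF lipschitz_on_continuous_on[OF L]] continuous_intros) auto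
  have \<gamma>'[simp]: "s \<in> {0..1} \<Longrightarrow> \<gamma>' s = \<gamma> s" for s by (simp add: \<gamma>'_def)
  have pc: "continuous_on UNIV (\<lambda>u::real \<times> 'a. \<gamma>' (fst u) + fst u *\<^sub>R snd u)"
    by (intro continuous_intros continuous_on_compose2[OF \<gamma>'c]) auto
  have pm [measurable]: "(\<lambda>u::real \<times> 'a. \<gamma>' (fst u) + fst u *\<^sub>R snd u) \<in> borel_measurable (lborel \<Otimes>\<^sub>M lborel)"
    using borel_measurable_continuous_onI[OF pc] by (simp add: lborel_prod)
  obtain N where N: "N \<in> null_sets lborel" "\<And>x. x \<notin> N \<Longrightarrow> x \<in> \<Omega> \<longrightarrow> (f has_derivative (\<lambda>h. G x \<bullet> h)) (at x)"
    using der unfolding eventually_ae_filter by auto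
  have [measurable]: "N \<in> sets borel" using N(1) by (simp add: null_sets_def)
  \<comment> \<open>For fixed \<open>s > 0\<close> the map \<open>z \<mapsto> \<gamma>' s + s z\<close> preserves
    null sets, so Fubini's theorem gives the claim for almost every \<open>z\<close>.\<close>
  have AEz: "AE z in lborel. AE s in lborel. s \<in> {0<..<1} \<longrightarrow> \<gamma>' s + s *\<^sub>R z \<notin> N"
  proof -
    have "AE s in (lborel::real measure). AE z in (lborel::'a measure). s \<in> {0<..<1} \<longrightarrow> \<gamma>' s + s *\<^sub>R z \<notin> N"
    proof (rule AE_I2)
      fix s :: real
      show "AE z in (lborel::'a measure). s \<in> {0<..<1} \<longrightarrow> \<gamma>' s + s *\<^sub>R z \<notin> N"
      proof (cases "s \<in> {0<..<1}")
        case True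
        have eq: "(lborel::'a measure) = density (distr lborel borel (\<lambda>x. \<gamma>' s + s *\<^sub>R x)) (\<lambda>_. \<bar>s\<bar> ^ DIM('a))"
          using True by (intro lborel_affine) auto
        have "AE x in lborel. x \<notin> N" using N(1) by (rule AE_not_in)
        then have "AE z in lborel. \<gamma>' s + s *\<^sub>R z \<notin> N"
          using True by (subst (asm) eq) (simp add: AE_density AE_distr_iff)
        then show ?thesis by auto
      qed auto
    qed
    moreover have "Measurable.pred (lborel \<Otimes>\<^sub>M lborel) (\<lambda>u::real \<times> 'a. fst u \<in> {0<..<1} \<longrightarrow> \<gamma>' (fst u) + fst u *\<^sub>R snd u \<notin> N)"
      by measurable
    ultimately show ?thesis
      using lborel_pair.AE_commute[of "\<lambda>s z. s \<in> {0<..<1} \<longrightarrow> \<gamma>' s + s *\<^sub>R z \<notin> N"] by (simp add: pred_def)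
  qed
  show ?thesis
    using AEz
  proof eventually_elim
    case (elim z)
    show ?case
    proof
      assume z: "z \<in> ball 0 (\<delta> / 2)"
      then have nz: "norm z < \<delta> / 2" by simp
      define p where "p s = \<gamma> s + s *\<^sub>R z" for s
      have pin: "p s \<in> \<Omega>" if s: "s \<in> {0..1}" for s
      proof (cases "s = 0")
        case False
        have "dist (\<gamma> s) (p s) = s * norm z" using s by (simp add: p_def dist_norm)
        also have "\<dots> < s * \<delta>" using nz s False \<delta> by (intro mult_strict_left_mono) auto
        also have "\<dots> \<le> bdist \<Omega> (\<gamma> s)" using \<gamma>(4)[OF s] by (simp add: mult.commute)
        finally show ?thesis using mem_of_dist_less_bdist \<gamma>(3)[OF s] by blast
      qed (simp add: p_def \<gamma>(1) y)
      have pl: "(L + norm z)-lipschitz_on {0..1} p"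
        unfolding p_def
      proof (intro lipschitz_on_add L lipschitz_onI)
        fix a b :: real
        show "dist (a *\<^sub>R z) (b *\<^sub>R z) \<le> norm z * dist a b"
          by (simp add: dist_norm scaleR_left_diff_distrib[symmetric])
      qed simp
      have "compact (p ` {0..1})"
        using lipschitz_on_continuous_on[OF pl] by (intro compact_continuous_image) auto
      moreover have "p ` {0..1} \<subseteq> \<Omega>" using pin by auto
      ultimately obtain M where "M-lipschitz_on (p ` {0..1}) f"
        using locally_lipschitz_imp_lipschitz_on_compact[OF op ll] by blast
      from lipschitz_on_compose[OF pl this] have gl: "(M * (L + norm z))-lipschitz_on {0..1} (\<lambda>s. f (p s))"
        by (simp add: o_def)
      have mG: "(\<lambda>s. ennreal ((K + \<delta>) * norm (G (\<gamma>' s + s *\<^sub>R z)))) \<in> borel_measurable borel"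
      proof -
        have "continuous_on UNIV (\<lambda>s. \<gamma>' s + s *\<^sub>R z)" using \<gamma>'c by (intro continuous_intros)
        from borel_measurable_continuous_onI[OF this] have [measurable]: "(\<lambda>s. \<gamma>' s + s *\<^sub>R z) \<in> borel_measurable borel" .
        show ?thesis by measurable
      qed
      have "ennreal \<bar>f (p 1) - f (p 0)\<bar> \<le> (\<integral>\<^sup>+s\<in>{0..1}. ennreal ((K + \<delta>) * norm (G (\<gamma>' s + s *\<^sub>R z))) \<partial>lborel)"
      proof (rule lipschitz_increment_le_integral[OF gl _ mG])
        show "AE s in lborel. s \<in> {0<..<1} \<longrightarrow> (\<exists>d. ((\<lambda>s. f (p s)) has_real_derivative d) (at s) \<and> ennreal \<bar>d\<bar> \<le> ennreal ((K + \<delta>) * norm (G (\<gamma>' s + s *\<^sub>R z))))"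
          using elim AE\<gamma>
        proof eventually_elim
          case (elim s)
          show ?case
          proof
            assume s: "s \<in> {0<..<1}"
            then have s01: "s \<in> {0..1}" by auto
            have nN: "p s \<notin> N" using elim s s01 by (simp add: p_def)
            have gd: "\<gamma> differentiable (at s)" and gK: "norm (vector_derivative \<gamma> (at s)) \<le> K" using elim s01 by auto
            define w where "w = vector_derivative \<gamma> (at s) + z"
            have "(\<gamma> has_derivative (\<lambda>h. h *\<^sub>R vector_derivative \<gamma> (at s))) (at s)"
              using gd by (simp add: vector_derivative_works has_vector_derivative_def)
            then have pd: "(p has_derivative (\<lambda>h. h *\<^sub>R w)) (at s)"
              unfolding p_def w_def by (auto intro!: derivative_eq_intros simp: scaleR_right_distrib)
            have fd: "(f has_derivative (\<lambda>h. G (p s) \<bullet> h)) (at (p s))" using N(2)[OF nN] pin[OF s01] by blast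
            from has_derivative_compose[OF pd fd]
            have "((\<lambda>s. f (p s)) has_real_derivative (G (p s) \<bullet> w)) (at s)"
              by (simp add: has_field_derivative_def mult.commute[of _ "G (p s) \<bullet> w"])
            moreover have "\<bar>G (p s) \<bullet> w\<bar> \<le> (K + \<delta>) * norm (G (\<gamma>' s + s *\<^sub>R z))"
            proof -
              have "norm w \<le> K + \<delta>" unfolding w_def using norm_triangle_ineq[of "vector_derivative \<gamma> (at s)" z] gK nz \<delta> by linarith
              then have "norm (G (p s)) * norm w \<le> norm (G (p s)) * (K + \<delta>)" by (intro mult_left_mono) auto
              then show ?thesis using Cauchy_Schwarz_ineq2[of "G (p s)" w] s01 by (simp add: p_def mult.commute)
            qed
            ultimately show "\<exists>d. ((\<lambda>s. f (p s)) has_real_derivative d) (at s) \<and> ennreal \<bar>d\<bar> \<le> ennreal ((K + \<delta>) * norm (G (\<gamma>' s + s *\<^sub>R z)))"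
              by (auto intro!: ennreal_leI)
          qed
        qed
      qed simp
      then show "ennreal \<bar>f (x0 + z) - f y\<bar> \<le> (\<integral>\<^sup>+s\<in>{0..1}. ennreal ((K + \<delta>) * norm (G (\<gamma> (max 0 (min 1 s)) + s *\<^sub>R z))) \<partial>lborel)"
        by (simp add: p_def \<gamma> \<gamma>'_def)
    qed
  qed
qed

text \<open>
The bound of \<open>john_increment_bound\<close> is averaged over \<open>z\<close>. At time \<open>s\<close> the points \<open>\<gamma> s + s z\<close> fill a ball of
radius \<open>\<delta> s / 2\<close>, and the substitution contributes \<open>s^(-n)\<close>. For \<open>s\<close> between \<open>2^(-j-1)\<close> and \<open>2^(-j)\<close> this
ball lies in the set of level \<open>j\<close>, and integration over these \<open>s\<close> gains one power of \<open>2^(-j)\<close>.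
\<close>

theorem john_representation:
  fixes \<Omega> :: "'a::euclidean_space set"
  assumes JD: "bounded_john_domain \<Omega>"
  shows "\<exists>C R c. 0 < C \<and> 0 < R \<and> 0 < c \<and> (\<forall>f G. locally_lipschitz_on \<Omega> f \<longrightarrow> G \<in> borel_measurable borel \<longrightarrow>
     (AE x in lborel. x \<in> \<Omega> \<longrightarrow> (f has_derivative (\<lambda>h. (G x :: 'a) \<bullet> h)) (at x)) \<longrightarrow>
     (\<exists>a::real. \<forall>y\<in>\<Omega>. ennreal \<bar>f y - a\<bar> \<le> ennreal C * (\<Sum>j. ennreal ((1 / 2 ^ j) powr (1 - real DIM('a))) *
        (\<integral>\<^sup>+x\<in>{x \<in> \<Omega>. c / 2 ^ j \<le> bdist \<Omega> x \<and> dist y x \<le> R / 2 ^ j}. ennreal (norm (G x)) \<partial>lborel))))"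
proof -
  obtain x0 \<delta> K0 where op: "open \<Omega>" and x0: "x0 \<in> \<Omega>" and \<delta>: "0 < \<delta>"
    and curve: "\<And>y. y \<in> \<Omega> \<Longrightarrow> \<exists>\<gamma>. john_curve \<Omega> x0 \<delta> K0 y \<gamma>"
    using JD unfolding bounded_john_domain_def by blast
  define K where "K = max K0 0"
  have K: "0 \<le> K" by (simp add: K_def)
  have curve': "\<exists>\<gamma>. john_curve \<Omega> x0 \<delta> K y \<gamma>" if y: "y \<in> \<Omega>" for y
  proof -
    obtain \<gamma> where \<gamma>: "john_curve \<Omega> x0 \<delta> K0 y \<gamma>" using curve[OF y] by blast
    have "AE s in lebesgue. s \<in> {0..1} \<longrightarrow> \<gamma> differentiable (at s) \<and> norm (vector_derivative \<gamma> (at s)) \<le> K0"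
      using \<gamma> by (simp only: john_curve_def)
    then have "AE s in lebesgue. s \<in> {0..1} \<longrightarrow> \<gamma> differentiable (at s) \<and> norm (vector_derivative \<gamma> (at s)) \<le> K"
      by eventually_elim (auto simp: K_def)
    then have "john_curve \<Omega> x0 \<delta> K y \<gamma>" using \<gamma> unfolding john_curve_def by blast
    then show ?thesis by (intro exI)
  qed
  define n where "n = DIM('a)"
  have n: "0 < n" by (simp add: n_def)
  define B where "B = ball (0::'a) (\<delta> / 2)"
  define m where "m = measure lborel B"
  have m: "0 < m" unfolding m_def B_def using \<delta> content_ball_pos[of "\<delta> / 2" "0::'a"] by simp
  have eB: "emeasure lborel B = ennreal m"
  proof -
    have "emeasure lborel B < \<infinity>" unfolding B_def by (rule emeasure_bounded_finite) simp
    then have "emeasure lborel B \<noteq> top" by simp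
    then show ?thesis unfolding m_def by (rule emeasure_eq_ennreal_measure)
  qed
  define R where "R = K + \<delta>"
  have R: "0 < R" using K \<delta> by (simp add: R_def)
  \<comment> \<open>A factor \<open>1/2\<close> is lost by thickening the curve and another one by
    \<open>s > 2^(-j-1)\<close>.\<close>
  define c where "c = \<delta> / 4"
  \<comment> \<open>The speed is at most \<open>K + \<delta>\<close>; the bound \<open>2^(n (j+1))\<close> for
    \<open>s^(-n)\<close> times the length \<open>2^(-j-1)\<close> of the range of
    \<open>s\<close> is \<open>2^(n-1) 2^(j (n-1))\<close>; and the average is over a ball of
    volume \<open>m\<close>.\<close>
  define C where "C = (K + \<delta>) * 2 ^ (n - 1) / m"
  have C: "0 < C" using R m by (simp add: C_def R_def)
  have main: "\<exists>a::real. \<forall>y\<in>\<Omega>. ennreal \<bar>f y - a\<bar> \<le> ennreal C * (\<Sum>j. ennreal ((1 / 2 ^ j) powr (1 - real DIM('a))) *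
        (\<integral>\<^sup>+x\<in>{x \<in> \<Omega>. c / 2 ^ j \<le> bdist \<Omega> x \<and> dist y x \<le> R / 2 ^ j}. ennreal (norm (G x)) \<partial>lborel))"
    if ll: "locally_lipschitz_on \<Omega> f" and G [measurable]: "G \<in> borel_measurable borel"
      and der: "AE x in lborel. x \<in> \<Omega> \<longrightarrow> (f has_derivative (\<lambda>h. (G x :: 'a) \<bullet> h)) (at x)" for f G
  proof -
    have x0d: "\<delta> \<le> bdist \<Omega> x0"
    proof -
      obtain \<gamma> where "john_curve \<Omega> x0 \<delta> K x0 \<gamma>" using curve'[OF x0] by blast
      then have "\<gamma> 1 = x0" "\<forall>s\<in>{0..1}. \<delta> * s \<le> bdist \<Omega> (\<gamma> s)" unfolding john_curve_def by blast+
      then show ?thesis using bspec[of "{0..1}" "\<lambda>s. \<delta> * s \<le> bdist \<Omega> (\<gamma> s)" 1] by simp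
    qed
    have cb: "cball x0 (\<delta> / 2) \<subseteq> \<Omega>"
    proof
      fix x assume "x \<in> cball x0 (\<delta> / 2)"
      then have "dist x0 x < bdist \<Omega> x0" using x0d \<delta> by simp
      then show "x \<in> \<Omega>" using mem_of_dist_less_bdist[OF x0] by blast
    qed
    have cont: "continuous_on \<Omega> f" by (rule locally_lipschitz_continuous[OF op ll])
    have bdd: "bounded (f ` cball x0 (\<delta> / 2))"
      using continuous_on_subset[OF cont cb] by (intro compact_imp_bounded compact_continuous_image) auto
    then obtain M where M: "\<And>x. x \<in> cball x0 (\<delta> / 2) \<Longrightarrow> \<bar>f x\<bar> \<le> M" unfolding bounded_iff by (auto simp del: mem_cball)
    define F where "F z = (if z \<in> B then f (x0 + z) else 0)" for z
    have Fm [measurable]: "F \<in> borel_measurable borel"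
      unfolding F_def[abs_def]
    proof (rule borel_measurable_continuous_on_if)
      show "B \<in> sets borel" by (simp add: B_def)
      show "continuous_on B (\<lambda>z. f (x0 + z))"
        by (rule continuous_on_compose2[OF continuous_on_subset[OF cont cb]]) (auto intro!: continuous_intros simp: B_def dist_norm)
    qed simp
    have Bm [measurable]: "B \<in> sets borel" "ball (0::'a) (\<delta> / 2) \<in> sets borel" by (simp_all add: B_def)
    have Fb: "\<bar>F z\<bar> \<le> \<bar>M\<bar>" for z using M[of "x0 + z"] by (auto simp: F_def B_def dist_norm)
    have intc: "integrable lborel (\<lambda>z. k * indicat_real B z)" for k
      by (intro integrable_mult_right integrable_real_indicator) (auto simp: eB)
    have intF: "integrable lborel F"
    proof (rule Bochner_Integration.integrable_bound[OF intc[of "\<bar>M\<bar>"]])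
      show "AE z in lborel. norm (F z) \<le> norm (\<bar>M\<bar> * indicat_real B z)"
      proof (rule AE_I2)
        fix z
        show "norm (F z) \<le> norm (\<bar>M\<bar> * indicat_real B z)"
          using Fb[of z] by (cases "z \<in> B") (simp_all add: F_def)
      qed
    qed measurable
    define a where "a = (\<integral>z. F z \<partial>lborel) / m"
    show ?thesis
    proof (intro exI[of _ a] ballI)
      fix y assume y: "y \<in> \<Omega>"
      obtain \<gamma> where J: "john_curve \<Omega> x0 \<delta> K y \<gamma>" using curve'[OF y] by blast
      have \<gamma>: "\<gamma> 0 = y" "\<And>s. s \<in> {0..1} \<Longrightarrow> \<gamma> s \<in> \<Omega>" "\<And>s. s \<in> {0..1} \<Longrightarrow> \<delta> * s \<le> bdist \<Omega> (\<gamma> s)"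
        using J by (auto simp: john_curve_def)
      obtain L where L: "L-lipschitz_on {0..1} \<gamma>" using J by (auto simp: john_curve_def)
      define \<gamma>' where "\<gamma>' s = \<gamma> (max 0 (min 1 s))" for s
      have \<gamma>'c: "continuous_on UNIV \<gamma>'"
        unfolding \<gamma>'_def by (intro continuous_on_compose2[OF lipschitz_on_continuous_on[OF L]] continuous_intros) auto
      have pc: "continuous_on UNIV (\<lambda>u::real \<times> 'a. \<gamma>' (fst u) + fst u *\<^sub>R snd u)"
        by (intro continuous_intros continuous_on_compose2[OF \<gamma>'c]) auto
      have pm [measurable]: "(\<lambda>u::real \<times> 'a. \<gamma>' (fst u) + fst u *\<^sub>R snd u) \<in> borel_measurable (lborel \<Otimes>\<^sub>M lborel)"
        using borel_measurable_continuous_onI[OF pc] by (simp add: lborel_prod)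
      define g where "g x = ennreal (norm (G x))" for x
      have gm [measurable]: "g \<in> borel_measurable borel" unfolding g_def[abs_def] by measurable
      define \<Psi> where "\<Psi> j = (\<integral>\<^sup>+x\<in>{x \<in> \<Omega>. c / 2 ^ j \<le> bdist \<Omega> x \<and> dist y x \<le> R / 2 ^ j}. g x \<partial>lborel)" for j :: nat
      have "ennreal (m * \<bar>f y - a\<bar>) = ennreal (norm (\<integral>z. F z - f y * indicat_real B z \<partial>lborel))"
      proof -
        have "(\<integral>z. F z - f y * indicat_real B z \<partial>lborel) = m * (a - f y)"
          using intF intc m by (simp add: a_def m_def right_diff_distrib)
        then show ?thesis using m by (simp add: abs_mult abs_minus_commute)
      qed
      also have "\<dots> \<le> (\<integral>\<^sup>+z. ennreal (norm (F z - f y * indicat_real B z)) \<partial>lborel)"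
        using intF intc by (intro integral_norm_bound_ennreal) auto
      also have "\<dots> \<le> (\<integral>\<^sup>+z. (\<integral>\<^sup>+s. indicator B z * (indicator {0..1} s * (ennreal (K + \<delta>) * g (\<gamma>' s + s *\<^sub>R z))) \<partial>lborel) \<partial>lborel)"
      proof (rule nn_integral_mono_AE)
        show "AE z in lborel. ennreal (norm (F z - f y * indicat_real B z))
          \<le> (\<integral>\<^sup>+s. indicator B z * (indicator {0..1} s * (ennreal (K + \<delta>) * g (\<gamma>' s + s *\<^sub>R z))) \<partial>lborel)"
          using john_increment_bound[OF op ll G der J K \<delta> y]
        proof eventually_elim
          case (elim z)
          show ?case
          proof (cases "z \<in> B")
            case True
            have "ennreal \<bar>f (x0 + z) - f y\<bar> \<le> (\<integral>\<^sup>+s\<in>{0..1}. ennreal ((K + \<delta>) * norm (G (\<gamma>' s + s *\<^sub>R z))) \<partial>lborel)"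
              using elim True by (simp add: B_def \<gamma>'_def)
            also have "\<dots> = (\<integral>\<^sup>+s. indicator {0..1} s * (ennreal (K + \<delta>) * g (\<gamma>' s + s *\<^sub>R z)) \<partial>lborel)"
              using K \<delta> by (intro nn_integral_cong) (simp add: g_def ennreal_mult mult.commute)
            finally show ?thesis using True by (simp add: F_def)
          qed (simp add: F_def)
        qed
      qed
      also have "\<dots> = (\<integral>\<^sup>+s. (\<integral>\<^sup>+z. indicator B z * (indicator {0..1} s * (ennreal (K + \<delta>) * g (\<gamma>' s + s *\<^sub>R z))) \<partial>lborel) \<partial>lborel)"
      proof (rule lborel_pair.Fubini')
        show "(\<lambda>(s, z). indicator B z * (indicator {0..1} s * (ennreal (K + \<delta>) * g (\<gamma>' s + s *\<^sub>R z)))) \<in> borel_measurable ((lborel::real measure) \<Otimes>\<^sub>M (lborel::'a measure))"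
          unfolding case_prod_beta by measurable
      qed
      also have "\<dots> \<le> (\<integral>\<^sup>+s. (\<Sum>j. ennreal ((K + \<delta>) * 2 ^ (n * (j + 1))) * \<Psi> j * indicator {1 / 2 ^ (j + 1)<..1 / 2 ^ j :: real} s) \<partial>lborel)"
      proof (rule nn_integral_mono_AE)
        show "AE s in lborel. (\<integral>\<^sup>+z. indicator B z * (indicator {0..1} s * (ennreal (K + \<delta>) * g (\<gamma>' s + s *\<^sub>R z))) \<partial>lborel)
           \<le> (\<Sum>j. ennreal ((K + \<delta>) * 2 ^ (n * (j + 1))) * \<Psi> j * indicator {1 / 2 ^ (j + 1)<..1 / 2 ^ j :: real} s)"
          using AE_lborel_singleton[of "0::real"]
        proof eventually_elim
          case (elim s)
          show ?case
          proof (cases "s \<in> {0..1}")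
            case True
            then have s: "0 < s" "s \<le> 1" using elim by auto
            \<comment> \<open>The level with \<open>2^(-j-1) < s \<le> 2^(-j)\<close>.\<close>
            define j where "j = (LEAST j. 1 / 2 ^ (j + 1) < s)"
            obtain i :: nat where "(1 / 2) ^ i < s" using real_arch_pow_inv[OF s(1), of "1/2"] by auto
            then have "1 / 2 ^ (i + 1) < s" by (simp add: power_one_over field_simps)
            then have j1: "1 / 2 ^ (j + 1) < s" unfolding j_def by (rule LeastI)
            have j2: "s \<le> 1 / 2 ^ j"
            proof (cases j)
              case (Suc i)
              have "\<not> 1 / 2 ^ (i + 1) < s"
                using not_less_Least[of i "\<lambda>j. 1 / 2 ^ (j + 1) < s"] Suc unfolding j_def by simp
              then show ?thesis using Suc by simp
            qed (use s in simp)
            have inv: "1 / s \<le> 2 ^ (j + 1)"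
            proof -
              have "1 / s \<le> 1 / (1 / 2 ^ (j + 1))" using j1 s by (intro divide_left_mono) auto
              then show ?thesis by simp
            qed
            have sub: "ball (\<gamma> s) (s * (\<delta> / 2)) \<subseteq> {x \<in> \<Omega>. c / 2 ^ j \<le> bdist \<Omega> x \<and> dist y x \<le> R / 2 ^ j}"
            proof
              fix x assume "x \<in> ball (\<gamma> s) (s * (\<delta> / 2))"
              then have dx: "dist (\<gamma> s) x < s * (\<delta> / 2)" by simp
              have dg: "\<delta> * s \<le> bdist \<Omega> (\<gamma> s)" by (rule \<gamma>(3)[OF True])
              have hs: "s * (\<delta> / 2) = \<delta> * s / 2" by simp
              have "0 < \<delta> * s" using \<delta> s by simp
              then have "x \<in> \<Omega>" using mem_of_dist_less_bdist[OF \<gamma>(2)[OF True], of x] dx dg hs by linarith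
              moreover have "c / 2 ^ j \<le> bdist \<Omega> x"
              proof -
                have "\<delta> / 2 * (1 / 2 ^ (j + 1)) \<le> \<delta> / 2 * s" using j1 \<delta> by (intro mult_left_mono) auto
                moreover have "\<delta> / 2 * (1 / 2 ^ (j + 1)) = c / 2 ^ j" by (simp add: c_def)
                ultimately have "c / 2 ^ j \<le> \<delta> * s / 2" by simp
                then show ?thesis using bdist_ge[of \<Omega> "\<gamma> s" x] dx dg hs by linarith
              qed
              moreover have "dist y x \<le> R / 2 ^ j"
              proof -
                have "norm (\<gamma> s - \<gamma> 0) \<le> K * (s - 0)" using s by (intro john_curve_lipschitz[OF J K]) auto
                then have "dist y (\<gamma> s) \<le> K * s" by (simp add: \<gamma>(1) dist_norm norm_minus_commute)
                then have "dist y x \<le> K * s + \<delta> * s / 2" using dist_triangle[of y x "\<gamma> s"] dx hs by linarith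
                also have "\<dots> \<le> R * s" using \<delta> s by (simp add: R_def algebra_simps)
                also have "\<dots> \<le> R * (1 / 2 ^ j)" using j2 R by (intro mult_left_mono) auto
                finally show ?thesis by simp
              qed
              ultimately show "x \<in> {x \<in> \<Omega>. c / 2 ^ j \<le> bdist \<Omega> x \<and> dist y x \<le> R / 2 ^ j}" by simp
            qed
            have gs: "\<gamma>' s = \<gamma> s" using s by (simp add: \<gamma>'_def)
            have cm: "(\<lambda>z. \<gamma> s + s *\<^sub>R z) \<in> borel_measurable borel" by measurable
            have "(\<integral>\<^sup>+z. indicator B z * (indicator {0..1} s * (ennreal (K + \<delta>) * g (\<gamma>' s + s *\<^sub>R z))) \<partial>lborel)
               = (\<integral>\<^sup>+z. ennreal (K + \<delta>) * (g (\<gamma> s + s *\<^sub>R z) * indicator (ball 0 (\<delta> / 2)) z) \<partial>lborel)"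
              using True by (intro nn_integral_cong) (simp add: gs B_def mult_ac)
            also have "\<dots> = ennreal (K + \<delta>) * (\<integral>\<^sup>+z\<in>ball 0 (\<delta> / 2). g (\<gamma> s + s *\<^sub>R z) \<partial>lborel)"
              using measurable_compose[OF cm gm] by (intro nn_integral_cmult) measurable
            also have "\<dots> = ennreal (K + \<delta>) * (ennreal (1 / s ^ DIM('a)) * (\<integral>\<^sup>+x\<in>ball (\<gamma> s) (s * (\<delta> / 2)). g x \<partial>lborel))"
              by (subst nn_integral_affine_ball[OF gm s(1)]) simp
            also have "\<dots> \<le> ennreal (K + \<delta>) * (ennreal (2 ^ (n * (j + 1))) * \<Psi> j)"
            proof (intro mult_left_mono mult_mono ennreal_leI)
              have "1 / s ^ DIM('a) = (1 / s) ^ n" by (simp add: n_def power_one_over)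
              also have "\<dots> \<le> (2 ^ (j + 1)) ^ n" using inv s by (intro power_mono) auto
              also have "\<dots> = 2 ^ (n * (j + 1))" by (metis power_mult mult.commute)
              finally show "1 / s ^ DIM('a) \<le> 2 ^ (n * (j + 1))" .
              show "(\<integral>\<^sup>+x\<in>ball (\<gamma> s) (s * (\<delta> / 2)). g x \<partial>lborel) \<le> \<Psi> j"
                unfolding \<Psi>_def using sub by (intro nn_integral_mono mult_left_mono) (auto simp: indicator_def)
            qed auto
            also have "\<dots> = ennreal ((K + \<delta>) * 2 ^ (n * (j + 1))) * \<Psi> j * indicator {1 / 2 ^ (j + 1)<..1 / 2 ^ j :: real} s"
              using j1 j2 K \<delta> by (simp add: ennreal_mult mult.assoc)
            also have "\<dots> \<le> (\<Sum>j. ennreal ((K + \<delta>) * 2 ^ (n * (j + 1))) * \<Psi> j * indicator {1 / 2 ^ (j + 1)<..1 / 2 ^ j :: real} s)"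
            proof -
              define t where "t i = ennreal ((K + \<delta>) * 2 ^ (n * (i + 1))) * \<Psi> i * indicator {1 / 2 ^ (i + 1)<..1 / 2 ^ i :: real} s" for i
              have "t j \<le> suminf t" using sum_le_suminf[of t "{j}"] by simp
              then show ?thesis unfolding t_def .
            qed
            finally show ?thesis .
          qed simp
        qed
      qed
      also have "\<dots> = (\<Sum>j. ennreal ((K + \<delta>) * 2 ^ (n * (j + 1))) * \<Psi> j * emeasure lborel {1 / 2 ^ (j + 1)<..1 / 2 ^ j :: real})"
        by (subst nn_integral_suminf) (auto simp: nn_integral_cmult_indicator)
      also have "\<dots> = (\<Sum>j. ennreal (m * C) * (ennreal ((1 / 2 ^ j) powr (1 - real DIM('a))) * \<Psi> j))"
      proof (intro suminf_cong)
        fix j :: nat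
        have len: "emeasure lborel {1 / 2 ^ (j + 1)<..1 / 2 ^ j :: real} = ennreal (1 / 2 ^ (j + 1))"
        proof -
          have "(1::real) / 2 ^ j - 1 / 2 ^ (j + 1) = 1 / 2 ^ (j + 1)" by (simp add: field_simps)
          moreover have "(1::real) / 2 ^ (j + 1) \<le> 1 / 2 ^ j" by (simp add: field_simps)
          ultimately show ?thesis by simp
        qed
        have "(K + \<delta>) * 2 ^ (n * (j + 1)) * (1 / 2 ^ (j + 1)) = m * C * (1 / 2 ^ j) powr (1 - real DIM('a))"
        proof -
          obtain n' where n': "n = Suc n'" using n by (cases n) auto
          have "(1 / 2 ^ j :: real) powr (1 - real DIM('a)) = (2 ^ j) powr (real n')"
          proof -
            have e0: "1 - real DIM('a) = - real n'" using n' by (simp add: n_def)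
            show ?thesis unfolding e0 by (simp add: powr_minus powr_divide)
          qed
          also have "\<dots> = 2 ^ (j * n')" by (simp add: powr_realpow power_mult)
          finally have e: "(1 / 2 ^ j :: real) powr (1 - real DIM('a)) = 2 ^ (j * n')" .
          have "n * (j + 1) = (j + 1) + (n' + j * n')" using n' by (simp add: algebra_simps)
          then have "(2::real) ^ (n * (j + 1)) * (1 / 2 ^ (j + 1)) = 2 ^ n' * 2 ^ (j * n')" by (simp add: power_add)
          then have "(K + \<delta>) * ((2::real) ^ (n * (j + 1)) * (1 / 2 ^ (j + 1))) = (K + \<delta>) * (2 ^ n' * 2 ^ (j * n'))" by (simp only:)
          then show ?thesis unfolding e using m n' by (simp add: C_def mult.assoc)
        qed
        then show "ennreal ((K + \<delta>) * 2 ^ (n * (j + 1))) * \<Psi> j * emeasure lborel {1 / 2 ^ (j + 1)<..1 / 2 ^ j :: real}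
            = ennreal (m * C) * (ennreal ((1 / 2 ^ j) powr (1 - real DIM('a))) * \<Psi> j)"
        proof -
          assume e: "(K + \<delta>) * 2 ^ (n * (j + 1)) * (1 / 2 ^ (j + 1)) = m * C * (1 / 2 ^ j) powr (1 - real DIM('a))"
          have "ennreal ((K + \<delta>) * 2 ^ (n * (j + 1))) * \<Psi> j * ennreal (1 / 2 ^ (j + 1))
             = ennreal ((K + \<delta>) * 2 ^ (n * (j + 1)) * (1 / 2 ^ (j + 1))) * \<Psi> j"
            using K \<delta> by (subst (2) ennreal_mult) (auto simp: mult_ac)
          also have "\<dots> = ennreal (m * C) * (ennreal ((1 / 2 ^ j) powr (1 - real DIM('a))) * \<Psi> j)"
            unfolding e using m C by (subst ennreal_mult) (auto simp: mult_ac)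
          finally show ?thesis unfolding len .
        qed
      qed
      also have "\<dots> = ennreal (m * C) * (\<Sum>j. ennreal ((1 / 2 ^ j) powr (1 - real DIM('a))) * \<Psi> j)"
        by (rule ennreal_suminf_cmult)
      finally have "ennreal (1 / m) * ennreal (m * \<bar>f y - a\<bar>) \<le> ennreal (1 / m) * (ennreal (m * C) * (\<Sum>j. ennreal ((1 / 2 ^ j) powr (1 - real DIM('a))) * \<Psi> j))"
        by (rule mult_left_mono) simp
      moreover have "ennreal (1 / m) * ennreal (m * \<bar>f y - a\<bar>) = ennreal \<bar>f y - a\<bar>"
        using m by (simp flip: ennreal_mult)
      moreover have "ennreal (1 / m) * (ennreal (m * C) * X) = ennreal C * X" for X
        using m C by (simp add: mult.assoc[symmetric] flip: ennreal_mult)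
      ultimately show "ennreal \<bar>f y - a\<bar> \<le> ennreal C * (\<Sum>j. ennreal ((1 / 2 ^ j) powr (1 - real DIM('a))) *
        (\<integral>\<^sup>+x\<in>{x \<in> \<Omega>. c / 2 ^ j \<le> bdist \<Omega> x \<and> dist y x \<le> R / 2 ^ j}. ennreal (norm (G x)) \<partial>lborel))"
        by (simp only: \<Psi>_def g_def)
    qed
  qed
  show ?thesis
    using C R \<delta> main by (intro exI[of _ C] exI[of _ R] exI[of _ c]) (simp add: c_def)
qed

section \<open>Shifted dyadic grids\<close>

text \<open>
Integers and points of \<open>\<int> + 2^j / 3\<close> are at least \<open>1/3\<close> apart, because \<open>3\<close> does not divide \<open>2^j\<close>. So a
shorter interval avoids one of the two sets.
\<close>

lemma one_third_trick:
  fixes a b :: real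
  assumes "a \<le> b" "b - a < 1 / 3"
  shows "\<lfloor>a\<rfloor> = \<lfloor>b\<rfloor> \<or> \<lfloor>a - 2 ^ j / 3\<rfloor> = \<lfloor>b - 2 ^ j / 3\<rfloor>"
proof (rule ccontr)
  assume "\<not> ?thesis"
  then have ne: "\<lfloor>a\<rfloor> \<noteq> \<lfloor>b\<rfloor>" "\<lfloor>a - 2 ^ j / 3\<rfloor> \<noteq> \<lfloor>b - 2 ^ j / 3\<rfloor>" by auto
  have sep: "\<exists>m::int. s < m \<and> real_of_int m \<le> t" if "s \<le> t" "\<lfloor>s\<rfloor> \<noteq> \<lfloor>t\<rfloor>" for s t :: real
  proof -
    have "\<lfloor>s\<rfloor> < \<lfloor>t\<rfloor>" using floor_mono[OF that(1)] that(2) by simp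
    then have "s < real_of_int \<lfloor>t\<rfloor>" by linarith
    then show ?thesis by (intro exI[of _ "\<lfloor>t\<rfloor>"]) auto
  qed
  obtain m where m: "a < real_of_int m" "real_of_int m \<le> b" using sep[OF assms(1) ne(1)] by auto
  obtain m' where m': "a - 2 ^ j / 3 < real_of_int m'" "real_of_int m' \<le> b - 2 ^ j / 3"
    using sep[OF _ ne(2)] assms(1) by auto
  have "\<bar>real_of_int m - (real_of_int m' + 2 ^ j / 3)\<bar> < 1 / 3" using m m' assms unfolding abs_less_iff by linarith
  then have "\<bar>real_of_int (3 * (m - m') - 2 ^ j)\<bar> < 1" by (simp add: abs_less_iff field_simps)
  then have "3 * (m - m') = 2 ^ j" by linarith
  then have "3 dvd (2::int) ^ j" by (metis dvd_triv_left)
  then have "3 dvd (2::int)" using prime_dvd_power[of "3::int" 2 j] by simp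
  then show False by simp
qed

definition grid_shift :: "real \<Rightarrow> 'n set \<Rightarrow> real ^ 'n" where
  "grid_shift L S = (\<chi> k. if k \<in> S then L / 3 else 0)"

text \<open>
In units of the cells of level \<open>j\<close> the shift by \<open>L / 3\<close> is a shift by \<open>2^j / 3\<close>. The set \<open>S\<close> collects the
coordinates in which the projection of the ball crosses a wall of the unshifted grid; by
\<open>one_third_trick\<close> it then crosses no wall of the shifted one.
\<close>

lemma ball_in_shifted_cell:
  fixes y :: "real ^ 'n"
  assumes L: "0 < L" and \<rho>: "6 * \<rho> < L"
  shows "\<exists>S. \<forall>x. dist y x \<le> \<rho> / 2 ^ j \<longrightarrow> dyadic (grid_shift L S) L j x = dyadic (grid_shift L S) L j y"
proof -
  define lo where "lo k = 2 ^ j * ((y $ k - \<rho> / 2 ^ j) / L)" for k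
  define hi where "hi k = 2 ^ j * ((y $ k + \<rho> / 2 ^ j) / L)" for k
  define S where "S = {k. \<lfloor>lo k\<rfloor> \<noteq> \<lfloor>hi k\<rfloor>}"
  show ?thesis
  proof (cases "0 \<le> \<rho>")
    case True
    have lh: "lo k \<le> hi k" "hi k - lo k < 1 / 3" for k
    proof -
      have e: "hi k - lo k = 2 * \<rho> / L" using L by (simp add: hi_def lo_def field_simps)
      show "lo k \<le> hi k" using e True L by (smt (verit) divide_nonneg_pos)
      show "hi k - lo k < 1 / 3" unfolding e using \<rho> L by (simp add: divide_less_eq)
    qed
    have shift: "2 ^ j * ((t - L / 3) / L) = 2 ^ j * (t / L) - 2 ^ j / 3" for t
      using L by (simp add: diff_divide_distrib right_diff_distrib)
    have key: "\<lfloor>2 ^ j * ((x $ k - grid_shift L S $ k) / L)\<rfloor> = \<lfloor>2 ^ j * ((y $ k - grid_shift L S $ k) / L)\<rfloor>"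
      if x: "dist y x \<le> \<rho> / 2 ^ j" for x k
    proof -
      have "\<bar>y $ k - x $ k\<bar> \<le> \<rho> / 2 ^ j"
        using component_le_norm_cart[of "y - x" k] x by (simp add: dist_norm)
      then have xk: "y $ k - \<rho> / 2 ^ j \<le> x $ k" "x $ k \<le> y $ k + \<rho> / 2 ^ j" unfolding abs_le_iff by linarith+
      have yk: "y $ k - \<rho> / 2 ^ j \<le> y $ k" "y $ k \<le> y $ k + \<rho> / 2 ^ j" using True by simp_all
      define s where "s = (if k \<in> S then 2 ^ j / 3 else (0::real))"
      have sh: "2 ^ j * ((t - grid_shift L S $ k) / L) = 2 ^ j * (t / L) - s" for t
        using shift[of t] by (simp add: grid_shift_def s_def)
      have eq: "\<lfloor>lo k - s\<rfloor> = \<lfloor>hi k - s\<rfloor>"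
        using one_third_trick[OF lh, of k j] by (auto simp: S_def s_def)
      have "\<lfloor>2 ^ j * (t / L) - s\<rfloor> = \<lfloor>lo k - s\<rfloor>" if "y $ k - \<rho> / 2 ^ j \<le> t" "t \<le> y $ k + \<rho> / 2 ^ j" for t
      proof -
        have "lo k \<le> 2 ^ j * (t / L)" "2 ^ j * (t / L) \<le> hi k"
          unfolding lo_def hi_def using that L by (auto intro!: mult_left_mono divide_right_mono)
        then have "\<lfloor>lo k - s\<rfloor> \<le> \<lfloor>2 ^ j * (t / L) - s\<rfloor>" "\<lfloor>2 ^ j * (t / L) - s\<rfloor> \<le> \<lfloor>hi k - s\<rfloor>"
          by (auto intro!: floor_mono)
        then show ?thesis using eq by simp
      qed
      from this[OF xk] this[OF yk] show ?thesis unfolding sh by simp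
    qed
    show ?thesis
      by (intro exI[of _ S] allI impI) (use key in \<open>simp add: dyadic_def vec_eq_iff\<close>)
  next
    case False
    then have "\<rho> / 2 ^ j < 0" by (simp add: divide_less_0_iff)
    then have "\<not> dist y x \<le> \<rho> / 2 ^ j" for x using zero_le_dist[of y x] by linarith
    then show ?thesis by blast
  qed
qed

text \<open>
The sides not exceeding \<open>D\<close> form a geometric series with ratio \<open>1/2\<close>, dominated by twice its first
term.
\<close>

lemma truncated_side_sum:
  assumes L: "0 < L" and D: "0 \<le> D"
  shows "(\<Sum>i=j..n. if dyadic_side L i \<le> D then dyadic_side L i else 0) \<le> 2 * min (dyadic_side L j) D"
proof (cases "j \<le> Suc n")
  case True
  then show ?thesis
  proof (induction j rule: inc_induct)
    case base
    show ?case using dyadic_side_pos[OF L, of "Suc n"] D by simp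
  next
    case (step j)
    have "(\<Sum>i=j..n. if dyadic_side L i \<le> D then dyadic_side L i else 0)
       = (if dyadic_side L j \<le> D then dyadic_side L j else 0) + (\<Sum>i=Suc j..n. if dyadic_side L i \<le> D then dyadic_side L i else 0)"
      using step.hyps by (intro sum.atLeast_Suc_atMost) simp
    also have "\<dots> \<le> (if dyadic_side L j \<le> D then dyadic_side L j else 0) + 2 * min (dyadic_side L (Suc j)) D"
      using step.IH by simp
    also have "\<dots> \<le> 2 * min (dyadic_side L j) D"
      using dyadic_side_Suc[of L j] dyadic_side_pos[OF L, of "Suc j"] by (auto simp: min_def)
    finally show ?case .
  qed
next
  case False
  then show ?thesis using dyadic_side_pos[OF L, of j] D by simp
qed

text \<open>
The minimum of two numbers is at most their geometric mean with any weights.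
\<close>

lemma truncated_side_sum_powr:
  assumes L: "0 < L" and D: "0 \<le> D" and \<alpha>: "0 \<le> \<alpha>" "\<alpha> \<le> 1"
  shows "(\<Sum>i=j..n. if dyadic_side L i \<le> D then dyadic_side L i else 0) \<le> 2 * (dyadic_side L j powr (1 - \<alpha>) * D powr \<alpha>)"
proof (cases "D = 0")
  case True
  have "\<not> dyadic_side L i \<le> D" for i using dyadic_side_pos[OF L, of i] True by simp
  then show ?thesis by simp
next
  case False
  define l where "l = dyadic_side L j"
  have l: "0 < l" and D': "0 < D" using dyadic_side_pos[OF L] False D by (auto simp: l_def)
  have "min l D = min l D powr (1 - \<alpha>) * min l D powr \<alpha>"
    using l D' by (simp flip: powr_add)
  also have "\<dots> \<le> l powr (1 - \<alpha>) * D powr \<alpha>"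
    using l D' \<alpha> by (intro mult_mono powr_mono2) auto
  finally show ?thesis using truncated_side_sum[OF L D, of j n] by (simp add: l_def)
qed

text \<open>
Each ball of level \<open>j\<close> in \<open>john_representation\<close> is contained in a cell of level \<open>j\<close> of one of the shifted
grids; which one depends on \<open>y\<close> and \<open>j\<close>, so the sum runs over all of them.
\<close>

lemma john_grid_representation:
  fixes \<Omega> :: "(real ^ 'n) set"
  assumes JD: "bounded_john_domain \<Omega>"
  obtains C L D where "0 < C" "0 < L" "0 < D"
    "\<And>f G. locally_lipschitz_on \<Omega> f \<Longrightarrow> G \<in> borel_measurable borel \<Longrightarrow>
      AE x in lborel. x \<in> \<Omega> \<longrightarrow> (f has_derivative (\<lambda>h. (G x :: real ^ 'n) \<bullet> h)) (at x) \<Longrightarrow>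
      \<exists>a::real. \<forall>y\<in>\<Omega>. ennreal \<bar>f y - a\<bar> \<le> ennreal C * (\<Sum>S\<in>(UNIV :: 'n set set). \<Sum>j.
         ennreal (dyadic_side L j powr (- real CARD('n))) *
        (\<integral>\<^sup>+x\<in>{x. dyadic (grid_shift L S) L j x = dyadic (grid_shift L S) L j y}.
            ennreal ((if x \<in> \<Omega> \<and> dyadic_side L j \<le> D * bdist \<Omega> x then dyadic_side L j else 0) * norm (G x)) \<partial>lebesgue))"
proof -
  from john_representation[OF JD] obtain C R c where CRc: "0 < C" "0 < R" "0 < c" and
    rep: "\<forall>f G. locally_lipschitz_on \<Omega> f \<longrightarrow> G \<in> borel_measurable borel \<longrightarrow>
     (AE x in lborel. x \<in> \<Omega> \<longrightarrow> (f has_derivative (\<lambda>h. (G x :: real ^ 'n) \<bullet> h)) (at x)) \<longrightarrow>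
     (\<exists>a::real. \<forall>y\<in>\<Omega>. ennreal \<bar>f y - a\<bar> \<le> ennreal C * (\<Sum>j. ennreal ((1 / 2 ^ j) powr (1 - real DIM(real ^ 'n))) *
        (\<integral>\<^sup>+x\<in>{x \<in> \<Omega>. c / 2 ^ j \<le> bdist \<Omega> x \<and> dist y x \<le> R / 2 ^ j}. ennreal (norm (G x)) \<partial>lborel)))"
    by (elim exE conjE) (rule that)
  \<comment> \<open>Any \<open>L > 6 R\<close> makes every ball of level \<open>j\<close> fit into a cell of level
    \<open>j\<close>.\<close>
  define L where "L = 7 * R"
  define D where "D = L / c"
  have L: "0 < L" "6 * R < L" using CRc by (auto simp: L_def)
  have D: "0 < D" using L CRc by (simp add: D_def)
  define N where "N = real CARD('n)"
  define C' where "C' = C * L powr (N - 1)"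
  have C': "0 < C'" using CRc L by (simp add: C'_def)
  show ?thesis
  proof (rule that[OF C' L(1) D])
    fix f and G :: "real ^ 'n \<Rightarrow> real ^ 'n"
    assume A: "locally_lipschitz_on \<Omega> f" "G \<in> borel_measurable borel"
      "AE x in lborel. x \<in> \<Omega> \<longrightarrow> (f has_derivative (\<lambda>h. G x \<bullet> h)) (at x)"
    obtain a where a: "\<And>y. y \<in> \<Omega> \<Longrightarrow> ennreal \<bar>f y - a\<bar> \<le> ennreal C * (\<Sum>j. ennreal ((1 / 2 ^ j) powr (1 - real DIM(real ^ 'n))) *
        (\<integral>\<^sup>+x\<in>{x \<in> \<Omega>. c / 2 ^ j \<le> bdist \<Omega> x \<and> dist y x \<le> R / 2 ^ j}. ennreal (norm (G x)) \<partial>lborel))"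
      using rep[rule_format, OF A] by blast
    define l where "l = dyadic_side L"
    have l0: "0 < l j" for j using dyadic_side_pos[OF L(1)] by (simp add: l_def)
    define k where "k j x = (if x \<in> \<Omega> \<and> l j \<le> D * bdist \<Omega> x then l j else 0) * norm (G x)" for j x
    define T where "T S j y = ennreal (l j powr (- N)) * (\<integral>\<^sup>+x\<in>{x. dyadic (grid_shift L S) L j x = dyadic (grid_shift L S) L j y}. ennreal (k j x) \<partial>lebesgue)"
      for S :: "'n set" and j y
    have "ennreal \<bar>f y - a\<bar> \<le> ennreal C' * (\<Sum>S\<in>UNIV. \<Sum>j. T S j y)" if y: "y \<in> \<Omega>" for y
    proof -
      have level: "ennreal ((1 / 2 ^ j) powr (1 - real DIM(real ^ 'n))) *
        (\<integral>\<^sup>+x\<in>{x \<in> \<Omega>. c / 2 ^ j \<le> bdist \<Omega> x \<and> dist y x \<le> R / 2 ^ j}. ennreal (norm (G x)) \<partial>lborel)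
          \<le> ennreal (L powr (N - 1)) * (\<Sum>S\<in>UNIV. T S j y)" for j
      proof -
        obtain S where S: "\<And>x. dist y x \<le> R / 2 ^ j \<Longrightarrow> dyadic (grid_shift L S) L j x = dyadic (grid_shift L S) L j y"
          using ball_in_shifted_cell[OF L, of y j] by blast
        have dl: "c / 2 ^ j \<le> b \<longleftrightarrow> l j \<le> D * b" for b
          using CRc L by (simp add: l_def dyadic_side_def D_def field_simps)
        have e: "(1 / 2 ^ j) powr (1 - real DIM(real ^ 'n)) = L powr (N - 1) * (l j powr (- N) * l j)"
        proof -
          have "1 / 2 ^ j = l j / L" using L by (simp add: l_def dyadic_side_def)
          then have "(1 / 2 ^ j) powr (1 - real DIM(real ^ 'n)) = (l j / L) powr (1 - N)" by (simp add: N_def)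
          also have "\<dots> = l j powr (1 - N) / L powr (1 - N)" by (rule powr_divide)
          also have "\<dots> = L powr (N - 1) * l j powr (1 - N)"
            using powr_minus_divide[of L "1 - N"] by simp
          also have "l j powr (1 - N) = l j powr (- N) * l j"
            using powr_add[of "l j" "- N" 1] l0[of j] by simp
          finally show ?thesis .
        qed
        have "ennreal (l j) * (\<integral>\<^sup>+x\<in>{x \<in> \<Omega>. c / 2 ^ j \<le> bdist \<Omega> x \<and> dist y x \<le> R / 2 ^ j}. ennreal (norm (G x)) \<partial>lborel)
           \<le> (\<integral>\<^sup>+x. ennreal (l j) * (ennreal (norm (G x)) * indicator {x \<in> \<Omega>. c / 2 ^ j \<le> bdist \<Omega> x \<and> dist y x \<le> R / 2 ^ j} x) \<partial>lborel)"
        proof (rule eq_refl, rule nn_integral_cmult[symmetric])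
          note [measurable] = A(2)
          have "open \<Omega>" using JD by (simp add: bounded_john_domain_def)
          then have [measurable]: "\<Omega> \<in> sets borel" by simp
          show "(\<lambda>x. ennreal (norm (G x)) * indicator {x \<in> \<Omega>. c / 2 ^ j \<le> bdist \<Omega> x \<and> dist y x \<le> R / 2 ^ j} x) \<in> borel_measurable lborel"
            by measurable
        qed
        also have "\<dots> \<le> (\<integral>\<^sup>+x\<in>{x. dyadic (grid_shift L S) L j x = dyadic (grid_shift L S) L j y}. ennreal (k j x) \<partial>lborel)"
          using S l0[of j] by (intro nn_integral_mono) (auto simp: indicator_def k_def dl ennreal_mult less_imp_le)
        finally have "ennreal (L powr (N - 1) * l j powr (- N)) * (ennreal (l j) * (\<integral>\<^sup>+x\<in>{x \<in> \<Omega>. c / 2 ^ j \<le> bdist \<Omega> x \<and> dist y x \<le> R / 2 ^ j}. ennreal (norm (G x)) \<partial>lborel))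
          \<le> ennreal (L powr (N - 1) * l j powr (- N)) * (\<integral>\<^sup>+x\<in>{x. dyadic (grid_shift L S) L j x = dyadic (grid_shift L S) L j y}. ennreal (k j x) \<partial>lborel)"
          by (rule mult_left_mono) simp
        also have "\<dots> = ennreal (L powr (N - 1)) * T S j y"
          by (simp add: T_def nn_integral_completion ennreal_mult mult.assoc)
        also have "\<dots> \<le> ennreal (L powr (N - 1)) * (\<Sum>S\<in>UNIV. T S j y)"
          by (intro mult_left_mono member_le_sum) auto
        finally show ?thesis unfolding e using l0[of j] by (simp add: ennreal_mult mult.assoc)
      qed
      have "ennreal \<bar>f y - a\<bar> \<le> ennreal C * (\<Sum>j. ennreal (L powr (N - 1)) * (\<Sum>S\<in>UNIV. T S j y))"
        by (rule order_trans[OF a[OF y]]) (intro mult_left_mono suminf_le level, auto)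
      also have "\<dots> = ennreal C' * (\<Sum>j. \<Sum>S\<in>UNIV. T S j y)"
        using CRc by (simp add: C'_def ennreal_mult mult.assoc ennreal_suminf_cmult)
      also have "(\<Sum>j. \<Sum>S\<in>UNIV. T S j y) = (\<Sum>S\<in>UNIV. \<Sum>j. T S j y)"
        by (rule suminf_sum) auto
      finally show ?thesis .
    qed
    then show "\<exists>a::real. \<forall>y\<in>\<Omega>. ennreal \<bar>f y - a\<bar> \<le> ennreal C' * (\<Sum>S\<in>(UNIV :: 'n set set). \<Sum>j.
         ennreal (dyadic_side L j powr (- real CARD('n))) *
        (\<integral>\<^sup>+x\<in>{x. dyadic (grid_shift L S) L j x = dyadic (grid_shift L S) L j y}.
            ennreal ((if x \<in> \<Omega> \<and> dyadic_side L j \<le> D * bdist \<Omega> x then dyadic_side L j else 0) * norm (G x)) \<partial>lebesgue))"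
      unfolding T_def k_def l_def N_def by blast
  qed
qed

section \<open>From the weight conditions to the dyadic form\<close>

lemma ennpow_pos_exponent: "0 < a \<Longrightarrow> 0 \<le> x \<Longrightarrow> ennpow (ennreal x) a = ennreal (x powr a)"
  by (auto simp: ennpow_def)

lemma ennpow_neg_exponent: "b < 0 \<Longrightarrow> 0 \<le> x \<Longrightarrow> ennpow (ennreal x) b = (if x = 0 then \<infinity> else ennreal (x powr b))"
  by (auto simp: ennpow_def)

lemma ennpow_eq_0_iff: "0 < a \<Longrightarrow> ennpow x a = 0 \<longleftrightarrow> x = 0"
  by (cases x) (auto simp: ennpow_def)

lemma ennpow_infinity: "0 < a \<Longrightarrow> ennpow \<infinity> a = \<infinity>"
  by (simp add: ennpow_def)

lemma cube_union_subset:
  fixes c c0 :: "real ^ 'n"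
  assumes "0 \<le> l" "0 \<le> l0"
  defines "l' \<equiv> l + l0 + 2 * dist c c0"
  shows "cube c l \<subseteq> cube c l'" "cube c0 l0 \<subseteq> cube c l'"
proof -
  show "cube c l \<subseteq> cube c l'"
  proof
    fix x assume "x \<in> cube c l"
    then have "\<bar>x $ k - c $ k\<bar> \<le> l / 2" for k by (simp add: mem_cube)
    moreover have "l / 2 \<le> l' / 2" using assms by simp
    ultimately show "x \<in> cube c l'" unfolding mem_cube by (meson order_trans)
  qed
  show "cube c0 l0 \<subseteq> cube c l'"
  proof
    fix x assume x: "x \<in> cube c0 l0"
    have "\<bar>x $ k - c $ k\<bar> \<le> l' / 2" for k
    proof -
      have "\<bar>x $ k - c0 $ k\<bar> \<le> l0 / 2" using x by (simp add: mem_cube)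
      moreover have "\<bar>c $ k - c0 $ k\<bar> \<le> dist c c0" using component_le_norm_cart[of "c - c0" k] by (simp add: dist_norm)
      moreover have "l' / 2 = l / 2 + l0 / 2 + dist c c0" by (simp add: l'_def add_divide_distrib)
      ultimately show ?thesis using assms(1) by linarith
    qed
    then show "x \<in> cube c l'" by (simp add: mem_cube)
  qed
qed

text \<open>
Local integrability of two weights follows from a bound for the product of their integrals, because
an infinite factor forces the other one to vanish. The integral \<open>B\<close>, of a negative power of a finite
weight in the applications, never vanishes, and \<open>A\<close> does not vanish on a cube enlarged to contain
\<open>cube c0 l0\<close>. The normalisation \<open>m\<close> is \<open>1\<close> for integrals and the volume for
averages.
\<close>

lemma weight_product_finite:
  fixes A B :: "real ^ 'n \<Rightarrow> real \<Rightarrow> ennreal" and m :: "real \<Rightarrow> ennreal"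
  assumes bound: "\<And>c l. 0 < l \<Longrightarrow> ennreal (\<kappa> l) * ennpow (A c l / m l) e1 * ennpow (B c l / m l) e2 \<le> ennreal K"
    and pos: "\<And>l. 0 < l \<Longrightarrow> 0 < \<kappa> l" "0 < e1" "0 < e2"
    and m: "\<And>l. 0 < l \<Longrightarrow> m l \<noteq> 0" "\<And>l. 0 < l \<Longrightarrow> m l \<noteq> \<infinity>"
    and Am: "\<And>c l c' l'. cube c l \<subseteq> cube c' l' \<Longrightarrow> A c l \<le> A c' l'"
    and Bm: "\<And>c l c' l'. cube c l \<subseteq> cube c' l' \<Longrightarrow> B c l \<le> B c' l'"
    and B0: "\<And>c l. 0 < l \<Longrightarrow> B c l \<noteq> 0" and A0: "0 < l0" "A c0 l0 \<noteq> 0" and l: "0 < l"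
  shows "A c l < \<infinity>" "B c l < \<infinity>"
proof -
  have inf: "\<not> (X = \<infinity> \<and> Y \<noteq> 0 \<or> X \<noteq> 0 \<and> Y = \<infinity>)" if "ennreal k * X * Y \<le> ennreal K" "0 < k" for X Y k
  proof
    assume "X = \<infinity> \<and> Y \<noteq> 0 \<or> X \<noteq> 0 \<and> Y = \<infinity>"
    then have "ennreal k * X * Y = \<infinity>" using that(2) by (auto simp: ennreal_mult_eq_top_iff)
    then show False using that(1) by (simp add: top_unique)
  qed
  have div0: "x / m l = 0 \<longleftrightarrow> x = 0" if "0 < l" for x l
    using m[OF that] by (simp add: ennreal_divide_eq_0_iff)
  have "A c l \<noteq> \<infinity>"
  proof
    assume "A c l = \<infinity>"
    then have "A c l / m l = \<infinity>" using m(2)[OF l] by (simp add: ennreal_top_divide)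
    then have "ennpow (A c l / m l) e1 = \<infinity>" by (simp only: ennpow_infinity[OF pos(2)])
    moreover have "ennpow (B c l / m l) e2 \<noteq> 0" using B0[OF l] div0[OF l] pos m(2)[OF l] by (simp add: ennpow_eq_0_iff)
    ultimately show False using inf[OF bound[OF l] pos(1)[OF l]] by blast
  qed
  then show "A c l < \<infinity>" by (simp add: less_top)
  define l' where "l' = l + l0 + 2 * dist c c0"
  have l': "0 < l'" using l A0 by (simp add: l'_def add_pos_nonneg)
  have sub: "cube c l \<subseteq> cube c l'" "cube c0 l0 \<subseteq> cube c l'"
    unfolding l'_def using l A0 by (intro cube_union_subset; simp)+
  have "B c l' \<noteq> \<infinity>"
  proof
    assume "B c l' = \<infinity>"
    then have "B c l' / m l' = \<infinity>" using m(2)[OF l'] by (simp add: ennreal_top_divide)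
    then have "ennpow (B c l' / m l') e2 = \<infinity>" by (simp only: ennpow_infinity[OF pos(3)])
    moreover have "ennpow (A c l' / m l') e1 \<noteq> 0"
    proof -
      have "A c l' \<noteq> 0" using Am[OF sub(2)] A0(2) by (auto simp: le_zero_eq)
      then show ?thesis using div0[OF l'] pos m(2)[OF l'] by (simp add: ennpow_eq_0_iff)
    qed
    ultimately show False using inf[OF bound[OF l'] pos(1)[OF l']] by blast
  qed
  then show "B c l < \<infinity>" using Bm[OF sub(1)] by (auto simp: less_top intro: le_less_trans)
qed

lemma cubes_exhaust: "\<exists>n::nat. x \<in> cube (0 :: real ^ 'n) (real (Suc n))"
proof -
  obtain n :: nat where n: "2 * norm x \<le> real n" using real_arch_simple by blast
  have "\<bar>x $ k - 0 $ k\<bar> \<le> real (Suc n) / 2" for k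
    using component_le_norm_cart[of x k] n by simp
  then show ?thesis unfolding mem_cube by blast
qed

lemma ae_of_cubes:
  assumes "\<And>n::nat. AE x in lebesgue. x \<in> cube (0 :: real ^ 'n) (real (Suc n)) \<longrightarrow> P x"
  shows "AE x in lebesgue. P x"
proof -
  have "AE x in lebesgue. \<forall>n::nat. x \<in> cube (0 :: real ^ 'n) (real (Suc n)) \<longrightarrow> P x"
    unfolding AE_all_countable using assms by blast
  then show ?thesis
  proof eventually_elim
    case (elim x)
    then show ?case using cubes_exhaust[of x] by blast
  qed
qed

lemma exists_cube_with_mass:
  fixes f :: "real ^ 'n \<Rightarrow> ennreal"
  assumes [measurable]: "f \<in> borel_measurable lebesgue" and "\<not> (AE x in lebesgue. f x = 0)"
  shows "\<exists>l>0. (\<integral>\<^sup>+x\<in>cube 0 l. f x \<partial>lebesgue) \<noteq> 0"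
proof (rule ccontr)
  assume "\<not> ?thesis"
  then have z: "(\<integral>\<^sup>+x\<in>cube (0 :: real ^ 'n) (real (Suc n)). f x \<partial>lebesgue) = 0" for n by auto
  have "AE x in lebesgue. f x = 0"
  proof (rule ae_of_cubes)
    fix n
    have "AE x in lebesgue. f x * indicator (cube (0 :: real ^ 'n) (real (Suc n))) x = 0"
      using z[of n] by (subst (asm) nn_integral_0_iff_AE) auto
    then show "AE x in lebesgue. x \<in> cube (0 :: real ^ 'n) (real (Suc n)) \<longrightarrow> f x = 0"
      by eventually_elim auto
  qed
  with assms(2) show False by contradiction
qed

lemma ae_finite_of_cubes:
  fixes f :: "real ^ 'n \<Rightarrow> ennreal"
  assumes [measurable]: "f \<in> borel_measurable lebesgue"
    and fin: "\<And>l. 0 < l \<Longrightarrow> (\<integral>\<^sup>+x\<in>cube 0 l. f x \<partial>lebesgue) < \<infinity>"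
  shows "AE x in lebesgue. f x \<noteq> \<infinity>"
proof (rule ae_of_cubes)
  fix n
  have "AE x in lebesgue. f x * indicator (cube (0 :: real ^ 'n) (real (Suc n))) x \<noteq> \<infinity>"
    using fin[of "real (Suc n)"] by (intro nn_integral_PInf_AE) auto
  then show "AE x in lebesgue. x \<in> cube (0 :: real ^ 'n) (real (Suc n)) \<longrightarrow> f x \<noteq> \<infinity>"
    by eventually_elim auto
qed

lemma cube_integral_pos:
  fixes f :: "real ^ 'n \<Rightarrow> ennreal"
  assumes [measurable]: "f \<in> borel_measurable lebesgue" and pos: "\<And>x. f x \<noteq> 0" and l: "0 < l"
  shows "(\<integral>\<^sup>+x\<in>cube c l. f x \<partial>lebesgue) \<noteq> 0"
proof
  assume "(\<integral>\<^sup>+x\<in>cube c l. f x \<partial>lebesgue) = 0"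
  then have "AE x in lebesgue. f x * indicator (cube c l) x = 0"
    by (subst (asm) nn_integral_0_iff_AE) auto
  then have "AE x in lebesgue. x \<notin> cube c l" by eventually_elim (use pos in auto)
  then have "emeasure lebesgue (cube c l) = 0"
    using AE_iff_measurable[of "cube c l" lebesgue "\<lambda>x. x \<notin> cube c l"] by auto
  then show False using emeasure_cube[of l c] l by simp
qed

lemma real_of_ennreal_bound: "ennreal x \<le> ennreal K \<Longrightarrow> x \<le> max K 0"
  by (auto simp: ennreal_le_iff2)

lemma measure_cube_powr:
  "0 < l \<Longrightarrow> measure lebesgue (cube (c :: real ^ 'n) l) powr e = l powr (real CARD('n) * e)"
  by (subst measure_cube) (simp_all add: powr_powr flip: powr_realpow)

text \<open>
The boundedness of the dyadic operators in dual form, uniformly in the grid, in the number of levels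
and in the functions \<open>k\<close>. This is the interface between the two conditions on the weights, which both
imply it, and the representation of functions, which is then used without distinguishing the cases.
\<close>

definition grid_estimate :: "real \<Rightarrow> real \<Rightarrow> real \<Rightarrow> (real ^ 'n \<Rightarrow> real) \<Rightarrow> (real ^ 'n \<Rightarrow> real) \<Rightarrow> bool" where
  "grid_estimate \<alpha> p q' w1 w2 \<longleftrightarrow>
    (\<exists>C\<ge>0. \<forall>org L k g h n. 0 < L \<longrightarrow> (\<forall>i. k i \<in> borel_measurable lebesgue) \<longrightarrow> (\<forall>i x. 0 \<le> k i x) \<longrightarrow>
      g \<in> borel_measurable lebesgue \<longrightarrow> h \<in> borel_measurable lebesgue \<longrightarrow> (\<forall>x. 0 \<le> g x) \<longrightarrow> (\<forall>x. 0 \<le> h x) \<longrightarrow>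
      (\<integral>\<^sup>+x. ennreal (g x powr p * w2 x) \<partial>lebesgue) \<le> 1 \<longrightarrow> (\<integral>\<^sup>+x. ennreal (h x powr q' * w1 x) \<partial>lebesgue) \<le> 1 \<longrightarrow>
      (\<forall>j x. (\<Sum>i=j..n. k i x) \<le> dyadic_side L j powr (1 - \<alpha>) * g x) \<longrightarrow>
      (\<Sum>i\<le>n. dyadic_form org L (\<lambda>x. h x * w1 x) k i) \<le> ennreal C)"

text \<open>
Translation of the two conditions, in which powers of the weights may be infinite, into the real
weights of \<open>dyadic_form_bound_fractional\<close> and \<open>dyadic_form_bound_bump\<close>. Finiteness of the integrals shows that
\<open>w2\<close> is positive almost everywhere, so that \<open>w2 powr (1 - p')\<close> agrees with the extended power.
\<close>

lemma weights_imp_grid_estimate: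
  fixes w1 w2 :: "real ^ 'n \<Rightarrow> real"
  assumes "1 < p" and "p \<le> q"
    and pp: "1 / p + 1 / p' = 1" and qq: "1 / q + 1 / q' = 1"
    and [measurable]: "w1 \<in> borel_measurable lebesgue" and w10: "\<And>x. 0 \<le> w1 x"
    and [measurable]: "w2 \<in> borel_measurable lebesgue" and w20: "\<And>x. 0 \<le> w2 x"
    and rd1: "reverse_doubling (\<lambda>x. ennreal (w1 x))"
    and rd2: "reverse_doubling (\<lambda>x. ennpow (ennreal (w2 x)) (1 - p'))"
    and c1: "p < q \<Longrightarrow>
      \<exists>K::real. \<forall>c. \<forall>l>0.
        ennreal (measure lebesgue (cube c l) powr ((1 - \<alpha>) / real CARD('n) - 1))
        * ennpow (\<integral>\<^sup>+x\<in>cube c l. ennreal (w1 x) \<partial>lebesgue) (1 / q)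
        * ennpow (\<integral>\<^sup>+x\<in>cube c l. ennpow (ennreal (w2 x)) (1 - p') \<partial>lebesgue) (1 / p')
        \<le> ennreal K"
    and c2: "p = q \<Longrightarrow>
      \<exists>r>1. \<exists>K::real. \<forall>c. \<forall>l>0.
        ennreal (measure lebesgue (cube c l) powr ((1 - \<alpha>) / real CARD('n) + 1 / q - 1 / p))
        * ennpow ((\<integral>\<^sup>+x\<in>cube c l. ennpow (ennreal (w1 x)) r \<partial>lebesgue)
            / emeasure lebesgue (cube c l)) (1 / (q * r))
        * ennpow ((\<integral>\<^sup>+x\<in>cube c l. ennpow (ennreal (w2 x)) ((1 - p') * r) \<partial>lebesgue)
            / emeasure lebesgue (cube c l)) (1 / (p' * r))
        \<le> ennreal K"
    and nz: "\<not> (AE x in lebesgue. w1 x = 0)"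
  shows "(\<forall>c l. 0 < l \<longrightarrow> (\<integral>\<^sup>+x\<in>cube c l. ennreal (w1 x) \<partial>lebesgue) < \<infinity>) \<and>
    grid_estimate \<alpha> p q' w1 w2" (is "?fin \<and> ?bound")
proof -
  have p'1: "1 < p'"
  proof -
    have "1 / p' = (p - 1) / p" using pp \<open>1 < p\<close> by (simp add: diff_divide_distrib)
    then have "1 / (1 / p') = 1 / ((p - 1) / p)" by simp
    then show ?thesis using \<open>1 < p\<close> by simp
  qed
  have q1: "1 < q" using assms(1,2) by simp
  define N where "N = real CARD('n)"
  have N: "0 < N" by (simp add: N_def)
  define \<sigma> where "\<sigma> x = w2 x powr (1 - p')" for x
  have \<sigma>m [measurable]: "\<sigma> \<in> borel_measurable lebesgue" unfolding \<sigma>_def by measurable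
  have \<sigma>0: "0 \<le> \<sigma> x" for x by (simp add: \<sigma>_def)
  have pp': "(1 - p') * (1 - p) = 1" using pp \<open>1 < p\<close> p'1 by (simp add: field_simps)
  have pe: "(1 - p') * (1 / p') = - (1 / p)" 
  proof -
    have "(1 - p') * (1 / p') = 1 / p' - 1" using p'1 by (simp add: field_simps)
    then show ?thesis using pp by linarith
  qed
  have w2pow: "ennpow (ennreal (w2 x)) b = (if w2 x = 0 then \<infinity> else ennreal (w2 x powr b))" if "b < 0" for x b
    by (rule ennpow_neg_exponent[OF that w20])
  have w2m: "(\<lambda>x. ennpow (ennreal (w2 x)) b) \<in> borel_measurable lebesgue" if "b < 0" for b
    unfolding w2pow[OF that] by measurable
  have w2nz: "ennpow (ennreal (w2 x)) b \<noteq> 0" if "b < 0" for x b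
    unfolding w2pow[OF that] using w20[of x] by simp
  have mono: "(\<integral>\<^sup>+x\<in>cube c l. f x \<partial>lebesgue) \<le> (\<integral>\<^sup>+x\<in>cube c' l'. f x \<partial>lebesgue)"
    if "cube c l \<subseteq> cube c' l'" for f :: "real ^ 'n \<Rightarrow> ennreal" and c l c' l'
    using that by (intro nn_integral_mono mult_left_mono) (auto simp: indicator_def)
  show ?thesis
  proof (cases "p < q")
    case True
    define A where "A c l = (\<integral>\<^sup>+x\<in>cube c l. ennreal (w1 x) \<partial>lebesgue)" for c :: "real ^ 'n" and l
    define B where "B c l = (\<integral>\<^sup>+x\<in>cube c l. ennpow (ennreal (w2 x)) (1 - p') \<partial>lebesgue)" for c :: "real ^ 'n" and l
    obtain K where K: "\<And>c l. 0 < l \<Longrightarrow> ennreal (measure lebesgue (cube c l) powr ((1 - \<alpha>) / N - 1))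
        * ennpow (A c l) (1 / q) * ennpow (B c l) (1 / p') \<le> ennreal K"
      using c1[OF True] unfolding A_def B_def N_def by blast
    have mc: "measure lebesgue (cube c l) powr ((1 - \<alpha>) / N - 1) = l powr (1 - \<alpha> - N)" if "0 < l" for c :: "real ^ 'n" and l
    proof -
      have "N * ((1 - \<alpha>) / N - 1) = 1 - \<alpha> - N" using N by (simp add: field_simps)
      then show ?thesis using measure_cube_powr[OF that, of c "(1 - \<alpha>) / N - 1"] by (simp add: N_def)
    qed
    obtain l0 where l0: "0 < l0" "A 0 l0 \<noteq> 0"
      using exists_cube_with_mass[of "\<lambda>x. ennreal (w1 x)"] nz w10 unfolding A_def by auto
    have b: "1 - p' < 0" using p'1 by simp
    have fin: "A c l < \<infinity>" "B c l < \<infinity>" if "0 < l" for c l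
    proof -
      have K': "ennreal (l powr (1 - \<alpha> - N)) * ennpow (A c l / 1) (1 / q) * ennpow (B c l / 1) (1 / p') \<le> ennreal K" if "0 < l" for c l
        using K[OF that, of c] unfolding mc[OF that] by (simp add: divide_ennreal_def)
      show "A c l < \<infinity>" "B c l < \<infinity>"
        by (rule weight_product_finite[where m = "\<lambda>_. 1" and \<kappa> = "\<lambda>l. l powr (1 - \<alpha> - N)" and A = A and B = B, OF K' _ _ _ _ _ _ _ _ l0 that];
            use q1 p'1 mono cube_integral_pos[OF w2m[OF b] w2nz[OF b]] in \<open>simp add: A_def B_def\<close>)+
    qed
    have w2p: "AE x in lebesgue. w2 x \<noteq> 0"
    proof -
      have "AE x in lebesgue. ennpow (ennreal (w2 x)) (1 - p') \<noteq> \<infinity>"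
        using fin(2)[of _ 0] by (intro ae_finite_of_cubes w2m b) (simp add: B_def)
      then show ?thesis by eventually_elim (auto simp: w2pow[OF b])
    qed
    define W where "W = density lebesgue (\<lambda>x. ennreal (w1 x))"
    define S where "S = density lebesgue (\<lambda>x. ennreal (\<sigma> x))"
    have W: "emeasure W (cube c l) = A c l" for c l
      unfolding W_def A_def by (subst emeasure_density) auto
    have S: "emeasure S (cube c l) = B c l" for c l
    proof -
      have "emeasure S (cube c l) = (\<integral>\<^sup>+x\<in>cube c l. ennreal (\<sigma> x) \<partial>lebesgue)"
        unfolding S_def by (subst emeasure_density) auto
      also have "\<dots> = B c l"
        unfolding B_def
      proof (rule nn_integral_cong_AE)
        show "AE x in lebesgue. ennreal (\<sigma> x) * indicator (cube c l) x = ennpow (ennreal (w2 x)) (1 - p') * indicator (cube c l) x"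
          using w2p by eventually_elim (simp add: w2pow[OF b] \<sigma>_def)
      qed
      finally show ?thesis .
    qed
    have Wm: "A c l = ennreal (measure W (cube c l))" and Sm: "B c l = ennreal (measure S (cube c l))" if "0 < l" for c l
      using fin[OF that, of c] W[of c l] S[of c l] by (simp_all add: measure_def less_top)
    \<comment> \<open>Reverse doubling is used for the single ratio \<open>3/5\<close> of
      \<open>tripled_reverse_doubling\<close>.\<close>
    have rd: "(3/5::real) \<in> {0<..<1}" by simp
    obtain \<delta>w where \<delta>w: "\<delta>w \<in> {0<..<1}" "\<And>c l. 0 < l \<Longrightarrow> A c (3/5 * l) \<le> ennreal \<delta>w * A c l"
      using bspec[OF rd1[unfolded reverse_doubling_def] rd] unfolding A_def by blast
    obtain \<delta>s where \<delta>s: "\<delta>s \<in> {0<..<1}" "\<And>c l. 0 < l \<Longrightarrow> B c (3/5 * l) \<le> ennreal \<delta>s * B c l"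
      using bspec[OF rd2[unfolded reverse_doubling_def] rd] unfolding B_def by blast
    have "\<exists>C\<ge>0. \<forall>org L k G h n. 0 < L \<longrightarrow> (\<forall>i. k i \<in> borel_measurable lebesgue) \<longrightarrow>
      G \<in> borel_measurable lebesgue \<longrightarrow> h \<in> borel_measurable lebesgue \<longrightarrow> (\<forall>x. 0 \<le> G x) \<longrightarrow> (\<forall>x. 0 \<le> h x) \<longrightarrow>
      (\<integral>\<^sup>+x. ennreal (G x powr p) \<partial>S) \<le> 1 \<longrightarrow> (\<integral>\<^sup>+x. ennreal (h x powr q') \<partial>W) \<le> 1 \<longrightarrow>
      (\<forall>i. AE x in lebesgue. k i x \<le> dyadic_side L i powr (1 - \<alpha>) * (G x * \<sigma> x)) \<longrightarrow>
      (\<Sum>i\<le>n. dyadic_form org L (\<lambda>x. h x * w1 x) k i) \<le> ennreal C"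
    proof (rule dyadic_form_bound_fractional[where w = w1 and \<sigma> = \<sigma> and \<delta>w = \<delta>w and \<delta>s = \<delta>s and K = "max K 0", folded S_def W_def])
      show "emeasure W (cube c l) < \<infinity>" "emeasure S (cube c l) < \<infinity>" if "0 < l" for c l
        using fin[OF that] by (simp_all add: W S)
      show "emeasure W (cube c (3/5 * l)) \<le> ennreal \<delta>w * emeasure W (cube c l)"
        "emeasure S (cube c (3/5 * l)) \<le> ennreal \<delta>s * emeasure S (cube c l)" if "0 < l" for c l
        unfolding W S using \<delta>w(2) \<delta>s(2) that by auto
      show "l powr (1 - \<alpha> - real CARD('n)) * measure W (cube c l) powr (1/q) * measure S (cube c l) powr (1/p') \<le> max K 0" if "0 < l" for c l
      proof (rule real_of_ennreal_bound)
        have "ennreal (l powr (1 - \<alpha> - N)) * ennreal (measure W (cube c l) powr (1/q)) * ennreal (measure S (cube c l) powr (1/p')) \<le> ennreal K"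
          using K[OF that, of c] q1 p'1 unfolding mc[OF that] Wm[OF that] Sm[OF that] by (simp add: ennpow_pos_exponent)
        then show "ennreal (l powr (1 - \<alpha> - real CARD('n)) * measure W (cube c l) powr (1/q) * measure S (cube c l) powr (1/p')) \<le> ennreal K"
          by (simp add: N_def ennreal_mult)
      qed
    qed (use \<delta>w(1) \<delta>s(1) w10 \<sigma>0 \<open>1 < p\<close> True pp qq in auto)
    then obtain C where C0: "0 \<le> C" and C: "\<And>org L k G h n. 0 < L \<Longrightarrow> (\<And>i. k i \<in> borel_measurable lebesgue) \<Longrightarrow>
      G \<in> borel_measurable lebesgue \<Longrightarrow> h \<in> borel_measurable lebesgue \<Longrightarrow> (\<And>x. 0 \<le> G x) \<Longrightarrow> (\<And>x. 0 \<le> h x) \<Longrightarrow>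
      (\<integral>\<^sup>+x. ennreal (G x powr p) \<partial>S) \<le> 1 \<Longrightarrow> (\<integral>\<^sup>+x. ennreal (h x powr q') \<partial>W) \<le> 1 \<Longrightarrow>
      (\<And>i. AE x in lebesgue. k i x \<le> dyadic_side L i powr (1 - \<alpha>) * (G x * \<sigma> x)) \<Longrightarrow>
      (\<Sum>i\<le>n. dyadic_form org L (\<lambda>x. h x * w1 x) k i) \<le> ennreal C"
      by blast
    have main: "(\<Sum>i\<le>n. dyadic_form org L (\<lambda>x. h x * w1 x) k i) \<le> ennreal C"
      if L: "0 < L" and [measurable]: "\<And>i. k i \<in> borel_measurable lebesgue" and k0: "\<And>i x. 0 \<le> k i x" and
      [measurable]: "g \<in> borel_measurable lebesgue" "h \<in> borel_measurable lebesgue" and g0: "\<And>x. 0 \<le> g x" and h0: "\<And>x. 0 \<le> h x"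
      and g1: "(\<integral>\<^sup>+x. ennreal (g x powr p * w2 x) \<partial>lebesgue) \<le> 1" and h1: "(\<integral>\<^sup>+x. ennreal (h x powr q' * w1 x) \<partial>lebesgue) \<le> 1"
      and k: "\<And>j x. (\<Sum>i=j..n. k i x) \<le> dyadic_side L j powr (1 - \<alpha>) * g x" for org L k g h n
    proof -
      \<comment> \<open>Since \<open>\<sigma>^(1-p) = w2\<close>, the norm of \<open>g\<close> in
        \<open>L^p(w2)\<close> is the norm of \<open>G\<close> in \<open>L^p(\<sigma>)\<close>.\<close>
      define G where "G x = g x / \<sigma> x" for x
      \<comment> \<open>Only the levels up to \<open>n\<close> obey the tail bound, so the others are cut off.\<close>
      define k' where "k' i x = (if i \<le> n then k i x else 0)" for i x
      have Gm [measurable]: "G \<in> borel_measurable lebesgue" unfolding G_def by measurable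
      have G\<sigma>: "AE x in lebesgue. G x * \<sigma> x = g x"
        using w2p by eventually_elim (simp add: G_def \<sigma>_def)
      have "(\<Sum>i\<le>n. dyadic_form org L (\<lambda>x. h x * w1 x) k' i) \<le> ennreal C"
      proof (rule C[OF L])
        show "k' i \<in> borel_measurable lebesgue" for i
          unfolding k'_def by (cases "i \<le> n") auto
        show "G \<in> borel_measurable lebesgue" "h \<in> borel_measurable lebesgue" by measurable
        show "0 \<le> G x" for x using g0 \<sigma>0 by (simp add: G_def)
        show "0 \<le> h x" for x by (rule h0)
        have "(\<integral>\<^sup>+x. ennreal (G x powr p) \<partial>S) = (\<integral>\<^sup>+x. ennreal (\<sigma> x) * ennreal (G x powr p) \<partial>lebesgue)"
          unfolding S_def by (subst nn_integral_density) auto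
        also have "\<dots> = (\<integral>\<^sup>+x. ennreal (g x powr p * w2 x) \<partial>lebesgue)"
        proof (rule nn_integral_cong_AE)
          show "AE x in lebesgue. ennreal (\<sigma> x) * ennreal (G x powr p) = ennreal (g x powr p * w2 x)"
            using w2p
          proof eventually_elim
            case (elim x)
            then have w: "0 < w2 x" using w20[of x] by simp
            have "\<sigma> x * G x powr p = g x powr p * (\<sigma> x / \<sigma> x powr p)" by (simp add: G_def powr_divide)
            also have "\<sigma> x / \<sigma> x powr p = \<sigma> x powr (1 - p)" using w by (simp add: \<sigma>_def powr_diff)
            also have "\<dots> = w2 x" using w by (simp add: \<sigma>_def powr_powr pp')
            finally show ?case using \<sigma>0[of x] by (simp flip: ennreal_mult)
          qed
        qed
        finally show "(\<integral>\<^sup>+x. ennreal (G x powr p) \<partial>S) \<le> 1" using g1 by simp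
        have "(\<integral>\<^sup>+x. ennreal (h x powr q') \<partial>W) = (\<integral>\<^sup>+x. ennreal (w1 x) * ennreal (h x powr q') \<partial>lebesgue)"
          unfolding W_def by (subst nn_integral_density) auto
        then show "(\<integral>\<^sup>+x. ennreal (h x powr q') \<partial>W) \<le> 1"
          using h1 w10 by (simp add: ennreal_mult mult.commute)
        show "AE x in lebesgue. k' i x \<le> dyadic_side L i powr (1 - \<alpha>) * (G x * \<sigma> x)" for i
          using G\<sigma>
        proof eventually_elim
          case (elim x)
          show ?case
          proof (cases "i \<le> n")
            case True
            have "k i x \<le> (\<Sum>i=i..n. k i x)" using True k0 by (intro member_le_sum) auto
            also note k
            finally show ?thesis using True elim by (simp add: k'_def)
          next
            case False
            then show ?thesis using elim g0[of x] by (simp add: k'_def)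
          qed
        qed
      qed
      moreover have "dyadic_form org L (\<lambda>x. h x * w1 x) k' i = dyadic_form org L (\<lambda>x. h x * w1 x) k i" if "i \<le> n" for i
        using that by (simp add: dyadic_form_def k'_def)
      ultimately show ?thesis by simp
    qed
    have ?fin using fin(1) by (simp add: A_def)
    moreover have ?bound
      unfolding grid_estimate_def
    proof (intro exI[of _ C] conjI C0 allI impI)
      fix org :: "real ^ 'n" and L and k :: "nat \<Rightarrow> real ^ 'n \<Rightarrow> real" and g h :: "real ^ 'n \<Rightarrow> real" and n
      assume a: "0 < L" "\<forall>i. k i \<in> borel_measurable lebesgue" "\<forall>i x. 0 \<le> k i x"
        "g \<in> borel_measurable lebesgue" "h \<in> borel_measurable lebesgue" "\<forall>x. 0 \<le> g x" "\<forall>x. 0 \<le> h x"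
        "(\<integral>\<^sup>+x. ennreal (g x powr p * w2 x) \<partial>lebesgue) \<le> 1" "(\<integral>\<^sup>+x. ennreal (h x powr q' * w1 x) \<partial>lebesgue) \<le> 1"
        "\<forall>j x. (\<Sum>i=j..n. k i x) \<le> dyadic_side L j powr (1 - \<alpha>) * g x"
      show "(\<Sum>i\<le>n. dyadic_form org L (\<lambda>x. h x * w1 x) k i) \<le> ennreal C"
        by (rule main[OF a(1) a(2)[rule_format] a(3)[rule_format] a(4,5) a(6)[rule_format] a(7)[rule_format] a(8,9) a(10)[rule_format]])
    qed
    ultimately show ?thesis ..
  next
    case False
    then have pq: "p = q" using \<open>p \<le> q\<close> by simp
    have q'p': "q' = p'"
    proof -
      have "1 / q' = 1 / p'" using pp qq unfolding pq by linarith
      then show ?thesis by (metis div_by_1 divide_divide_eq_right mult_1)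
    qed
    obtain r K where r: "1 < r" and K0: "\<And>c l. 0 < l \<Longrightarrow>
        ennreal (measure lebesgue (cube c l) powr ((1 - \<alpha>) / N + 1 / q - 1 / p))
        * ennpow ((\<integral>\<^sup>+x\<in>cube c l. ennpow (ennreal (w1 x)) r \<partial>lebesgue)
            / emeasure lebesgue (cube c l)) (1 / (q * r))
        * ennpow ((\<integral>\<^sup>+x\<in>cube c l. ennpow (ennreal (w2 x)) ((1 - p') * r) \<partial>lebesgue)
            / emeasure lebesgue (cube c l)) (1 / (p' * r))
        \<le> ennreal K"
      using c2[OF pq] unfolding N_def by blast
    define A where "A c l = (\<integral>\<^sup>+x\<in>cube c l. ennreal (w1 x powr r) \<partial>lebesgue)" for c :: "real ^ 'n" and l
    define B where "B c l = (\<integral>\<^sup>+x\<in>cube c l. ennpow (ennreal (w2 x)) ((1 - p') * r) \<partial>lebesgue)" for c :: "real ^ 'n" and l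
    define m where "m l = ennreal (l ^ CARD('n))" for l
    have em: "emeasure lebesgue (cube c l) = m l" if "0 < l" for c :: "real ^ 'n" and l
      using emeasure_cube[of l c] that by (simp add: m_def)
    have mc: "measure lebesgue (cube c l) powr ((1 - \<alpha>) / N + 1 / q - 1 / p) = l powr (1 - \<alpha>)" if "0 < l" for c :: "real ^ 'n" and l
    proof -
      have "N * ((1 - \<alpha>) / N + 1 / q - 1 / p) = 1 - \<alpha>" using N by (simp add: pq)
      then show ?thesis using measure_cube_powr[OF that, of c "(1 - \<alpha>) / N + 1 / q - 1 / p"] by (simp add: N_def)
    qed
    have K: "ennreal (l powr (1 - \<alpha>)) * ennpow (A c l / m l) (1 / (p * r)) * ennpow (B c l / m l) (1 / (p' * r)) \<le> ennreal K" if "0 < l" for c l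
    proof -
      have "ennpow (ennreal (w1 x)) r = ennreal (w1 x powr r)" for x using r w10 by (simp add: ennpow_pos_exponent)
      then show ?thesis using K0[OF that, of c] unfolding mc[OF that] em[OF that] A_def B_def by (simp add: pq)
    qed
    have b: "(1 - p') * r < 0" using p'1 r by (simp add: mult_less_0_iff)
    have "\<not> (AE x in lebesgue. ennreal (w1 x powr r) = 0)"
    proof
      assume "AE x in lebesgue. ennreal (w1 x powr r) = 0"
      then have "AE x in lebesgue. w1 x = 0" by eventually_elim (simp add: ennreal_eq_0_iff)
      with nz show False by contradiction
    qed
    then obtain l0 where l0: "0 < l0" "A 0 l0 \<noteq> 0"
      using exists_cube_with_mass[of "\<lambda>x. ennreal (w1 x powr r)"] unfolding A_def by auto
    have fin: "A c l < \<infinity>" "B c l < \<infinity>" if "0 < l" for c l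
      by (rule weight_product_finite[where m = m and \<kappa> = "\<lambda>l. l powr (1 - \<alpha>)" and A = A and B = B, OF K _ _ _ _ _ _ _ _ l0 that];
          use r \<open>1 < p\<close> p'1 mono cube_integral_pos[OF w2m[OF b] w2nz[OF b]] in \<open>simp add: A_def B_def m_def\<close>)+
    have w2p: "AE x in lebesgue. w2 x \<noteq> 0"
    proof -
      have "AE x in lebesgue. ennpow (ennreal (w2 x)) ((1 - p') * r) \<noteq> \<infinity>"
        using fin(2)[of _ 0] by (intro ae_finite_of_cubes w2m b) (simp add: B_def)
      then show ?thesis by eventually_elim (auto simp: w2pow[OF b])
    qed
    have \<sigma>r: "\<sigma> x powr r = w2 x powr ((1 - p') * r)" for x by (simp add: \<sigma>_def powr_powr)
    have S: "(\<integral>\<^sup>+x\<in>cube c l. ennreal (\<sigma> x powr r) \<partial>lebesgue) = B c l" for c l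
      unfolding B_def
    proof (rule nn_integral_cong_AE)
      show "AE x in lebesgue. ennreal (\<sigma> x powr r) * indicator (cube c l) x = ennpow (ennreal (w2 x)) ((1 - p') * r) * indicator (cube c l) x"
        using w2p by eventually_elim (simp add: w2pow[OF b] \<sigma>r)
    qed
    \<comment> \<open>On a set of finite volume the inequality \<open>w1 \<le> 1 + w1^r\<close> gives
      integrability.\<close>
    have finw: "(\<integral>\<^sup>+x\<in>cube c l. ennreal (w1 x) \<partial>lebesgue) < \<infinity>" if "0 < l" for c l
    proof -
      have "(\<integral>\<^sup>+x\<in>cube c l. ennreal (w1 x) \<partial>lebesgue) \<le> (\<integral>\<^sup>+x. indicator (cube c l) x + ennreal (w1 x powr r) * indicator (cube c l) x \<partial>lebesgue)"
      proof (intro nn_integral_mono)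
        fix x
        have "w1 x \<le> 1 + w1 x powr r"
        proof (cases "w1 x \<le> 1")
          case False
          then have "w1 x powr 1 \<le> w1 x powr r" using r by (intro powr_mono) auto
          with False show ?thesis by simp
        qed (simp add: add_increasing2)
        then have "ennreal (w1 x) \<le> ennreal (1 + w1 x powr r)" by (rule ennreal_leI)
        also have "\<dots> = 1 + ennreal (w1 x powr r)" by simp
        finally show "ennreal (w1 x) * indicator (cube c l) x \<le> indicator (cube c l) x + ennreal (w1 x powr r) * indicator (cube c l) x"
          by (simp add: indicator_def)
      qed
      also have "\<dots> = emeasure lebesgue (cube c l) + A c l"
        unfolding A_def by (subst nn_integral_add) auto
      also have "\<dots> < \<infinity>" using fin(1)[OF that, of c] em[OF that, of c] by (simp add: m_def)
      finally show ?thesis .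
    qed
    have "\<exists>C\<ge>0. \<forall>org L k u v n. 0 < L \<longrightarrow> (\<forall>i. k i \<in> borel_measurable lebesgue) \<longrightarrow> (\<forall>i x. 0 \<le> k i x) \<longrightarrow>
      u \<in> borel_measurable lebesgue \<longrightarrow> v \<in> borel_measurable lebesgue \<longrightarrow> (\<forall>x. 0 \<le> u x) \<longrightarrow> (\<forall>x. 0 \<le> v x) \<longrightarrow>
      (\<integral>\<^sup>+x. ennreal (u x powr p) \<partial>lebesgue) \<le> 1 \<longrightarrow> (\<integral>\<^sup>+x. ennreal (v x powr p') \<partial>lebesgue) \<le> 1 \<longrightarrow>
      (AE x in lebesgue. \<forall>j\<le>n. (\<Sum>i=j..n. k i x) \<le> dyadic_side L j powr (1 - \<alpha>) * (u x * \<sigma> x powr (1/p'))) \<longrightarrow>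
      (\<Sum>i\<le>n. dyadic_form org L (\<lambda>x. v x * w1 x powr (1/p)) k i) \<le> ennreal C"
    proof (rule dyadic_form_bound_bump[where K = "max K 0" and r = r])
      show "(\<integral>\<^sup>+x\<in>cube c l. ennreal (w1 x powr r) \<partial>lebesgue) < \<infinity>" "(\<integral>\<^sup>+x\<in>cube c l. ennreal (\<sigma> x powr r) \<partial>lebesgue) < \<infinity>"
        if "0 < l" for c l using fin[OF that] by (simp_all add: S A_def)
      show "l powr (1 - \<alpha>) * (enn2real (\<integral>\<^sup>+x\<in>cube c l. ennreal (w1 x powr r) \<partial>lebesgue) / l ^ CARD('n)) powr (1 / (p * r)) *
        (enn2real (\<integral>\<^sup>+x\<in>cube c l. ennreal (\<sigma> x powr r) \<partial>lebesgue) / l ^ CARD('n)) powr (1 / (p' * r)) \<le> max K 0" if "0 < l" for c l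
      proof (rule real_of_ennreal_bound)
        define X where "X = enn2real (A c l)" define Y where "Y = enn2real (B c l)"
        have XY: "A c l = ennreal X" "B c l = ennreal Y" "0 \<le> X" "0 \<le> Y" using fin[OF that, of c] by (simp_all add: X_def Y_def less_top)
        have d: "A c l / m l = ennreal (X / l ^ CARD('n))" "B c l / m l = ennreal (Y / l ^ CARD('n))"
          using XY that by (simp_all add: m_def divide_ennreal)
        have e: "0 < 1 / (p * r)" "0 < 1 / (p' * r)" using \<open>1 < p\<close> p'1 r by auto
        have "ennreal (l powr (1 - \<alpha>)) * ennreal ((X / l ^ CARD('n)) powr (1 / (p * r))) * ennreal ((Y / l ^ CARD('n)) powr (1 / (p' * r))) \<le> ennreal K"
          using K[OF that, of c] XY that unfolding d by (simp add: ennpow_pos_exponent[OF e(1)] ennpow_pos_exponent[OF e(2)])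
        then show "ennreal (l powr (1 - \<alpha>) * (enn2real (\<integral>\<^sup>+x\<in>cube c l. ennreal (w1 x powr r) \<partial>lebesgue) / l ^ CARD('n)) powr (1 / (p * r)) *
        (enn2real (\<integral>\<^sup>+x\<in>cube c l. ennreal (\<sigma> x powr r) \<partial>lebesgue) / l ^ CARD('n)) powr (1 / (p' * r))) \<le> ennreal K"
          unfolding S A_def[symmetric] X_def[symmetric] Y_def[symmetric] by (simp add: ennreal_mult)
      qed
    qed (use w10 \<sigma>0 \<open>1 < p\<close> pp r in auto)
    then obtain C where C0: "0 \<le> C" and C: "\<And>org L k u v n. 0 < L \<Longrightarrow> (\<And>i. k i \<in> borel_measurable lebesgue) \<Longrightarrow> (\<And>i x. 0 \<le> k i x) \<Longrightarrow>
      u \<in> borel_measurable lebesgue \<Longrightarrow> v \<in> borel_measurable lebesgue \<Longrightarrow> (\<And>x. 0 \<le> u x) \<Longrightarrow> (\<And>x. 0 \<le> v x) \<Longrightarrow>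
      (\<integral>\<^sup>+x. ennreal (u x powr p) \<partial>lebesgue) \<le> 1 \<Longrightarrow> (\<integral>\<^sup>+x. ennreal (v x powr p') \<partial>lebesgue) \<le> 1 \<Longrightarrow>
      (AE x in lebesgue. \<forall>j\<le>n. (\<Sum>i=j..n. k i x) \<le> dyadic_side L j powr (1 - \<alpha>) * (u x * \<sigma> x powr (1/p'))) \<Longrightarrow>
      (\<Sum>i\<le>n. dyadic_form org L (\<lambda>x. v x * w1 x powr (1/p)) k i) \<le> ennreal C"
      by blast
    have main: "(\<Sum>i\<le>n. dyadic_form org L (\<lambda>x. h x * w1 x) k i) \<le> ennreal C"
      if L: "0 < L" and km: "\<And>i. k i \<in> borel_measurable lebesgue" and k0: "\<And>i x. 0 \<le> k i x" and
      [measurable]: "g \<in> borel_measurable lebesgue" "h \<in> borel_measurable lebesgue" and g0: "\<And>x. 0 \<le> g x" and h0: "\<And>x. 0 \<le> h x"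
      and g1: "(\<integral>\<^sup>+x. ennreal (g x powr p * w2 x) \<partial>lebesgue) \<le> 1" and h1: "(\<integral>\<^sup>+x. ennreal (h x powr q' * w1 x) \<partial>lebesgue) \<le> 1"
      and k: "\<And>j x. (\<Sum>i=j..n. k i x) \<le> dyadic_side L j powr (1 - \<alpha>) * g x" for org L k g h n
    proof -
      define u where "u x = g x * w2 x powr (1/p)" for x
      define v where "v x = h x * w1 x powr (1/p')" for x
      have vw: "v x * w1 x powr (1/p) = h x * w1 x" for x
      proof -
        have "1 / p' + 1 / p = 1" using pp by simp
        then have "w1 x powr (1/p') * w1 x powr (1/p) = w1 x" using w10[of x] by (simp flip: powr_add)
        then show ?thesis by (simp add: v_def mult.assoc)
      qed
      have "(\<Sum>i\<le>n. dyadic_form org L (\<lambda>x. v x * w1 x powr (1/p)) k i) \<le> ennreal C"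
      proof (rule C[OF L km k0])
        show "u \<in> borel_measurable lebesgue" "v \<in> borel_measurable lebesgue" unfolding u_def v_def by measurable
        show "0 \<le> u x" "0 \<le> v x" for x using g0 h0 by (simp_all add: u_def v_def)
        have "u x powr p = g x powr p * w2 x" for x using \<open>1 < p\<close> w20[of x] by (simp add: u_def powr_mult powr_powr)
        then show "(\<integral>\<^sup>+x. ennreal (u x powr p) \<partial>lebesgue) \<le> 1" using g1 by simp
        have "v x powr p' = h x powr q' * w1 x" for x using p'1 w10[of x] by (simp add: v_def powr_mult powr_powr q'p')
        then show "(\<integral>\<^sup>+x. ennreal (v x powr p') \<partial>lebesgue) \<le> 1" using h1 by simp
        show "AE x in lebesgue. \<forall>j\<le>n. (\<Sum>i=j..n. k i x) \<le> dyadic_side L j powr (1 - \<alpha>) * (u x * \<sigma> x powr (1/p'))"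
          using w2p
        proof eventually_elim
          case (elim x)
          then have w: "0 < w2 x" using w20[of x] by simp
          have "\<sigma> x powr (1/p') = w2 x powr (- (1/p))" unfolding \<sigma>_def powr_powr pe ..
          then have "u x * \<sigma> x powr (1/p') = g x * (w2 x powr (1/p) * w2 x powr (- (1/p)))" by (simp add: u_def)
          also have "w2 x powr (1/p) * w2 x powr (- (1/p)) = 1" using w by (simp flip: powr_add)
          finally show ?case using k by simp
        qed
      qed
      then show ?thesis by (simp add: vw)
    qed
    have ?fin using finw by simp
    moreover have ?bound
      unfolding grid_estimate_def
    proof (intro exI[of _ C] conjI C0 allI impI)
      fix org :: "real ^ 'n" and L and k :: "nat \<Rightarrow> real ^ 'n \<Rightarrow> real" and g h :: "real ^ 'n \<Rightarrow> real" and n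
      assume a: "0 < L" "\<forall>i. k i \<in> borel_measurable lebesgue" "\<forall>i x. 0 \<le> k i x"
        "g \<in> borel_measurable lebesgue" "h \<in> borel_measurable lebesgue" "\<forall>x. 0 \<le> g x" "\<forall>x. 0 \<le> h x"
        "(\<integral>\<^sup>+x. ennreal (g x powr p * w2 x) \<partial>lebesgue) \<le> 1" "(\<integral>\<^sup>+x. ennreal (h x powr q' * w1 x) \<partial>lebesgue) \<le> 1"
        "\<forall>j x. (\<Sum>i=j..n. k i x) \<le> dyadic_side L j powr (1 - \<alpha>) * g x"
      show "(\<Sum>i\<le>n. dyadic_form org L (\<lambda>x. h x * w1 x) k i) \<le> ennreal C"
        by (rule main[OF a(1) a(2)[rule_format] a(3)[rule_format] a(4,5) a(6)[rule_format] a(7)[rule_format] a(8,9) a(10)[rule_format]])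
    qed
    ultimately show ?thesis ..
  qed
qed

section \<open>Duality and conclusion\<close>

lemma ennreal_eq_0_of_scaled_bound:
  assumes "\<And>t. 0 < t \<Longrightarrow> ennreal t * X \<le> ennreal C"
  shows "X = 0"
proof (rule ccontr)
  assume X: "X \<noteq> 0"
  have "X \<noteq> \<infinity>" using assms[of 1] by (auto simp: top_unique)
  then obtain x where x: "X = ennreal x" "0 \<le> x" by (cases X) auto
  then have "0 < x" using X by (cases "x = 0") auto
  define t where "t = (max C 0 + 1) / x"
  have t: "0 < t" using \<open>0 < x\<close> by (simp add: t_def add_nonneg_pos)
  have "ennreal (t * x) \<le> ennreal C" using assms[OF t] x t by (simp add: ennreal_mult)
  then have "t * x \<le> max C 0" by (rule real_of_ennreal_bound)
  then show False using \<open>0 < x\<close> by (simp add: t_def)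
qed

text \<open>
The test function is \<open>F^(q-1)\<close>, normalised. To normalise it, \<open>\<integral> F^q w\<close> must be finite, which holds after
truncation of \<open>F\<close> because \<open>w\<close> has finite mass on \<open>\<Omega>\<close>; the truncation is removed by monotone
convergence.
\<close>

lemma duality_bound:
  fixes F :: "real ^ 'n \<Rightarrow> real" and w :: "real ^ 'n \<Rightarrow> real"
  assumes Fm [measurable]: "F \<in> borel_measurable lebesgue" and F0: "\<And>x. 0 \<le> F x" and supp: "\<And>x. x \<notin> \<Omega> \<Longrightarrow> F x = 0"
    and [measurable]: "w \<in> borel_measurable lebesgue" and w0: "\<And>x. 0 \<le> w x"
    and \<Omega> [measurable]: "\<Omega> \<in> sets lebesgue" and fin: "(\<integral>\<^sup>+x\<in>\<Omega>. ennreal (w x) \<partial>lebesgue) < \<infinity>"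
    and q: "1 < q" "1 / q + 1 / q' = 1" and C: "0 \<le> C"
    and dual: "\<And>h. h \<in> borel_measurable lebesgue \<Longrightarrow> (\<And>x. 0 \<le> h x) \<Longrightarrow> (\<And>x. x \<notin> \<Omega> \<Longrightarrow> h x = 0) \<Longrightarrow>
       (\<integral>\<^sup>+x. ennreal (h x powr q' * w x) \<partial>lebesgue) \<le> 1 \<Longrightarrow>
       (\<integral>\<^sup>+x. ennreal (F x * (h x * w x)) \<partial>lebesgue) \<le> ennreal C"
  shows "(\<integral>\<^sup>+x. ennreal (F x powr q * w x) \<partial>lebesgue) \<le> ennreal (C powr q)"
proof -
  have q'1: "1 < q'"
  proof -
    have "1 / q' = (q - 1) / q" using q by (simp add: diff_divide_distrib)
    then have "1 / (1 / q') = 1 / ((q - 1) / q)" by simp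
    then show ?thesis using q by simp
  qed
  have qq: "(q - 1) * q' = q" using q q'1 by (simp add: field_simps)
  define Fn where "Fn m x = min (F x) (real m)" for m :: nat and x
  have [measurable]: "Fn m \<in> borel_measurable lebesgue" for m unfolding Fn_def by measurable
  have Fn: "0 \<le> Fn m x" "Fn m x \<le> real m" "Fn m x \<le> F x" for m x using F0 by (auto simp: Fn_def)
  have Fns: "Fn m x = 0" if "x \<notin> \<Omega>" for m x using supp[OF that] by (simp add: Fn_def)
  have bound: "(\<integral>\<^sup>+x. ennreal (Fn m x powr q * w x) \<partial>lebesgue) \<le> ennreal (C powr q)" for m
  proof -
    define I where "I = (\<integral>\<^sup>+x. ennreal (Fn m x powr q * w x) \<partial>lebesgue)"
    have "I \<le> (\<integral>\<^sup>+x. ennreal (real m powr q) * (ennreal (w x) * indicator \<Omega> x) \<partial>lebesgue)"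
      unfolding I_def
    proof (intro nn_integral_mono)
      fix x
      show "ennreal (Fn m x powr q * w x) \<le> ennreal (real m powr q) * (ennreal (w x) * indicator \<Omega> x)"
      proof (cases "x \<in> \<Omega>")
        case True
        have "Fn m x powr q * w x \<le> real m powr q * w x" using Fn[of m x] w0 q by (intro mult_right_mono powr_mono2) auto
        from ennreal_leI[OF this] show ?thesis using True by (simp add: ennreal_mult w0)
      qed (simp add: Fns)
    qed
    also have "\<dots> = ennreal (real m powr q) * (\<integral>\<^sup>+x\<in>\<Omega>. ennreal (w x) \<partial>lebesgue)"
      by (rule nn_integral_cmult) measurable
    also have "\<dots> < \<infinity>" using fin by (simp add: ennreal_mult_less_top)
    finally obtain J where J: "I = ennreal J" "0 \<le> J" by (cases I) auto
    show ?thesis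
    proof (cases "J = 0")
      case True
      then show ?thesis using J by (simp add: I_def)
    next
      case False
      then have J0: "0 < J" using J by simp
      define h where "h x = Fn m x powr (q - 1) / J powr (1 / q')" for x
      have hm: "h \<in> borel_measurable lebesgue" unfolding h_def by measurable
      have hq: "h x powr q' = Fn m x powr q / J" for x
        using J0 q'1 Fn[of m x] by (simp add: h_def powr_divide powr_powr qq)
      have h1: "(\<integral>\<^sup>+x. ennreal (h x powr q' * w x) \<partial>lebesgue) \<le> 1"
      proof -
        have "(\<integral>\<^sup>+x. ennreal (h x powr q' * w x) \<partial>lebesgue) = (\<integral>\<^sup>+x. ennreal (1 / J) * ennreal (Fn m x powr q * w x) \<partial>lebesgue)"
          using J0 w0 by (intro nn_integral_cong) (simp add: hq flip: ennreal_mult)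
        also have "\<dots> = ennreal (1 / J) * I" unfolding I_def by (rule nn_integral_cmult) measurable
        also have "\<dots> = 1" using J J0 by (simp flip: ennreal_mult)
        finally show ?thesis by simp
      qed
      have hs: "h x = 0" if "x \<notin> \<Omega>" for x using Fns[OF that] by (simp add: h_def)
      have h0: "0 \<le> h x" for x by (simp add: h_def)
      have "ennreal (1 / J powr (1 / q')) * I = (\<integral>\<^sup>+x. ennreal (1 / J powr (1 / q')) * ennreal (Fn m x powr q * w x) \<partial>lebesgue)"
        unfolding I_def by (rule nn_integral_cmult[symmetric]) measurable
      also have "\<dots> \<le> (\<integral>\<^sup>+x. ennreal (F x * (h x * w x)) \<partial>lebesgue)"
      proof (intro nn_integral_mono)
        fix x
        have "Fn m x powr q = Fn m x * Fn m x powr (q - 1)"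
          using Fn[of m x] q by (cases "Fn m x = 0") (auto simp: powr_diff)
        then have "1 / J powr (1 / q') * (Fn m x powr q * w x) = Fn m x * (h x * w x)" by (simp add: h_def)
        also have "\<dots> \<le> F x * (h x * w x)" using Fn h0 w0 by (intro mult_right_mono) auto
        finally show "ennreal (1 / J powr (1 / q')) * ennreal (Fn m x powr q * w x) \<le> ennreal (F x * (h x * w x))"
          using w0 by (simp add: ennreal_leI flip: ennreal_mult)
      qed
      also have "\<dots> \<le> ennreal C" by (rule dual[OF hm h0 hs h1])
      finally have "ennreal (1 / J powr (1 / q') * J) \<le> ennreal C"
        using J by (simp add: ennreal_mult del: times_divide_eq_left)
      then have "1 / J powr (1 / q') * J \<le> C" using C by (subst (asm) ennreal_le_iff)
      moreover have "1 / J powr (1 / q') * J = J powr (1 / q)"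
      proof -
        have "J = J powr (1 / q) * J powr (1 / q')" using J0 q by (simp flip: powr_add)
        then show ?thesis using J0 by (simp add: field_simps)
      qed
      ultimately have "J powr (1 / q) \<le> C" by simp
      then have "(J powr (1 / q)) powr q \<le> C powr q" using q by (intro powr_mono2) auto
      then have "J \<le> C powr q" using J0 q by (simp add: powr_powr)
      then show ?thesis using J by (simp add: I_def[symmetric] ennreal_leI)
    qed
  qed
  have "(\<integral>\<^sup>+x. ennreal (F x powr q * w x) \<partial>lebesgue) = (\<integral>\<^sup>+x. (SUP m. ennreal (Fn m x powr q * w x)) \<partial>lebesgue)"
  proof (intro nn_integral_cong antisym)
    fix x
    obtain m :: nat where "F x \<le> real m" using real_arch_simple by blast
    then have "Fn m x = F x" by (simp add: Fn_def)
    then show "ennreal (F x powr q * w x) \<le> (SUP m. ennreal (Fn m x powr q * w x))" by (intro SUP_upper2[of m]) auto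
    show "(SUP m. ennreal (Fn m x powr q * w x)) \<le> ennreal (F x powr q * w x)"
      using Fn q w0 by (intro SUP_least ennreal_leI mult_right_mono powr_mono2) auto
  qed
  also have "\<dots> = (SUP m. \<integral>\<^sup>+x. ennreal (Fn m x powr q * w x) \<partial>lebesgue)"
  proof (rule nn_integral_monotone_convergence_SUP)
    show "incseq (\<lambda>m x. ennreal (Fn m x powr q * w x))"
    proof (intro incseq_SucI le_funI ennreal_leI mult_right_mono powr_mono2)
      show "Fn m x \<le> Fn (Suc m) x" for m x by (auto simp: Fn_def)
    qed (use Fn w0 q in auto)
  qed measurable
  also have "\<dots> \<le> ennreal (C powr q)" by (rule SUP_least) (rule bound)
  finally show ?thesis .
qed

lemma cell_integral_measurable:
  fixes k :: "nat \<Rightarrow> real ^ 'n \<Rightarrow> real"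
  assumes "0 < L"
  shows "(\<lambda>x. \<integral>\<^sup>+y\<in>{y. dyadic org L i y = dyadic org L i x}. ennreal (k i y) \<partial>lebesgue) \<in> borel_measurable lebesgue"
  by (rule measurable_compose[OF dyadic_measurable[OF refl], of "\<lambda>c. \<integral>\<^sup>+y\<in>{y. dyadic org L i y = c}. ennreal (k i y) \<partial>lebesgue" borel]) simp

lemma bounded_subset_cube:
  fixes \<Omega> :: "(real ^ 'n) set"
  assumes "bounded \<Omega>"
  obtains l where "0 < l" "\<Omega> \<subseteq> cube 0 l"
proof -
  obtain b where b: "0 < b" "\<And>x. x \<in> \<Omega> \<Longrightarrow> norm x \<le> b" using assms unfolding bounded_pos by blast
  have "\<Omega> \<subseteq> cube 0 (2 * b)"
  proof
    fix x assume "x \<in> \<Omega>"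
    have "\<bar>x $ k - 0 $ k\<bar> \<le> 2 * b / 2" for k
      using component_le_norm_cart[of x k] b(2)[OF \<open>x \<in> \<Omega>\<close>] by simp
    then show "x \<in> cube 0 (2 * b)" unfolding mem_cube by blast
  qed
  then show ?thesis using that[of "2 * b"] b(1) by simp
qed

lemma borel_imp_lebesgue_measurable:
  "f \<in> borel_measurable borel \<Longrightarrow> f \<in> borel_measurable lebesgue"
  by (rule measurable_completion) simp

text \<open>
The inequality for gradients of norm at most \<open>1\<close>. The scaling \<open>t\<close> of \<open>f\<close> is quantified after \<open>a\<close>: if the
gradient vanishes, the conclusion has to hold with one \<open>a\<close> for all \<open>t\<close>.
\<close>

lemma normalized_poincare:
  fixes \<Omega> :: "(real ^ 'n) set"
  assumes JD: "bounded_john_domain \<Omega>" and \<alpha>: "\<alpha> \<in> {0..1}" and p: "1 < p" and q: "1 < q" "1 / q + 1 / q' = 1"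
    and [measurable]: "w1 \<in> borel_measurable lebesgue" and w10: "\<And>x. 0 \<le> w1 x"
    and [measurable]: "w2 \<in> borel_measurable lebesgue" and w20: "\<And>x. 0 \<le> w2 x"
    and fin: "\<forall>c l. 0 < l \<longrightarrow> (\<integral>\<^sup>+x\<in>cube c l. ennreal (w1 x) \<partial>lebesgue) < \<infinity>"
    and fb: "grid_estimate \<alpha> p q' w1 w2"
  shows "\<exists>C E. 0 \<le> C \<and> 0 < E \<and> (\<forall>f G. locally_lipschitz_on \<Omega> f \<longrightarrow> G \<in> borel_measurable borel \<longrightarrow>
     (AE x in lborel. x \<in> \<Omega> \<longrightarrow> (f has_derivative (\<lambda>h. (G x :: real ^ 'n) \<bullet> h)) (at x)) \<longrightarrow>
     (\<exists>a::real. \<forall>t>0. (\<integral>\<^sup>+x\<in>\<Omega>. ennreal ((t * E * (norm (G x) * bdist \<Omega> x powr \<alpha>)) powr p * w2 x) \<partial>lebesgue) \<le> 1 \<longrightarrow>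
        (\<integral>\<^sup>+x\<in>\<Omega>. ennreal ((t * \<bar>f x - a\<bar>) powr q * w1 x) \<partial>lebesgue) \<le> ennreal (C powr q)))"
proof -
  have op: "open \<Omega>" and bd: "bounded \<Omega>" using JD by (auto simp: bounded_john_domain_def)
  have \<Omega>b [measurable]: "\<Omega> \<in> sets borel" using op by simp
  have \<Omega>m [measurable]: "\<Omega> \<in> sets lebesgue" using \<Omega>b by simp
  obtain C L D where CLD: "0 < C" "0 < L" "0 < D" and rep: "\<And>f G. locally_lipschitz_on \<Omega> f \<Longrightarrow> G \<in> borel_measurable borel \<Longrightarrow>
      AE x in lborel. x \<in> \<Omega> \<longrightarrow> (f has_derivative (\<lambda>h. (G x :: real ^ 'n) \<bullet> h)) (at x) \<Longrightarrow>
      \<exists>a::real. \<forall>y\<in>\<Omega>. ennreal \<bar>f y - a\<bar> \<le> ennreal C * (\<Sum>S\<in>(UNIV :: 'n set set). \<Sum>j.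
         ennreal (dyadic_side L j powr (- real CARD('n))) *
        (\<integral>\<^sup>+x\<in>{x. dyadic (grid_shift L S) L j x = dyadic (grid_shift L S) L j y}.
            ennreal ((if x \<in> \<Omega> \<and> dyadic_side L j \<le> D * bdist \<Omega> x then dyadic_side L j else 0) * norm (G x)) \<partial>lebesgue))"
    by (rule john_grid_representation[OF JD]) (rule that)
  from fb[unfolded grid_estimate_def] obtain C1 where C1: "0 \<le> C1" and fb': "\<forall>org L k g h n. 0 < L \<longrightarrow> (\<forall>i. k i \<in> borel_measurable lebesgue) \<longrightarrow> (\<forall>i x. 0 \<le> k i x) \<longrightarrow>
      g \<in> borel_measurable lebesgue \<longrightarrow> h \<in> borel_measurable lebesgue \<longrightarrow> (\<forall>x. 0 \<le> g x) \<longrightarrow> (\<forall>x. 0 \<le> h x) \<longrightarrow>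
      (\<integral>\<^sup>+x. ennreal (g x powr p * w2 x) \<partial>lebesgue) \<le> 1 \<longrightarrow> (\<integral>\<^sup>+x. ennreal (h x powr q' * w1 x) \<partial>lebesgue) \<le> 1 \<longrightarrow>
      (\<forall>j x. (\<Sum>i=j..n. k i x) \<le> dyadic_side L j powr (1 - \<alpha>) * g x) \<longrightarrow>
      (\<Sum>i\<le>n. dyadic_form org L (\<lambda>x. h x * w1 x) k i) \<le> ennreal C1"
    by (elim exE conjE) (rule that)
  obtain l0 where l0: "0 < l0" "\<Omega> \<subseteq> cube 0 l0" using bounded_subset_cube[OF bd] by blast
  have fin\<Omega>: "(\<integral>\<^sup>+x\<in>\<Omega>. ennreal (w1 x) \<partial>lebesgue) < \<infinity>"
  proof (rule le_less_trans)
    show "(\<integral>\<^sup>+x\<in>\<Omega>. ennreal (w1 x) \<partial>lebesgue) \<le> (\<integral>\<^sup>+x\<in>cube 0 l0. ennreal (w1 x) \<partial>lebesgue)"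
      using l0(2) by (intro nn_integral_mono mult_left_mono) (auto simp: indicator_def)
    show "(\<integral>\<^sup>+x\<in>cube 0 l0. ennreal (w1 x) \<partial>lebesgue) < \<infinity>" using fin l0(1) by blast
  qed
  define M where "M = real (card (UNIV :: 'n set set))"
  define C2 where "C2 = C * (M * C1)"
  have C2: "0 \<le> C2" using CLD C1 by (simp add: C2_def M_def)
  define E where "E = 2 * D powr \<alpha>"
  have E: "0 < E" using CLD by (simp add: E_def)
  have main: "(\<integral>\<^sup>+x\<in>\<Omega>. ennreal ((t * \<bar>f x - a\<bar>) powr q * w1 x) \<partial>lebesgue) \<le> ennreal (C2 powr q)"
    if ll: "locally_lipschitz_on \<Omega> f" and [measurable]: "G \<in> borel_measurable borel" and
      a: "\<forall>y\<in>\<Omega>. ennreal \<bar>f y - a\<bar> \<le> ennreal C * (\<Sum>S\<in>(UNIV :: 'n set set). \<Sum>j.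
         ennreal (dyadic_side L j powr (- real CARD('n))) *
        (\<integral>\<^sup>+x\<in>{x. dyadic (grid_shift L S) L j x = dyadic (grid_shift L S) L j y}.
            ennreal ((if x \<in> \<Omega> \<and> dyadic_side L j \<le> D * bdist \<Omega> x then dyadic_side L j else 0) * norm (G x)) \<partial>lebesgue))"
      and t: "0 < t" and small: "(\<integral>\<^sup>+x\<in>\<Omega>. ennreal ((t * E * (norm (G x) * bdist \<Omega> x powr \<alpha>)) powr p * w2 x) \<partial>lebesgue) \<le> 1"
    for f and G :: "real ^ 'n \<Rightarrow> real ^ 'n" and a t
  proof -
    define l where "l = dyadic_side L"
    have l: "0 < l j" for j using dyadic_side_pos[OF CLD(2)] by (simp add: l_def)
    define k0 where "k0 j x = (if x \<in> \<Omega> \<and> l j \<le> D * bdist \<Omega> x then l j else 0) * norm (G x)" for j x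
    define k where "k j x = t * k0 j x" for j x
    have k0n: "0 \<le> k0 j x" and kn: "0 \<le> k j x" for j x using l[of j] t by (simp_all add: k0_def k_def)
    have k0m: "k0 j \<in> borel_measurable borel" for j unfolding k0_def by measurable
    have km: "k j \<in> borel_measurable lebesgue" for j
      unfolding k_def using borel_imp_lebesgue_measurable[OF k0m[of j]] by (intro borel_measurable_times) auto
    define g where "g x = (if x \<in> \<Omega> then t * E * (norm (G x) * bdist \<Omega> x powr \<alpha>) else 0)" for x
    have gb: "g \<in> borel_measurable borel" unfolding g_def by measurable
    have gm: "g \<in> borel_measurable lebesgue" using gb by (rule borel_imp_lebesgue_measurable)
    have g0: "0 \<le> g x" for x using t E by (simp add: g_def)
    have g1: "(\<integral>\<^sup>+x. ennreal (g x powr p * w2 x) \<partial>lebesgue) \<le> 1"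
    proof (rule order_trans[OF eq_refl small], intro nn_integral_cong)
      fix x
      show "ennreal (g x powr p * w2 x) = ennreal ((t * E * (norm (G x) * bdist \<Omega> x powr \<alpha>)) powr p * w2 x) * indicator \<Omega> x"
        by (cases "x \<in> \<Omega>") (simp_all add: g_def)
    qed
    \<comment> \<open>The truncation of the levels by the distance to the boundary becomes the factor
      \<open>d^\<alpha>\<close>.\<close>
    have ksum: "(\<Sum>i=j..n. k i x) \<le> dyadic_side L j powr (1 - \<alpha>) * g x" for j n x
    proof (cases "x \<in> \<Omega>")
      case True
      have d0: "0 \<le> bdist \<Omega> x" by (simp add: bdist_def infdist_nonneg)
      have "(\<Sum>i=j..n. k i x) = t * norm (G x) * (\<Sum>i=j..n. if dyadic_side L i \<le> D * bdist \<Omega> x then dyadic_side L i else 0)"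
        unfolding sum_distrib_left by (intro sum.cong refl) (simp add: k_def k0_def l_def True)
      also have "\<dots> \<le> t * norm (G x) * (2 * (dyadic_side L j powr (1 - \<alpha>) * (D * bdist \<Omega> x) powr \<alpha>))"
        using t \<alpha> d0 CLD by (intro mult_left_mono truncated_side_sum_powr) auto
      also have "\<dots> = dyadic_side L j powr (1 - \<alpha>) * g x"
        using True by (simp add: g_def E_def powr_mult mult_ac)
      finally show ?thesis .
    qed (simp add: k_def k0_def g_def)
    define F where "F x = (if x \<in> \<Omega> then t * \<bar>f x - a\<bar> else 0)" for x
    have cont: "continuous_on \<Omega> f" by (rule locally_lipschitz_continuous[OF op ll])
    have "F \<in> borel_measurable borel"
      unfolding F_def by (intro borel_measurable_continuous_on_if continuous_intros cont) simp
    then have Fm: "F \<in> borel_measurable lebesgue" by (rule borel_imp_lebesgue_measurable)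
    have "(\<integral>\<^sup>+x. ennreal (F x powr q * w1 x) \<partial>lebesgue) \<le> ennreal (C2 powr q)"
    proof (rule duality_bound[OF Fm _ _ _ w10 \<Omega>m fin\<Omega> q C2])
      show "0 \<le> F x" for x using t by (simp add: F_def)
      show "F x = 0" if "x \<notin> \<Omega>" for x using that by (simp add: F_def)
      show "w1 \<in> borel_measurable lebesgue" by measurable
      fix h :: "real ^ 'n \<Rightarrow> real"
      assume hm [measurable]: "h \<in> borel_measurable lebesgue" and h0: "\<And>x. 0 \<le> h x" and hs: "\<And>x. x \<notin> \<Omega> \<Longrightarrow> h x = 0"
        and h1: "(\<integral>\<^sup>+x. ennreal (h x powr q' * w1 x) \<partial>lebesgue) \<le> 1"
      define T where "T S j x = ennreal (l j powr (- real CARD('n))) *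
          (\<integral>\<^sup>+y\<in>{y. dyadic (grid_shift L S) L j y = dyadic (grid_shift L S) L j x}. ennreal (k j y) \<partial>lebesgue)" for S :: "'n set" and j x
      have Tm [measurable]: "T S j \<in> borel_measurable lebesgue" for S j
        unfolding T_def using cell_integral_measurable[OF CLD(2), where org = "grid_shift L S" and i = j and k = k] by (intro borel_measurable_times_ennreal) auto
      have formT: "(\<integral>\<^sup>+x. ennreal (h x * w1 x) * T S j x \<partial>lebesgue) = dyadic_form (grid_shift L S) L (\<lambda>x. h x * w1 x) k j" for S j
        by (simp add: dyadic_form_def T_def l_def)
      have pw: "ennreal (F x * (h x * w1 x)) \<le> ennreal C * (\<Sum>S\<in>UNIV. \<Sum>j. ennreal (h x * w1 x) * T S j x)" for x
      proof (cases "x \<in> \<Omega>")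
        case True
        define T0 where "T0 S j = ennreal (l j powr (- real CARD('n))) *
          (\<integral>\<^sup>+y\<in>{y. dyadic (grid_shift L S) L j y = dyadic (grid_shift L S) L j x}. ennreal (k0 j y) \<partial>lebesgue)" for S :: "'n set" and j
        have TT0: "T S j x = ennreal t * T0 S j" for S j
        proof -
          have cm: "{y. dyadic (grid_shift L S) L j y = dyadic (grid_shift L S) L j x} \<in> sets lebesgue"
            using measurable_sets[OF dyadic_measurable[OF refl, of "grid_shift L S" L j], of "{dyadic (grid_shift L S) L j x}"]
            by (simp add: vimage_def)
          have "(\<integral>\<^sup>+y\<in>{y. dyadic (grid_shift L S) L j y = dyadic (grid_shift L S) L j x}. ennreal (k j y) \<partial>lebesgue)
             = (\<integral>\<^sup>+y. ennreal t * (ennreal (k0 j y) * indicator {y. dyadic (grid_shift L S) L j y = dyadic (grid_shift L S) L j x} y) \<partial>lebesgue)"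
            using t k0n by (intro nn_integral_cong) (simp add: k_def ennreal_mult mult.assoc)
          also have "\<dots> = ennreal t * (\<integral>\<^sup>+y\<in>{y. dyadic (grid_shift L S) L j y = dyadic (grid_shift L S) L j x}. ennreal (k0 j y) \<partial>lebesgue)"
            using cm borel_imp_lebesgue_measurable[OF k0m[of j]] by (intro nn_integral_cmult borel_measurable_times_ennreal) auto
          finally show ?thesis by (simp add: T_def T0_def mult_ac)
        qed
        have "ennreal \<bar>f x - a\<bar> \<le> ennreal C * (\<Sum>S\<in>UNIV. \<Sum>j. T0 S j)"
          using bspec[OF a True] unfolding T0_def k0_def l_def .
        then have "ennreal (h x * w1 x) * (ennreal t * ennreal \<bar>f x - a\<bar>) \<le> ennreal (h x * w1 x) * (ennreal t * (ennreal C * (\<Sum>S\<in>UNIV. \<Sum>j. T0 S j)))"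
          by (intro mult_left_mono) auto
        also have "\<dots> = ennreal C * (\<Sum>S\<in>UNIV. \<Sum>j. ennreal (h x * w1 x) * T S j x)"
        proof -
          have e: "(\<Sum>S\<in>UNIV. \<Sum>j. ennreal (h x * w1 x) * (ennreal t * T0 S j))
            = ennreal (h x * w1 x) * (ennreal t * (\<Sum>S\<in>UNIV. \<Sum>j. T0 S j))"
            by (simp only: ennreal_suminf_cmult sum_distrib_left[symmetric])
          show ?thesis unfolding TT0 e by (simp only: mult_ac)
        qed
        also have "ennreal (h x * w1 x) * (ennreal t * ennreal \<bar>f x - a\<bar>) = ennreal (F x * (h x * w1 x))"
          using True t h0[of x] w10[of x] by (simp add: F_def ennreal_mult mult_ac)
        finally show ?thesis .
      qed (simp add: F_def)
      have "(\<integral>\<^sup>+x. ennreal (F x * (h x * w1 x)) \<partial>lebesgue) \<le> (\<integral>\<^sup>+x. ennreal C * (\<Sum>S\<in>UNIV. \<Sum>j. ennreal (h x * w1 x) * T S j x) \<partial>lebesgue)"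
        by (intro nn_integral_mono pw)
      also have "\<dots> = ennreal C * (\<integral>\<^sup>+x. (\<Sum>S\<in>UNIV. \<Sum>j. ennreal (h x * w1 x) * T S j x) \<partial>lebesgue)"
        by (rule nn_integral_cmult) measurable
      also have "(\<integral>\<^sup>+x. (\<Sum>S\<in>UNIV. \<Sum>j. ennreal (h x * w1 x) * T S j x) \<partial>lebesgue)
         = (\<Sum>S\<in>UNIV. \<integral>\<^sup>+x. (\<Sum>j. ennreal (h x * w1 x) * T S j x) \<partial>lebesgue)"
        by (rule nn_integral_sum) measurable
      also have "\<dots> = (\<Sum>S\<in>UNIV. \<Sum>j. dyadic_form (grid_shift L S) L (\<lambda>x. h x * w1 x) k j)"
        unfolding formT[symmetric] by (intro sum.cong refl nn_integral_suminf) measurable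
      also have "\<dots> \<le> (\<Sum>S\<in>(UNIV :: 'n set set). ennreal C1)"
      proof (rule sum_mono)
        fix S :: "'n set"
        show "(\<Sum>j. dyadic_form (grid_shift L S) L (\<lambda>x. h x * w1 x) k j) \<le> ennreal C1"
        proof (rule suminf_le_const)
          fix n
          have "(\<Sum>j<n. dyadic_form (grid_shift L S) L (\<lambda>x. h x * w1 x) k j) \<le> (\<Sum>j\<le>n. dyadic_form (grid_shift L S) L (\<lambda>x. h x * w1 x) k j)"
            by (intro sum_mono2) auto
          also have "\<dots> \<le> ennreal C1"
            by (rule fb'[rule_format, OF CLD(2) km kn gm hm g0 h0 g1 h1 ksum])
          finally show "(\<Sum>j<n. dyadic_form (grid_shift L S) L (\<lambda>x. h x * w1 x) k j) \<le> ennreal C1" .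
        qed simp
      qed
      also have "\<dots> = ennreal (M * C1)"
        using C1 by (simp add: M_def ennreal_mult ennreal_of_nat_eq_real_of_nat)
      also have "ennreal C * ennreal (M * C1) = ennreal C2"
        using CLD C1 by (simp add: C2_def M_def ennreal_mult)
      finally show "(\<integral>\<^sup>+x. ennreal (F x * (h x * w1 x)) \<partial>lebesgue) \<le> ennreal C2" by (simp add: mult_left_mono)
    qed
    moreover have "(\<integral>\<^sup>+x\<in>\<Omega>. ennreal ((t * \<bar>f x - a\<bar>) powr q * w1 x) \<partial>lebesgue) = (\<integral>\<^sup>+x. ennreal (F x powr q * w1 x) \<partial>lebesgue)"
    proof (intro nn_integral_cong)
      fix x
      show "ennreal ((t * \<bar>f x - a\<bar>) powr q * w1 x) * indicator \<Omega> x = ennreal (F x powr q * w1 x)"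
        by (cases "x \<in> \<Omega>") (simp_all add: F_def)
    qed
    ultimately show ?thesis by simp
  qed
  show ?thesis
  proof (rule exI[of _ C2], rule exI[of _ E], intro conjI C2 E allI impI)
    fix f and G :: "real ^ 'n \<Rightarrow> real ^ 'n"
    assume A: "locally_lipschitz_on \<Omega> f" "G \<in> borel_measurable borel"
      "AE x in lborel. x \<in> \<Omega> \<longrightarrow> (f has_derivative (\<lambda>h. G x \<bullet> h)) (at x)"
    obtain a where a: "\<forall>y\<in>\<Omega>. ennreal \<bar>f y - a\<bar> \<le> ennreal C * (\<Sum>S\<in>(UNIV :: 'n set set). \<Sum>j.
         ennreal (dyadic_side L j powr (- real CARD('n))) *
        (\<integral>\<^sup>+x\<in>{x. dyadic (grid_shift L S) L j x = dyadic (grid_shift L S) L j y}.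
            ennreal ((if x \<in> \<Omega> \<and> dyadic_side L j \<le> D * bdist \<Omega> x then dyadic_side L j else 0) * norm (G x)) \<partial>lebesgue))"
      using rep[OF A] by blast
    show "\<exists>a::real. \<forall>t>0. (\<integral>\<^sup>+x\<in>\<Omega>. ennreal ((t * E * (norm (G x) * bdist \<Omega> x powr \<alpha>)) powr p * w2 x) \<partial>lebesgue) \<le> 1 \<longrightarrow>
        (\<integral>\<^sup>+x\<in>\<Omega>. ennreal ((t * \<bar>f x - a\<bar>) powr q * w1 x) \<partial>lebesgue) \<le> ennreal (C2 powr q)"
      using main[OF A(1,2) a] by (intro exI[of _ a]) blast
  qed
qed

theorem theorem4p1:
  fixes \<Omega> :: "(real ^ 'n) set"
    and \<alpha> p p' q :: real
    and w1 w2 :: "real ^ 'n \<Rightarrow> real"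
  assumes "bounded_john_domain \<Omega>"
    and "\<alpha> \<in> {0..1}"
    and "1 < p" and "p \<le> q"
    and "1 / p + 1 / p' = 1"
    and "w1 \<in> borel_measurable lebesgue" and "\<And>x. 0 \<le> w1 x"
    and "w2 \<in> borel_measurable lebesgue" and "\<And>x. 0 \<le> w2 x"
    and "reverse_doubling (\<lambda>x. ennreal (w1 x))"
    and "reverse_doubling (\<lambda>x. ennpow (ennreal (w2 x)) (1 - p'))"
    and "p < q \<Longrightarrow>
      \<exists>K::real. \<forall>c. \<forall>l>0.
        ennreal (measure lebesgue (cube c l) powr ((1 - \<alpha>) / real CARD('n) - 1))
        * ennpow (\<integral>\<^sup>+x\<in>cube c l. ennreal (w1 x) \<partial>lebesgue) (1 / q)
        * ennpow (\<integral>\<^sup>+x\<in>cube c l. ennpow (ennreal (w2 x)) (1 - p') \<partial>lebesgue) (1 / p')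
        \<le> ennreal K"
    and "p = q \<Longrightarrow>
      \<exists>r>1. \<exists>K::real. \<forall>c. \<forall>l>0.
        ennreal (measure lebesgue (cube c l) powr ((1 - \<alpha>) / real CARD('n) + 1 / q - 1 / p))
        * ennpow ((\<integral>\<^sup>+x\<in>cube c l. ennpow (ennreal (w1 x)) r \<partial>lebesgue)
            / emeasure lebesgue (cube c l)) (1 / (q * r))
        * ennpow ((\<integral>\<^sup>+x\<in>cube c l. ennpow (ennreal (w2 x)) ((1 - p') * r) \<partial>lebesgue)
            / emeasure lebesgue (cube c l)) (1 / (p' * r))
        \<le> ennreal K"
  shows "\<exists>C>0. \<forall>f::real ^ 'n \<Rightarrow> real. locally_lipschitz_on \<Omega> f \<longrightarrow>
      (INF a::real. Lp_norm q \<Omega> (\<lambda>x. (f x - a) * w1 x powr (1 / q)))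
      \<le> ennreal C *
        Lp_norm p \<Omega> (\<lambda>x. (bdist \<Omega> x powr \<alpha> * w2 x powr (1 / p)) *\<^sub>R gradient f x)"
proof -
  have p0: "0 < p" and q1: "1 < q" and q0: "0 < q" using assms(3,4) by auto
  have op: "open \<Omega>" using assms(1) by (simp add: bounded_john_domain_def)
  have \<Omega>m [measurable]: "\<Omega> \<in> sets lebesgue" "\<Omega> \<in> sets borel" using op by simp_all
  note [measurable] = assms(6) assms(8)
  have lhs: "Lp_norm q \<Omega> (\<lambda>x. (f x - a) * w1 x powr (1 / q)) = ennpow (\<integral>\<^sup>+x\<in>\<Omega>. ennreal (\<bar>f x - a\<bar> powr q * w1 x) \<partial>lebesgue) (1 / q)" for f a
    unfolding Lp_norm_def using q0 assms(7) by (simp add: abs_mult powr_mult powr_powr)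
  show ?thesis
  proof (cases "AE x in lebesgue. w1 x = 0")
    case True
    have z: "Lp_norm q \<Omega> (\<lambda>x. (f x - 0) * w1 x powr (1 / q)) = 0" for f
    proof -
      have "(\<integral>\<^sup>+x\<in>\<Omega>. ennreal (\<bar>f x - 0\<bar> powr q * w1 x) \<partial>lebesgue) = (\<integral>\<^sup>+x. 0 \<partial>(lebesgue :: (real ^ 'n) measure))"
      proof (rule nn_integral_cong_AE)
        show "AE x in lebesgue. ennreal (\<bar>f x - 0\<bar> powr q * w1 x) * indicator \<Omega> x = 0"
          using True by eventually_elim simp
      qed
      then show ?thesis unfolding lhs using q0 by (simp add: ennpow_eq_0_iff)
    qed
    have inf: "(INF a::real. Lp_norm q \<Omega> (\<lambda>x. (f x - a) * w1 x powr (1 / q))) \<le> 0" for f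
      by (rule INF_lower2[of 0]) (rule UNIV_I, rule eq_refl[OF z])
    show ?thesis
    proof (intro exI[of _ 1] conjI allI impI)
      fix f :: "real ^ 'n \<Rightarrow> real"
      show "(INF a::real. Lp_norm q \<Omega> (\<lambda>x. (f x - a) * w1 x powr (1 / q))) \<le> ennreal 1 *
        Lp_norm p \<Omega> (\<lambda>x. (bdist \<Omega> x powr \<alpha> * w2 x powr (1 / p)) *\<^sub>R gradient f x)"
        by (rule order_trans[OF inf zero_le])
    qed simp
  next
    case False
    define q' where "q' = q / (q - 1)"
    have qq: "1 / q + 1 / q' = 1" using q1 by (simp add: q'_def divide_simps)
    have bounds: "(\<forall>c l. 0 < l \<longrightarrow> (\<integral>\<^sup>+x\<in>cube c l. ennreal (w1 x) \<partial>lebesgue) < \<infinity>) \<and> grid_estimate \<alpha> p q' w1 w2"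
      by (rule weights_imp_grid_estimate[OF assms(3,4,5) qq assms(6-13) False])
    from normalized_poincare[OF assms(1,2,3) q1 qq assms(6,7,8,9) conjunct1[OF bounds] conjunct2[OF bounds]] obtain C E where C: "0 \<le> C" and E: "0 < E"
      and sp: "\<forall>f G. locally_lipschitz_on \<Omega> f \<longrightarrow> G \<in> borel_measurable borel \<longrightarrow>
     (AE x in lborel. x \<in> \<Omega> \<longrightarrow> (f has_derivative (\<lambda>h. (G x :: real ^ 'n) \<bullet> h)) (at x)) \<longrightarrow>
     (\<exists>a::real. \<forall>t>0. (\<integral>\<^sup>+x\<in>\<Omega>. ennreal ((t * E * (norm (G x) * bdist \<Omega> x powr \<alpha>)) powr p * w2 x) \<partial>lebesgue) \<le> 1 \<longrightarrow>
        (\<integral>\<^sup>+x\<in>\<Omega>. ennreal ((t * \<bar>f x - a\<bar>) powr q * w1 x) \<partial>lebesgue) \<le> ennreal (C powr q))"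
      by (elim exE conjE) (rule that)
    \<comment> \<open>The summand \<open>1\<close> makes the constant positive.\<close>
    define C' where "C' = C * E + 1"
    have C': "0 < C'" using C E by (simp add: C'_def add_nonneg_pos)
    show ?thesis
    proof (intro exI[of _ C'] conjI C' allI impI)
      fix f :: "real ^ 'n \<Rightarrow> real" assume ll: "locally_lipschitz_on \<Omega> f"
      obtain G :: "real ^ 'n \<Rightarrow> real ^ 'n" where G [measurable]: "G \<in> borel_measurable borel" and
        GD: "AE x in lborel. x \<in> \<Omega> \<longrightarrow> (f has_derivative (\<lambda>h. G x \<bullet> h)) (at x) \<and> gradient f x = G x"
        using gradient_borel_representative[OF op ll] by blast
      have GD1: "AE x in lborel. x \<in> \<Omega> \<longrightarrow> (f has_derivative (\<lambda>h. G x \<bullet> h)) (at x)"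
        using GD by eventually_elim blast
      obtain a where a: "\<And>t. 0 < t \<Longrightarrow> (\<integral>\<^sup>+x\<in>\<Omega>. ennreal ((t * E * (norm (G x) * bdist \<Omega> x powr \<alpha>)) powr p * w2 x) \<partial>lebesgue) \<le> 1 \<Longrightarrow>
        (\<integral>\<^sup>+x\<in>\<Omega>. ennreal ((t * \<bar>f x - a\<bar>) powr q * w1 x) \<partial>lebesgue) \<le> ennreal (C powr q)"
        using sp[rule_format, OF ll G GD1] by blast
      define X where "X = (\<integral>\<^sup>+x\<in>\<Omega>. ennreal (\<bar>f x - a\<bar> powr q * w1 x) \<partial>lebesgue)"
      define Y where "Y = (\<integral>\<^sup>+x\<in>\<Omega>. ennreal ((norm (G x) * bdist \<Omega> x powr \<alpha>) powr p * w2 x) \<partial>lebesgue)"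
      have rhs: "Lp_norm p \<Omega> (\<lambda>x. (bdist \<Omega> x powr \<alpha> * w2 x powr (1 / p)) *\<^sub>R gradient f x) = ennpow Y (1 / p)"
      proof -
        have AEl: "AE x in lebesgue. x \<in> \<Omega> \<longrightarrow> gradient f x = G x"
          using AE_completion[OF GD] by eventually_elim blast
        have "(\<integral>\<^sup>+x\<in>\<Omega>. ennreal (norm ((bdist \<Omega> x powr \<alpha> * w2 x powr (1 / p)) *\<^sub>R gradient f x) powr p) \<partial>lebesgue) = Y"
          unfolding Y_def
        proof (rule nn_integral_cong_AE)
          show "AE x in lebesgue. ennreal (norm ((bdist \<Omega> x powr \<alpha> * w2 x powr (1 / p)) *\<^sub>R gradient f x) powr p) * indicator \<Omega> x
             = ennreal ((norm (G x) * bdist \<Omega> x powr \<alpha>) powr p * w2 x) * indicator \<Omega> x"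
            using AEl
          proof eventually_elim
            case (elim x)
            show ?case
            proof (cases "x \<in> \<Omega>")
              case True
              have "norm ((bdist \<Omega> x powr \<alpha> * w2 x powr (1 / p)) *\<^sub>R gradient f x) = (norm (G x) * bdist \<Omega> x powr \<alpha>) * w2 x powr (1 / p)"
                using elim True by (simp add: abs_mult mult_ac)
              moreover have "(w2 x powr (1 / p)) powr p = w2 x" using p0 assms(9)[of x] by (simp add: powr_powr)
              ultimately have "norm ((bdist \<Omega> x powr \<alpha> * w2 x powr (1 / p)) *\<^sub>R gradient f x) powr p = (norm (G x) * bdist \<Omega> x powr \<alpha>) powr p * w2 x"
                by (simp only: powr_mult)
              then show ?thesis by (simp only:)
            qed simp
          qed
        qed
        then show ?thesis by (simp add: Lp_norm_def)
      qed
      have sX: "(\<integral>\<^sup>+x\<in>\<Omega>. ennreal ((t * \<bar>f x - a\<bar>) powr q * w1 x) \<partial>lebesgue) = ennreal (t powr q) * X" if "0 < t" for t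
      proof -
        have cont: "continuous_on \<Omega> f" by (rule locally_lipschitz_continuous[OF op ll])
        have "(\<lambda>x. if x \<in> \<Omega> then \<bar>f x - a\<bar> else 0) \<in> borel_measurable borel"
          by (intro borel_measurable_continuous_on_if continuous_intros cont) simp
        then have Fm: "(\<lambda>x. if x \<in> \<Omega> then \<bar>f x - a\<bar> else 0) \<in> borel_measurable lebesgue" by (rule borel_imp_lebesgue_measurable)
        have m: "(\<lambda>x. ennreal ((if x \<in> \<Omega> then \<bar>f x - a\<bar> else 0) powr q * w1 x)) \<in> borel_measurable lebesgue"
          using Fm by measurable
        have "(\<integral>\<^sup>+x\<in>\<Omega>. ennreal ((t * \<bar>f x - a\<bar>) powr q * w1 x) \<partial>lebesgue)
           = (\<integral>\<^sup>+x. ennreal (t powr q) * ennreal ((if x \<in> \<Omega> then \<bar>f x - a\<bar> else 0) powr q * w1 x) \<partial>lebesgue)"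
        proof (intro nn_integral_cong)
          fix x
          show "ennreal ((t * \<bar>f x - a\<bar>) powr q * w1 x) * indicator \<Omega> x
            = ennreal (t powr q) * ennreal ((if x \<in> \<Omega> then \<bar>f x - a\<bar> else 0) powr q * w1 x)"
            using assms(7)[of x] by (cases "x \<in> \<Omega>") (simp_all add: powr_mult mult.assoc flip: ennreal_mult)
        qed
        also have "\<dots> = ennreal (t powr q) * (\<integral>\<^sup>+x. ennreal ((if x \<in> \<Omega> then \<bar>f x - a\<bar> else 0) powr q * w1 x) \<partial>lebesgue)"
          by (rule nn_integral_cmult[OF m])
        also have "(\<integral>\<^sup>+x. ennreal ((if x \<in> \<Omega> then \<bar>f x - a\<bar> else 0) powr q * w1 x) \<partial>lebesgue) = X"
          unfolding X_def by (intro nn_integral_cong) (simp add: indicator_def)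
        finally show ?thesis .
      qed
      have sY: "(\<integral>\<^sup>+x\<in>\<Omega>. ennreal ((t * E * (norm (G x) * bdist \<Omega> x powr \<alpha>)) powr p * w2 x) \<partial>lebesgue) = ennreal ((t * E) powr p) * Y" if "0 < t" for t
      proof -
        have "(\<integral>\<^sup>+x\<in>\<Omega>. ennreal ((t * E * (norm (G x) * bdist \<Omega> x powr \<alpha>)) powr p * w2 x) \<partial>lebesgue)
           = (\<integral>\<^sup>+x. ennreal ((t * E) powr p) * (ennreal ((norm (G x) * bdist \<Omega> x powr \<alpha>) powr p * w2 x) * indicator \<Omega> x) \<partial>lebesgue)"
        proof (intro nn_integral_cong)
          fix x
          have "(t * E * (norm (G x) * bdist \<Omega> x powr \<alpha>)) powr p * w2 x
             = (t * E) powr p * ((norm (G x) * bdist \<Omega> x powr \<alpha>) powr p * w2 x)"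
            unfolding powr_mult[of "t * E"] by (rule mult.assoc)
          then show "ennreal ((t * E * (norm (G x) * bdist \<Omega> x powr \<alpha>)) powr p * w2 x) * indicator \<Omega> x
             = ennreal ((t * E) powr p) * (ennreal ((norm (G x) * bdist \<Omega> x powr \<alpha>) powr p * w2 x) * indicator \<Omega> x)"
            using ennreal_mult[of "(t * E) powr p" "(norm (G x) * bdist \<Omega> x powr \<alpha>) powr p * w2 x"] assms(9)[of x]
            by (simp only: mult.assoc) (simp add: mult.assoc)
        qed
        also have "\<dots> = ennreal ((t * E) powr p) * Y"
          unfolding Y_def
        proof (rule nn_integral_cmult)
          have "(\<lambda>x. (norm (G x) * bdist \<Omega> x powr \<alpha>) powr p) \<in> borel_measurable borel" by measurable
          then have [measurable]: "(\<lambda>x. (norm (G x) * bdist \<Omega> x powr \<alpha>) powr p) \<in> borel_measurable lebesgue" by (rule borel_imp_lebesgue_measurable)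
          show "(\<lambda>x. ennreal ((norm (G x) * bdist \<Omega> x powr \<alpha>) powr p * w2 x) * indicator \<Omega> x) \<in> borel_measurable lebesgue"
            by measurable
        qed
        finally show ?thesis .
      qed
      have scaled: "ennreal (t powr q) * X \<le> ennreal (C powr q)" if "0 < t" "ennreal ((t * E) powr p) * Y \<le> 1" for t
        using a[OF that(1)] that(2) unfolding sX[OF that(1)] sY[OF that(1)] by blast
      have "ennpow X (1 / q) \<le> ennreal C' * ennpow Y (1 / p)"
      proof (cases Y)
        case top
        then show ?thesis using p0 C' ennpow_infinity[of "1 / p"] by (simp add: ennreal_mult_top)
      next
        case (real y)
        show ?thesis
        proof (cases "y = 0")
          case True
          \<comment> \<open>With gradient norm \<open>0\<close> all multiples of \<open>f\<close> are admissible,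
            which forces \<open>f = a\<close> in \<open>L^q(w1)\<close>.\<close>
          have "X = 0"
          proof (rule ennreal_eq_0_of_scaled_bound)
            fix s :: real assume s: "0 < s"
            have "ennreal ((s powr (1 / q)) powr q) * X \<le> ennreal (C powr q)"
              using s True real by (intro scaled) simp_all
            then show "ennreal s * X \<le> ennreal (C powr q)" using s q0 by (simp add: powr_powr)
          qed
          then have "ennpow X (1 / q) = 0" using q0 by (simp only: ennpow_eq_0_iff zero_less_divide_1_iff)
          then show ?thesis by simp
        next
          case False
          then have y: "0 < y" using real by simp
          \<comment> \<open>The scaling for which the norm of the gradient term is exactly \<open>1\<close>.\<close>
          define t where "t = 1 / (E * y powr (1 / p))"
          have t: "0 < t" using E y by (simp add: t_def)
          have tE: "t * E = 1 / y powr (1 / p)" using E by (simp add: t_def)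
          have "(t * E) powr p = 1 / y" unfolding tE using y p0 by (simp add: powr_divide powr_powr)
          then have "ennreal ((t * E) powr p) * Y = 1" using y real by (simp flip: ennreal_mult)
          then have sc: "ennreal (t powr q) * X \<le> ennreal (C powr q)" using t by (intro scaled) simp_all
          have "X \<noteq> \<infinity>"
          proof
            assume "X = \<infinity>"
            then have "ennreal (t powr q) * X = \<infinity>" using t by (simp add: ennreal_mult_top)
            with sc show False by (simp add: top_unique)
          qed
          then obtain x where x: "X = ennreal x" "0 \<le> x" by (cases X) auto
          have "ennreal (t powr q * x) \<le> ennreal (C powr q)" using sc x by (simp add: ennreal_mult)
          then have "t powr q * x \<le> C powr q" by (subst (asm) ennreal_le_iff) auto
          then have "(t powr q * x) powr (1 / q) \<le> (C powr q) powr (1 / q)" using x q0 by (intro powr_mono2) auto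
          then have "t * x powr (1 / q) \<le> C" using t C q0 by (simp add: powr_mult powr_powr)
          then have "x powr (1 / q) \<le> C / t" using t by (simp add: field_simps)
          also have "C / t = C * E * y powr (1 / p)" by (simp add: t_def)
          also have "\<dots> \<le> C' * y powr (1 / p)" by (intro mult_right_mono) (simp_all add: C'_def)
          finally have "ennreal (x powr (1 / q)) \<le> ennreal (C' * y powr (1 / p))" by (rule ennreal_leI)
          then show ?thesis
            using x y real C' p0 q0 by (simp add: ennpow_pos_exponent ennreal_mult)
        qed
      qed
      then have "Lp_norm q \<Omega> (\<lambda>x. (f x - a) * w1 x powr (1 / q)) \<le> ennreal C' *
        Lp_norm p \<Omega> (\<lambda>x. (bdist \<Omega> x powr \<alpha> * w2 x powr (1 / p)) *\<^sub>R gradient f x)"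
        unfolding lhs rhs X_def .
      then show "(INF a::real. Lp_norm q \<Omega> (\<lambda>x. (f x - a) * w1 x powr (1 / q))) \<le> ennreal C' *
        Lp_norm p \<Omega> (\<lambda>x. (bdist \<Omega> x powr \<alpha> * w2 x powr (1 / p)) *\<^sub>R gradient f x)"
        by (intro INF_lower2[of a]) auto
    qed
  qed
qed

end
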